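(* There is a sequence of minimal planar domains $\Sigma_i\subset\mathbb R^3$ with $\partial \Sigma_i\subset \partial B_{R_i}$, where $R_i\to \infty$, such that: \begin{enumerate} \item $\Sigma_i$ converges in $C^\infty_{loc}(\mathbb R^3\setminus \mathcal{S})$ to a foliation $\mathcal{L}$ of $\mathbb R^3$ by planes parallel to the plane $\{x_3=0\}$. Here $\mathcal{S}=\mathcal{S}^-\cup \mathcal{S}^+$ is the union of two distinct lines $\mathcal{S}^\pm$, each parallel to the $x_3$-axis and at distance $1$ from it; \item For every $\epsilon>0$ and all $i$ sufficiently large, $\Sigma_i\cap B_{R_i} \setminus T_\epsilon(\mathcal{S})$ consists of a union of single-valued graphs over the plane $\{x_3=0\}$; \item For every $R>1$, $\delta>0$ and points $p_i^\pm\in \Sigma_i\cap B_R$ with $\delta<|x_3(p_i^+)-x_3(p_i^-)|$, the points $p_i^-$ and $p_i^+$ lie in the same connected component of $\Sigma_i\cap B_{2R}$ and $\operatorname{dist}^{\Sigma_i}(p_i^-,p_i^+)\to \infty$. \end{enumerate}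
   Context: $x_1,x_2,x_3$ are the standard coordinates on $\mathbb R^3$. $B_r$ denotes the open ball of radius $r$ centered at the origin, and $T_\epsilon(A)$ the open tubular neighborhood of radius $\epsilon$ of a set $A\subset\mathbb R^3$. A planar domain is a surface of genus zero. $\operatorname{dist}^{\Sigma}$ is the intrinsic distance on the surface $\Sigma$. A lamination is a foliation which need not fill space; convergence to it is smooth convergence of the surfaces to the leaves away from $\mathcal S$. *)

theory Defs
  imports "HOL-Analysis.Analysis" "HOL-Library.Extended_Real"
begin

definition pt3 :: "real \<Rightarrow> real \<Rightarrow> real \<Rightarrow> real^3" where
  "pt3 x y z = (\<chi> k. if k = 1 then x else if k = 2 then y else z)"

definition proj12 :: "real^3 \<Rightarrow> real \<times> real" where
  "proj12 p = (p$1, p$2)"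

definition pd1 :: "(real \<times> real \<Rightarrow> real) \<Rightarrow> real \<times> real \<Rightarrow> real" where
  "pd1 u = (\<lambda>(x, y). deriv (\<lambda>t. u (t, y)) x)"

definition pd2 :: "(real \<times> real \<Rightarrow> real) \<Rightarrow> real \<times> real \<Rightarrow> real" where
  "pd2 u = (\<lambda>(x, y). deriv (\<lambda>t. u (x, t)) y)"

fun iter_pd :: "bool list \<Rightarrow> (real \<times> real \<Rightarrow> real) \<Rightarrow> real \<times> real \<Rightarrow> real" where
  "iter_pd [] u = u"
| "iter_pd (b # bs) u = (if b then pd1 else pd2) (iter_pd bs u)"

definition smooth_on :: "(real \<times> real) set \<Rightarrow> (real \<times> real \<Rightarrow> real) \<Rightarrow> bool" where
  "smooth_on D u \<longleftrightarrow> open D \<and> (\<forall>bs. \<forall>z\<in>D. iter_pd bs u differentiable (at z))"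

definition minimal_graph_eq :: "(real \<times> real) set \<Rightarrow> (real \<times> real \<Rightarrow> real) \<Rightarrow> bool" where
  "minimal_graph_eq D u \<longleftrightarrow> (\<forall>z\<in>D.
     (1 + (pd2 u z)\<^sup>2) * pd1 (pd1 u) z - 2 * pd1 u z * pd2 u z * pd2 (pd1 u) z
     + (1 + (pd1 u z)\<^sup>2) * pd2 (pd2 u) z = 0)"

text \<open>A smooth embedded surface (without boundary) in R^3 with zero mean curvature:
  locally it is the graph of a smooth solution of the minimal surface equation over
  some plane (orthonormal frame e1, e2, e3).\<close>
definition minimal_surface :: "(real^3) set \<Rightarrow> bool" where
  "minimal_surface M \<longleftrightarrow> (\<forall>p\<in>M. \<exists>e1 e2 e3 U W u.
      norm e1 = 1 \<and> norm e2 = 1 \<and> norm e3 = 1 \<and>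
      e1 \<bullet> e2 = 0 \<and> e1 \<bullet> e3 = 0 \<and> e2 \<bullet> e3 = 0 \<and>
      open U \<and> p \<in> U \<and> smooth_on W u \<and> minimal_graph_eq W u \<and>
      M \<inter> U = (\<lambda>(x, y). x *\<^sub>R e1 + y *\<^sub>R e2 + u (x, y) *\<^sub>R e3) ` W)"

definition planar_domain :: "(real^3) set \<Rightarrow> bool" where
  "planar_domain M \<longleftrightarrow> (\<exists>T :: (real \<times> real) set. open T \<and> connected T \<and> M homeomorphic T)"

definition tube :: "(real^3) set \<Rightarrow> real \<Rightarrow> (real^3) set" where
  "tube A e = (\<Union>a\<in>A. ball a e)"

definition hgraph :: "(real \<times> real) set \<Rightarrow> (real \<times> real \<Rightarrow> real) \<Rightarrow> (real^3) set" where
  "hgraph D u = {pt3 x y (u (x, y)) | x y. (x, y) \<in> D}"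

definition curve_length :: "(real \<Rightarrow> real^3) \<Rightarrow> ereal" where
  "curve_length g = (SUP (n, t) \<in> {(n, t). t 0 = 0 \<and> t n = 1 \<and> (\<forall>k<n. t k \<le> t (Suc k))}.
       ereal (\<Sum>k<n. dist (g (t (Suc k))) (g (t k))))"

text \<open>Intrinsic distance on M (infimum of lengths of curves in M; \<infinity> if none).\<close>
definition intrinsic_dist :: "(real^3) set \<Rightarrow> real^3 \<Rightarrow> real^3 \<Rightarrow> ereal" where
  "intrinsic_dist M p q = (INF g \<in> {g. path g \<and> path_image g \<subseteq> M \<and> pathstart g = p \<and> pathfinish g = q}.
       curve_length g)"

text \<open>The sequence of surfaces \<Sigma> i converges in C^\<infinity>_loc(R^3 - S) to the foliation of R^3 by
  the planes {x_3 = c}: around every point p outside S there is a ball B_r(p) missing S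
  such that, for i large, \<Sigma> i \<inter> B_r(p) is a union of graphs over the disc of radius r
  about the projection of p, all of whose derivatives of positive order tend to 0
  uniformly, and every point of the ball (hence every leaf) is a limit of points of
  the \<Sigma> i.\<close>
definition converges_to_horizontal_foliation_away ::
  "(nat \<Rightarrow> (real^3) set) \<Rightarrow> (real^3) set \<Rightarrow> bool" where
  "converges_to_horizontal_foliation_away \<Sigma> S \<longleftrightarrow>
    (\<forall>p. p \<notin> S \<longrightarrow> (\<exists>r>0. ball p r \<inter> S = {} \<and>
       (\<exists>F :: nat \<Rightarrow> (real \<times> real \<Rightarrow> real) set.
          (\<forall>\<^sub>F i in sequentially.
             \<Sigma> i \<inter> ball p r = (\<Union>u\<in>F i. hgraph (ball (proj12 p) r) u) \<inter> ball p r \<and>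
             (\<forall>u\<in>F i. smooth_on (ball (proj12 p) r) u)) \<and>
          (\<forall>bs. bs \<noteq> [] \<longrightarrow> (\<forall>e>0. \<forall>\<^sub>F i in sequentially.
             \<forall>u\<in>F i. \<forall>z\<in>ball (proj12 p) r. \<bar>iter_pd bs u z\<bar> < e))) \<and>
       (\<forall>q\<in>ball p r. \<exists>x :: nat \<Rightarrow> real^3. (\<forall>i. x i \<in> \<Sigma> i) \<and> x \<longlonglongrightarrow> q)))"

end

theory Submission
  imports Defs "HOL-Complex_Analysis.Complex_Analysis" "HOL-Real_Asymp.Real_Asymp"
begin

text \<open>The surfaces come from explicit elliptic Weierstrass data. Let \<open>\<epsilon> = q\<^sup>2\<close>. A Lambert-type series gives a
  function \<open>Y \<epsilon>\<close> on the punctured plane with simple poles at the powers of \<open>\<epsilon>\<close> and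
  \<open>Y \<epsilon> (s / \<epsilon>) = Y \<epsilon> s + 1\<close>. For \<open>S \<epsilon> s = - s * Y' \<epsilon> s\<close> a Liouville argument yields real constants
  \<open>e\<close>, \<open>m\<close> with \<open>(2 S(\<epsilon>\<^sup>2) - S(\<epsilon>))\<^sup>2 = S(\<epsilon>)\<^sup>2 - 4 e S(\<epsilon>) - 4 m\<close>. This is the conformality relation for
  the harmonic map with coordinates \<open>2 Re W\<close>, \<open>- b Im Y\<close> and \<open>c0 ln |s| - B Re Y\<close>, where
  \<open>W = Y \<epsilon> - 2 Y (\<epsilon>\<^sup>2)\<close>. Replacing \<open>s\<close> by \<open>s / \<epsilon>\<close> reflects the first coordinate and raises the height by
  a constant \<open>h\<close>, so the image is a stack of nearly horizontal sheets joined by small catenoidal necks placed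
  alternately near the vertical lines over \<open>(1, 0)\<close> and \<open>(- 1, 0)\<close>.

  Up to \<open>O(q)\<close> a sheet projects to the plane by the Moebius map \<open>(1 + s) / (1 - s)\<close>, which makes it a graph away
  from the necks; near a neck, equality of heights and of projections is compared directly. This gives
  embeddedness in a ball of radius \<open>ln (1 / q) / 4\<close>, and the component of the surface there is parametrized by a
  plane domain. As \<open>q \<rightarrow> 0\<close> the height \<open>h = O(q ln (1 / q))\<close> tends to zero, so the sheets fill space and
  become flat. A curve that climbs a fixed amount passes about \<open>1 / h\<close> necks, alternately near the two lines at distance
  2, and is therefore long.\<close>

section \<open>Conformal harmonic parametrizations\<close>

text \<open>The linear term of the quadratic relation forces the summand \<open>B * Re Y\<close> in
  the height, and \<open>b > 2\<close> with it. The price is a tilt: towards its end at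
  \<open>s = 1\<close> a sheet has slope about \<open>B / 2\<close> in the first direction, and the
  next sheet, being reflected, has the opposite slope. Neighbouring sheets therefore cross at a
  distance of order \<open>ln (1 / q)\<close>, so the complete periodic surface is not embedded.
  This is why the radius of the ball is only a multiple of \<open>ln (1 / q)\<close>. Tilt and
  logarithmic growth are both of size \<open>q\<close>, and only numerical constants such as
  \<open>B \<le> 11 / 10 * c0\<close> separate them. The second obstacle is that a waist itself has
  size \<open>q\<close>, the size of the projection error on a sheet. Near a waist the catenoidal
  main term must be split off, and the rest must be small of order \<open>q\<^sup>2\<close> as a
  Lipschitz function of \<open>ln s\<close>. Convergence of all derivatives comes from the
  holomorphic data: \<open>p3\<close> is of order \<open>q\<close>, while the Jacobian of the
  projection stays away from 0 off the axes.\<close>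

lemma iter_pd_append: "iter_pd (bs @ cs) u = iter_pd bs (iter_pd cs u)"
  by (induction bs) auto

lemma pd_eq_has_derivative:
  assumes "(u has_derivative (\<lambda>(a, b). a * A + b * B)) (at z)"
  shows "pd1 u z = A" "pd2 u z = B"
proof -
  obtain x y where z: "z = (x, y)" by (cases z)
  have "((\<lambda>t. (t, y)) has_derivative (\<lambda>t. (t, 0))) (at x)"
    by (auto intro!: derivative_eq_intros)
  then have "((\<lambda>t. u (t, y)) has_derivative (\<lambda>t. (case (t, 0) of (a, b) \<Rightarrow> a * A + b * B))) (at x)"
    by (rule has_derivative_compose) (use assms z in simp)
  then have "((\<lambda>t. u (t, y)) has_real_derivative A) (at x)"
    by (simp add: has_field_derivative_def mult.commute[of _ A])
  then show "pd1 u z = A" by (simp add: pd1_def z DERIV_imp_deriv)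
  have "((\<lambda>t. (x, t)) has_derivative (\<lambda>t. (0, t))) (at y)"
    by (auto intro!: derivative_eq_intros)
  then have "((\<lambda>t. u (x, t)) has_derivative (\<lambda>t. (case (0, t) of (a, b) \<Rightarrow> a * A + b * B))) (at y)"
    by (rule has_derivative_compose) (use assms z in simp)
  then have "((\<lambda>t. u (x, t)) has_real_derivative B) (at y)"
    by (simp add: has_field_derivative_def mult.commute[of _ B])
  then show "pd2 u z = B" by (simp add: pd2_def z DERIV_imp_deriv)
qed

lemma has_derivative_pd:
  assumes "u differentiable (at z)"
  shows "(u has_derivative (\<lambda>(a, b). a * pd1 u z + b * pd2 u z)) (at z)"
proof -
  obtain f' where f': "(u has_derivative f') (at z)" using assms unfolding differentiable_def by blast
  then interpret bounded_linear f' by (rule has_derivative_bounded_linear)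
  have eq: "f' = (\<lambda>(a, b). a * f' (1, 0) + b * f' (0, 1))"
  proof
    fix p :: "real \<times> real"
    have "f' (fst p *\<^sub>R (1, 0) + snd p *\<^sub>R (0, 1)) = fst p *\<^sub>R f' (1, 0) + snd p *\<^sub>R f' (0, 1)"
      by (simp add: add scaleR del: scaleR_Pair)
    then show "f' p = (case p of (a, b) \<Rightarrow> a * f' (1, 0) + b * f' (0, 1))" by (cases p) simp
  qed
  note f'' = has_derivative_eq_rhs[OF f' eq]
  show ?thesis using f'' unfolding pd_eq_has_derivative[OF f''] .
qed

lemma pd_cong_open:
  assumes "open W" "\<And>z. z \<in> W \<Longrightarrow> u z = v z" "z \<in> W"
  shows "pd1 u z = pd1 v z" "pd2 u z = pd2 v z"
proof -
  obtain x y where z: "z = (x, y)" by (cases z)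
  have "open ((\<lambda>t. (t, y)) -` W)" "open ((\<lambda>t. (x, t)) -` W)"
    using assms(1) by (auto intro!: open_vimage continuous_intros)
  then have "\<forall>\<^sub>F t in nhds x. u (t, y) = v (t, y)" "\<forall>\<^sub>F t in nhds y. u (x, t) = v (x, t)"
    using assms z by (auto simp: eventually_nhds)
  then show "pd1 u z = pd1 v z" "pd2 u z = pd2 v z"
    by (simp_all add: pd1_def pd2_def z deriv_cong_ev)
qed

section \<open>Locally uniform families and their Wirtinger derivatives\<close>

definition locally_bounded_family :: "complex set \<Rightarrow> (nat \<Rightarrow> complex \<Rightarrow> complex) \<Rightarrow> bool" where
  "locally_bounded_family N E \<longleftrightarrow>
    (\<forall>K. compact K \<and> K \<subseteq> N \<longrightarrow> (\<exists>C>0. \<forall>\<^sub>F i in sequentially. \<forall>s\<in>K. norm (E i s) \<le> C))"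

definition locally_null_family :: "complex set \<Rightarrow> (nat \<Rightarrow> complex \<Rightarrow> complex) \<Rightarrow> bool" where
  "locally_null_family N E \<longleftrightarrow>
    (\<forall>K. compact K \<and> K \<subseteq> N \<longrightarrow> (\<forall>e>0. \<forall>\<^sub>F i in sequentially. \<forall>s\<in>K. norm (E i s) < e))"

text \<open>The derivatives of the height function of a graph, expressed in the parameter domain, are built from
  holomorphic data by the operations below. Both classes are closed under the Wirtinger derivatives (by Cauchy's
  estimate), so bounds on the data propagate to derivatives of every order.\<close>

inductive smooth_family :: "complex set \<Rightarrow> (nat \<Rightarrow> complex \<Rightarrow> complex) \<Rightarrow> bool" for N where
  holomorphic: "\<forall>\<^sub>F i in sequentially. g i holomorphic_on N \<Longrightarrow> locally_bounded_family N g
     \<Longrightarrow> smooth_family N g"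
| cnj: "smooth_family N E \<Longrightarrow> smooth_family N (\<lambda>i s. cnj (E i s))"
| add: "smooth_family N E \<Longrightarrow> smooth_family N F \<Longrightarrow> smooth_family N (\<lambda>i s. E i s + F i s)"
| mult: "smooth_family N E \<Longrightarrow> smooth_family N F \<Longrightarrow> smooth_family N (\<lambda>i s. E i s * F i s)"
| inverse: "smooth_family N E \<Longrightarrow> \<forall>\<^sub>F i in sequentially. \<forall>s\<in>N. E i s \<noteq> 0 \<Longrightarrow>
     locally_bounded_family N (\<lambda>i s. inverse (E i s)) \<Longrightarrow> smooth_family N (\<lambda>i s. inverse (E i s))"

inductive null_family :: "complex set \<Rightarrow> (nat \<Rightarrow> complex \<Rightarrow> complex) \<Rightarrow> bool" for N where
  holomorphic: "\<forall>\<^sub>F i in sequentially. g i holomorphic_on N \<Longrightarrow> locally_null_family N g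
     \<Longrightarrow> null_family N g"
| cnj: "null_family N E \<Longrightarrow> null_family N (\<lambda>i s. cnj (E i s))"
| add: "null_family N E \<Longrightarrow> null_family N F \<Longrightarrow> null_family N (\<lambda>i s. E i s + F i s)"
| mult: "null_family N E \<Longrightarrow> smooth_family N F \<Longrightarrow> null_family N (\<lambda>i s. E i s * F i s)"

lemma smooth_family_const: "smooth_family N (\<lambda>i s. c)"
  by (rule smooth_family.holomorphic)
     (auto simp: locally_bounded_family_def intro!: exI[of _ "norm c + 1"] add_nonneg_pos)

text \<open>Preparation for Cauchy's estimate: discs of one radius \<open>d\<close> about all points
  of \<open>K\<close> lie in a single compact set, so a bound there bounds derivatives on
  \<open>K\<close>.\<close>

lemma compact_thickening:
  fixes K :: "complex set"
  assumes "compact K" "open N" "K \<subseteq> N"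
  obtains d K' where "d > 0" "compact K'" "K' \<subseteq> N" "\<And>s. s \<in> K \<Longrightarrow> cball s d \<subseteq> K'"
proof -
  obtain e where e: "e > 0" "(\<Union>x\<in>K. ball x e) \<subseteq> N"
    using compact_subset_open_imp_ball_epsilon_subset[OF assms] by blast
  define K' where "K' = {x + y | x y. x \<in> K \<and> y \<in> cball 0 (e/2)}"
  have "compact K'" unfolding K'_def by (rule compact_sums) (use assms in auto)
  moreover have "K' \<subseteq> N"
  proof
    fix w assume "w \<in> K'"
    then obtain x y where "w = x + y" "x \<in> K" "norm y \<le> e/2" by (auto simp: K'_def)
    then have "w \<in> ball x e" using e(1) by (simp add: dist_norm)
    then show "w \<in> N" using e(2) \<open>x \<in> K\<close> by blast
  qed
  moreover have "cball s (e/2) \<subseteq> K'" if "s \<in> K" for s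
  proof
    fix w assume "w \<in> cball s (e/2)"
    then have "w = s + (w - s)" "w - s \<in> cball 0 (e/2)" by (auto simp: dist_norm norm_minus_commute)
    then show "w \<in> K'" using that unfolding K'_def by blast
  qed
  ultimately show ?thesis using that[of "e/2" K'] e(1) by auto
qed

lemma norm_deriv_le_cball:
  assumes "f holomorphic_on N" "open N" "cball s d \<subseteq> N" "d > 0"
    "\<And>w. w \<in> cball s d \<Longrightarrow> norm (f w) \<le> C"
  shows "norm (deriv f s) \<le> C / d"
proof -
  have "norm ((deriv ^^ 1) f s) \<le> fact 1 * C / d ^ 1"
  proof (rule Cauchy_inequality)
    show "f holomorphic_on ball s d"
      using assms ball_subset_cball by (blast intro: holomorphic_on_subset)
    show "continuous_on (cball s d) f"
      using assms by (blast intro: holomorphic_on_imp_continuous_on continuous_on_subset)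
  qed (use assms in \<open>auto simp: dist_norm norm_minus_commute\<close>)
  then show ?thesis by simp
qed

lemma locally_bounded_family_deriv:
  assumes "open N" "\<forall>\<^sub>F i in sequentially. g i holomorphic_on N" "locally_bounded_family N g"
  shows "locally_bounded_family N (\<lambda>i. deriv (g i))"
  unfolding locally_bounded_family_def
proof (intro allI impI)
  fix K assume K: "compact K \<and> K \<subseteq> N"
  then obtain d K' where d: "d > 0" "compact K'" "K' \<subseteq> N" "\<And>s. s \<in> K \<Longrightarrow> cball s d \<subseteq> K'"
    using compact_thickening assms(1) by metis
  obtain C where C: "C > 0" "\<forall>\<^sub>F i in sequentially. \<forall>s\<in>K'. norm (g i s) \<le> C"
    using assms(3) d unfolding locally_bounded_family_def by blast
  have "\<forall>\<^sub>F i in sequentially. \<forall>s\<in>K. norm (deriv (g i) s) \<le> C / d"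
    using assms(2) C(2)
  proof eventually_elim
    case (elim i)
    show ?case
      by (intro ballI norm_deriv_le_cball[OF elim(1) assms(1)]) (use d elim in blast)+
  qed
  then show "\<exists>C>0. \<forall>\<^sub>F i in sequentially. \<forall>s\<in>K. norm (deriv (g i) s) \<le> C"
    using C(1) d(1) by (intro exI[of _ "C / d"]) auto
qed

lemma locally_null_family_deriv:
  assumes "open N" "\<forall>\<^sub>F i in sequentially. g i holomorphic_on N" "locally_null_family N g"
  shows "locally_null_family N (\<lambda>i. deriv (g i))"
  unfolding locally_null_family_def
proof (intro allI impI)
  fix K and e :: real assume K: "compact K \<and> K \<subseteq> N" and e: "e > 0"
  obtain d K' where d: "d > 0" "compact K'" "K' \<subseteq> N" "\<And>s. s \<in> K \<Longrightarrow> cball s d \<subseteq> K'"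
    using compact_thickening assms(1) K by metis
  have "\<forall>\<^sub>F i in sequentially. \<forall>s\<in>K'. norm (g i s) < e * d / 2"
    using assms(3)[unfolded locally_null_family_def, rule_format, of K' "e * d / 2"] d(1,2,3) e by simp
  with assms(2) show "\<forall>\<^sub>F i in sequentially. \<forall>s\<in>K. norm (deriv (g i) s) < e"
  proof eventually_elim
    case (elim i)
    show ?case
    proof
      fix s assume s: "s \<in> K"
      have "norm (deriv (g i) s) \<le> (e * d / 2) / d"
        by (rule norm_deriv_le_cball[OF elim(1) assms(1)]) (use s d elim in \<open>force simp: less_imp_le\<close>)+
      then show "norm (deriv (g i) s) < e" using d e by simp
    qed
  qed
qed

text \<open>\<open>E1\<close> and \<open>E2\<close> are the derivatives in \<open>s\<close> and in
  \<open>cnj s\<close>, read off from the real differential.\<close>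

definition wirtinger_family ::
  "complex set \<Rightarrow> (nat \<Rightarrow> complex \<Rightarrow> complex) \<Rightarrow> (nat \<Rightarrow> complex \<Rightarrow> complex) \<Rightarrow> (nat \<Rightarrow> complex \<Rightarrow> complex) \<Rightarrow> bool" where
  "wirtinger_family N E E1 E2 \<longleftrightarrow> (\<forall>\<^sub>F i in sequentially. \<forall>s\<in>N.
     (E i has_derivative (\<lambda>d. E1 i s * d + E2 i s * cnj d)) (at s))"

lemma wirtinger_holomorphic:
  assumes "open N" "\<forall>\<^sub>F i in sequentially. g i holomorphic_on N"
  shows "wirtinger_family N g (\<lambda>i. deriv (g i)) (\<lambda>i s. 0)"
  unfolding wirtinger_family_def using assms(2)
proof eventually_elim
  case (elim i)
  then show ?case using holomorphic_derivI[OF elim assms(1)] by (auto simp: has_field_derivative_def)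
qed

lemma wirtinger_cnj:
  assumes "wirtinger_family N E E1 E2"
  shows "wirtinger_family N (\<lambda>i s. cnj (E i s)) (\<lambda>i s. cnj (E2 i s)) (\<lambda>i s. cnj (E1 i s))"
  using assms unfolding wirtinger_family_def
proof eventually_elim
  case (elim i)
  show ?case
  proof
    fix s assume "s \<in> N"
    with elim have "(E i has_derivative (\<lambda>d. E1 i s * d + E2 i s * cnj d)) (at s)" by blast
    from has_derivative_cnj[OF this]
    show "((\<lambda>s. cnj (E i s)) has_derivative (\<lambda>d. cnj (E2 i s) * d + cnj (E1 i s) * cnj d)) (at s)"
      by (simp add: add.commute)
  qed
qed

lemma wirtinger_add:
  assumes "wirtinger_family N E E1 E2" "wirtinger_family N F F1 F2"
  shows "wirtinger_family N (\<lambda>i s. E i s + F i s) (\<lambda>i s. E1 i s + F1 i s) (\<lambda>i s. E2 i s + F2 i s)"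
  using assms unfolding wirtinger_family_def
proof eventually_elim
  case (elim i)
  then show ?case by (auto intro!: derivative_eq_intros simp: algebra_simps)
qed

lemma wirtinger_mult:
  assumes "wirtinger_family N E E1 E2" "wirtinger_family N F F1 F2"
  shows "wirtinger_family N (\<lambda>i s. E i s * F i s) (\<lambda>i s. E1 i s * F i s + F1 i s * E i s)
     (\<lambda>i s. E2 i s * F i s + F2 i s * E i s)"
  using assms unfolding wirtinger_family_def
proof eventually_elim
  case (elim i)
  then show ?case by (auto intro!: derivative_eq_intros simp: algebra_simps)
qed

lemma wirtinger_inverse:
  assumes "wirtinger_family N E E1 E2" "\<forall>\<^sub>F i in sequentially. \<forall>s\<in>N. E i s \<noteq> 0"
  shows "wirtinger_family N (\<lambda>i s. inverse (E i s))
     (\<lambda>i s. (-1) * E1 i s * (inverse (E i s) * inverse (E i s)))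
     (\<lambda>i s. (-1) * E2 i s * (inverse (E i s) * inverse (E i s)))"
  using assms unfolding wirtinger_family_def
proof eventually_elim
  case (elim i)
  then show ?case by (auto intro!: derivative_eq_intros simp: algebra_simps)
qed

lemma smooth_family_wirtinger:
  assumes "open N" "smooth_family N E"
  shows "\<exists>E1 E2. smooth_family N E1 \<and> smooth_family N E2 \<and> wirtinger_family N E E1 E2"
  using assms(2)
proof induction
  case (holomorphic g)
  have "smooth_family N (\<lambda>i. deriv (g i))"
  proof (rule smooth_family.holomorphic)
    show "\<forall>\<^sub>F i in sequentially. deriv (g i) holomorphic_on N"
      using holomorphic(1) by eventually_elim (use assms(1) in \<open>auto intro: holomorphic_deriv\<close>)
  qed (intro locally_bounded_family_deriv assms holomorphic)
  then show ?case using wirtinger_holomorphic[OF assms(1) holomorphic(1)] smooth_family_const by blast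
next
  case (cnj E) then show ?case using wirtinger_cnj smooth_family.cnj by blast
next
  case (add E F)
  then obtain E1 E2 F1 F2 where E: "smooth_family N E1" "smooth_family N E2" "smooth_family N F1"
    "smooth_family N F2" "wirtinger_family N E E1 E2" "wirtinger_family N F F1 F2" by auto
  show ?case
    by (intro exI conjI) (rule smooth_family.add[OF E(1,3)] smooth_family.add[OF E(2,4)] wirtinger_add[OF E(5,6)])+
next
  case (mult E F)
  then obtain E1 E2 F1 F2 where E: "smooth_family N E1" "smooth_family N E2" "smooth_family N F1"
    "smooth_family N F2" "wirtinger_family N E E1 E2" "wirtinger_family N F F1 F2" by auto
  show ?case
    by (intro exI conjI) (rule wirtinger_mult[OF E(5,6)]
      smooth_family.add[OF smooth_family.mult[OF E(1) mult(2)] smooth_family.mult[OF E(3) mult(1)]]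
      smooth_family.add[OF smooth_family.mult[OF E(2) mult(2)] smooth_family.mult[OF E(4) mult(1)]])+
next
  case (inverse E)
  then obtain E1 E2 where E: "smooth_family N E1" "smooth_family N E2" "wirtinger_family N E E1 E2" by auto
  have i: "smooth_family N (\<lambda>i s. inverse (E i s))"
    using inverse by (intro smooth_family.inverse)
  show ?case
    by (intro exI conjI) (rule wirtinger_inverse[OF E(3) inverse(2)]
      smooth_family.mult[OF smooth_family.mult[OF smooth_family_const[of N "-1"] E(1)] smooth_family.mult[OF i i]]
      smooth_family.mult[OF smooth_family.mult[OF smooth_family_const[of N "-1"] E(2)] smooth_family.mult[OF i i]])+
qed

lemma null_family_wirtinger:
  assumes "open N" "null_family N E"
  shows "\<exists>E1 E2. null_family N E1 \<and> null_family N E2 \<and> wirtinger_family N E E1 E2"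
  using assms(2)
proof induction
  case (holomorphic g)
  have "null_family N (\<lambda>i. deriv (g i))"
  proof (rule null_family.holomorphic)
    show "\<forall>\<^sub>F i in sequentially. deriv (g i) holomorphic_on N"
      using holomorphic(1) by eventually_elim (use assms(1) in \<open>auto intro: holomorphic_deriv\<close>)
  qed (intro locally_null_family_deriv assms holomorphic)
  moreover have "null_family N (\<lambda>i s. 0)"
    by (rule null_family.holomorphic) (auto simp: locally_null_family_def)
  ultimately show ?case using wirtinger_holomorphic[OF assms(1) holomorphic(1)] by blast
next
  case (cnj E) then show ?case using wirtinger_cnj null_family.cnj by blast
next
  case (add E F)
  then obtain E1 E2 F1 F2 where E: "null_family N E1" "null_family N E2" "null_family N F1"
    "null_family N F2" "wirtinger_family N E E1 E2" "wirtinger_family N F F1 F2" by auto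
  show ?case
    by (intro exI conjI) (rule null_family.add[OF E(1,3)] null_family.add[OF E(2,4)] wirtinger_add[OF E(5,6)])+
next
  case (mult E F)
  \<comment> \<open>One null factor suffices: the derivatives of the other factor are again smooth
    families, hence bounded on compact sets.\<close>
  then obtain E1 E2 F1 F2 where E: "null_family N E1" "null_family N E2" "smooth_family N F1"
    "smooth_family N F2" "wirtinger_family N E E1 E2" "wirtinger_family N F F1 F2"
    using smooth_family_wirtinger[OF assms(1) mult(2)] by auto
  have 1: "null_family N (\<lambda>i s. F1 i s * E i s)" "null_family N (\<lambda>i s. F2 i s * E i s)"
    using null_family.mult[OF mult(1) E(3)] null_family.mult[OF mult(1) E(4)]
    by (simp_all add: mult.commute)
  show ?case
    by (intro exI conjI) (rule wirtinger_mult[OF E(5,6)] null_family.add[OF null_family.mult[OF E(1) mult(2)] 1(1)]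
      null_family.add[OF null_family.mult[OF E(2) mult(2)] 1(2)])+
qed

lemma smooth_family_bounded:
  assumes "smooth_family N E" shows "locally_bounded_family N E"
  using assms
proof induction
  case (add E F)
  show ?case unfolding locally_bounded_family_def
  proof (intro allI impI)
    fix K assume K: "compact K \<and> K \<subseteq> N"
    obtain C D where C: "C > 0" "D > 0" "\<forall>\<^sub>F i in sequentially. \<forall>s\<in>K. norm (E i s) \<le> C"
      "\<forall>\<^sub>F i in sequentially. \<forall>s\<in>K. norm (F i s) \<le> D"
      using add.IH[unfolded locally_bounded_family_def, rule_format, OF K] by blast
    have "\<forall>\<^sub>F i in sequentially. \<forall>s\<in>K. norm (E i s + F i s) \<le> C + D"
      using C(3,4) by eventually_elim (auto intro: norm_triangle_mono)
    then show "\<exists>C>0. \<forall>\<^sub>F i in sequentially. \<forall>s\<in>K. norm (E i s + F i s) \<le> C"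
      using C(1,2) by (intro exI[of _ "C + D"]) auto
  qed
next
  case (mult E F)
  show ?case unfolding locally_bounded_family_def
  proof (intro allI impI)
    fix K assume K: "compact K \<and> K \<subseteq> N"
    obtain C D where C: "C > 0" "D > 0" "\<forall>\<^sub>F i in sequentially. \<forall>s\<in>K. norm (E i s) \<le> C"
      "\<forall>\<^sub>F i in sequentially. \<forall>s\<in>K. norm (F i s) \<le> D"
      using mult.IH[unfolded locally_bounded_family_def, rule_format, OF K] by blast
    have "\<forall>\<^sub>F i in sequentially. \<forall>s\<in>K. norm (E i s * F i s) \<le> C * D"
      using C(3,4) by eventually_elim (use C in \<open>auto simp: norm_mult intro!: mult_mono\<close>)
    then show "\<exists>C>0. \<forall>\<^sub>F i in sequentially. \<forall>s\<in>K. norm (E i s * F i s) \<le> C"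
      using C(1,2) by (intro exI[of _ "C * D"]) auto
  qed
qed (auto simp: locally_bounded_family_def)

lemma null_family_null:
  assumes "null_family N E" shows "locally_null_family N E"
  using assms
proof induction
  case (add E F)
  show ?case unfolding locally_null_family_def
  proof (intro allI impI)
    fix K and e :: real assume K: "compact K \<and> K \<subseteq> N" and e: "e > 0"
    have "\<forall>\<^sub>F i in sequentially. \<forall>s\<in>K. norm (E i s) < e/2" "\<forall>\<^sub>F i in sequentially. \<forall>s\<in>K. norm (F i s) < e/2"
      using add.IH[unfolded locally_null_family_def, rule_format, OF K, of "e/2"] e by auto
    then show "\<forall>\<^sub>F i in sequentially. \<forall>s\<in>K. norm (E i s + F i s) < e"
    proof eventually_elim
      case (elim i)
      show ?case
      proof
        fix s assume "s \<in> K"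
        then have "norm (E i s) < e/2" "norm (F i s) < e/2" using elim by auto
        then show "norm (E i s + F i s) < e" using norm_triangle_ineq[of "E i s" "F i s"] by linarith
      qed
    qed
  qed
next
  case (mult E F)
  show ?case unfolding locally_null_family_def
  proof (intro allI impI)
    fix K and e :: real assume K: "compact K \<and> K \<subseteq> N" and e: "e > 0"
    obtain D where D: "D > 0" "\<forall>\<^sub>F i in sequentially. \<forall>s\<in>K. norm (F i s) \<le> D"
      using smooth_family_bounded[OF mult(2), unfolded locally_bounded_family_def, rule_format, OF K] by blast
    have "e / D > 0" using e D by simp
    then have "\<forall>\<^sub>F i in sequentially. \<forall>s\<in>K. norm (E i s) < e / D"
      using mult.IH[unfolded locally_null_family_def, rule_format, OF K] by blast
    then show "\<forall>\<^sub>F i in sequentially. \<forall>s\<in>K. norm (E i s * F i s) < e"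
      using D(2)
    proof eventually_elim
      case (elim i)
      show ?case
      proof
        fix s assume "s \<in> K"
        then have "norm (E i s) * norm (F i s) \<le> norm (E i s) * D" "norm (E i s) * D < e"
          using elim D by (auto intro: mult_left_mono simp: pos_less_divide_eq)
        then show "norm (E i s * F i s) < e" by (simp add: norm_mult)
      qed
    qed
  qed
qed (auto simp: locally_null_family_def)

text \<open>For an inverse chart \<open>\<iota>\<close>, \<open>z1\<close> and \<open>z2\<close> are
  the images of the two coordinate directions. The chain rule turns real partial derivatives into
  Wirtinger derivatives contracted with them.\<close>

lemma chart_derivative:
  assumes "(\<iota> has_derivative (\<lambda>(a, b). of_real a * z1 + of_real b * z2)) (at z)"
    "(E has_derivative (\<lambda>d. e1 * d + e2 * cnj d)) (at (\<iota> z))"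
    "open W" "z \<in> W" "\<And>z. z \<in> W \<Longrightarrow> u z = Re (E (\<iota> z))"
  shows "u differentiable (at z)" "pd1 u z = Re (e1 * z1 + e2 * cnj z1)"
    "pd2 u z = Re (e1 * z2 + e2 * cnj z2)"
proof -
  have "((\<lambda>z. Re (E (\<iota> z))) has_derivative
     (\<lambda>w. Re ((\<lambda>d. e1 * d + e2 * cnj d) ((\<lambda>(a, b). of_real a * z1 + of_real b * z2) w)))) (at z)"
    by (intro has_derivative_Re has_derivative_compose[OF assms(1,2)])
  then have d: "((\<lambda>z. Re (E (\<iota> z))) has_derivative
     (\<lambda>(a, b). a * Re (e1 * z1 + e2 * cnj z1) + b * Re (e1 * z2 + e2 * cnj z2))) (at z)"
    by (rule has_derivative_eq_rhs) (auto simp: fun_eq_iff algebra_simps)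
  from has_derivative_transform_within_open[OF d assms(3,4)] assms(5)
  have *: "(u has_derivative (\<lambda>(a, b). a * Re (e1 * z1 + e2 * cnj z1) + b * Re (e1 * z2 + e2 * cnj z2))) (at z)"
    by simp
  show "pd1 u z = Re (e1 * z1 + e2 * cnj z1)" "pd2 u z = Re (e1 * z2 + e2 * cnj z2)"
    using pd_eq_has_derivative[OF *] by simp_all
  show "u differentiable (at z)" using * by (auto simp: differentiable_def)
qed

text \<open>The class \<open>P\<close> stays abstract so that one induction serves smooth and null
  families alike. The invariant: each iterated partial derivative is the real part of a member of
  \<open>P\<close> pulled back by the inverse chart.\<close>

lemma iter_pd_family:
  assumes step: "\<And>E. P E \<Longrightarrow> \<exists>E1 E2. wirtinger_family N E E1 E2 \<and>
      P (\<lambda>i s. E1 i s * Z1 i s + E2 i s * cnj (Z1 i s)) \<and> P (\<lambda>i s. E1 i s * Z2 i s + E2 i s * cnj (Z2 i s))"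
    and chart: "\<forall>\<^sub>F i in sequentially. open (W i) \<and> (\<forall>z\<in>W i. \<iota> i z \<in> N \<and>
      (\<iota> i has_derivative (\<lambda>(a, b). of_real a * Z1 i (\<iota> i z) + of_real b * Z2 i (\<iota> i z))) (at z))"
    and E: "P E" "\<forall>\<^sub>F i in sequentially. \<forall>z\<in>W i. u i z = Re (E i (\<iota> i z))"
  shows "\<exists>E'. P E' \<and> (\<forall>\<^sub>F i in sequentially. \<forall>z\<in>W i.
      iter_pd bs (u i) z = Re (E' i (\<iota> i z)) \<and> iter_pd bs (u i) differentiable (at z))"
proof (induction bs)
  case Nil
  obtain E1 E2 where "wirtinger_family N E E1 E2" using step[OF E(1)] by auto
  then have "\<forall>\<^sub>F i in sequentially. \<forall>z\<in>W i. u i differentiable (at z)"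
    unfolding wirtinger_family_def using chart E(2)
  proof eventually_elim
    case (elim i)
    then show ?case
      by (intro ballI chart_derivative(1)[where W = "W i" and E = "E i" and \<iota> = "\<iota> i"]) blast+
  qed
  with E(2) have "\<forall>\<^sub>F i in sequentially. \<forall>z\<in>W i. u i z = Re (E i (\<iota> i z)) \<and> u i differentiable (at z)"
    by eventually_elim auto
  with E(1) show ?case by auto
next
  case (Cons b bs)
  then obtain F where F: "P F" "\<forall>\<^sub>F i in sequentially. \<forall>z\<in>W i.
      iter_pd bs (u i) z = Re (F i (\<iota> i z)) \<and> iter_pd bs (u i) differentiable (at z)" by auto
  obtain F1 F2 where FW: "wirtinger_family N F F1 F2" and
     P1: "P (\<lambda>i s. F1 i s * Z1 i s + F2 i s * cnj (Z1 i s))" and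
     P2: "P (\<lambda>i s. F1 i s * Z2 i s + F2 i s * cnj (Z2 i s))" using step[OF F(1)] by auto
  define G where "G = (if b then (\<lambda>i s. F1 i s * Z1 i s + F2 i s * cnj (Z1 i s))
    else (\<lambda>i s. F1 i s * Z2 i s + F2 i s * cnj (Z2 i s)))"
  have G: "P G" using P1 P2 by (simp add: G_def)
  have ev: "\<forall>\<^sub>F i in sequentially. \<forall>z\<in>W i. iter_pd (b # bs) (u i) z = Re (G i (\<iota> i z))"
    using F(2) FW[unfolded wirtinger_family_def] chart
  proof eventually_elim
    case (elim i)
    show ?case
    proof
      fix z assume z: "z \<in> W i"
      with elim have 1: "(\<iota> i has_derivative (\<lambda>(a, b). of_real a * Z1 i (\<iota> i z) + of_real b * Z2 i (\<iota> i z))) (at z)"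
        and 2: "(F i has_derivative (\<lambda>d. F1 i (\<iota> i z) * d + F2 i (\<iota> i z) * cnj d)) (at (\<iota> i z))"
        and 3: "open (W i)" and 4: "\<And>z. z \<in> W i \<Longrightarrow> iter_pd bs (u i) z = Re (F i (\<iota> i z))" by auto
      show "iter_pd (b # bs) (u i) z = Re (G i (\<iota> i z))"
        using chart_derivative(2,3)[OF 1 2 3 z 4] by (simp add: G_def)
    qed
  qed
  obtain G1 G2 where "wirtinger_family N G G1 G2" using step[OF G] by auto
  then have "\<forall>\<^sub>F i in sequentially. \<forall>z\<in>W i. iter_pd (b # bs) (u i) differentiable (at z)"
    unfolding wirtinger_family_def using chart ev
  proof eventually_elim
    case (elim i)
    then show ?case
      by (intro ballI chart_derivative(1)[where W = "W i" and E = "G i" and \<iota> = "\<iota> i"]) blast+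
  qed
  with ev have "\<forall>\<^sub>F i in sequentially. \<forall>z\<in>W i. iter_pd (b # bs) (u i) z = Re (G i (\<iota> i z)) \<and>
      iter_pd (b # bs) (u i) differentiable (at z)" by eventually_elim auto
  with G show ?case by blast
qed

lemma smooth_family_chart_step:
  assumes "open N" "smooth_family N Z1" "smooth_family N Z2" "smooth_family N E"
  shows "\<exists>E1 E2. wirtinger_family N E E1 E2 \<and>
      smooth_family N (\<lambda>i s. E1 i s * Z1 i s + E2 i s * cnj (Z1 i s)) \<and>
      smooth_family N (\<lambda>i s. E1 i s * Z2 i s + E2 i s * cnj (Z2 i s))"
proof -
  obtain E1 E2 where E: "smooth_family N E1" "smooth_family N E2" "wirtinger_family N E E1 E2"
    using smooth_family_wirtinger[OF assms(1,4)] by auto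
  have *: "smooth_family N (\<lambda>i s. E1 i s * Z i s + E2 i s * cnj (Z i s))" if "smooth_family N Z" for Z
    by (rule smooth_family.add[OF smooth_family.mult[OF E(1) that]
          smooth_family.mult[OF E(2) smooth_family.cnj[OF that]]])
  show ?thesis using E(3) *[OF assms(2)] *[OF assms(3)] by auto
qed

lemma null_family_chart_step:
  assumes "open N" "smooth_family N Z1" "smooth_family N Z2" "null_family N E"
  shows "\<exists>E1 E2. wirtinger_family N E E1 E2 \<and>
      null_family N (\<lambda>i s. E1 i s * Z1 i s + E2 i s * cnj (Z1 i s)) \<and>
      null_family N (\<lambda>i s. E1 i s * Z2 i s + E2 i s * cnj (Z2 i s))"
proof -
  obtain E1 E2 where E: "null_family N E1" "null_family N E2" "wirtinger_family N E E1 E2"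
    using null_family_wirtinger[OF assms(1,4)] by auto
  have *: "null_family N (\<lambda>i s. E1 i s * Z i s + E2 i s * cnj (Z i s))" if "smooth_family N Z" for Z
    by (rule null_family.add[OF null_family.mult[OF E(1) that]
          null_family.mult[OF E(2) smooth_family.cnj[OF that]]])
  show ?thesis using E(3) *[OF assms(2)] *[OF assms(3)] by auto
qed

section \<open>Height functions over two of the coordinates\<close>

definition jac :: "(complex \<Rightarrow> complex) \<Rightarrow> (complex \<Rightarrow> complex) \<Rightarrow> complex \<Rightarrow> real" where
  "jac p1 p2 s = Im (cnj (p1 s) * p2 s)"

text \<open>\<open>jac\<close> is minus the determinant of the differential
  \<open>d \<mapsto> (Re (p1 * d), Re (p2 * d))\<close>. \<open>dual1\<close> and
  \<open>dual2\<close> form the basis dual to these two functionals, that is, the columns of the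
  inverse differential.\<close>

definition dual1 :: "(complex \<Rightarrow> complex) \<Rightarrow> (complex \<Rightarrow> complex) \<Rightarrow> complex \<Rightarrow> complex" where
  "dual1 p1 p2 s = \<i> * cnj (p2 s) * inverse (of_real (jac p1 p2 s))"

definition dual2 :: "(complex \<Rightarrow> complex) \<Rightarrow> (complex \<Rightarrow> complex) \<Rightarrow> complex \<Rightarrow> complex" where
  "dual2 p1 p2 s = - \<i> * cnj (p1 s) * inverse (of_real (jac p1 p2 s))"

text \<open>The coordinates are locally real parts of primitives of \<open>p1\<close>,
  \<open>p2\<close>, \<open>p3\<close>, hence harmonic. Smoothness of the height comes from this
  holomorphy; conformality enters in \<open>minimal_gr\<close>.\<close>

locale harmonic_graph =
  fixes N :: "complex set" and x1 x2 x3 :: "complex \<Rightarrow> real" and p1 p2 p3 :: "complex \<Rightarrow> complex"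
  assumes open_N: "open N"
    and x1: "\<And>s. s \<in> N \<Longrightarrow> (x1 has_derivative (\<lambda>d. Re (p1 s * d))) (at s)"
    and x2: "\<And>s. s \<in> N \<Longrightarrow> (x2 has_derivative (\<lambda>d. Re (p2 s * d))) (at s)"
    and x3: "\<And>s. s \<in> N \<Longrightarrow> (x3 has_derivative (\<lambda>d. Re (p3 s * d))) (at s)"
    and hol: "p1 holomorphic_on N" "p2 holomorphic_on N" "p3 holomorphic_on N"
    and jac: "\<And>s. s \<in> N \<Longrightarrow> jac p1 p2 s \<noteq> 0"
    and inj: "inj_on (\<lambda>s. (x1 s, x2 s)) N"
begin

definition W :: "(real \<times> real) set" where "W = (\<lambda>s. (x1 s, x2 s)) ` N"
definition inv_chart :: "real \<times> real \<Rightarrow> complex" where "inv_chart = inv_into N (\<lambda>s. (x1 s, x2 s))"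
definition gr :: "real \<times> real \<Rightarrow> real" where "gr z = x3 (inv_chart z)"
abbreviation "Z1 \<equiv> dual1 p1 p2"
abbreviation "Z2 \<equiv> dual2 p1 p2"

lemma inv_chart: "s \<in> N \<Longrightarrow> inv_chart (x1 s, x2 s) = s"
  unfolding inv_chart_def using inv_into_f_f[OF inj] by simp

lemma inv_chart_in: "z \<in> W \<Longrightarrow> inv_chart z \<in> N"
  using inv_chart by (auto simp: W_def)

lemma F_deriv: "s \<in> N \<Longrightarrow>
   ((\<lambda>s. Complex (x1 s) (x2 s)) has_derivative (\<lambda>d. Complex (Re (p1 s * d)) (Re (p2 s * d)))) (at s)"
  unfolding has_derivative_componentwise_within[of "\<lambda>s. Complex (x1 s) (x2 s)"]
  using x1[of s] x2[of s] by (auto simp: Basis_complex_def)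

lemma open_W: "open W"
proof -
  define F where "F s = Complex (x1 s) (x2 s)" for s
  have cont: "continuous_on N F"
    using F_deriv unfolding F_def
    by (meson continuous_at_imp_continuous_on has_derivative_continuous)
  have "inj_on F N" using inj by (auto simp: inj_on_def F_def)
  with invariance_of_domain[OF cont open_N] have o: "open (F ` N)" by simp
  have "W = (\<lambda>z. Complex (fst z) (snd z)) -` (F ` N)"
    by (auto simp: W_def F_def image_iff vimage_def)
  moreover have "continuous_on UNIV (\<lambda>z :: real \<times> real. Complex (fst z) (snd z))"
    unfolding complex_eq by (intro continuous_intros)
  ultimately show ?thesis using o by (simp add: open_vimage)
qed

lemma inv_chart_deriv:
  assumes "z \<in> W"
  shows "(inv_chart has_derivative (\<lambda>(a, b). of_real a * Z1 (inv_chart z) + of_real b * Z2 (inv_chart z))) (at z)"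
proof -
  obtain s where s: "s \<in> N" "z = (x1 s, x2 s)" using assms by (auto simp: W_def)
  define F where "F s = Complex (x1 s) (x2 s)" for s
  define G where "G w = inv_chart (Re w, Im w)" for w
  define J where "J = jac p1 p2 s"
  have J: "J \<noteq> 0" using jac s J_def by simp
  \<comment> \<open>Duality at \<open>s\<close>; these four values make the candidate derivative a
    right inverse of the differential of \<open>F\<close>.\<close>
  have a: "Re (p1 s * Z1 s) = 1" "Re (p2 s * Z1 s) = 0" "Re (p1 s * Z2 s) = 0" "Re (p2 s * Z2 s) = 1"
    using J unfolding dual1_def dual2_def J_def[symmetric]
    by (simp_all add: J_def jac_def field_simps)
  have "(G has_derivative (\<lambda>w. of_real (Re w) * Z1 s + of_real (Im w) * Z2 s)) (at (F s))"
  proof (rule has_derivative_inverse_on[where f' = "\<lambda>s d. Complex (Re (p1 s * d)) (Re (p2 s * d))" and S = N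
     and g' = "\<lambda>s w. of_real (Re w) * Z1 s + of_real (Im w) * Z2 s"])
    show "(F has_derivative (\<lambda>d. Complex (Re (p1 s * d)) (Re (p2 s * d)))) (at s)" if "s \<in> N" for s
      using F_deriv[OF that] by (simp add: F_def[abs_def])
    show "(\<lambda>d. Complex (Re (p1 s * d)) (Re (p2 s * d))) \<circ> (\<lambda>w. of_real (Re w) * Z1 s + of_real (Im w) * Z2 s) = id"
    proof
      fix w :: complex
      have "Re (p1 s * (of_real (Re w) * Z1 s + of_real (Im w) * Z2 s)) =
         Re w * Re (p1 s * Z1 s) + Im w * Re (p1 s * Z2 s)"
        "Re (p2 s * (of_real (Re w) * Z1 s + of_real (Im w) * Z2 s)) =
         Re w * Re (p2 s * Z1 s) + Im w * Re (p2 s * Z2 s)" by (simp_all add: algebra_simps)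
      then show "((\<lambda>d. Complex (Re (p1 s * d)) (Re (p2 s * d))) \<circ> (\<lambda>w. of_real (Re w) * Z1 s + of_real (Im w) * Z2 s)) w = id w"
        using a by (simp add: complex_eq_iff)
    qed
  qed (use open_N s inv_chart in \<open>auto simp: G_def F_def\<close>)
  then have G: "(G has_derivative (\<lambda>w. of_real (Re w) * Z1 s + of_real (Im w) * Z2 s)) (at (Complex (fst z) (snd z)))"
    by (simp add: F_def s(2))
  have "((\<lambda>z. Complex (fst z) (snd z)) has_derivative (\<lambda>z. Complex (fst z) (snd z))) (at z)"
    by (rule bounded_linear_imp_has_derivative)
       (auto simp: linear_conv_bounded_linear[symmetric] complex_eq_iff intro!: linearI)
  from has_derivative_compose[OF this G] have "((\<lambda>z. G (Complex (fst z) (snd z))) has_derivative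
      (\<lambda>z. of_real (Re (Complex (fst z) (snd z))) * Z1 s + of_real (Im (Complex (fst z) (snd z))) * Z2 s)) (at z)"
    .
  moreover have "inv_chart z = s" by (simp only: s(2) inv_chart[OF s(1)])
  ultimately show ?thesis unfolding G_def by (simp add: case_prod_unfold)
qed

lemma gr_derivs:
  assumes "z \<in> W"
  shows "gr differentiable (at z)" "pd1 gr z = Re (p3 (inv_chart z) * Z1 (inv_chart z))"
    "pd2 gr z = Re (p3 (inv_chart z) * Z2 (inv_chart z))"
proof -
  \<comment> \<open>The real differential \<open>Re (p3 * d)\<close> in Wirtinger form; the two
    halves recombine when the real part is taken.\<close>
  have e: "((\<lambda>s. complex_of_real (x3 s)) has_derivative
     (\<lambda>d. p3 (inv_chart z) / 2 * d + cnj (p3 (inv_chart z)) / 2 * cnj d)) (at (inv_chart z))"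
    by (rule has_derivative_eq_rhs[OF has_derivative_of_real[OF x3[OF inv_chart_in[OF assms]]]])
       (auto simp: fun_eq_iff complex_eq_iff field_simps)
  have g: "gr z = Re (complex_of_real (x3 (inv_chart z)))" for z by (simp add: gr_def)
  note c = chart_derivative[OF inv_chart_deriv[OF assms] e open_W assms g]
  show "gr differentiable (at z)" by (rule c)
  show "pd1 gr z = Re (p3 (inv_chart z) * Z1 (inv_chart z))" "pd2 gr z = Re (p3 (inv_chart z) * Z2 (inv_chart z))"
    using c by (simp_all add: algebra_simps)
qed

end

lemma smooth_family_Z:
  assumes p: "smooth_family N p1" "smooth_family N p2"
    and J: "locally_bounded_family N (\<lambda>i s. inverse (of_real (jac (p1 i) (p2 i) s)))"
       "\<forall>\<^sub>F i in sequentially. \<forall>s\<in>N. jac (p1 i) (p2 i) s \<noteq> 0"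
  shows "smooth_family N (\<lambda>i. dual1 (p1 i) (p2 i))"
    "smooth_family N (\<lambda>i. dual2 (p1 i) (p2 i))"
proof -
  have eq: "(\<lambda>i s. complex_of_real (jac (p1 i) (p2 i) s)) =
     (\<lambda>i s. - (\<i> / 2) * (cnj (p1 i s) * p2 i s + (-1) * (p1 i s * cnj (p2 i s))))"
    by (simp add: jac_def fun_eq_iff complex_eq_iff field_simps)
  have "smooth_family N (\<lambda>i s. complex_of_real (jac (p1 i) (p2 i) s))"
    unfolding eq by (intro smooth_family.mult smooth_family.add smooth_family_const smooth_family.cnj p)
  then have i: "smooth_family N (\<lambda>i s. inverse (complex_of_real (jac (p1 i) (p2 i) s)))"
    by (rule smooth_family.inverse) (use J in auto)
  note * = smooth_family.mult[OF smooth_family.mult[OF smooth_family_const smooth_family.cnj[OF p(2)]] i, of \<i>]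
   smooth_family.mult[OF smooth_family.mult[OF smooth_family_const smooth_family.cnj[OF p(1)]] i, of "-\<i>"]
  show "smooth_family N (\<lambda>i. dual1 (p1 i) (p2 i))"
    "smooth_family N (\<lambda>i. dual2 (p1 i) (p2 i))"
    using * unfolding dual1_def[abs_def] dual2_def[abs_def] by simp_all
qed

text \<open>The induction starts at the first derivatives, which are real parts of \<open>p3\<close>
  times a dual vector. The height itself is not assumed to come from \<open>P\<close>.\<close>

lemma harmonic_graph_family:
  assumes "open N"
    and hg: "\<forall>\<^sub>F i in sequentially. harmonic_graph N (x1 i) (x2 i) (x3 i) (p1 i) (p2 i) (p3 i)"
    and step: "\<And>E. P E \<Longrightarrow> \<exists>E1 E2. wirtinger_family N E E1 E2 \<and>
      P (\<lambda>i s. E1 i s * dual1 (p1 i) (p2 i) s + E2 i s * cnj (dual1 (p1 i) (p2 i) s)) \<and>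
      P (\<lambda>i s. E1 i s * dual2 (p1 i) (p2 i) s + E2 i s * cnj (dual2 (p1 i) (p2 i) s))"
    and P: "P (\<lambda>i s. p3 i s * dual1 (p1 i) (p2 i) s)"
      "P (\<lambda>i s. p3 i s * dual2 (p1 i) (p2 i) s)"
    and "bs \<noteq> []"
  shows "\<exists>E. P E \<and> (\<forall>\<^sub>F i in sequentially. \<forall>z\<in>harmonic_graph.W N (x1 i) (x2 i).
    iter_pd bs (harmonic_graph.gr N (x1 i) (x2 i) (x3 i)) z = Re (E i (harmonic_graph.inv_chart N (x1 i) (x2 i) z)) \<and>
    iter_pd bs (harmonic_graph.gr N (x1 i) (x2 i) (x3 i)) differentiable (at z))"
proof -
  \<comment> \<open>\<open>iter_pd\<close> applies the last entry of the list first, so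
    \<open>b\<close> is the first derivative taken.\<close>
  obtain cs b where bs: "bs = cs @ [b]" using \<open>bs \<noteq> []\<close> by (metis rev_exhaust)
  define E0 where "E0 = (if b then (\<lambda>i s. p3 i s * dual1 (p1 i) (p2 i) s)
    else (\<lambda>i s. p3 i s * dual2 (p1 i) (p2 i) s))"
  have E0: "P E0" using P by (simp add: E0_def)
  have chart: "\<forall>\<^sub>F i in sequentially. open (harmonic_graph.W N (x1 i) (x2 i)) \<and>
    (\<forall>z\<in>harmonic_graph.W N (x1 i) (x2 i). harmonic_graph.inv_chart N (x1 i) (x2 i) z \<in> N \<and>
      (harmonic_graph.inv_chart N (x1 i) (x2 i) has_derivative
        (\<lambda>(a, b). of_real a * dual1 (p1 i) (p2 i) (harmonic_graph.inv_chart N (x1 i) (x2 i) z)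
          + of_real b * dual2 (p1 i) (p2 i) (harmonic_graph.inv_chart N (x1 i) (x2 i) z))) (at z))"
    using hg
  proof eventually_elim
    case (elim i)
    then interpret harmonic_graph N "x1 i" "x2 i" "x3 i" "p1 i" "p2 i" "p3 i" .
    show ?case using open_W inv_chart_in inv_chart_deriv by blast
  qed
  have "\<forall>\<^sub>F i in sequentially. \<forall>z\<in>harmonic_graph.W N (x1 i) (x2 i).
     iter_pd [b] (harmonic_graph.gr N (x1 i) (x2 i) (x3 i)) z =
       Re (E0 i (harmonic_graph.inv_chart N (x1 i) (x2 i) z))"
    using hg
  proof eventually_elim
    case (elim i)
    then interpret harmonic_graph N "x1 i" "x2 i" "x3 i" "p1 i" "p2 i" "p3 i" .
    show ?case using gr_derivs by (simp add: E0_def)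
  qed
  from iter_pd_family[of P N "\<lambda>i. dual1 (p1 i) (p2 i)" "\<lambda>i. dual2 (p1 i) (p2 i)",
     OF step chart E0 this, of cs]
  show ?thesis by (simp add: bs iter_pd_append)
qed

context harmonic_graph
begin

text \<open>The family argument for constant sequences: on compact sets, continuity bounds the
  holomorphic data and the inverse Jacobian.\<close>

lemma smooth_gr: "smooth_on W gr"
proof -
  have sf: "smooth_family N (\<lambda>_::nat. g)" if "g holomorphic_on N" for g
  proof (rule smooth_family.holomorphic)
    show "locally_bounded_family N (\<lambda>_. g)" unfolding locally_bounded_family_def
    proof (intro allI impI)
      fix K assume "compact K \<and> K \<subseteq> N"
      then have "bounded (g ` K)"
        by (meson compact_continuous_image compact_imp_bounded continuous_on_subset holomorphic_on_imp_continuous_on that)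
      then show "\<exists>C>0. \<forall>\<^sub>F i in sequentially. \<forall>s\<in>K. cmod (g s) \<le> C"
        unfolding bounded_pos by auto
    qed
  qed (use that in simp)
  have J: "locally_bounded_family N (\<lambda>_::nat. \<lambda>s. inverse (complex_of_real (jac p1 p2 s)))"
    unfolding locally_bounded_family_def
  proof (intro allI impI)
    fix K assume K: "compact K \<and> K \<subseteq> N"
    have "continuous_on N p1" "continuous_on N p2" using hol holomorphic_on_imp_continuous_on by auto
    then have "continuous_on N (jac p1 p2)" unfolding jac_def[abs_def] by (intro continuous_intros)
    then have "continuous_on K (jac p1 p2)" using K continuous_on_subset by blast
    then have "continuous_on K (\<lambda>s. inverse (complex_of_real (jac p1 p2 s)))"
      by (intro continuous_intros) (use jac K in auto)
    then have "bounded ((\<lambda>s. inverse (complex_of_real (jac p1 p2 s))) ` K)"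
      using K compact_continuous_image compact_imp_bounded by blast
    then show "\<exists>C>0. \<forall>\<^sub>F i in sequentially. \<forall>s\<in>K. cmod (inverse (complex_of_real (jac p1 p2 s))) \<le> C"
      unfolding bounded_pos by auto
  qed
  note Z = smooth_family_Z[OF sf[OF hol(1)] sf[OF hol(2)] J]
  have Z': "smooth_family N (\<lambda>_. Z1)" "smooth_family N (\<lambda>_. Z2)" using Z jac by auto
  have hg: "\<forall>\<^sub>F i in sequentially. harmonic_graph N x1 x2 x3 p1 p2 p3"
    using harmonic_graph_axioms by simp
  have "iter_pd bs gr differentiable (at z)" if "z \<in> W" for bs z
  proof (cases "bs = []")
    case False
    obtain E where "\<forall>\<^sub>F i in (sequentially :: nat filter). \<forall>z\<in>W. iter_pd bs gr z = Re (E i (inv_chart z)) \<and>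
       iter_pd bs gr differentiable (at z)"
      using harmonic_graph_family[OF open_N hg, of "smooth_family N" bs,
        OF smooth_family_chart_step[OF open_N Z'] smooth_family.mult[OF sf[OF hol(3)] Z'(1)]
        smooth_family.mult[OF sf[OF hol(3)] Z'(2)] False] by auto
    then show ?thesis using that by (auto simp: eventually_sequentially)
  qed (use that gr_derivs in simp)
  then show ?thesis using open_W by (simp add: smooth_on_def)
qed

lemma pd_gr_derivative:
  assumes "z \<in> W"
  shows "(iter_pd bs gr has_derivative (\<lambda>(a, b). a * pd1 (iter_pd bs gr) z + b * pd2 (iter_pd bs gr) z)) (at z)"
  by (rule has_derivative_pd) (use smooth_gr assms in \<open>simp add: smooth_on_def\<close>)

text \<open>Holomorphy of \<open>p1\<close>, \<open>p2\<close>, \<open>p3\<close> gives one linear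
  relation between the second derivatives of the height, with coefficients quadratic in
  \<open>p1\<close> and \<open>p2\<close>. Conformality identifies these coefficients, up to a
  factor, with those of the minimal surface equation.\<close>

lemma minimal_gr:
  assumes conf: "\<And>s. s \<in> N \<Longrightarrow> (p1 s)\<^sup>2 + (p2 s)\<^sup>2 + (p3 s)\<^sup>2 = 0"
  shows "minimal_graph_eq W gr"
  unfolding minimal_graph_eq_def
proof
  fix z assume z: "z \<in> W"
  then obtain s where s: "s \<in> N" "z = (x1 s, x2 s)" by (auto simp: W_def)
  define U where "U s = pd1 gr (x1 s, x2 s)" for s
  define V where "V s = pd2 gr (x1 s, x2 s)" for s
  \<comment> \<open>The tangent plane of the graph: \<open>p3\<close> is the combination of
    \<open>p1\<close> and \<open>p2\<close> with the two slopes as real coefficients.\<close>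
  have p3: "p3 t = of_real (U t) * p1 t + of_real (V t) * p2 t" if "t \<in> N" for t
  proof -
    have t: "(x1 t, x2 t) \<in> W" using that by (auto simp: W_def)
    have "jac p1 p2 t \<noteq> 0" using jac that by simp
    moreover have "U t = Re (p3 t * Z1 t)" "V t = Re (p3 t * Z2 t)"
      using gr_derivs[OF t] inv_chart[OF that] by (simp_all add: U_def V_def)
    ultimately have "U t * jac p1 p2 t = Re (p3 t * (\<i> * cnj (p2 t)))"
      "V t * jac p1 p2 t = Re (p3 t * (- \<i> * cnj (p1 t)))"
      unfolding dual1_def dual2_def by (simp_all add: field_simps)
    then have "jac p1 p2 t * Re (p3 t) = jac p1 p2 t * (U t * Re (p1 t) + V t * Re (p2 t))"
      "jac p1 p2 t * Im (p3 t) = jac p1 p2 t * (U t * Im (p1 t) + V t * Im (p2 t))"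
      unfolding jac_def by simp_all algebra+
    with \<open>jac p1 p2 t \<noteq> 0\<close> show ?thesis by (simp add: complex_eq_iff)
  qed
  define A B C D where "A = pd1 (pd1 gr) z" and "B = pd2 (pd1 gr) z" and "C = pd1 (pd2 gr) z" and "D = pd2 (pd2 gr) z"
  have ch: "((\<lambda>s. (x1 s, x2 s)) has_derivative (\<lambda>d. (Re (p1 s * d), Re (p2 s * d)))) (at s)"
    by (intro has_derivative_Pair x1 x2 s)
  have dU: "(U has_derivative (\<lambda>d. Re (p1 s * d) * A + Re (p2 s * d) * B)) (at s)"
  proof -
    have "((\<lambda>t. iter_pd [True] gr (x1 t, x2 t)) has_derivative (\<lambda>d. (\<lambda>(a, b). a * pd1 (iter_pd [True] gr) z
       + b * pd2 (iter_pd [True] gr) z) (Re (p1 s * d), Re (p2 s * d)))) (at s)"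
      by (rule has_derivative_compose[OF ch]) (unfold s(2)[symmetric], rule pd_gr_derivative[OF z])
    then show ?thesis by (simp add: U_def[abs_def] A_def B_def)
  qed
  have dV: "(V has_derivative (\<lambda>d. Re (p1 s * d) * C + Re (p2 s * d) * D)) (at s)"
  proof -
    have "((\<lambda>t. iter_pd [False] gr (x1 t, x2 t)) has_derivative (\<lambda>d. (\<lambda>(a, b). a * pd1 (iter_pd [False] gr) z
       + b * pd2 (iter_pd [False] gr) z) (Re (p1 s * d), Re (p2 s * d)))) (at s)"
      by (rule has_derivative_compose[OF ch]) (unfold s(2)[symmetric], rule pd_gr_derivative[OF z])
    then show ?thesis by (simp add: V_def[abs_def] C_def D_def)
  qed
  obtain q1 q2 q3 where q: "(p1 has_derivative (\<lambda>d. q1 * d)) (at s)" "(p2 has_derivative (\<lambda>d. q2 * d)) (at s)"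
     "(p3 has_derivative (\<lambda>d. q3 * d)) (at s)"
    using hol[THEN holomorphic_derivI, OF open_N s(1)] unfolding has_field_derivative_def by blast
  have d: "((\<lambda>t. of_real (U t) * p1 t + of_real (V t) * p2 t) has_derivative
    (\<lambda>d. of_real (U s) * (q1 * d) + of_real (Re (p1 s * d) * A + Re (p2 s * d) * B) * p1 s +
       (of_real (V s) * (q2 * d) + of_real (Re (p1 s * d) * C + Re (p2 s * d) * D) * p2 s))) (at s)"
    by (intro has_derivative_add has_derivative_mult has_derivative_of_real dU dV q)
  have "(p3 has_derivative
    (\<lambda>d. of_real (U s) * (q1 * d) + of_real (Re (p1 s * d) * A + Re (p2 s * d) * B) * p1 s +
       (of_real (V s) * (q2 * d) + of_real (Re (p1 s * d) * C + Re (p2 s * d) * D) * p2 s))) (at s)"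
    by (rule has_derivative_transform_within_open[OF d open_N s(1)]) (use p3 in simp)
  from has_derivative_unique[OF q(3) this]
  have eq: "q3 * d = of_real (U s) * (q1 * d) + of_real (Re (p1 s * d) * A + Re (p2 s * d) * B) * p1 s +
       (of_real (V s) * (q2 * d) + of_real (Re (p1 s * d) * C + Re (p2 s * d) * D) * p2 s)" for d by (rule fun_cong)
  define a b c e where "a = Re (p1 s)" and "b = Im (p1 s)" and "c = Re (p2 s)" and "e = Im (p2 s)"
  define J where "J = a * e - b * c"
  have J: "J \<noteq> 0" using jac[OF s(1)] by (simp add: jac_def J_def a_def b_def c_def e_def)
  \<comment> \<open>The terms with \<open>q1\<close>, \<open>q2\<close>, \<open>q3\<close> are
    complex linear in the direction and cancel when the directions 1 and \<open>\<i>\<close> are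
    compared. The imaginary part of what remains is \<open>R\<close>, the real part the symmetry of
    the mixed derivatives.\<close>
  note e1 = eq[of 1] and e2 = eq[of \<i>]
  have R: "(a\<^sup>2 + b\<^sup>2) * A + (a * c + b * e) * (B + C) + (c\<^sup>2 + e\<^sup>2) * D = 0"
    using e1 e2 by (simp add: complex_eq_iff a_def b_def c_def e_def power2_eq_square) algebra
  have I: "J * (B - C) = 0"
    using e1 e2 by (simp add: complex_eq_iff a_def b_def c_def e_def power2_eq_square J_def) algebra
  have BC: "B = C" using I J by simp
  define u v where "u = U s" and "v = V s"
  have cf: "(p1 s)\<^sup>2 + (p2 s)\<^sup>2 + (of_real u * p1 s + of_real v * p2 s)\<^sup>2 = 0"
    using conf[OF s(1)] unfolding p3[OF s(1)] u_def v_def .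
  \<comment> \<open>\<open>l\<close> is the conformal factor: both tangent vectors have this squared
    length, and they are orthogonal.\<close>
  define l where "l = (1 + u\<^sup>2) * a\<^sup>2 + 2 * u * v * a * c + (1 + v\<^sup>2) * c\<^sup>2"
  have l2: "(1 + u\<^sup>2) * b\<^sup>2 + 2 * u * v * b * e + (1 + v\<^sup>2) * e\<^sup>2 = l"
    using arg_cong[OF cf, of Re] by (simp add: power2_eq_square a_def b_def c_def e_def l_def algebra_simps)
  have l12: "(1 + u\<^sup>2) * a * b + u * v * (a * e + b * c) + (1 + v\<^sup>2) * c * e = 0"
    using arg_cong[OF cf, of Im] by (simp add: power2_eq_square a_def b_def c_def e_def algebra_simps)
  \<comment> \<open>The identities below invert the congruence that takes the first fundamental form
    of the graph to \<open>l\<close> times the identity. Then \<open>J\<^sup>2\<close> times the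
    minimal surface operator is \<open>l\<close> times the left side of \<open>R\<close>.\<close>
  define l2' where "l2' = (1 + u\<^sup>2) * b\<^sup>2 + 2 * u * v * b * e + (1 + v\<^sup>2) * e\<^sup>2"
  define l12' where "l12' = (1 + u\<^sup>2) * a * b + u * v * (a * e + b * c) + (1 + v\<^sup>2) * c * e"
  have ll: "l2' = l" "l12' = 0" using l2 l12 by (simp_all add: l2'_def l12'_def)
  have "J\<^sup>2 * (1 + u\<^sup>2) = e\<^sup>2 * l - 2 * c * e * l12' + c\<^sup>2 * l2'"
    unfolding J_def l_def l2'_def l12'_def by (simp add: power2_eq_square algebra_simps)
  then have 1: "J\<^sup>2 * (1 + u\<^sup>2) = l * (c\<^sup>2 + e\<^sup>2)" using ll by (simp add: algebra_simps)
  have "J\<^sup>2 * (1 + v\<^sup>2) = b\<^sup>2 * l - 2 * a * b * l12' + a\<^sup>2 * l2'"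
    unfolding J_def l_def l2'_def l12'_def by (simp add: power2_eq_square algebra_simps)
  then have 2: "J\<^sup>2 * (1 + v\<^sup>2) = l * (a\<^sup>2 + b\<^sup>2)" using ll by (simp add: algebra_simps)
  have "J\<^sup>2 * (u * v) = - b * e * l + (a * e + b * c) * l12' - a * c * l2'"
    unfolding J_def l_def l2'_def l12'_def by (simp add: power2_eq_square algebra_simps)
  then have 3: "J\<^sup>2 * (u * v) = - l * (a * c + b * e)" using ll by (simp add: algebra_simps)
  have "J\<^sup>2 * ((1 + v\<^sup>2) * A - 2 * (u * v) * B + (1 + u\<^sup>2) * D) = 0"
    using 1 2 3 R BC by algebra
  then have "(1 + v\<^sup>2) * A - 2 * (u * v) * B + (1 + u\<^sup>2) * D = 0" using J by simp
  then show "(1 + (pd2 gr z)\<^sup>2) * pd1 (pd1 gr) z - 2 * pd1 gr z * pd2 gr z * pd2 (pd1 gr) z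
     + (1 + (pd1 gr z)\<^sup>2) * pd2 (pd2 gr) z = 0"
    by (simp add: A_def B_def D_def u_def v_def U_def V_def s(2) mult.assoc)
qed

end

text \<open>A quantitative inverse function theorem: the differential of the projection is
  invertible at \<open>s0\<close> and continuous in operator norm, so the projection is injective on
  a small ball.\<close>

lemma local_harmonic_graph:
  assumes T: "open T" "s0 \<in> T"
    and x1: "\<And>s. s \<in> T \<Longrightarrow> (x1 has_derivative (\<lambda>d. Re (p1 s * d))) (at s)"
    and x2: "\<And>s. s \<in> T \<Longrightarrow> (x2 has_derivative (\<lambda>d. Re (p2 s * d))) (at s)"
    and x3: "\<And>s. s \<in> T \<Longrightarrow> (x3 has_derivative (\<lambda>d. Re (p3 s * d))) (at s)"
    and hol: "p1 holomorphic_on T" "p2 holomorphic_on T" "p3 holomorphic_on T"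
    and J0: "jac p1 p2 s0 \<noteq> 0"
  obtains N where "s0 \<in> N" "N \<subseteq> T" "harmonic_graph N x1 x2 x3 p1 p2 p3"
proof -
  have cont: "continuous_on T p1" "continuous_on T p2" using hol holomorphic_on_imp_continuous_on by auto
  then have "continuous_on T (jac p1 p2)" unfolding jac_def[abs_def] by (intro continuous_intros)
  then have "open (T \<inter> jac p1 p2 -` (- {0}))"
    using T(1) by (intro continuous_open_preimage) auto
  define F where "F s = Complex (x1 s) (x2 s)" for s
  define D where "D s d = Complex (Re (p1 s * d)) (Re (p2 s * d))" for s d
  define J where "J = jac p1 p2 s0"
  define G where "G w = of_real (Re w) * dual1 p1 p2 s0 + of_real (Im w) * dual2 p1 p2 s0" for w
  define T' where "T' = T \<inter> jac p1 p2 -` (- {0})"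
  have T': "open T'" "s0 \<in> T'" using \<open>open (T \<inter> jac p1 p2 -` (- {0}))\<close> T J0 by (auto simp: T'_def)
  have FD: "(F has_derivative D s) (at s)" if "s \<in> T" for s
    unfolding F_def[abs_def] D_def[abs_def]
      has_derivative_componentwise_within[of "\<lambda>s. Complex (x1 s) (x2 s)"]
    using x1[OF that] x2[OF that] by (auto simp: Basis_complex_def)
  have blG: "bounded_linear G"
    unfolding G_def[abs_def]
    by (auto simp: linear_conv_bounded_linear[symmetric] algebra_simps scaleR_conv_of_real intro!: linearI)
  have GD: "G \<circ> D s0 = id"
  proof
    fix w :: complex
    have J: "J \<noteq> 0" using J0 by (simp add: J_def)
    have "of_real J * (G \<circ> D s0) w = of_real J * w"
      using J unfolding o_def G_def D_def dual1_def dual2_def J_def[symmetric]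
      by (simp add: complex_eq_iff field_simps) (simp add: J_def jac_def algebra_simps)
    then show "(G \<circ> D s0) w = id w" using J by simp
  qed
  \<comment> \<open>The differential depends on the point only through \<open>p1\<close> and
    \<open>p2\<close>, so their continuity controls the operator norm.\<close>
  have small: "\<exists>d>0. \<forall>x. dist s0 x < d \<longrightarrow> onorm (\<lambda>v. D x v - D s0 v) < e" if "e > 0" for e
  proof -
    have e4: "e / 4 > 0" using that by simp
    have "isCont p1 s0" "isCont p2 s0" using cont T by (auto simp: continuous_on_eq_continuous_at)
    then obtain d1 d2 where d: "d1 > 0" "\<And>x. dist x s0 < d1 \<Longrightarrow> dist (p1 x) (p1 s0) < e / 4"
      "d2 > 0" "\<And>x. dist x s0 < d2 \<Longrightarrow> dist (p2 x) (p2 s0) < e / 4"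
      unfolding continuous_at using e4 by (metis LIM_def dist_self)
    have "onorm (\<lambda>v. D x v - D s0 v) < e" if "dist s0 x < min d1 d2" for x
    proof -
      have n: "norm (p1 x - p1 s0) < e / 4" "norm (p2 x - p2 s0) < e / 4"
        using d(2)[of x] d(4)[of x] that unfolding dist_norm[symmetric] by (simp_all add: dist_commute)
      have "onorm (\<lambda>v. D x v - D s0 v) \<le> e / 2"
      proof (rule onorm_le)
        fix v
        have "D x v - D s0 v = of_real (Re ((p1 x - p1 s0) * v)) + \<i> * of_real (Re ((p2 x - p2 s0) * v))"
          by (simp add: D_def complex_eq_iff algebra_simps)
        also have "norm \<dots> \<le> \<bar>Re ((p1 x - p1 s0) * v)\<bar> + \<bar>Re ((p2 x - p2 s0) * v)\<bar>"
          by (rule order_trans[OF norm_triangle_ineq]) (simp only: norm_mult norm_ii norm_of_real mult_1 order_refl)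
        also have "\<dots> \<le> norm (p1 x - p1 s0) * norm v + norm (p2 x - p2 s0) * norm v"
          using abs_Re_le_cmod[of "(p1 x - p1 s0) * v"] abs_Re_le_cmod[of "(p2 x - p2 s0) * v"]
          by (simp only: norm_mult add_mono)
        also have "\<dots> \<le> e / 4 * norm v + e / 4 * norm v"
          using n by (intro add_mono mult_right_mono) auto
        finally show "norm (D x v - D s0 v) \<le> e / 2 * norm v" by simp
      qed
      then show ?thesis using \<open>e > 0\<close> by linarith
    qed
    then show ?thesis using d by (intro exI[of _ "min d1 d2"]) auto
  qed
  obtain r where r: "r > 0" "ball s0 r \<subseteq> T'" "inj_on F (ball s0 r)"
    by (rule has_derivative_locally_injective[OF T'(2,1) blG GD FD small]) (auto simp: T'_def)
  have "harmonic_graph (ball s0 r) x1 x2 x3 p1 p2 p3"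
  proof
    show "p1 holomorphic_on ball s0 r" "p2 holomorphic_on ball s0 r" "p3 holomorphic_on ball s0 r"
      using hol r(2) by (auto simp: T'_def intro: holomorphic_on_subset)
    show "inj_on (\<lambda>s. (x1 s, x2 s)) (ball s0 r)" using r(3) by (auto simp: inj_on_def F_def)
  qed (use r(2) x1 x2 x3 in \<open>auto simp: T'_def\<close>)
  with that[of "ball s0 r"] r show ?thesis by (auto simp: T'_def)
qed

text \<open>At every point some two coordinates have independent differentials, so the image is
  locally a graph over a coordinate plane; cyclic permutation reduces the three cases to one. The
  homeomorphism keeps other parts of the image out of the neighbourhood \<open>U\<close>.\<close>

lemma minimal_surface_image:
  fixes X :: "complex \<Rightarrow> real^3"
  assumes T: "open T"
    and X: "\<And>s. X s = pt3 (x1 s) (x2 s) (x3 s)"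
    and x1: "\<And>s. s \<in> T \<Longrightarrow> (x1 has_derivative (\<lambda>d. Re (p1 s * d))) (at s)"
    and x2: "\<And>s. s \<in> T \<Longrightarrow> (x2 has_derivative (\<lambda>d. Re (p2 s * d))) (at s)"
    and x3: "\<And>s. s \<in> T \<Longrightarrow> (x3 has_derivative (\<lambda>d. Re (p3 s * d))) (at s)"
    and hol: "p1 holomorphic_on T" "p2 holomorphic_on T" "p3 holomorphic_on T"
    and conf: "\<And>s. s \<in> T \<Longrightarrow> (p1 s)\<^sup>2 + (p2 s)\<^sup>2 + (p3 s)\<^sup>2 = 0"
    and imm: "\<And>s. s \<in> T \<Longrightarrow> p1 s \<noteq> 0 \<or> p2 s \<noteq> 0 \<or> p3 s \<noteq> 0"
    and homeo: "homeomorphism T (X ` T) X g"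
  shows "minimal_surface (X ` T)"
  unfolding minimal_surface_def
proof
  define E where "E = (axis 1 1 :: real^3)"
  define F where "F = (axis 2 1 :: real^3)"
  define G where "G = (axis 3 1 :: real^3)"
  have on: "norm E = 1" "norm F = 1" "norm G = 1" "E \<bullet> F = 0" "E \<bullet> G = 0" "F \<bullet> G = 0"
    "F \<bullet> E = 0" "G \<bullet> E = 0" "G \<bullet> F = 0"
    by (simp_all add: E_def F_def G_def inner_axis_axis)
  have XE: "X s = x1 s *\<^sub>R E + x2 s *\<^sub>R F + x3 s *\<^sub>R G" for s
    unfolding X pt3_def E_def F_def G_def by (simp add: vec_eq_iff forall_3 axis_def)
  fix p assume "p \<in> X ` T"
  then obtain s0 where s0: "s0 \<in> T" "p = X s0" by auto
  have key: "\<exists>e1 e2 e3 U W u.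
      norm e1 = 1 \<and> norm e2 = 1 \<and> norm e3 = 1 \<and>
      e1 \<bullet> e2 = 0 \<and> e1 \<bullet> e3 = 0 \<and> e2 \<bullet> e3 = 0 \<and>
      open U \<and> p \<in> U \<and> smooth_on W u \<and> minimal_graph_eq W u \<and>
      X ` T \<inter> U = (\<lambda>(x, y). x *\<^sub>R e1 + y *\<^sub>R e2 + u (x, y) *\<^sub>R e3) ` W"
    if y: "\<And>s. s \<in> T \<Longrightarrow> (y1 has_derivative (\<lambda>d. Re (q1 s * d))) (at s)"
      "\<And>s. s \<in> T \<Longrightarrow> (y2 has_derivative (\<lambda>d. Re (q2 s * d))) (at s)"
      "\<And>s. s \<in> T \<Longrightarrow> (y3 has_derivative (\<lambda>d. Re (q3 s * d))) (at s)"
      and q: "q1 holomorphic_on T" "q2 holomorphic_on T" "q3 holomorphic_on T"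
      and J: "jac q1 q2 s0 \<noteq> 0" and cq: "\<And>s. s \<in> T \<Longrightarrow> (q1 s)\<^sup>2 + (q2 s)\<^sup>2 + (q3 s)\<^sup>2 = 0"
      and Xy: "\<And>s. X s = y1 s *\<^sub>R e1 + y2 s *\<^sub>R e2 + y3 s *\<^sub>R e3"
      and e: "norm e1 = 1 \<and> norm e2 = 1 \<and> norm e3 = 1 \<and> e1 \<bullet> e2 = 0 \<and> e1 \<bullet> e3 = 0 \<and> e2 \<bullet> e3 = 0"
    for y1 y2 y3 q1 q2 q3 e1 e2 e3
  proof -
    obtain N where N: "s0 \<in> N" "N \<subseteq> T" "harmonic_graph N y1 y2 y3 q1 q2 q3"
      using local_harmonic_graph[OF T s0(1) y q J] by metis
    interpret harmonic_graph N y1 y2 y3 q1 q2 q3 by (rule N)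
    have "openin (top_of_set (X ` T)) (X ` N)"
      using homeomorphism_imp_open_map[OF homeo] N(2) open_N T by (simp add: open_subset)
    then obtain U where U: "open U" "X ` N = X ` T \<inter> U" by (auto simp: openin_open)
    have "X ` N = (\<lambda>(x, y). x *\<^sub>R e1 + y *\<^sub>R e2 + gr (x, y) *\<^sub>R e3) ` W"
      unfolding W_def image_image by (intro image_cong refl) (simp add: Xy gr_def inv_chart)
    moreover have "minimal_graph_eq W gr" using minimal_gr cq N(2) by blast
    moreover have "p \<in> U" using U(2) N(1) s0(2) by blast
    ultimately show ?thesis
      using e U smooth_gr
      by - (rule exI[of _ e1], rule exI[of _ e2], rule exI[of _ e3], rule exI[of _ U], rule exI[of _ W], rule exI[of _ gr], simp)
  qed
  have "jac p1 p2 s0 \<noteq> 0 \<or> jac p2 p3 s0 \<noteq> 0 \<or> jac p3 p1 s0 \<noteq> 0"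
  proof (rule ccontr)
    assume nz: "\<not> ?thesis"
    define a b c d e f where "a = Re (p1 s0)" and "b = Im (p1 s0)" and "c = Re (p2 s0)"
      and "d = Im (p2 s0)" and "e = Re (p3 s0)" and "f = Im (p3 s0)"
    have z: "a * d - b * c = 0" "c * f - d * e = 0" "e * b - f * a = 0"
      using nz by (simp_all add: jac_def a_def b_def c_def d_def e_def f_def)
    \<comment> \<open>Conformality: the real and imaginary parts of \<open>(p1, p2, p3)\<close> are
      orthogonal and of equal length. When all minors vanish, Lagrange's identity forces both to be
      zero.\<close>
    have r: "a\<^sup>2 + c\<^sup>2 + e\<^sup>2 = b\<^sup>2 + d\<^sup>2 + f\<^sup>2" "a * b + c * d + e * f = 0"
    proof -
      have "Re ((p1 s0)\<^sup>2 + (p2 s0)\<^sup>2 + (p3 s0)\<^sup>2) = 0" "Im ((p1 s0)\<^sup>2 + (p2 s0)\<^sup>2 + (p3 s0)\<^sup>2) = 0"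
        using conf[OF s0(1)] by simp_all
      then show "a\<^sup>2 + c\<^sup>2 + e\<^sup>2 = b\<^sup>2 + d\<^sup>2 + f\<^sup>2" "a * b + c * d + e * f = 0"
        by (simp_all add: power2_eq_square a_def b_def c_def d_def e_def f_def algebra_simps)
    qed
    have "(a\<^sup>2 + c\<^sup>2 + e\<^sup>2) * (b\<^sup>2 + d\<^sup>2 + f\<^sup>2) = (a * b + c * d + e * f)\<^sup>2 + (a * d - b * c)\<^sup>2
       + (c * f - d * e)\<^sup>2 + (e * b - f * a)\<^sup>2" by (simp add: power2_eq_square algebra_simps)
    then have "(a\<^sup>2 + c\<^sup>2 + e\<^sup>2) = 0" unfolding z r by (simp add: r(1)[symmetric])
    then have "a = 0" "c = 0" "e = 0" by (smt (verit) zero_le_power2 power2_eq_iff zero_power2 power_zero_numeral pos2 zero_eq_power2)+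
    moreover have "b\<^sup>2 + d\<^sup>2 + f\<^sup>2 = 0" using r(1) \<open>a\<^sup>2 + c\<^sup>2 + e\<^sup>2 = 0\<close> by simp
    then have "b = 0" "d = 0" "f = 0" by (smt (verit) zero_le_power2 power2_eq_iff zero_power2 power_zero_numeral pos2 zero_eq_power2)+
    ultimately show False using imm[OF s0(1)]
      by (simp add: complex_eq_iff a_def b_def c_def d_def e_def f_def)
  qed
  then show "\<exists>e1 e2 e3 U W u.
      norm e1 = 1 \<and> norm e2 = 1 \<and> norm e3 = 1 \<and>
      e1 \<bullet> e2 = 0 \<and> e1 \<bullet> e3 = 0 \<and> e2 \<bullet> e3 = 0 \<and>
      open U \<and> p \<in> U \<and> smooth_on W u \<and> minimal_graph_eq W u \<and>
      X ` T \<inter> U = (\<lambda>(x, y). x *\<^sub>R e1 + y *\<^sub>R e2 + u (x, y) *\<^sub>R e3) ` W"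
  proof (elim disjE)
    assume J: "jac p1 p2 s0 \<noteq> 0"
    show ?thesis by (rule key[OF x1 x2 x3 hol J conf XE]) (use on in auto)
  next
    assume J: "jac p2 p3 s0 \<noteq> 0"
    have c: "(p2 s)\<^sup>2 + (p3 s)\<^sup>2 + (p1 s)\<^sup>2 = 0" if "s \<in> T" for s
      using conf[OF that] by (simp add: algebra_simps)
    have Xp: "X s = x2 s *\<^sub>R F + x3 s *\<^sub>R G + x1 s *\<^sub>R E" for s
      using XE[of s] by (simp add: algebra_simps)
    show ?thesis by (rule key[OF x2 x3 x1 hol(2,3,1) J c Xp]) (use on in auto)
  next
    assume J: "jac p3 p1 s0 \<noteq> 0"
    have c: "(p3 s)\<^sup>2 + (p1 s)\<^sup>2 + (p2 s)\<^sup>2 = 0" if "s \<in> T" for s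
      using conf[OF that] by (simp add: algebra_simps)
    have Xp: "X s = x3 s *\<^sub>R G + x1 s *\<^sub>R E + x2 s *\<^sub>R F" for s
      using XE[of s] by (simp add: algebra_simps)
    show ?thesis by (rule key[OF x3 x1 x2 hol(3,1,2) J c Xp]) (use on in auto)
  qed
qed

section \<open>The elliptic relation\<close>

definition geo :: "complex \<Rightarrow> complex" where "geo t = t / (1 - t)"

definition lambert :: "real \<Rightarrow> complex \<Rightarrow> complex" where
  "lambert \<epsilon> t = (\<Sum>n. geo (of_real \<epsilon> ^ Suc n * t))"

definition half_cayley :: "complex \<Rightarrow> complex" where "half_cayley s = (s + 1) / (2 * (s - 1))"

definition Yreg :: "real \<Rightarrow> complex \<Rightarrow> complex" where "Yreg \<epsilon> s = lambert \<epsilon> (1 / s) - lambert \<epsilon> s"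

text \<open>A multiplicative form of the Weierstrass zeta function:
  \<open>s * \<theta>' / \<theta> - 1 / 2\<close>, where \<open>\<theta>\<close> is the theta
  product of \<open>1 - s\<close> and all
  \<open>(1 - \<epsilon> ^ n * s) * (1 - \<epsilon> ^ n / s)\<close> with \<open>n \<ge> 1\<close>.
  The constant makes it odd under \<open>s \<mapsto> 1 / s\<close>.\<close>

definition Y :: "real \<Rightarrow> complex \<Rightarrow> complex" where "Y \<epsilon> s = half_cayley s + Yreg \<epsilon> s"

definition lambert_dom :: "real \<Rightarrow> complex set" where
  "lambert_dom \<epsilon> = {t. \<forall>n. of_real \<epsilon> ^ Suc n * t \<noteq> 1}"

definition Dom :: "real \<Rightarrow> complex set" where
  "Dom \<epsilon> = {s. s \<noteq> 0 \<and> (\<forall>k::int. s \<noteq> of_real (\<epsilon> powi k))}"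

section \<open>The Lambert series and its functional equations\<close>

lemma norm_geo_le:
  assumes "norm t \<le> 1 / 2" shows "norm (geo t) \<le> 2 * norm t"
proof -
  have "1 / 2 \<le> norm (1 - t)" using norm_triangle_ineq2[of 1 t] assms by simp
  then have "norm t / norm (1 - t) \<le> norm t / (1 / 2)" by (intro divide_left_mono) auto
  then show ?thesis by (simp add: geo_def norm_divide)
qed

lemma summable_geo:
  assumes "0 < \<epsilon>" "\<epsilon> < 1" shows "summable (\<lambda>n. geo (of_real \<epsilon> ^ Suc n * t))"
proof (rule summable_comparison_test_ev)
  have "(\<lambda>n. \<epsilon> ^ n * norm t) \<longlonglongrightarrow> 0 * norm t"
    by (intro tendsto_intros LIMSEQ_realpow_zero) (use assms in auto)
  then have "\<forall>\<^sub>F n in sequentially. \<epsilon> ^ n * norm t < 1 / 2" by (rule order_tendstoD) simp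
  then show "\<forall>\<^sub>F n in sequentially. norm (geo (of_real \<epsilon> ^ Suc n * t)) \<le> 2 * norm t * \<epsilon> ^ n"
  proof eventually_elim
    case (elim n)
    have le: "norm (of_real \<epsilon> ^ Suc n * t) \<le> \<epsilon> ^ n * norm t"
      using assms by (simp add: norm_mult norm_power mult_right_mono mult_left_le_one_le)
    from norm_geo_le[of "of_real \<epsilon> ^ Suc n * t"] le elim
    have "norm (geo (of_real \<epsilon> ^ Suc n * t)) \<le> 2 * norm (of_real \<epsilon> ^ Suc n * t)" by linarith
    also have "\<dots> \<le> 2 * norm t * \<epsilon> ^ n" using le by (simp add: mult_ac)
    finally show ?case .
  qed
  show "summable (\<lambda>n. 2 * norm t * \<epsilon> ^ n)"
    using assms by (intro summable_mult summable_geometric) auto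
qed

text \<open>Splitting off the first term. This recursion yields the shift law of \<open>Y\<close>
  and the continuation of \<open>lambert\<close> past its poles.\<close>

lemma lambert_rec:
  assumes "0 < \<epsilon>" "\<epsilon> < 1"
  shows "lambert \<epsilon> t = geo (of_real \<epsilon> * t) + lambert \<epsilon> (of_real \<epsilon> * t)"
  using suminf_split_head[OF summable_geo[OF assms, of t]]
  by (simp add: lambert_def mult_ac)

lemma lambert_bound_aux:
  assumes "0 < \<epsilon>" "\<epsilon> \<le> 1 / 4" "norm t \<le> 1 / (2 * \<epsilon>)"
  shows "norm (geo (of_real \<epsilon> ^ Suc n * t)) \<le> 2 * \<epsilon> * norm t * \<epsilon> ^ n"
proof -
  have 1: "norm (of_real \<epsilon> ^ Suc n * t) = \<epsilon> * norm t * \<epsilon> ^ n"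
    using assms by (simp add: norm_mult norm_power)
  have 2: "\<epsilon> * norm t \<le> 1 / 2" using assms by (simp add: field_simps)
  have "\<epsilon> ^ n \<le> 1" using assms by (intro power_le_one) auto
  with 2 have "\<epsilon> * norm t * \<epsilon> ^ n \<le> 1 / 2 * 1" using assms by (intro mult_mono) auto
  with norm_geo_le[of "of_real \<epsilon> ^ Suc n * t"] 1 show ?thesis by simp
qed

lemma norm_lambert_le:
  assumes "0 < \<epsilon>" "\<epsilon> \<le> 1 / 4" "norm t \<le> 1 / (2 * \<epsilon>)"
  shows "norm (lambert \<epsilon> t) \<le> 3 * \<epsilon> * norm t"
proof -
  have s: "(\<lambda>n. 2 * \<epsilon> * norm t * \<epsilon> ^ n) sums (2 * \<epsilon> * norm t * (1 / (1 - \<epsilon>)))"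
    using assms by (intro sums_mult geometric_sums) auto
  have "norm (lambert \<epsilon> t) \<le> (\<Sum>n. 2 * \<epsilon> * norm t * \<epsilon> ^ n)"
    unfolding lambert_def by (rule norm_suminf_le[OF lambert_bound_aux[OF assms] sums_summable[OF s]])
  also have "\<dots> = 2 * \<epsilon> * norm t * (1 / (1 - \<epsilon>))" using s by (simp add: sums_iff)
  also have "\<dots> \<le> 2 * \<epsilon> * norm t * (3 / 2)"
    using assms by (intro mult_left_mono) (auto simp: field_simps)
  finally show ?thesis by simp
qed

lemma lambert_holomorphic_ball:
  assumes "0 < \<epsilon>" "\<epsilon> \<le> 1 / 4"
  shows "lambert \<epsilon> holomorphic_on ball 0 (1 / (2 * \<epsilon>))"
proof (rule holomorphic_uniform_sequence[where f = "\<lambda>n t. \<Sum>i<n. geo (of_real \<epsilon> ^ Suc i * t)"])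
  have ne: "of_real \<epsilon> ^ Suc i * t \<noteq> 1" if "t \<in> ball 0 (1 / (2 * \<epsilon>))" for i and t :: complex
  proof
    assume "of_real \<epsilon> ^ Suc i * t = 1"
    then have "norm (of_real \<epsilon> ^ Suc i * t) = 1" by simp
    then have "\<epsilon> * norm t * \<epsilon> ^ i = 1" using assms by (simp add: norm_mult norm_power mult_ac)
    moreover have "\<epsilon> * norm t < 1 / 2" using that assms by (simp add: field_simps)
    moreover have "\<epsilon> ^ i \<le> 1" using assms by (intro power_le_one) auto
    moreover have "\<epsilon> * norm t * \<epsilon> ^ i \<le> \<epsilon> * norm t * 1"
      using assms calculation by (intro mult_left_mono) auto
    ultimately show False by linarith
  qed
  show "(\<lambda>t. \<Sum>i<n. geo (of_real \<epsilon> ^ Suc i * t)) holomorphic_on ball 0 (1 / (2 * \<epsilon>))" for n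
    unfolding geo_def using ne by (intro holomorphic_intros) (metis right_minus_eq)
  fix x :: complex assume "x \<in> ball 0 (1 / (2 * \<epsilon>))"
  then obtain d where d: "d > 0" "cball x d \<subseteq> ball 0 (1 / (2 * \<epsilon>))"
    using open_contains_cball by blast
  have "uniform_limit (cball x d) (\<lambda>n t. \<Sum>i<n. geo (of_real \<epsilon> ^ Suc i * t))
      (\<lambda>t. \<Sum>i. geo (of_real \<epsilon> ^ Suc i * t)) sequentially"
  proof (rule Weierstrass_m_test[where M = "\<lambda>n. 2 * \<epsilon> * (1 / (2 * \<epsilon>)) * \<epsilon> ^ n"])
    fix n and t :: complex assume "t \<in> cball x d"
    then have t: "norm t \<le> 1 / (2 * \<epsilon>)" using d by auto
    have "norm (geo (of_real \<epsilon> ^ Suc n * t)) \<le> 2 * \<epsilon> * norm t * \<epsilon> ^ n" by (rule lambert_bound_aux[OF assms t])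
    also have "\<dots> \<le> 2 * \<epsilon> * (1 / (2 * \<epsilon>)) * \<epsilon> ^ n"
      using t assms by (intro mult_right_mono mult_left_mono) auto
    finally show "norm (geo (of_real \<epsilon> ^ Suc n * t)) \<le> 2 * \<epsilon> * (1 / (2 * \<epsilon>)) * \<epsilon> ^ n" .
  next
    show "summable (\<lambda>n. 2 * \<epsilon> * (1 / (2 * \<epsilon>)) * \<epsilon> ^ n)"
      using assms by (intro summable_mult summable_geometric) auto
  qed
  then show "\<exists>d>0. cball x d \<subseteq> ball 0 (1 / (2 * \<epsilon>)) \<and> uniform_limit (cball x d)
      (\<lambda>n t. \<Sum>i<n. geo (of_real \<epsilon> ^ Suc i * t)) (lambert \<epsilon>) sequentially"
    using d unfolding lambert_def[abs_def] by blast
qed simp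

text \<open>The recursion carries differentiability outwards from the ball of radius
  \<open>1 / (2 * \<epsilon>)\<close>; each step enlarges the radius by the factor
  \<open>1 / \<epsilon>\<close>.\<close>

lemma lambert_field_differentiable:
  assumes "0 < \<epsilon>" "\<epsilon> \<le> 1 / 4"
  shows "norm t < 1 / (2 * \<epsilon>) / \<epsilon> ^ n \<Longrightarrow> t \<in> lambert_dom \<epsilon> \<Longrightarrow> lambert \<epsilon> field_differentiable (at t)"
proof (induction n arbitrary: t)
  case 0
  then show ?case using lambert_holomorphic_ball[OF assms] by (simp add: holomorphic_on_open field_differentiable_def)
next
  case (Suc n)
  have "norm (of_real \<epsilon> * t) < 1 / (2 * \<epsilon>) / \<epsilon> ^ n"
    using Suc.prems(1) assms by (simp add: norm_mult field_simps)
  moreover have "of_real \<epsilon> * t \<in> lambert_dom \<epsilon>" unfolding lambert_dom_def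
  proof clarify
    fix m assume "of_real \<epsilon> ^ Suc m * (of_real \<epsilon> * t) = 1"
    then have "of_real \<epsilon> ^ Suc (Suc m) * t = 1" by (simp add: mult_ac)
    with Suc.prems(2) show False by (auto simp: lambert_dom_def simp del: power_Suc)
  qed
  ultimately have "lambert \<epsilon> field_differentiable (at (of_real \<epsilon> * t))" by (rule Suc.IH)
  then have 1: "(\<lambda>t. lambert \<epsilon> (of_real \<epsilon> * t)) field_differentiable (at t)"
    using field_differentiable_compose[of "\<lambda>t. of_real \<epsilon> * t" t "lambert \<epsilon>"]
    by (simp add: o_def field_differentiable_mult)
  have "of_real \<epsilon> * t \<noteq> 1" using Suc.prems(2) unfolding lambert_dom_def by (force dest: spec[of _ 0])
  then have "(\<lambda>t. geo (of_real \<epsilon> * t)) field_differentiable (at t)"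
    unfolding geo_def by (intro derivative_intros) auto
  with 1 have "(\<lambda>t. geo (of_real \<epsilon> * t) + lambert \<epsilon> (of_real \<epsilon> * t)) field_differentiable (at t)"
    by (intro field_differentiable_add)
  moreover have "(\<lambda>t. geo (of_real \<epsilon> * t) + lambert \<epsilon> (of_real \<epsilon> * t)) = lambert \<epsilon>"
    by (rule ext, rule lambert_rec[symmetric]) (use assms in auto)
  ultimately show ?case by simp
qed

lemma lambert_differentiable:
  assumes "0 < \<epsilon>" "\<epsilon> \<le> 1 / 4" "t \<in> lambert_dom \<epsilon>"
  shows "lambert \<epsilon> field_differentiable (at t)"
proof -
  have "(\<lambda>n. norm t * (2 * \<epsilon>) * \<epsilon> ^ n) \<longlonglongrightarrow> norm t * (2 * \<epsilon>) * 0"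
    by (intro tendsto_intros LIMSEQ_realpow_zero) (use assms in auto)
  then have "\<forall>\<^sub>F n in sequentially. norm t * (2 * \<epsilon>) * \<epsilon> ^ n < 1" by (rule order_tendstoD) simp
  then obtain n where "norm t * (2 * \<epsilon>) * \<epsilon> ^ n < 1" by (auto simp: eventually_sequentially)
  then show ?thesis using lambert_field_differentiable[OF assms(1,2), of t n] assms
    by (simp add: field_simps)
qed

lemma lambert_cnj: "lambert \<epsilon> (cnj t) = cnj (lambert \<epsilon> t)" if "0 < \<epsilon>" "\<epsilon> < 1"
proof -
  have "(\<lambda>n. geo (of_real \<epsilon> ^ Suc n * t)) sums lambert \<epsilon> t"
    unfolding lambert_def using summable_geo[OF that] by (rule summable_sums)
  then have "(\<lambda>n. cnj (geo (of_real \<epsilon> ^ Suc n * t))) sums cnj (lambert \<epsilon> t)" by (simp only: sums_cnj)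
  then show ?thesis unfolding lambert_def by (simp add: geo_def sums_iff)
qed

text \<open>Even powers of \<open>\<epsilon>\<close> form the series with
  \<open>\<epsilon>\<^sup>2\<close> at \<open>t\<close>, odd powers the one at
  \<open>t / \<epsilon>\<close>.\<close>

lemma lambert_split:
  assumes "0 < \<epsilon>" "\<epsilon> < 1"
  shows "lambert \<epsilon> t = lambert (\<epsilon>\<^sup>2) t + lambert (\<epsilon>\<^sup>2) (t / of_real \<epsilon>)"
proof -
  define f where "f n = geo (of_real \<epsilon> ^ Suc n * t)" for n
  have e2: "0 < \<epsilon>\<^sup>2" "\<epsilon>\<^sup>2 < 1" using assms by (auto simp: power_less_one_iff)
  have "f sums lambert \<epsilon> t"
    unfolding lambert_def f_def[abs_def] using summable_geo[OF assms] by (rule summable_sums)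
  from sums_group[OF this, of 2] have 1: "(\<lambda>n. f (2 * n) + f (Suc (2 * n))) sums lambert \<epsilon> t"
    by (simp add: numeral_2_eq_2 mult.commute)
  have "(\<lambda>n. f (Suc (2 * n))) sums lambert (\<epsilon>\<^sup>2) t"
  proof -
    have "f (Suc (2 * n)) = geo (of_real (\<epsilon>\<^sup>2) ^ Suc n * t)" for n
      using power_mult[of "complex_of_real \<epsilon>" 2 "Suc n"] unfolding f_def by simp
    then show ?thesis using summable_sums[OF summable_geo[OF e2, of t]] unfolding lambert_def by simp
  qed
  moreover have "(\<lambda>n. f (2 * n)) sums lambert (\<epsilon>\<^sup>2) (t / of_real \<epsilon>)"
  proof -
    have "f (2 * n) = geo (of_real (\<epsilon>\<^sup>2) ^ Suc n * (t / of_real \<epsilon>))" for n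
    proof -
      have "of_real (\<epsilon>\<^sup>2) ^ Suc n * (t / of_real \<epsilon>) = complex_of_real \<epsilon> ^ (2 * Suc n) * (t / of_real \<epsilon>)"
        by (simp only: power_mult of_real_power)
      also have "\<dots> = of_real \<epsilon> ^ Suc (2 * n) * t" using assms by simp
      finally show ?thesis by (simp only: f_def)
    qed
    then show ?thesis using summable_sums[OF summable_geo[OF e2, of "t / of_real \<epsilon>"]] unfolding lambert_def by simp
  qed
  ultimately have "(\<lambda>n. f (2 * n) + f (Suc (2 * n))) sums (lambert (\<epsilon>\<^sup>2) (t / of_real \<epsilon>) + lambert (\<epsilon>\<^sup>2) t)"
    by (intro sums_add)
  with 1 show ?thesis by (simp add: sums_iff add.commute)
qed

lemma Dom_inverse: "s \<in> Dom \<epsilon> \<Longrightarrow> 1 / s \<in> Dom \<epsilon>"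
  unfolding Dom_def
proof clarify
  assume s: "s \<noteq> 0" "\<forall>k::int. s \<noteq> of_real (\<epsilon> powi k)"
  have "1 / s \<noteq> of_real (\<epsilon> powi k)" for k :: int
  proof
    assume "1 / s = of_real (\<epsilon> powi k)"
    moreover have "s = 1 / (1 / s)" by simp
    ultimately have "s = of_real (\<epsilon> powi (-k))"
      by (metis of_real_inverse power_int_minus inverse_eq_divide)
    with s show False by blast
  qed
  then show "1 / s \<noteq> 0 \<and> (\<forall>k::int. 1 / s \<noteq> of_real (\<epsilon> powi k))" using s(1) by simp
qed

lemma Dom_scale:
  assumes "s \<in> Dom \<epsilon>" "\<epsilon> > 0" shows "s * of_real (\<epsilon> powi k) \<in> Dom \<epsilon>"
  unfolding Dom_def
proof (intro CollectI conjI allI notI)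
  fix j :: int assume "s * of_real (\<epsilon> powi k) = of_real (\<epsilon> powi j)"
  then have "s = of_real (\<epsilon> powi j) / of_real (\<epsilon> powi k)" using assms by (simp add: field_simps)
  also have "\<dots> = of_real (\<epsilon> powi (j - k))" using assms by (simp add: power_int_diff)
  finally show False using assms unfolding Dom_def by blast
qed (use assms in \<open>auto simp: Dom_def\<close>)

lemma Dom_divide: "s \<in> Dom \<epsilon> \<Longrightarrow> \<epsilon> > 0 \<Longrightarrow> s / of_real \<epsilon> \<in> Dom \<epsilon>"
  using Dom_scale[of s \<epsilon> "-1"] by (simp add: power_int_minus field_simps)

lemma Dom_cnj: "s \<in> Dom \<epsilon> \<Longrightarrow> cnj s \<in> Dom \<epsilon>"
  using complex_cnj_cancel_iff[of s "of_real (\<epsilon> powi k)" for k] unfolding Dom_def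
  by (simp del: complex_cnj_cancel_iff)

lemma Dom_square: "\<epsilon> > 0 \<Longrightarrow> s \<in> Dom \<epsilon> \<Longrightarrow> s \<in> Dom (\<epsilon>\<^sup>2)"
proof -
  assume s: "\<epsilon> > 0" "s \<in> Dom \<epsilon>"
  have "\<epsilon>\<^sup>2 powi k = \<epsilon> powi (2 * k)" for k :: int
    using power_int_mult[of \<epsilon> 2 k] by simp
  then show ?thesis using s(2) unfolding Dom_def mem_Collect_eq by metis
qed

lemma Dom_nonzero: "s \<in> Dom \<epsilon> \<Longrightarrow> s \<noteq> 0" and Dom_ne_1: "s \<in> Dom \<epsilon> \<Longrightarrow> s \<noteq> 1"
proof -
  assume "s \<in> Dom \<epsilon>"
  then have "s \<noteq> of_real (\<epsilon> powi 0)" unfolding Dom_def by blast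
  then show "s \<noteq> 1" by simp
qed (simp add: Dom_def)

lemma Dom_ne_eps: "s \<in> Dom \<epsilon> \<Longrightarrow> s \<noteq> of_real \<epsilon>"
proof -
  assume "s \<in> Dom \<epsilon>"
  then have "s \<noteq> of_real (\<epsilon> powi 1)" unfolding Dom_def by blast
  then show ?thesis by simp
qed

lemma Dom_lambert_dom:
  assumes "s \<in> Dom \<epsilon>" "\<epsilon> > 0" shows "s \<in> lambert_dom \<epsilon>" "1 / s \<in> lambert_dom \<epsilon>"
proof -
  have *: "s \<in> lambert_dom \<epsilon>" if "s \<in> Dom \<epsilon>" for s
    unfolding lambert_dom_def
  proof clarify
    fix n assume "of_real \<epsilon> ^ Suc n * s = 1"
    then have "s = 1 / of_real (\<epsilon> ^ Suc n)" using assms(2) by (simp add: field_simps)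
    then have "s = of_real (\<epsilon> powi (- int (Suc n)))"
      by (simp add: power_int_minus field_simps del: of_nat_Suc)
    with that show False by (auto simp: Dom_def)
  qed
  show "s \<in> lambert_dom \<epsilon>" "1 / s \<in> lambert_dom \<epsilon>" using * assms(1) Dom_inverse by auto
qed

lemma Y_inverse: "s \<noteq> 0 \<Longrightarrow> s \<noteq> 1 \<Longrightarrow> Y \<epsilon> (1 / s) = - Y \<epsilon> s"
proof -
  assume s: "s \<noteq> 0" "s \<noteq> 1"
  then have "s - 1 \<noteq> 0" "1 - s \<noteq> 0" by auto
  then have "half_cayley (1 / s) = - half_cayley s" using s unfolding half_cayley_def by (simp add: divide_simps) (simp add: algebra_simps)?
  then show ?thesis by (simp add: Y_def Yreg_def)
qed

lemma Y_cnj: "0 < \<epsilon> \<Longrightarrow> \<epsilon> < 1 \<Longrightarrow> Y \<epsilon> (cnj s) = cnj (Y \<epsilon> s)"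
  using lambert_cnj[of \<epsilon> "1 / s"] lambert_cnj[of \<epsilon> s] by (simp add: Y_def Yreg_def half_cayley_def)

lemma half_cayley_eq: "s \<noteq> 1 \<Longrightarrow> half_cayley s = 1 / 2 + 1 / (s - 1)"
  by (simp add: half_cayley_def field_simps)

lemma geo_eq: "s \<noteq> 1 \<Longrightarrow> geo s = - 1 - 1 / (s - 1)"
  by (simp add: geo_def divide_simps) (simp add: algebra_simps)

lemma half_cayley_scale:
  assumes "s \<noteq> 0" "e \<noteq> 0" "s \<noteq> e" shows "half_cayley (s / e) = 1 / 2 + geo (e / s)"
  using assms unfolding half_cayley_def geo_def by (simp add: divide_simps)

text \<open>The shifted \<open>half_cayley\<close> supplies the first term of the series in
  \<open>1 / s\<close>, and the term released by the series in \<open>s\<close> becomes the new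
  \<open>half_cayley\<close>. Each exchange leaves 1/2.\<close>

lemma Y_divide:
  assumes "0 < \<epsilon>" "\<epsilon> < 1" "s \<in> Dom \<epsilon>"
  shows "Y \<epsilon> (s / of_real \<epsilon>) = Y \<epsilon> s + 1"
proof -
  have s: "s \<noteq> 0" "s \<noteq> 1" "s \<noteq> of_real \<epsilon>"
    using Dom_nonzero[OF assms(3)] Dom_ne_1[OF assms(3)] Dom_ne_eps[OF assms(3)] by auto
  have 1: "lambert \<epsilon> (s / of_real \<epsilon>) = geo s + lambert \<epsilon> s"
    using lambert_rec[OF assms(1,2), of "s / of_real \<epsilon>"] assms by simp
  have 2: "lambert \<epsilon> (1 / s) = geo (of_real \<epsilon> / s) + lambert \<epsilon> (of_real \<epsilon> / s)"
    using lambert_rec[OF assms(1,2), of "1 / s"] by simp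
  have "half_cayley (s / of_real \<epsilon>) = 1 / 2 + geo (of_real \<epsilon> / s)" using s assms by (intro half_cayley_scale) auto
  then show ?thesis using 1 2 geo_eq[OF s(2)] half_cayley_eq[OF s(2)] by (simp add: Y_def Yreg_def)
qed

text \<open>The poles of \<open>Y \<epsilon>\<close> at even powers of \<open>\<epsilon>\<close> go
  to the first summand, those at odd powers to the second.\<close>

lemma Y_split:
  assumes "0 < \<epsilon>" "\<epsilon> < 1" "s \<in> Dom \<epsilon>"
  shows "Y \<epsilon> s = Y (\<epsilon>\<^sup>2) s + Y (\<epsilon>\<^sup>2) (s / of_real \<epsilon>) - 1 / 2"
proof -
  have s: "s \<noteq> 0" "s \<noteq> 1" "s \<noteq> of_real \<epsilon>"
    using Dom_nonzero[OF assms(3)] Dom_ne_1[OF assms(3)] Dom_ne_eps[OF assms(3)] by auto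
  have e2: "0 < \<epsilon>\<^sup>2" "\<epsilon>\<^sup>2 < 1" using assms by (auto simp: power_less_one_iff)
  have 1: "lambert (\<epsilon>\<^sup>2) (1 / s / of_real \<epsilon>) = geo (of_real \<epsilon> / s) + lambert (\<epsilon>\<^sup>2) (of_real \<epsilon> / s)"
    using lambert_rec[OF e2, of "1 / s / of_real \<epsilon>"] assms s by (simp add: power2_eq_square)
  have "half_cayley (s / of_real \<epsilon>) = 1 / 2 + geo (of_real \<epsilon> / s)" using s assms by (intro half_cayley_scale) auto
  then show ?thesis
    using lambert_split[OF assms(1,2), of "1 / s"] lambert_split[OF assms(1,2), of s] 1
    by (simp add: Y_def Yreg_def)
qed

text \<open>The Koebe function. It is \<open>- s\<close> times the derivative of
  \<open>half_cayley\<close> and carries the double pole of \<open>S\<close> at 1.\<close>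

definition koebe :: "complex \<Rightarrow> complex" where "koebe s = s / (s - 1)\<^sup>2"
definition Sreg :: "real \<Rightarrow> complex \<Rightarrow> complex" where "Sreg \<epsilon> s = - s * deriv (Yreg \<epsilon>) s"
text \<open>Minus the derivative of \<open>Y\<close> with respect to \<open>ln s\<close>, hence a
  Weierstrass elliptic function up to an additive constant.\<close>

definition S :: "real \<Rightarrow> complex \<Rightarrow> complex" where "S \<epsilon> s = - s * deriv (Y \<epsilon>) s"
text \<open>This is \<open>Dom\<close> with the point 1 restored (see \<open>Dom_eq\<close>): the
  pole at 1 comes from \<open>half_cayley\<close> alone, so \<open>Yreg\<close> and
  \<open>Sreg\<close> are regular there.\<close>

definition Dom1 :: "real \<Rightarrow> complex set" where
  "Dom1 \<epsilon> = {s. s \<noteq> 0 \<and> s \<in> lambert_dom \<epsilon> \<and> 1 / s \<in> lambert_dom \<epsilon>}"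

text \<open>Near a given point all but finitely many of the conditions hold automatically, because
  the powers of \<open>\<epsilon>\<close> tend to 0.\<close>

lemma open_lambert_dom:
  assumes "0 < \<epsilon>" "\<epsilon> < 1" shows "open (lambert_dom \<epsilon>)"
  unfolding open_contains_ball
proof
  fix t0 assume t0: "t0 \<in> lambert_dom \<epsilon>"
  have "(\<lambda>n. \<epsilon> ^ n * (norm t0 + 1)) \<longlonglongrightarrow> 0 * (norm t0 + 1)"
    by (intro tendsto_intros LIMSEQ_realpow_zero) (use assms in auto)
  then have "\<forall>\<^sub>F n in sequentially. \<epsilon> ^ n * (norm t0 + 1) < 1" by (rule order_tendstoD) simp
  then obtain M where M: "\<And>n. n \<ge> M \<Longrightarrow> \<epsilon> ^ n * (norm t0 + 1) < 1" by (auto simp: eventually_sequentially)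
  define U where "U = ball t0 1 \<inter> (\<Inter>n\<in>{..<M}. {t. of_real \<epsilon> ^ Suc n * t \<noteq> 1})"
  have "open {t. complex_of_real \<epsilon> ^ Suc n * t \<noteq> 1}" for n
    by (intro open_Collect_neq continuous_intros)
  then have "open U" unfolding U_def by (intro open_Int open_INT) auto
  moreover have "t0 \<in> U" using t0 by (auto simp: U_def lambert_dom_def)
  ultimately obtain e where e: "e > 0" "ball t0 e \<subseteq> U" unfolding open_contains_ball by blast
  have "U \<subseteq> lambert_dom \<epsilon>"
  proof
    fix t assume t: "t \<in> U"
    have "of_real \<epsilon> ^ Suc n * t \<noteq> 1" for n
    proof (cases "n < M")
      case True then show ?thesis using t by (auto simp: U_def)
    next
      case False
      have "norm t \<le> norm t0 + 1"
        using t norm_triangle_ineq2[of t t0] by (simp add: U_def dist_norm norm_minus_commute)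
      then have "\<epsilon> ^ Suc n * norm t \<le> \<epsilon> ^ Suc n * (norm t0 + 1)" using assms by (intro mult_left_mono) auto
      also have "\<dots> < 1" using M[of "Suc n"] False by simp
      finally have "norm (of_real \<epsilon> ^ Suc n * t) \<noteq> 1" using assms by (simp add: norm_mult norm_power)
      then show ?thesis by auto
    qed
    then show "t \<in> lambert_dom \<epsilon>" by (simp add: lambert_dom_def)
  qed
  with e show "\<exists>e>0. ball t0 e \<subseteq> lambert_dom \<epsilon>" by blast
qed

lemma Dom_Dom1: "0 < \<epsilon> \<Longrightarrow> s \<in> Dom \<epsilon> \<Longrightarrow> s \<in> Dom1 \<epsilon>"
  using Dom_lambert_dom Dom_nonzero by (auto simp: Dom1_def)

lemma open_Dom1: "0 < \<epsilon> \<Longrightarrow> \<epsilon> < 1 \<Longrightarrow> open (Dom1 \<epsilon>)"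
proof -
  assume e: "0 < \<epsilon>" "\<epsilon> < 1"
  have "open ((- {0}) \<inter> (\<lambda>s. 1 / s) -` lambert_dom \<epsilon>)"
    by (intro continuous_open_preimage open_lambert_dom e continuous_intros) auto
  moreover have "Dom1 \<epsilon> = (- {0}) \<inter> (\<lambda>s. 1 / s) -` lambert_dom \<epsilon> \<inter> lambert_dom \<epsilon>" by (auto simp: Dom1_def)
  ultimately show ?thesis using open_lambert_dom[OF e] by auto
qed

lemma Dom_eq:
  assumes "0 < \<epsilon>" shows "Dom \<epsilon> = Dom1 \<epsilon> - {1}"
proof
  show "Dom \<epsilon> \<subseteq> Dom1 \<epsilon> - {1}" using Dom_Dom1 Dom_ne_1 assms by blast
  show "Dom1 \<epsilon> - {1} \<subseteq> Dom \<epsilon>"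
  proof
    fix s assume s: "s \<in> Dom1 \<epsilon> - {1}"
    have "s \<noteq> of_real (\<epsilon> powi k)" for k
    proof
      assume k: "s = of_real (\<epsilon> powi k)"
      show False
      proof (cases k rule: int_cases3)
        case zero then show False using k s by simp
      next
        case (pos n)
        then obtain m where m: "n = Suc m" using not0_implies_Suc by auto
        then have "s = of_real \<epsilon> ^ Suc m"
          using k pos by (simp only: power_int_of_nat of_real_power)
        moreover have "of_real \<epsilon> ^ Suc m * (1 / s) \<noteq> 1" using s unfolding Dom1_def lambert_dom_def by blast
        ultimately show False using assms by simp
      next
        case (neg n)
        then obtain m where m: "n = Suc m" using not0_implies_Suc by auto
        then have "s = inverse (of_real \<epsilon> ^ Suc m)"
          using k neg by (simp only: power_int_minus power_int_of_nat of_real_inverse of_real_power)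
        moreover have "of_real \<epsilon> ^ Suc m * s \<noteq> 1" using s unfolding Dom1_def lambert_dom_def by blast
        moreover have "complex_of_real \<epsilon> ^ Suc m \<noteq> 0" using assms by simp
        ultimately show False by (metis right_inverse)
      qed
    qed
    then show "s \<in> Dom \<epsilon>" using s by (auto simp: Dom_def Dom1_def)
  qed
qed

lemma open_Dom: "0 < \<epsilon> \<Longrightarrow> \<epsilon> < 1 \<Longrightarrow> open (Dom \<epsilon>)"
  using open_Dom1[of \<epsilon>] Dom_eq[of \<epsilon>] by (metis open_Diff closed_singleton)

lemma Yreg_deriv:
  assumes "0 < \<epsilon>" "\<epsilon> \<le> 1 / 4" "s \<in> Dom1 \<epsilon>"
  shows "(Yreg \<epsilon> has_field_derivative - deriv (lambert \<epsilon>) (1 / s) / s\<^sup>2 - deriv (lambert \<epsilon>) s) (at s)"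
proof -
  have s: "s \<noteq> 0" "(lambert \<epsilon> has_field_derivative deriv (lambert \<epsilon>) s) (at s)"
    "(lambert \<epsilon> has_field_derivative deriv (lambert \<epsilon>) (1 / s)) (at (1 / s))"
    using assms lambert_differentiable[OF assms(1,2)] by (auto simp: Dom1_def field_differentiable_derivI)
  have "((\<lambda>s. 1 / s) has_field_derivative - 1 / s\<^sup>2) (at s)"
    using s(1) by (auto intro!: derivative_eq_intros simp: power2_eq_square)
  from DERIV_chain2[OF s(3) this]
  have "((\<lambda>s. lambert \<epsilon> (1 / s)) has_field_derivative deriv (lambert \<epsilon>) (1 / s) * (- 1 / s\<^sup>2)) (at s)" by simp
  from DERIV_diff[OF this s(2)] show ?thesis by (simp add: Yreg_def[abs_def])
qed

lemma Sreg_eq: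
  assumes "0 < \<epsilon>" "\<epsilon> \<le> 1 / 4" "s \<in> Dom1 \<epsilon>"
  shows "Sreg \<epsilon> s = deriv (lambert \<epsilon>) (1 / s) / s + s * deriv (lambert \<epsilon>) s"
proof -
  have "s \<noteq> 0" using assms(3) by (simp add: Dom1_def)
  then show ?thesis unfolding Sreg_def DERIV_imp_deriv[OF Yreg_deriv[OF assms]]
    by (simp add: field_simps power2_eq_square)
qed

lemma Yreg_holomorphic:
  assumes "0 < \<epsilon>" "\<epsilon> \<le> 1 / 4" shows "Yreg \<epsilon> holomorphic_on Dom1 \<epsilon>"
  using Yreg_deriv[OF assms] open_Dom1[of \<epsilon>] assms by (auto simp: holomorphic_on_open)

lemma Sreg_holomorphic:
  assumes "0 < \<epsilon>" "\<epsilon> \<le> 1 / 4" shows "Sreg \<epsilon> holomorphic_on Dom1 \<epsilon>"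
  unfolding Sreg_def[abs_def] using Yreg_holomorphic[OF assms] open_Dom1[of \<epsilon>] assms
  by (intro holomorphic_intros holomorphic_deriv) auto

lemma half_cayley_deriv: "s \<noteq> 1 \<Longrightarrow> (half_cayley has_field_derivative - 1 / (s - 1)\<^sup>2) (at s)"
  unfolding half_cayley_def[abs_def]
  by (auto intro!: derivative_eq_intros simp: divide_simps power2_eq_square) (simp add: algebra_simps)?

lemma Y_deriv:
  assumes "0 < \<epsilon>" "\<epsilon> \<le> 1 / 4" "s \<in> Dom \<epsilon>"
  shows "(Y \<epsilon> has_field_derivative - S \<epsilon> s / s) (at s)"
proof -
  have s: "s \<noteq> 0" "s \<noteq> 1" using assms(3) Dom_nonzero Dom_ne_1 by auto
  have "(Y \<epsilon> has_field_derivative - 1 / (s - 1)\<^sup>2 + (- deriv (lambert \<epsilon>) (1 / s) / s\<^sup>2 - deriv (lambert \<epsilon>) s)) (at s)"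
    unfolding Y_def[abs_def] using Dom_Dom1[OF assms(1,3)] s
    by (intro DERIV_add half_cayley_deriv Yreg_deriv assms(1,2)) auto
  then have "(Y \<epsilon> has_field_derivative deriv (Y \<epsilon>) s) (at s)"
    using DERIV_imp_deriv by metis
  then show ?thesis using s by (simp add: S_def)
qed

lemma S_eq_Sreg:
  assumes "0 < \<epsilon>" "\<epsilon> \<le> 1 / 4" "s \<in> Dom \<epsilon>" shows "S \<epsilon> s = koebe s + Sreg \<epsilon> s"
proof -
  have s: "s \<noteq> 0" "s \<noteq> 1" "s \<in> Dom1 \<epsilon>" using assms(1,3) Dom_nonzero Dom_ne_1 Dom_Dom1 by auto
  have "(Y \<epsilon> has_field_derivative - 1 / (s - 1)\<^sup>2 + (- deriv (lambert \<epsilon>) (1 / s) / s\<^sup>2 - deriv (lambert \<epsilon>) s)) (at s)"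
    unfolding Y_def[abs_def] using s
    by (intro DERIV_add half_cayley_deriv Yreg_deriv assms(1,2)) auto
  then have "S \<epsilon> s = - s * (- 1 / (s - 1)\<^sup>2 + (- deriv (lambert \<epsilon>) (1 / s) / s\<^sup>2 - deriv (lambert \<epsilon>) s))"
    using DERIV_imp_deriv unfolding S_def by metis
  moreover have "s - 1 \<noteq> 0" using s(2) by simp
  ultimately show ?thesis unfolding Sreg_eq[OF assms(1,2) s(3)] koebe_def using s(1)
    by (simp add: divide_simps power2_eq_square) (simp add: algebra_simps)
qed

lemma S_holomorphic:
  assumes "0 < \<epsilon>" "\<epsilon> \<le> 1 / 4" shows "S \<epsilon> holomorphic_on Dom \<epsilon>"
proof -
  have "Y \<epsilon> holomorphic_on Dom \<epsilon>" using Y_deriv[OF assms] open_Dom[of \<epsilon>] assms by (auto simp: holomorphic_on_open)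
  then show ?thesis unfolding S_def[abs_def] using open_Dom[of \<epsilon>] assms
    by (intro holomorphic_intros holomorphic_deriv) auto
qed

lemma S_divide:
  assumes "0 < \<epsilon>" "\<epsilon> \<le> 1 / 4" "s \<in> Dom \<epsilon>" shows "S \<epsilon> (s / of_real \<epsilon>) = S \<epsilon> s"
proof -
  have s: "s \<noteq> 0" using assms Dom_nonzero by auto
  have d: "((\<lambda>s. s / of_real \<epsilon>) has_field_derivative 1 / of_real \<epsilon>) (at s)"
    using assms(1) by (auto intro!: derivative_eq_intros)
  note DERIV_chain2[OF Y_deriv[OF assms(1,2) Dom_divide[OF assms(3,1)]] d]
  moreover have "((\<lambda>s. Y \<epsilon> (s / of_real \<epsilon>)) has_field_derivative - S \<epsilon> s / s) (at s)"
  proof (rule has_field_derivative_transform_within_open)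
    show "((\<lambda>s. Y \<epsilon> s + 1) has_field_derivative - S \<epsilon> s / s) (at s)"
      by (rule derivative_eq_intros Y_deriv assms | simp)+
    show "open (Dom \<epsilon>)" using open_Dom assms by auto
  qed (use Y_divide[of \<epsilon>] assms in auto)
  ultimately have "- S \<epsilon> (s / of_real \<epsilon>) / (s / of_real \<epsilon>) * (1 / of_real \<epsilon>) = - S \<epsilon> s / s"
    by (rule DERIV_unique)
  then show ?thesis using s assms(1) by (simp add: field_simps)
qed

text \<open>Division by \<open>\<epsilon>\<close> is a half period for
  \<open>S (\<epsilon>\<^sup>2)\<close>: it exchanges two functions whose sum is
  \<open>S \<epsilon>\<close>. Their product is therefore invariant.\<close>

lemma S_square_divide:
  assumes "0 < \<epsilon>" "\<epsilon> \<le> 1 / 4" "s \<in> Dom \<epsilon>" shows "S (\<epsilon>\<^sup>2) (s / of_real \<epsilon>) = S \<epsilon> s - S (\<epsilon>\<^sup>2) s"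
proof -
  have s: "s \<noteq> 0" using assms Dom_nonzero by auto
  have e2: "0 < \<epsilon>\<^sup>2" "\<epsilon>\<^sup>2 \<le> 1 / 4"
  proof -
    show "0 < \<epsilon>\<^sup>2" using assms by simp
    have "\<epsilon> * \<epsilon> \<le> 1 / 4 * 1" using assms by (intro mult_mono) auto
    then show "\<epsilon>\<^sup>2 \<le> 1 / 4" by (simp add: power2_eq_square)
  qed
  have d: "((\<lambda>s. s / of_real \<epsilon>) has_field_derivative 1 / of_real \<epsilon>) (at s)"
    using assms(1) by (auto intro!: derivative_eq_intros)
  note DERIV_chain2[OF Y_deriv[OF e2 Dom_square[OF assms(1) Dom_divide[OF assms(3,1)]]] d]
  moreover have "((\<lambda>s. Y (\<epsilon>\<^sup>2) (s / of_real \<epsilon>)) has_field_derivative (- S \<epsilon> s / s) - (- S (\<epsilon>\<^sup>2) s / s)) (at s)"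
  proof (rule has_field_derivative_transform_within_open)
    show "((\<lambda>s. Y \<epsilon> s - Y (\<epsilon>\<^sup>2) s + 1 / 2) has_field_derivative (- S \<epsilon> s / s) - (- S (\<epsilon>\<^sup>2) s / s)) (at s)"
      by (rule derivative_eq_intros Y_deriv assms Dom_square e2 | simp)+
    show "open (Dom \<epsilon>)" using open_Dom assms by auto
  qed (use Y_split[of \<epsilon>] assms in auto)
  ultimately have "- S (\<epsilon>\<^sup>2) (s / of_real \<epsilon>) / (s / of_real \<epsilon>) * (1 / of_real \<epsilon>) =
     (- S \<epsilon> s / s) - (- S (\<epsilon>\<^sup>2) s / s)"
    by (rule DERIV_unique)
  then show ?thesis using s assms(1) by (simp add: field_simps)
qed

section \<open>The quadratic relation\<close>

lemma Sreg_inverse: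
  assumes "0 < \<epsilon>" "\<epsilon> \<le> 1 / 4" "s \<in> Dom1 \<epsilon>" shows "Sreg \<epsilon> (1 / s) = Sreg \<epsilon> s"
proof -
  have "1 / s \<in> Dom1 \<epsilon>" using assms(3) by (auto simp: Dom1_def)
  with assms show ?thesis by (simp add: Sreg_eq add.commute mult.commute)
qed

lemma annulus_Dom1:
  assumes "0 < \<epsilon>" "\<epsilon> < 1" "\<epsilon> < norm s" "norm s < 1 / \<epsilon>" shows "s \<in> Dom1 \<epsilon>"
proof -
  have *: "t \<in> lambert_dom \<epsilon>" if "norm t < 1 / \<epsilon>" for t :: complex
    unfolding lambert_dom_def
  proof clarify
    fix n assume "of_real \<epsilon> ^ Suc n * t = 1"
    then have "norm (of_real \<epsilon> ^ Suc n * t) = 1" by simp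
    then have 1: "\<epsilon> ^ n * (\<epsilon> * norm t) = 1" using assms by (simp add: norm_mult norm_power mult_ac)
    have "\<epsilon> * norm t < 1" using that assms by (simp add: field_simps)
    moreover have "\<epsilon> ^ n * (\<epsilon> * norm t) \<le> 1 * (\<epsilon> * norm t)"
      using assms by (intro mult_right_mono power_le_one) auto
    ultimately show False using 1 by linarith
  qed
  have "s \<noteq> 0" using assms by auto
  moreover have "norm (1 / s) < 1 / \<epsilon>" using assms by (simp add: norm_divide frac_less2)
  ultimately show ?thesis using *[of s] *[of "1 / s"] assms by (simp add: Dom1_def)
qed

text \<open>The leading coefficient of the double pole of \<open>S (\<epsilon>\<^sup>2) * (S
  \<epsilon> - S (\<epsilon>\<^sup>2))\<close> at 1, since both functions have the polar part
  \<open>koebe\<close>.\<close>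

definition liouville_coeff :: "real \<Rightarrow> complex" where "liouville_coeff \<epsilon> = Sreg \<epsilon> 1 - Sreg (\<epsilon>\<^sup>2) 1"

text \<open>The poles of this combination cancel and it is invariant under \<open>s \<mapsto> s / \<epsilon>\<close>, hence it is constant.\<close>

definition liouville_defect :: "real \<Rightarrow> complex \<Rightarrow> complex" where
  "liouville_defect \<epsilon> s = S (\<epsilon>\<^sup>2) s * (S \<epsilon> s - S (\<epsilon>\<^sup>2) s) - liouville_coeff \<epsilon> * S \<epsilon> s"

lemma square_le_quarter: "0 < \<epsilon> \<Longrightarrow> \<epsilon> \<le> 1 / 4 \<Longrightarrow> 0 < \<epsilon>\<^sup>2 \<and> \<epsilon>\<^sup>2 \<le> (1 / 4 :: real) \<and> \<epsilon>\<^sup>2 \<le> \<epsilon>"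
proof -
  assume e: "0 < \<epsilon>" "\<epsilon> \<le> 1 / 4"
  have "\<epsilon> * \<epsilon> \<le> \<epsilon> * 1" using e by (intro mult_left_mono) auto
  moreover have "\<epsilon> * 1 \<le> 1 / 4" using e by simp
  ultimately have "\<epsilon> * \<epsilon> \<le> 1 / 4" "\<epsilon> * \<epsilon> \<le> \<epsilon>" by linarith+
  moreover have "0 < \<epsilon> * \<epsilon>" using e by simp
  ultimately show ?thesis unfolding power2_eq_square by blast
qed

lemma liouville_defect_divide:
  assumes "0 < \<epsilon>" "\<epsilon> \<le> 1 / 4" "s \<in> Dom \<epsilon>" shows "liouville_defect \<epsilon> (s / of_real \<epsilon>) = liouville_defect \<epsilon> s"
  unfolding liouville_defect_def S_divide[OF assms] S_square_divide[OF assms] by (simp add: algebra_simps)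

lemma invariant_scale:
  assumes "0 < \<epsilon>" "\<And>s. s \<in> Dom \<epsilon> \<Longrightarrow> f (s / of_real \<epsilon>) = f s" "s \<in> Dom \<epsilon>"
  shows "f (s * of_real (\<epsilon> powi k)) = f s"
proof (induction k rule: int_induct[where k = 0])
  case (step1 i)
  have "s * of_real (\<epsilon> powi (i + 1)) / of_real \<epsilon> = s * of_real (\<epsilon> powi i)"
    using assms(1) by (simp add: power_int_add)
  then show ?case
    using step1 assms(2)[OF Dom_scale[OF assms(3,1), of "i + 1"]] by simp
next
  case (step2 i)
  have "s * of_real (\<epsilon> powi i) / of_real \<epsilon> = s * of_real (\<epsilon> powi (i - 1))"
    using assms(1) by (simp add: power_int_diff)
  then show ?case
    using step2 assms(2)[OF Dom_scale[OF assms(3,1), of i]] by simp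
qed simp

text \<open>The annulus is exactly one period, its radii having ratio \<open>1 / q\<^sup>2\<close>.
  The strict upper bound later makes the level of a surface point unique.\<close>

lemma exists_scale:
  assumes "0 < q" "q < 1" "s \<noteq> (0::complex)"
  shows "\<exists>k::int. q \<le> norm (s * of_real ((q\<^sup>2) powi k)) \<and> norm (s * of_real ((q\<^sup>2) powi k)) < 1 / q"
proof -
  define l where "l = ln (norm s)"
  define L where "L = - ln q"
  have L: "L > 0" using assms by (simp add: L_def)
  define k where "k = \<lfloor>(l + L) / (2 * L)\<rfloor>"
  have k: "of_int k \<le> (l + L) / (2 * L)" "(l + L) / (2 * L) < of_int k + 1" unfolding k_def by linarith+
  then have k': "2 * L * k \<le> l + L" "l + L < 2 * L * (k + 1)" using L by (simp_all add: field_simps)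
  have n: "norm (s * of_real ((q\<^sup>2) powi k)) = exp (l - 2 * L * k)"
  proof -
    have "(q\<^sup>2) powi k = exp (- 2 * L * k)"
    proof -
      have "q\<^sup>2 = exp (- 2 * L)" using assms by (simp add: L_def exp_double)
      then have "(q\<^sup>2) powi k = (q\<^sup>2) powr (of_int k)" using assms by (simp add: powr_real_of_int')
      also have "\<dots> = exp (- 2 * L * k)" using \<open>q\<^sup>2 = exp (- 2 * L)\<close> by (simp add: powr_def mult_ac)
      finally show ?thesis .
    qed
    then have "norm (s * of_real ((q\<^sup>2) powi k)) = norm s * exp (- 2 * L * k)"
      by (simp only: norm_mult norm_of_real) simp
    then show ?thesis using assms by (simp add: l_def exp_diff exp_minus field_simps)
  qed
  have "q = exp (- L)" "1 / q = exp L" using assms by (simp_all add: L_def exp_minus inverse_eq_divide)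
  moreover have "- L \<le> l - 2 * L * k" "l - 2 * L * k < L" using k' by (simp_all add: algebra_simps)
  ultimately have "q \<le> exp (l - 2 * L * k)" "exp (l - 2 * L * k) < 1 / q" by (metis exp_le_cancel_iff exp_less_cancel_iff)+
  then show ?thesis unfolding n[symmetric] by (intro exI[of _ k] conjI)
qed

lemma unit_Dom1:
  assumes "0 < \<epsilon>" "\<epsilon> < 1" "norm s = 1" shows "s \<in> Dom1 \<epsilon>"
  by (rule annulus_Dom1) (use assms in \<open>auto simp: field_simps\<close>)

text \<open>With \<open>S = koebe + Sreg\<close> the only singular part is \<open>koebe * f\<close>,
  and \<open>f\<close> has a double zero at 1: its value vanishes by the choice of
  \<open>liouville_coeff\<close>, its derivative by the symmetry
  \<open>s \<mapsto> 1 / s\<close>.\<close>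

lemma liouville_defect_removable:
  assumes e: "0 < \<epsilon>" "\<epsilon> \<le> 1 / 4"
  shows "\<exists>g. g holomorphic_on Dom1 \<epsilon> \<and> (\<forall>s\<in>Dom \<epsilon>. g s = liouville_defect \<epsilon> s)"
proof -
  have e2: "0 < \<epsilon>\<^sup>2" "\<epsilon>\<^sup>2 \<le> 1 / 4" using square_le_quarter[OF e] by auto
  have op: "open (Dom1 \<epsilon>)" using open_Dom1 e by simp
  have one: "1 \<in> Dom1 \<epsilon>" by (rule annulus_Dom1) (use e in \<open>auto simp: field_simps\<close>)
  have D12: "Dom1 \<epsilon> \<subseteq> Dom1 (\<epsilon>\<^sup>2)"
  proof -
    have "Dom \<epsilon> \<subseteq> Dom (\<epsilon>\<^sup>2)" using Dom_square e by auto
    moreover have "1 \<in> Dom1 (\<epsilon>\<^sup>2)"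
      by (rule annulus_Dom1) (use e2 in \<open>auto simp: field_simps\<close>)
    ultimately show ?thesis using Dom_eq[of \<epsilon>] Dom_eq[of "\<epsilon>\<^sup>2"] e e2 by blast
  qed
  define a where "a = Sreg (\<epsilon>\<^sup>2)"
  define b where "b = Sreg \<epsilon>"
  define f where "f s = b s - a s - liouville_coeff \<epsilon>" for s
  have ha: "a holomorphic_on Dom1 \<epsilon>" unfolding a_def
    using Sreg_holomorphic[OF e2] D12 holomorphic_on_subset by blast
  have hb: "b holomorphic_on Dom1 \<epsilon>" unfolding b_def by (rule Sreg_holomorphic[OF e])
  have hf: "f holomorphic_on Dom1 \<epsilon>" unfolding f_def[abs_def] by (intro holomorphic_intros ha hb)
  have f1: "f 1 = 0" by (simp add: f_def a_def b_def liouville_coeff_def)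
  have finv: "f (1 / s) = f s" if "s \<in> Dom1 \<epsilon>" for s
    using Sreg_inverse[OF e that] Sreg_inverse[OF e2] that D12 by (auto simp: f_def a_def b_def)
  have f'1: "deriv f 1 = 0"
  proof -
    have d: "(f has_field_derivative deriv f 1) (at (1 / 1))"
      using holomorphic_derivI[OF hf op one] by simp
    have "((\<lambda>s::complex. 1 / s) has_field_derivative - 1) (at 1)"
      by (auto intro!: derivative_eq_intros)
    from DERIV_chain2[OF d this] have "((\<lambda>s. f (1 / s)) has_field_derivative - deriv f 1) (at 1)" by simp
    moreover have "((\<lambda>s. f (1 / s)) has_field_derivative deriv f 1) (at 1)"
      by (rule has_field_derivative_transform_within_open[OF holomorphic_derivI[OF hf op one] op one])
         (use finv in auto)
    ultimately have "- deriv f 1 = deriv f 1" by (rule DERIV_unique)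
    then show ?thesis by simp
  qed
  \<comment> \<open>Dividing twice by \<open>z - 1\<close> produces the holomorphic
    \<open>f2\<close>; then \<open>koebe * f\<close> extends over 1 as
    \<open>s * f2\<close>.\<close>
  define f1 where "f1 z = (if z = 1 then deriv f 1 else (f z - f 1) / (z - 1))" for z
  have hf1: "f1 holomorphic_on Dom1 \<epsilon>" unfolding f1_def[abs_def] by (rule pole_lemma_open[OF hf op])
  define f2 where "f2 z = (if z = 1 then deriv f1 1 else (f1 z - f1 1) / (z - 1))" for z
  have hf2: "f2 holomorphic_on Dom1 \<epsilon>" unfolding f2_def[abs_def] by (rule pole_lemma_open[OF hf1 op])
  have f2: "f2 s = f s / (s - 1)\<^sup>2" if "s \<noteq> 1" for s
    using that f1 f'1 by (simp add: f2_def f1_def power2_eq_square)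
  define g where "g s = s * f2 s + a s * (b s - a s) - liouville_coeff \<epsilon> * b s" for s
  have "g holomorphic_on Dom1 \<epsilon>" unfolding g_def[abs_def] by (intro holomorphic_intros ha hb hf2)
  moreover have "g s = liouville_defect \<epsilon> s" if "s \<in> Dom \<epsilon>" for s
  proof -
    have s: "s \<noteq> 1" using that Dom_ne_1 by auto
    have "s * f2 s = koebe s * f s" using f2[OF s] by (simp add: koebe_def)
    then show ?thesis
      unfolding g_def liouville_defect_def S_eq_Sreg[OF e that] S_eq_Sreg[OF e2 Dom_square[OF e(1) that]] a_def[symmetric] b_def[symmetric]
      by (simp add: f_def algebra_simps)
  qed
  ultimately show ?thesis by blast
qed

text \<open>In the coordinate \<open>u = ln s\<close> the defect becomes entire, and all its values
  are taken on one compact annulus, so Liouville's theorem applies.\<close>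

lemma liouville_defect_constant:
  assumes q: "0 < q" "q\<^sup>2 \<le> 1 / 4"
  shows "\<exists>m. \<forall>s\<in>Dom (q\<^sup>2). liouville_defect (q\<^sup>2) s = m"
proof -
  define \<epsilon> where "\<epsilon> = q\<^sup>2"
  have e: "0 < \<epsilon>" "\<epsilon> \<le> 1 / 4" using q by (simp_all add: \<epsilon>_def)
  have q1: "q < 1"
  proof (rule ccontr)
    assume "\<not> q < 1"
    then have "1 \<le> q\<^sup>2" by simp
    with q show False by simp
  qed
  obtain g where g: "g holomorphic_on Dom1 \<epsilon>" "\<And>s. s \<in> Dom \<epsilon> \<Longrightarrow> g s = liouville_defect \<epsilon> s"
    using liouville_defect_removable[OF e] by blast
  have op: "open (Dom1 \<epsilon>)" using open_Dom1 e by simp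
  define A where "A = {s::complex. q \<le> norm s \<and> norm s \<le> 1 / q}"
  have eq: "\<epsilon> < q" using q q1 by (simp add: \<epsilon>_def power2_eq_square)
  have AD: "A \<subseteq> Dom1 \<epsilon>"
  proof
    fix s assume "s \<in> A"
    moreover have "1 / q < 1 / \<epsilon>" using eq e by (simp add: frac_less2)
    ultimately show "s \<in> Dom1 \<epsilon>" using e eq by (intro annulus_Dom1) (auto simp: A_def)
  qed
  have "compact A"
  proof -
    have "A = cball 0 (1 / q) - ball 0 q" by (auto simp: A_def)
    then show ?thesis by (simp add: compact_diff)
  qed
  then have bA: "bounded (g ` A)"
    using AD g(1) by (meson compact_continuous_image compact_imp_bounded continuous_on_subset holomorphic_on_imp_continuous_on)
  \<comment> \<open>The excluded values of \<open>exp u\<close> are powers of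
    \<open>\<epsilon>\<close>, all equivalent to 1, so the single default \<open>g 1\<close> fills
    every removable singularity.\<close>
  define H where "H u = (if exp u \<in> Dom \<epsilon> then liouville_defect \<epsilon> (exp u) else g 1)" for u
  \<comment> \<open>Any representative in \<open>Dom1\<close> may be used; near a given
    \<open>u\<close> this expresses \<open>H\<close> through the holomorphic
    \<open>g\<close>.\<close>
  have Hg: "H u = g (exp u * of_real (\<epsilon> powi k))" if "exp u * of_real (\<epsilon> powi k) \<in> Dom1 \<epsilon>" for u k
  proof (cases "exp u \<in> Dom \<epsilon>")
    case True
    then show ?thesis using invariant_scale[of \<epsilon> "liouville_defect \<epsilon>", OF e(1) liouville_defect_divide[OF e], of "exp u" k] g(2)[OF Dom_scale[OF True e(1)]]
      by (simp add: H_def)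
  next
    case False
    have "exp u * of_real (\<epsilon> powi k) \<notin> Dom \<epsilon>"
    proof
      assume "exp u * of_real (\<epsilon> powi k) \<in> Dom \<epsilon>"
      from Dom_scale[OF this e(1), of "-k"] have "exp u \<in> Dom \<epsilon>"
        using e by (simp add: power_int_minus mult.assoc)
      with False show False ..
    qed
    then have "exp u * of_real (\<epsilon> powi k) = 1" using that Dom_eq[OF e(1)] by blast
    then show ?thesis using False by (simp add: H_def)
  qed
  have ex: "\<exists>k. exp u * of_real (\<epsilon> powi k) \<in> A" for u
    using exists_scale[OF q(1) q1, of "exp u"] unfolding A_def \<epsilon>_def by (auto intro: less_imp_le)
  have "H holomorphic_on UNIV"
    unfolding holomorphic_on_def
  proof
    fix u
    obtain k where k: "exp u * of_real (\<epsilon> powi k) \<in> A" using ex by blast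
    define h where "h w = g (exp w * of_real (\<epsilon> powi k))" for w
    have d: "((\<lambda>w. exp w * of_real (\<epsilon> powi k)) has_field_derivative exp u * of_real (\<epsilon> powi k)) (at u)"
      by (auto intro!: derivative_eq_intros)
    have "exp u * of_real (\<epsilon> powi k) \<in> Dom1 \<epsilon>" using k AD by blast
    from DERIV_chain2[OF holomorphic_derivI[OF g(1) op this] d]
    obtain D where D: "(h has_field_derivative D) (at u)"
      unfolding h_def[abs_def] by blast
    have "open ((\<lambda>w. exp w * of_real (\<epsilon> powi k)) -` Dom1 \<epsilon>)"
      by (intro open_vimage op continuous_intros)
    then have "(H has_field_derivative D) (at u)"
      by (rule has_field_derivative_transform_within_open[OF D]) (use k AD Hg in \<open>auto simp: h_def\<close>)
    then show "H field_differentiable (at u within UNIV)" by (auto simp: field_differentiable_def)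
  qed
  moreover have "range H \<subseteq> g ` A"
  proof
    fix x assume "x \<in> range H"
    then obtain u where "x = H u" by auto
    moreover obtain k where "exp u * of_real (\<epsilon> powi k) \<in> A" using ex by blast
    ultimately show "x \<in> g ` A" using Hg AD by blast
  qed
  ultimately have "H constant_on UNIV" using bA bounded_subset Liouville_theorem by blast
  then obtain m where m: "\<And>u. H u = m" by (auto simp: constant_on_def)
  have "liouville_defect \<epsilon> s = m" if "s \<in> Dom \<epsilon>" for s
  proof -
    have "exp (Ln s) = s" using Dom_nonzero[OF that] by simp
    then show ?thesis using m[of "Ln s"] that by (simp add: H_def)
  qed
  then show ?thesis by (auto simp: \<epsilon>_def)
qed

text \<open>Cauchy's estimate on discs of radius \<open>1 / (8 * \<epsilon>)\<close>: they stay
  within radius \<open>3 / (8 * \<epsilon>)\<close>, where \<open>lambert\<close> is at most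
  9/8.\<close>

lemma norm_deriv_lambert_le:
  assumes "0 < \<epsilon>" "\<epsilon> \<le> 1 / 4" "norm t \<le> 1 / (4 * \<epsilon>)"
  shows "norm (deriv (lambert \<epsilon>) t) \<le> 9 * \<epsilon>"
proof -
  have sub: "norm w \<le> 3 / (8 * \<epsilon>)" if "w \<in> cball t (1 / (8 * \<epsilon>))" for w
  proof -
    have "norm w \<le> norm t + norm (w - t)" using norm_triangle_ineq[of t "w - t"] by simp
    also have "\<dots> \<le> 1 / (4 * \<epsilon>) + 1 / (8 * \<epsilon>)" using that assms by (simp add: dist_norm norm_minus_commute)
    also have "\<dots> = 3 / (8 * \<epsilon>)" using assms by (simp add: field_simps)
    finally show ?thesis .
  qed
  have le: "3 / (8 * \<epsilon>) < 1 / (2 * \<epsilon>)" using assms by (simp add: field_simps)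
  have "norm (deriv (lambert \<epsilon>) t) \<le> (9 / 8) / (1 / (8 * \<epsilon>))"
  proof (rule norm_deriv_le_cball[OF lambert_holomorphic_ball[OF assms(1,2)]])
    show "cball t (1 / (8 * \<epsilon>)) \<subseteq> ball 0 (1 / (2 * \<epsilon>))" using sub le by force
    fix w assume "w \<in> cball t (1 / (8 * \<epsilon>))"
    note w = sub[OF this]
    have "norm (lambert \<epsilon> w) \<le> 3 * \<epsilon> * norm w" by (rule norm_lambert_le[OF assms(1,2)]) (use w le in linarith)
    also have "\<dots> \<le> 3 * \<epsilon> * (3 / (8 * \<epsilon>))" using w assms by (intro mult_left_mono) auto
    finally show "norm (lambert \<epsilon> w) \<le> 9 / 8" using assms by simp
  qed (use assms in auto)
  then show ?thesis using assms by (simp add: field_simps)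
qed

text \<open>One use of the recursion: the first term has derivative
  \<open>\<epsilon> / (1 - \<epsilon> * t)\<^sup>2\<close>, and the rest is the derivative at
  \<open>\<epsilon> * t\<close>, already of order \<open>\<epsilon>\<close>, times a further
  \<open>\<epsilon>\<close> from the chain rule.\<close>

lemma deriv_lambert_approx_gen:
  assumes "0 < \<epsilon>" "\<epsilon> \<le> 1 / 16" "norm t \<le> 1 / (16 * \<epsilon>)"
  shows "norm (deriv (lambert \<epsilon>) t - of_real \<epsilon>) \<le> 3 * \<epsilon>\<^sup>2 * norm t + 9 * \<epsilon>\<^sup>2"
proof -
  define c where "c = complex_of_real \<epsilon>"
  have nct': "norm (c * t) = \<epsilon> * norm t" using assms by (simp add: c_def norm_mult)
  have nct: "norm (c * t) \<le> 1 / 16" unfolding nct' using assms by (simp add: field_simps)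
  have ne: "1 - c * t \<noteq> 0"
  proof
    assume "1 - c * t = 0"
    then have "norm (c * t) = 1" by (metis eq_iff_diff_eq_0 norm_one)
    with nct show False by simp
  qed
  have le: "1 \<le> 1 / (4 * \<epsilon>)" using assms by (simp add: field_simps)
  have b: "c * t \<in> ball 0 (1 / (2 * \<epsilon>))"
  proof -
    have "1 / (4 * \<epsilon>) < 1 / (2 * \<epsilon>)" using assms by (simp add: field_simps)
    then have "norm (c * t) < 1 / (2 * \<epsilon>)" using nct le assms by linarith
    then show ?thesis by simp
  qed
  have d: "(lambert \<epsilon> has_field_derivative deriv (lambert \<epsilon>) (c * t)) (at (c * t))"
    by (rule holomorphic_derivI[OF lambert_holomorphic_ball _ b]) (use assms in auto)
  have "((\<lambda>t. c * t) has_field_derivative c) (at t)" by (auto intro!: derivative_eq_intros)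
  from DERIV_chain2[OF d this] have 1: "((\<lambda>t. lambert \<epsilon> (c * t)) has_field_derivative deriv (lambert \<epsilon>) (c * t) * c) (at t)" .
  have 2: "((\<lambda>t. geo (c * t)) has_field_derivative c / (1 - c * t)\<^sup>2) (at t)"
    unfolding geo_def using ne by (auto intro!: derivative_eq_intros simp: field_simps power2_eq_square)
  have "lambert \<epsilon> = (\<lambda>t. geo (c * t) + lambert \<epsilon> (c * t))"
    by (rule ext, unfold c_def, rule lambert_rec) (use assms in auto)
  then have "(lambert \<epsilon> has_field_derivative (c / (1 - c * t)\<^sup>2 + deriv (lambert \<epsilon>) (c * t) * c)) (at t)"
    using DERIV_add[OF 2 1] by simp
  then have eq: "deriv (lambert \<epsilon>) t = c / (1 - c * t)\<^sup>2 + deriv (lambert \<epsilon>) (c * t) * c" by (rule DERIV_imp_deriv)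
  have A: "norm (deriv (lambert \<epsilon>) (c * t) * c) \<le> 9 * \<epsilon> * \<epsilon>"
  proof -
    have "norm (c * t) \<le> 1 / (4 * \<epsilon>)" using nct le assms by linarith
    then have "norm (deriv (lambert \<epsilon>) (c * t)) \<le> 9 * \<epsilon>" by (intro norm_deriv_lambert_le) (use assms in auto)
    moreover have "norm c = \<epsilon>" using assms by (simp add: c_def)
    ultimately show ?thesis using assms by (simp add: norm_mult mult_right_mono)
  qed
  have B: "norm (c / (1 - c * t)\<^sup>2 - c) \<le> 3 * \<epsilon> * (\<epsilon> * norm t)"
  proof -
    define x where "x = c * t"
    have x: "norm x \<le> 1 / 16" using nct by (simp add: x_def)
    have "norm (1 - x) \<ge> 15 / 16" using norm_triangle_ineq2[of 1 x] x assms by simp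
    then have "(15 / 16)\<^sup>2 \<le> (norm (1 - x))\<^sup>2" by (intro power_mono) auto
    then have n1: "5 / 6 \<le> norm ((1 - x)\<^sup>2)" unfolding norm_power by (simp add: power2_eq_square)
    have "c / (1 - x)\<^sup>2 - c = c * (x * (2 - x)) / (1 - x)\<^sup>2"
    proof -
      have "(1 - x)\<^sup>2 \<noteq> 0" using ne by (simp add: x_def)
      then have "c / (1 - x)\<^sup>2 - c = (c - c * (1 - x)\<^sup>2) / (1 - x)\<^sup>2" by (simp add: diff_divide_distrib)
      also have "c - c * (1 - x)\<^sup>2 = c * (x * (2 - x))" by (simp add: power2_eq_square algebra_simps)
      finally show ?thesis .
    qed
    then have "norm (c / (1 - x)\<^sup>2 - c) = \<epsilon> * (norm x * norm (2 - x)) / norm ((1 - x)\<^sup>2)"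
      using assms by (simp add: norm_mult norm_divide c_def)
    also have "\<dots> \<le> \<epsilon> * (norm x * (5 / 2)) / (5 / 6)"
    proof -
      have "norm (2 - x) \<le> 5 / 2" using norm_triangle_ineq4[of 2 x] x assms by simp
      then show ?thesis using assms x n1 by (intro frac_le mult_left_mono mult_mono) auto
    qed
    also have "\<dots> = 3 * \<epsilon> * (\<epsilon> * norm t)" using nct' by (simp add: x_def)
    finally show ?thesis by (simp add: x_def)
  qed
  have "norm (deriv (lambert \<epsilon>) t - c) \<le> norm (c / (1 - c * t)\<^sup>2 - c) + norm (deriv (lambert \<epsilon>) (c * t) * c)"
    using norm_triangle_ineq[of "c / (1 - c * t)\<^sup>2 - c" "deriv (lambert \<epsilon>) (c * t) * c"] by (simp add: eq algebra_simps)
  then show ?thesis using A B by (simp add: c_def power2_eq_square)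
qed

lemma deriv_lambert_approx:
  assumes "0 < \<epsilon>" "\<epsilon> \<le> 1 / 16" "norm t \<le> 1"
  shows "norm (deriv (lambert \<epsilon>) t - of_real \<epsilon>) \<le> 12 * \<epsilon>\<^sup>2"
proof -
  have "1 \<le> 1 / (16 * \<epsilon>)" using assms by (simp add: field_simps)
  then have "norm (deriv (lambert \<epsilon>) t - of_real \<epsilon>) \<le> 3 * \<epsilon>\<^sup>2 * norm t + 9 * \<epsilon>\<^sup>2"
    by (intro deriv_lambert_approx_gen) (use assms in linarith)+
  moreover have "3 * \<epsilon>\<^sup>2 * norm t \<le> 3 * \<epsilon>\<^sup>2 * 1" using assms by (intro mult_left_mono) auto
  ultimately show ?thesis by linarith
qed

text \<open>Symmetry under conjugation. It makes the constants of the quadratic relation real, as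
  real coordinate functions require.\<close>

lemma deriv_lambert_real:
  assumes "0 < \<epsilon>" "\<epsilon> \<le> 1 / 4" "of_real t \<in> lambert_dom \<epsilon>"
  shows "deriv (lambert \<epsilon>) (of_real t) \<in> \<real>"
proof -
  define D where "D = deriv (lambert \<epsilon>) (of_real t)"
  have "(lambert \<epsilon> has_field_derivative D) (at (of_real t))"
    using lambert_differentiable[OF assms] by (simp add: D_def field_differentiable_derivI)
  then have d: "(lambert \<epsilon> has_derivative (\<lambda>h. D * h)) (at (cnj (of_real t)))"
    by (simp add: has_field_derivative_def)
  have "(cnj has_derivative cnj) (at (of_real t))"
    by (intro bounded_linear_imp_has_derivative bounded_linear_cnj)
  from has_derivative_compose[OF this d]
  have "((\<lambda>x. cnj (lambert \<epsilon> (cnj x))) has_derivative (\<lambda>h. cnj (D * cnj h))) (at (of_real t))"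
    by (rule has_derivative_cnj)
  moreover have "(\<lambda>x. cnj (lambert \<epsilon> (cnj x))) = lambert \<epsilon>"
    using assms by (simp add: lambert_cnj)
  ultimately have "(lambert \<epsilon> has_derivative (\<lambda>h. cnj (D * cnj h))) (at (of_real t))" by simp
  then have "(\<lambda>h. cnj (D * cnj h)) = (\<lambda>h. D * h)" using d by (intro has_derivative_unique) auto
  from fun_cong[OF this, of 1] show ?thesis by (simp add: D_def[symmetric] Reals_cnj_iff)
qed

text \<open>The constants are explicit: \<open>e\<close> is \<open>liouville_coeff\<close>, and
  \<open>m\<close> is the constant defect evaluated at \<open>s = -1\<close>, a fixed point of
  \<open>s \<mapsto> 1 / s\<close> where \<open>koebe\<close> is -1/4 and only the derivative of
  \<open>lambert\<close> at -1 enters.\<close>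

lemma elliptic_relation:
  assumes q: "0 < q" "q \<le> 1 / 1000"
  shows "\<exists>e m :: real. \<bar>e - 2 * q\<^sup>2\<bar> \<le> q\<^sup>2 / 100 \<and> \<bar>m - q\<^sup>2\<bar> \<le> q\<^sup>2 / 100 \<and>
    (\<forall>s\<in>Dom (q\<^sup>2). (2 * S ((q\<^sup>2)\<^sup>2) s - S (q\<^sup>2) s)\<^sup>2 =
       (S (q\<^sup>2) s)\<^sup>2 - 4 * of_real e * S (q\<^sup>2) s - 4 * of_real m)"
proof -
  define \<epsilon> where "\<epsilon> = q\<^sup>2"
  have small: "\<epsilon> \<le> 1 / 1000000"
  proof -
    have "q * q \<le> 1 / 1000 * (1 / 1000)" using q by (intro mult_mono) auto
    then show ?thesis by (simp add: \<epsilon>_def power2_eq_square)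
  qed
  have e: "0 < \<epsilon>" "\<epsilon> \<le> 1 / 4" "\<epsilon> \<le> 1 / 16" "\<epsilon> < 1" using q small by (auto simp: \<epsilon>_def)
  have e2: "0 < \<epsilon>\<^sup>2" "\<epsilon>\<^sup>2 \<le> 1 / 4" "\<epsilon>\<^sup>2 \<le> \<epsilon>" using square_le_quarter[OF e(1,2)] by auto
  have ee1: "\<epsilon>\<^sup>2 \<le> \<epsilon> / 1000000" using small e(1) by (simp add: power2_eq_square)
  have e2': "\<epsilon>\<^sup>2 \<le> 1 / 16" "\<epsilon>\<^sup>2 < 1" using e2 e by auto
  have inv1: "(1::complex) / (-1) = -1" by simp
  have one: "(1::complex) \<in> Dom1 \<epsilon>" "(1::complex) \<in> Dom1 (\<epsilon>\<^sup>2)" "(-1::complex) \<in> Dom1 \<epsilon>" "(-1::complex) \<in> Dom1 (\<epsilon>\<^sup>2)"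
    using unit_Dom1[of \<epsilon>] unit_Dom1[of "\<epsilon>\<^sup>2"] e e2 e2' by auto
  have m1: "(-1::complex) \<in> Dom \<epsilon>" using one(3) Dom_eq[OF e(1)] by (auto simp: complex_eq_iff)
  define L where "L t = deriv (lambert \<epsilon>) t" for t
  define L2 where "L2 t = deriv (lambert (\<epsilon>\<^sup>2)) t" for t
  have real: "L 1 \<in> \<real>" "L (-1) \<in> \<real>" "L2 1 \<in> \<real>" "L2 (-1) \<in> \<real>"
    using deriv_lambert_real[OF e(1,2), of 1] deriv_lambert_real[OF e(1,2), of "-1"]
      deriv_lambert_real[OF e2(1,2), of 1] deriv_lambert_real[OF e2(1,2), of "-1"] one
    by (auto simp: L_def L2_def Dom1_def)
  have ap: "norm (L 1 - of_real \<epsilon>) \<le> 12 * \<epsilon>\<^sup>2" "norm (L (-1) - of_real \<epsilon>) \<le> 12 * \<epsilon>\<^sup>2"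
    unfolding L_def by (rule deriv_lambert_approx[OF e(1,3)], simp)+
  have ap2: "norm (L2 t) \<le> 3 / 2 * \<epsilon>\<^sup>2" if "norm t \<le> 1" for t
  proof -
    have "norm (L2 t - of_real (\<epsilon>\<^sup>2)) \<le> 12 * (\<epsilon>\<^sup>2)\<^sup>2"
      unfolding L2_def by (rule deriv_lambert_approx[OF e2(1) e2'(1) that])
    moreover have "norm (L2 t) \<le> norm (L2 t - of_real (\<epsilon>\<^sup>2)) + norm (complex_of_real (\<epsilon>\<^sup>2))"
      using norm_triangle_ineq[of "L2 t - of_real (\<epsilon>\<^sup>2)" "of_real (\<epsilon>\<^sup>2)"] by simp
    moreover have "norm (complex_of_real (\<epsilon>\<^sup>2)) = \<epsilon>\<^sup>2" by (simp only: norm_of_real abs_power2)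
    moreover have "(\<epsilon>\<^sup>2)\<^sup>2 \<le> \<epsilon>\<^sup>2 * (1 / 1000000)"
      unfolding power2_eq_square[of "\<epsilon>\<^sup>2"] using e2 small by (intro mult_left_mono) linarith+
    ultimately show ?thesis using e2(1) by linarith
  qed
  define x where "x = Re (L 1)"
  define x' where "x' = Re (L (-1))"
  define y where "y = Re (L2 1)"
  define y' where "y' = Re (L2 (-1))"
  have of_real: "L 1 = of_real x" "L (-1) = of_real x'" "L2 1 = of_real y" "L2 (-1) = of_real y'"
    using real by (simp_all add: x_def x'_def y_def y'_def)
  have bx: "\<bar>x - \<epsilon>\<bar> \<le> 12 * \<epsilon>\<^sup>2" "\<bar>x' - \<epsilon>\<bar> \<le> 12 * \<epsilon>\<^sup>2"
    using ap unfolding of_real by (simp_all only: of_real_diff[symmetric] norm_of_real)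
  have by': "\<bar>y\<bar> \<le> 3 / 2 * \<epsilon>\<^sup>2" "\<bar>y'\<bar> \<le> 3 / 2 * \<epsilon>\<^sup>2"
    using ap2[of 1] ap2[of "-1"] unfolding of_real by (simp_all only: norm_of_real) simp_all
  define c where "c = 2 * x - 2 * y"
  have liouville_coeff: "liouville_coeff \<epsilon> = of_real c"
    unfolding liouville_coeff_def Sreg_eq[OF e(1,2) one(1)] Sreg_eq[OF e2(1,2) one(2)]
    using of_real by (simp add: c_def L_def L2_def)
  have c: "\<bar>c - 2 * \<epsilon>\<bar> \<le> 27 * \<epsilon>\<^sup>2" using bx by' unfolding c_def by linarith
  obtain m0 where m0: "\<And>s. s \<in> Dom \<epsilon> \<Longrightarrow> liouville_defect \<epsilon> s = m0"
    using liouville_defect_constant[OF q(1)] e by (auto simp: \<epsilon>_def)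
  define v1 where "v1 = - (1 / 4) - 2 * y'"
  define v2 where "v2 = - 2 * x' + 2 * y'"
  have S2: "S (\<epsilon>\<^sup>2) (-1) = of_real v1"
    unfolding S_eq_Sreg[OF e2(1,2) Dom_square[OF e(1) m1]] Sreg_eq[OF e2(1,2) one(4)] inv1
    using of_real by (simp add: v1_def L2_def koebe_def)
  have S1: "S \<epsilon> (-1) - S (\<epsilon>\<^sup>2) (-1) = of_real v2"
    unfolding S_eq_Sreg[OF e2(1,2) Dom_square[OF e(1) m1]] Sreg_eq[OF e2(1,2) one(4)] inv1
      S_eq_Sreg[OF e(1,2) m1] Sreg_eq[OF e(1,2) one(3)]
    using of_real by (simp add: v2_def L_def L2_def)
  define m where "m = v1 * (v2 - c) - c * v2"
  have m: "m0 = of_real m"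
  proof -
    have "m0 = S (\<epsilon>\<^sup>2) (-1) * (S \<epsilon> (-1) - S (\<epsilon>\<^sup>2) (-1)) - liouville_coeff \<epsilon> * ((S \<epsilon> (-1) - S (\<epsilon>\<^sup>2) (-1)) + S (\<epsilon>\<^sup>2) (-1))"
      using m0[OF m1] by (simp add: liouville_defect_def)
    also have "\<dots> = of_real v1 * of_real v2 - of_real c * (of_real v2 + of_real v1)"
      unfolding S1 liouville_coeff unfolding S2 ..
    also have "\<dots> = of_real m" unfolding m_def by (simp add: algebra_simps)
    finally show ?thesis .
  qed
  have mb: "\<bar>m - \<epsilon>\<bar> \<le> 100 * \<epsilon>\<^sup>2"
  proof -
    \<comment> \<open>To leading order \<open>v1 = -1/4\<close>, \<open>v2 = -2 * \<epsilon>\<close>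
      and \<open>c = 2 * \<epsilon>\<close>, so \<open>m\<close> is about \<open>\<epsilon>\<close>;
      \<open>a\<close> collects the error of \<open>v2 - c\<close>.\<close>
    define a where "a = v2 - c + 4 * \<epsilon>"
    have a: "\<bar>a\<bar> \<le> 54 * \<epsilon>\<^sup>2" using bx by' c unfolding a_def v2_def by linarith
    have eq: "m - \<epsilon> = - a / 4 - 2 * y' * (v2 - c) - c * v2"
      unfolding m_def v1_def a_def by (simp add: field_simps)
    have l: "\<bar>v2 - c\<bar> \<le> 5 * \<epsilon>" "\<bar>c\<bar> \<le> 3 * \<epsilon>" "\<bar>v2\<bar> \<le> 3 * \<epsilon>"
      using a c bx by' ee1 e(1) unfolding a_def v2_def by linarith+
    have 1: "\<bar>c * v2\<bar> \<le> 3 * \<epsilon> * (3 * \<epsilon>)" unfolding abs_mult using l e by (intro mult_mono) auto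
    have 2: "\<bar>2 * y' * (v2 - c)\<bar> \<le> (3 * \<epsilon>\<^sup>2) * 1"
    proof -
      have "\<bar>2 * y'\<bar> * \<bar>v2 - c\<bar> \<le> (3 * \<epsilon>\<^sup>2) * 1"
        by (rule mult_mono) (use l(1) by' small e in linarith)+
      then show ?thesis by (simp only: abs_mult)
    qed
    have "3 * \<epsilon> * (3 * \<epsilon>) = 9 * \<epsilon>\<^sup>2" by (simp add: power2_eq_square)
    with 1 2 a eq show ?thesis by linarith
  qed
  have "(2 * S (\<epsilon>\<^sup>2) s - S \<epsilon> s)\<^sup>2 = (S \<epsilon> s)\<^sup>2 - 4 * of_real c * S \<epsilon> s - 4 * of_real m" if "s \<in> Dom \<epsilon>" for s
  proof -
    have "(2 * S (\<epsilon>\<^sup>2) s - S \<epsilon> s)\<^sup>2 = (S \<epsilon> s)\<^sup>2 - 4 * liouville_coeff \<epsilon> * S \<epsilon> s - 4 * liouville_defect \<epsilon> s"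
      by (simp add: liouville_defect_def power2_eq_square algebra_simps)
    then show ?thesis using m0[OF that] m liouville_coeff by simp
  qed
  moreover have "\<bar>c - 2 * \<epsilon>\<bar> \<le> \<epsilon> / 100" "\<bar>m - \<epsilon>\<bar> \<le> \<epsilon> / 100" using c mb ee1 by linarith+
  ultimately show ?thesis unfolding \<epsilon>_def by (intro exI[of _ c] exI[of _ m]) blast
qed

section \<open>The stack of necks\<close>

text \<open>With \<open>\<epsilon> = q\<^sup>2\<close>, multiplying the parameter by \<open>1 / \<epsilon>\<close> moves one sheet of the surface
  to the next; the waists of the necks are the circles of radius \<open>q powi k\<close>, \<open>k\<close> odd.\<close>

locale neck_stack =
  fixes q e m :: real
  assumes q_pos: "0 < q" and q_small: "q \<le> 1 / 10 ^ 12" and ln_q: "100 \<le> ln (1 / q)"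
    and e_bound: "\<bar>e - 2 * q\<^sup>2\<bar> \<le> q\<^sup>2 / 100" and m_bound: "\<bar>m - q\<^sup>2\<bar> \<le> q\<^sup>2 / 100"
    and relation: "\<And>s. s \<in> Dom (q\<^sup>2) \<Longrightarrow> (2 * S ((q\<^sup>2)\<^sup>2) s - S (q\<^sup>2) s)\<^sup>2 =
       (S (q\<^sup>2) s)\<^sup>2 - 4 * of_real e * S (q\<^sup>2) s - 4 * of_real m"
begin

definition "eps = q\<^sup>2"
text \<open>The values forced by conformality. With \<open>T = S eps\<close> and
  \<open>w\<^sup>2 = T\<^sup>2 - 4 * e * T - 4 * m\<close>, the polynomial
  \<open>4 * w\<^sup>2 - b\<^sup>2 * T\<^sup>2 + (c0 + B * T)\<^sup>2\<close> in \<open>T\<close>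
  vanishes exactly when \<open>c0\<^sup>2 = 16 * m\<close>, \<open>c0 * B = 8 * e\<close> and
  \<open>b\<^sup>2 = 4 + B\<^sup>2\<close>.\<close>

definition "c0 = 4 * sqrt m"
definition "B = 2 * e / sqrt m"
definition "b = sqrt (4 + B\<^sup>2)"
text \<open>The vertical period: the logarithm contributes \<open>c0 * ln (1 / eps)\<close>, and the
  increment 1 of \<open>Y\<close> subtracts \<open>B\<close>.\<close>

definition "h = 2 * c0 * ln (1 / q) - B"
definition W :: "complex \<Rightarrow> complex" where "W s = Y eps s - 2 * Y (eps\<^sup>2) s"
definition x1 :: "complex \<Rightarrow> real" where "x1 s = 2 * Re (W s)"
definition x2 :: "complex \<Rightarrow> real" where "x2 s = - b * Im (Y eps s)"
definition x3 :: "complex \<Rightarrow> real" where "x3 s = c0 * ln (norm s) - B * Re (Y eps s)"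
definition X :: "complex \<Rightarrow> real^3" where "X s = pt3 (x1 s) (x2 s) (x3 s)"
definition p1 :: "complex \<Rightarrow> complex" where "p1 s = 2 * (2 * S (eps\<^sup>2) s - S eps s) / s"
definition p2 :: "complex \<Rightarrow> complex" where "p2 s = - \<i> * of_real b * S eps s / s"
definition p3 :: "complex \<Rightarrow> complex" where "p3 s = (of_real c0 + of_real B * S eps s) / s"

lemma eps: "0 < eps" "eps \<le> 1 / 4" "eps < 1" "eps \<le> 1 / 16" "0 < eps\<^sup>2" "eps\<^sup>2 \<le> 1 / 4" "eps\<^sup>2 < 1" "eps \<le> q / 10 ^ 12"
proof -
  have "q * q \<le> q * (1 / 10 ^ 12)" using q_pos q_small by (intro mult_left_mono) auto
  then show a: "eps \<le> q / 10 ^ 12" by (simp add: eps_def power2_eq_square)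
  show "0 < eps" "0 < eps\<^sup>2" using q_pos by (simp_all add: eps_def)
  show b: "eps \<le> 1 / 16" using a q_small by (simp add: field_simps)
  then show "eps \<le> 1 / 4" "eps < 1" by auto
  then show "eps\<^sup>2 \<le> 1 / 4" "eps\<^sup>2 < 1" using square_le_quarter[OF \<open>0 < eps\<close>] by auto
qed

lemma q1: "q < 1" "1 < 1 / q"
proof -
  show "q < 1" using q_small by (rule order_le_less_trans) simp
  then show "1 < 1 / q" using q_pos by simp
qed

lemma sqrt_m: "99 / 100 * q \<le> sqrt m" "sqrt m \<le> 101 / 100 * q" "0 < m"
proof -
  have m: "99 / 100 * q\<^sup>2 \<le> m" "m \<le> 101 / 100 * q\<^sup>2" using m_bound by linarith+
  show "99 / 100 * q \<le> sqrt m"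
  proof (rule real_le_rsqrt)
    have "(99 / 100 * q)\<^sup>2 \<le> 99 / 100 * q\<^sup>2" by (simp add: power_mult_distrib power2_eq_square)
    then show "(99 / 100 * q)\<^sup>2 \<le> m" using m by linarith
  qed
  show "sqrt m \<le> 101 / 100 * q"
  proof (rule real_le_lsqrt)
    have "101 / 100 * q\<^sup>2 \<le> (101 / 100 * q)\<^sup>2" by (simp add: power_mult_distrib power2_eq_square)
    then show "m \<le> (101 / 100 * q)\<^sup>2" using m by linarith
  qed (use q_pos in simp)
  show "0 < m" using m(1) q_pos by (smt (verit) zero_less_power mult_pos_pos divide_pos_pos)
qed

text \<open>As \<open>e\<close> is about \<open>2 * q\<^sup>2\<close> and \<open>m\<close> about
  \<open>q\<^sup>2\<close>, both \<open>c0\<close> and \<open>B\<close> are about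
  \<open>4 * q\<close>. Their comparison lets the logarithm win against the tilt in the height
  estimates.\<close>

lemma constants: "39 / 10 * q \<le> c0" "c0 \<le> 41 / 10 * q" "0 < B" "B \<le> 42 / 10 * q" "B \<le> 11 / 10 * c0"
  "2 \<le> b" "b \<le> 2 + 5 * q\<^sup>2"
proof -
  note s = sqrt_m
  have qq: "0 < q\<^sup>2" using q_pos by simp
  show c0: "39 / 10 * q \<le> c0" "c0 \<le> 41 / 10 * q" using s q_pos by (simp_all add: c0_def)
  have sp: "0 < sqrt m" using s by simp
  have e: "0 < e" "e \<le> 201 / 100 * q\<^sup>2" using e_bound qq by linarith+
  show "0 < B" using e sp by (simp add: B_def)
  have "B * sqrt m = 2 * e" using sp by (simp add: B_def)
  have "2 * e \<le> 42 / 10 * q * (99 / 100 * q)" using e qq by (simp add: power2_eq_square)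
  also have "\<dots> \<le> 42 / 10 * q * sqrt m" using s(1) q_pos by (intro mult_left_mono) auto
  finally show Bq: "B \<le> 42 / 10 * q" using sp by (simp add: B_def divide_le_eq)
  have "99 / 100 * q\<^sup>2 \<le> m" using m_bound by linarith
  then have "2 * e \<le> 44 / 10 * m" using e qq by linarith
  also have "m = sqrt m * sqrt m" using s by simp
  finally show "B \<le> 11 / 10 * c0" using sp by (simp add: B_def c0_def divide_le_eq mult_ac)
  have "sqrt (2\<^sup>2) \<le> b" unfolding b_def by (rule real_sqrt_le_mono) simp
  then show "2 \<le> b" by simp
  have "B\<^sup>2 \<le> (42 / 10 * q)\<^sup>2" using Bq \<open>0 < B\<close> by (intro power_mono) auto
  then have "B\<^sup>2 \<le> 20 * q\<^sup>2" using qq by (simp add: power_mult_distrib power2_eq_square)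
  moreover have "(2 + 5 * q\<^sup>2)\<^sup>2 = 4 + 20 * q\<^sup>2 + (5 * q\<^sup>2)\<^sup>2" by (simp add: power2_sum)
  ultimately have "4 + B\<^sup>2 \<le> (2 + 5 * q\<^sup>2)\<^sup>2" using zero_le_power2[of "5 * q\<^sup>2"] by linarith
  then show "b \<le> 2 + 5 * q\<^sup>2" unfolding b_def by (rule real_le_lsqrt[rotated]) simp
qed

lemma open_dom: "open (Dom eps)" using open_Dom eps by auto

lemma x1_deriv: "s \<in> Dom eps \<Longrightarrow> (x1 has_derivative (\<lambda>d. Re (p1 s * d))) (at s)"
proof -
  assume s: "s \<in> Dom eps"
  have p: "Re (p1 s * d) = 2 * Re ((- S eps s / s - 2 * (- S (eps\<^sup>2) s / s)) * d)" for d
  proof -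
    have "p1 s * d = 2 * ((- S eps s / s - 2 * (- S (eps\<^sup>2) s / s)) * d)"
      using Dom_nonzero[OF s] by (simp add: p1_def field_simps)
    moreover have "Re (2 * z) = 2 * Re z" for z by simp
    ultimately show ?thesis by metis
  qed
  have "(W has_field_derivative - S eps s / s - 2 * (- S (eps\<^sup>2) s / s)) (at s)"
    unfolding W_def[abs_def] by (intro DERIV_diff DERIV_cmult Y_deriv eps s Dom_square)
  then have "(W has_derivative (\<lambda>d. (- S eps s / s - 2 * (- S (eps\<^sup>2) s / s)) * d)) (at s)"
    by (simp add: has_field_derivative_def)
  from has_derivative_mult_right[OF has_derivative_Re[OF this], of 2]
  show ?thesis unfolding x1_def[abs_def]
    by (rule has_derivative_eq_rhs) (simp only: p)
qed

lemma Y_has_derivative: "s \<in> Dom eps \<Longrightarrow> (Y eps has_derivative (\<lambda>d. - S eps s / s * d)) (at s)"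
  using Y_deriv[OF eps(1,2)] unfolding has_field_derivative_def .

lemma x2_deriv: "s \<in> Dom eps \<Longrightarrow> (x2 has_derivative (\<lambda>d. Re (p2 s * d))) (at s)"
proof -
  assume s: "s \<in> Dom eps"
  have p: "Re (p2 s * d) = - b * Im (- S eps s / s * d)" for d
  proof -
    have "p2 s * d = of_real b * (\<i> * (- S eps s / s * d))"
      using Dom_nonzero[OF s] by (simp add: p2_def field_simps)
    moreover have "Re (of_real b * (\<i> * z)) = - b * Im z" for z by simp
    ultimately show ?thesis by metis
  qed
  from has_derivative_mult_right[OF has_derivative_Im[OF Y_has_derivative[OF s]], of "- b"]
  show ?thesis unfolding x2_def[abs_def] by (rule has_derivative_eq_rhs) (simp only: p)
qed

lemma x3_deriv: "s \<in> Dom eps \<Longrightarrow> (x3 has_derivative (\<lambda>d. Re (p3 s * d))) (at s)"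
proof -
  assume s: "s \<in> Dom eps"
  then have s0: "s \<noteq> 0" using Dom_nonzero by auto
  have n: "((\<lambda>s. ln (norm s)) has_derivative (\<lambda>d. Re (1 / s * d))) (at s)"
  proof -
    have "(norm has_derivative (\<lambda>d. d \<bullet> sgn s)) (at s)" by (rule has_derivative_norm[OF s0])
    from has_derivative_ln[OF _ this] s0
    have "((\<lambda>s. ln (norm s)) has_derivative (\<lambda>d. inverse (norm s) * (d \<bullet> sgn s))) (at s)"
      by (simp add: mult.commute divide_inverse)
    moreover have "inverse (norm s) * (d \<bullet> sgn s) = Re (1 / s * d)" for d
      using s0 by (simp add: inner_complex_def sgn_div_norm Re_divide cmod_power2[symmetric] power2_eq_square
          divide_simps del: power2_eq_square)
         (simp add: cmod_power2[symmetric] power2_eq_square algebra_simps)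
    ultimately show ?thesis by simp
  qed
  have "(x3 has_derivative (\<lambda>d. c0 * Re (1 / s * d) - B * Re (- S eps s / s * d))) (at s)"
    unfolding x3_def[abs_def]
    by (intro has_derivative_diff has_derivative_mult_right n has_derivative_Re Y_has_derivative s)
  moreover have "Re (p3 s * d) = c0 * Re (1 / s * d) - B * Re (- S eps s / s * d)" for d
  proof -
    have "p3 s * d = of_real c0 * (1 / s * d) - of_real B * (- S eps s / s * d)"
      using s0 by (simp add: p3_def field_simps)
    moreover have "Re (of_real c0 * z - of_real B * w) = c0 * Re z - B * Re w" for z w by simp
    ultimately show ?thesis by metis
  qed
  ultimately show ?thesis by simp
qed

lemma p_holomorphic: "p1 holomorphic_on Dom eps" "p2 holomorphic_on Dom eps" "p3 holomorphic_on Dom eps"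
proof -
  have 1: "S eps holomorphic_on Dom eps" by (rule S_holomorphic) (use eps in auto)
  have 2: "S (eps\<^sup>2) holomorphic_on Dom eps"
    using S_holomorphic[of "eps\<^sup>2"] Dom_square eps by (meson holomorphic_on_subset subsetI)
  show "p1 holomorphic_on Dom eps" "p2 holomorphic_on Dom eps" "p3 holomorphic_on Dom eps"
    unfolding p1_def[abs_def] p2_def[abs_def] p3_def[abs_def]
    by (intro holomorphic_intros 1 2; use Dom_nonzero in blast)+
qed

lemma conformal:
  assumes "s \<in> Dom eps" shows "(p1 s)\<^sup>2 + (p2 s)\<^sup>2 + (p3 s)\<^sup>2 = 0"
proof -
  define w where "w = 2 * S (eps\<^sup>2) s - S eps s"
  define T where "T = S eps s"
  have s: "s \<noteq> 0" using assms Dom_nonzero by auto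
  have w: "w\<^sup>2 = T\<^sup>2 - 4 * of_real e * T - 4 * of_real m"
    using relation[of s] assms by (simp add: w_def T_def eps_def)
  have m: "sqrt m * sqrt m = m" "sqrt m \<noteq> 0" using sqrt_m by auto
  have c: "c0 * B = 8 * e" "c0\<^sup>2 = 16 * m" "b\<^sup>2 = 4 + B\<^sup>2"
    using m by (simp_all add: c0_def B_def b_def power2_eq_square add_nonneg_nonneg)
  have c': "of_real c0 * of_real B = (8 * of_real e :: complex)" "(of_real c0)\<^sup>2 = (16 * of_real m :: complex)"
    "(of_real b)\<^sup>2 = (4 + (of_real B)\<^sup>2 :: complex)"
    using arg_cong[OF c(1), of complex_of_real] arg_cong[OF c(2), of complex_of_real]
      arg_cong[OF c(3), of complex_of_real] by simp_all
  have "4 * w\<^sup>2 - (of_real b)\<^sup>2 * T\<^sup>2 + (of_real c0 + of_real B * T)\<^sup>2 = 0"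
    unfolding w power2_sum c' using c'(1) by (simp add: power_mult_distrib algebra_simps c'(2))
  moreover have "(p1 s)\<^sup>2 + (p2 s)\<^sup>2 + (p3 s)\<^sup>2 =
     (4 * w\<^sup>2 - (of_real b)\<^sup>2 * T\<^sup>2 + (of_real c0 + of_real B * T)\<^sup>2) / s\<^sup>2"
  proof -
    have "(p1 s)\<^sup>2 = 4 * w\<^sup>2 / s\<^sup>2" "(p2 s)\<^sup>2 = - ((of_real b)\<^sup>2 * T\<^sup>2) / s\<^sup>2"
      "(p3 s)\<^sup>2 = (of_real c0 + of_real B * T)\<^sup>2 / s\<^sup>2"
    proof -
      have "p1 s = 2 * w / s" by (simp only: p1_def w_def)
      then show "(p1 s)\<^sup>2 = 4 * w\<^sup>2 / s\<^sup>2" by (simp add: power_divide power_mult_distrib)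
    qed (simp_all add: p2_def p3_def T_def power_divide power_mult_distrib)
    then show ?thesis by (simp add: add_divide_distrib diff_divide_distrib)
  qed
  ultimately show ?thesis by simp
qed

text \<open>Where \<open>p2\<close> vanishes so does \<open>S eps\<close>, and \<open>p3\<close>
  reduces to \<open>c0 / s\<close>.\<close>

lemma immersion:
  assumes "s \<in> Dom eps" shows "p1 s \<noteq> 0 \<or> p2 s \<noteq> 0 \<or> p3 s \<noteq> 0"
proof (rule ccontr)
  assume "\<not> ?thesis"
  then have p: "p2 s = 0" "p3 s = 0" by auto
  have s: "s \<noteq> 0" using assms Dom_nonzero by auto
  have "b \<noteq> 0" "c0 \<noteq> 0" using constants q_pos by auto
  with p s show False by (simp add: p2_def p3_def)
qed

lemma W_divide: "s \<in> Dom eps \<Longrightarrow> W (s / of_real eps) = - W s"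
  using Y_divide[OF eps(1,3)] Y_split[OF eps(1,3)] by (simp add: W_def)

lemma ln_eps: "ln (1 / eps) = 2 * ln (1 / q)"
  using q_pos by (simp add: eps_def ln_div ln_realpow)

lemma X_divide:
  assumes "s \<in> Dom eps"
  shows "x1 (s / of_real eps) = - x1 s" "x2 (s / of_real eps) = x2 s" "x3 (s / of_real eps) = x3 s + h"
proof -
  show "x1 (s / of_real eps) = - x1 s" by (simp add: x1_def W_divide[OF assms])
  show "x2 (s / of_real eps) = x2 s" by (simp add: x2_def Y_divide[OF eps(1,3) assms])
  have "ln (norm (s / of_real eps)) = ln (norm s) + ln (1 / eps)"
    using assms Dom_nonzero eps(1) by (simp add: norm_divide ln_div)
  then show "x3 (s / of_real eps) = x3 s + h"
    by (simp add: x3_def Y_divide[OF eps(1,3) assms] h_def ln_eps algebra_simps)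
qed

text \<open>Inversion in the unit circle corresponds to the half-turn about the second axis. It
  exchanges the two necks of a sheet, so estimates need to be proved only at the outer one.\<close>

lemma X_reflect:
  assumes "s \<in> Dom eps"
  shows "1 / cnj s \<in> Dom eps" "x1 (1 / cnj s) = - x1 s" "x2 (1 / cnj s) = x2 s" "x3 (1 / cnj s) = - x3 s"
proof -
  have s: "s \<noteq> 0" "s \<noteq> 1" "cnj s \<noteq> 0" "cnj s \<noteq> 1" using assms Dom_nonzero Dom_ne_1 by auto
  show "1 / cnj s \<in> Dom eps" by (intro Dom_inverse Dom_cnj assms)
  have Y: "Y d (1 / cnj s) = - cnj (Y d s)" if "0 < d" "d < 1" for d
    using Y_inverse[OF s(3,4), of d] Y_cnj[OF that, of s] by simp
  note Y = Y[OF eps(1,3)] Y[OF eps(5,7)]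
  show "x1 (1 / cnj s) = - x1 s" "x2 (1 / cnj s) = x2 s" by (simp_all add: x1_def x2_def W_def Y)
  have "ln (norm (1 / cnj s)) = - ln (norm s)" using s by (simp add: norm_divide ln_div)
  then show "x3 (1 / cnj s) = - x3 s" by (simp add: x3_def Y)
qed

definition sg :: "int \<Rightarrow> real" where "sg k = (if even k then 1 else - 1)"

lemma X_scale:
  assumes "s \<in> Dom eps"
  shows "x1 (s * of_real (eps powi (- k))) = sg k * x1 s \<and> x2 (s * of_real (eps powi (- k))) = x2 s \<and>
     x3 (s * of_real (eps powi (- k))) = x3 s + of_int k * h"
proof (induction k rule: int_induct[where k = 0])
  case (step1 i)
  have "eps powi (- (i + 1)) = eps powi (- i) / eps"
    using eps(1) power_int_diff[of eps "- i" 1] by simp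
  then have "s * of_real (eps powi (- (i + 1))) = s * of_real (eps powi (- i)) / of_real eps"
    by (simp only: of_real_divide times_divide_eq_right)
  then show ?case using step1 X_divide[OF Dom_scale[OF assms eps(1), of "- i"]]
    by (simp add: sg_def algebra_simps)
next
  case (step2 i)
  have "eps powi (- i) = eps powi (- (i - 1)) / eps"
    using eps(1) power_int_diff[of eps "- (i - 1)" 1] by simp
  then have "s * of_real (eps powi (- i)) = s * of_real (eps powi (- (i - 1))) / of_real eps"
    by (simp only: of_real_divide times_divide_eq_right)
  then show ?case using step2 X_divide[OF Dom_scale[OF assms eps(1), of "- (i - 1)"]]
    by (simp add: sg_def algebra_simps split: if_splits)
qed (simp add: sg_def)

end

text \<open>The limit position of a sheet: \<open>s = 0\<close> and \<open>s = \<infinity>\<close>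
  go to the necks at 1 and -1, and the pole \<open>s = 1\<close> goes to infinity.\<close>

definition zeta :: "complex \<Rightarrow> complex" where "zeta s = (1 + s) / (1 - s)"

lemma half_cayley_zeta: "half_cayley s = - zeta s / 2"
proof (cases "s = 1")
  case False
  then have "s - 1 \<noteq> 0" "1 - s \<noteq> 0" by auto
  then show ?thesis unfolding half_cayley_def zeta_def by (simp add: divide_simps) (simp add: algebra_simps)?
qed (simp add: half_cayley_def zeta_def)

lemma zeta_inverse: "s \<noteq> 0 \<Longrightarrow> zeta (1 / s) = - zeta s"
proof (cases "s = 1")
  case False
  assume "s \<noteq> 0"
  with False have "s - 1 \<noteq> 0" "1 - s \<noteq> 0" "1 - 1 / s \<noteq> 0" by auto
  then show ?thesis using \<open>s \<noteq> 0\<close> unfolding zeta_def by (simp add: divide_simps) (simp add: algebra_simps)?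
qed (simp add: zeta_def)

lemma zeta_eq: "s \<noteq> 1 \<Longrightarrow> zeta s = - 1 + 2 / (1 - s)"
  by (simp add: zeta_def field_simps)

lemma zeta_diff:
  assumes "s \<noteq> 1" "t \<noteq> 1" shows "s - t = (zeta s - zeta t) * (1 - s) * (1 - t) / 2"
proof -
  have n: "1 - s \<noteq> 0" "1 - t \<noteq> 0" using assms by auto
  have "zeta s - zeta t = 2 / (1 - s) - 2 / (1 - t)" using assms by (simp add: zeta_eq)
  also have "\<dots> = 2 * (s - t) / ((1 - s) * (1 - t))" using n by (simp add: diff_frac_eq algebra_simps)
  finally show ?thesis using n by simp
qed

lemma zeta_inj: "s \<noteq> 1 \<Longrightarrow> t \<noteq> 1 \<Longrightarrow> zeta s = zeta t \<Longrightarrow> s = t"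
  using zeta_diff[of s t] by simp

section \<open>Estimates on one sheet\<close>

context neck_stack
begin

text \<open>One period together with both boundary waists, the circles of radius \<open>q\<close>
  and \<open>1 / q\<close>; 1 is the only pole in this annulus.\<close>

definition sheet :: "complex set" where "sheet = {s. q \<le> norm s \<and> norm s \<le> 1 / q \<and> s \<noteq> 1}"

lemma eps_q: "eps * (1 / q) = q" "eps < q" "eps\<^sup>2 * (1 / q) \<le> q / 10 ^ 12" "eps\<^sup>2 \<le> eps"
proof -
  show 1: "eps * (1 / q) = q" using q_pos by (simp add: eps_def power2_eq_square)
  show "eps < q" using eps(8) q_pos by simp
  show "eps\<^sup>2 \<le> eps" using square_le_quarter[OF eps(1,2)] by simp
  have "eps\<^sup>2 * (1 / q) = eps * (eps * (1 / q))" by (simp add: power2_eq_square)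
  also have "\<dots> = eps * q" using 1 by simp
  also have "\<dots> \<le> eps * 1" using q1 eps by (intro mult_left_mono) auto
  finally show "eps\<^sup>2 * (1 / q) \<le> q / 10 ^ 12" using eps(8) by linarith
qed

lemma sheetD:
  assumes "s \<in> sheet"
  shows "s \<noteq> 0" "s \<noteq> 1" "s \<in> Dom eps" "s \<in> Dom1 eps" "s \<in> Dom1 (eps\<^sup>2)" "norm s \<le> 1 / q" "norm (1 / s) \<le> 1 / q" "q \<le> norm s"
proof -
  have n: "q \<le> norm s" "norm s \<le> 1 / q" "s \<noteq> 1" using assms by (auto simp: sheet_def)
  show "norm s \<le> 1 / q" "s \<noteq> 1" "q \<le> norm s" using n by auto
  show s0: "s \<noteq> 0" using n q_pos by auto
  show "norm (1 / s) \<le> 1 / q" using n q_pos by (simp add: norm_divide frac_le)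
  have "1 / q < 1 / eps" using eps_q(2) eps(1) by (intro divide_strict_left_mono) auto
  then show D: "s \<in> Dom1 eps" using n eps_q(2) eps(1,3) by (intro annulus_Dom1) auto
  then show "s \<in> Dom eps" using Dom_eq[OF eps(1)] n by auto
  have "1 / eps \<le> 1 / eps\<^sup>2" using eps_q(4) eps by (simp add: frac_le)
  then show "s \<in> Dom1 (eps\<^sup>2)" using n eps_q eps \<open>1 / q < 1 / eps\<close> by (intro annulus_Dom1) linarith+
qed

lemma sheet_reflect: "s \<in> sheet \<Longrightarrow> 1 / cnj s \<in> sheet"
proof -
  assume s: "s \<in> sheet"
  have "1 / cnj s \<noteq> 1"
  proof
    assume "1 / cnj s = 1"
    then have "cnj s = 1" by (metis div_by_1 divide_divide_eq_right mult_1 one_eq_divide_iff)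
    then show False using sheetD(2)[OF s] complex_cnj_one_iff by blast
  qed
  moreover have "norm (1 / cnj s) = 1 / norm s" by (simp add: norm_divide)
  moreover have "q \<le> 1 / norm s"
    using sheetD(6)[OF s] sheetD(1)[OF s] q_pos by (simp add: field_simps)
  ultimately show ?thesis using sheetD(7)[OF s] by (simp add: sheet_def norm_divide)
qed

lemma q_le_inverse_eps: "1 / q \<le> 1 / (16 * eps)" "1 / q \<le> 1 / (4 * eps)" "1 / q \<le> 1 / (2 * eps)"
  "1 / q \<le> 1 / (16 * eps\<^sup>2)" "1 / q \<le> 1 / (4 * eps\<^sup>2)" "1 / q \<le> 1 / (2 * eps\<^sup>2)"
proof -
  have a: "16 * eps \<le> q" using eps(8) q_pos by simp
  show "1 / q \<le> 1 / (16 * eps)" "1 / q \<le> 1 / (4 * eps)" "1 / q \<le> 1 / (2 * eps)"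
    using a eps(1) by (intro divide_left_mono; simp)+
  show "1 / q \<le> 1 / (16 * eps\<^sup>2)" "1 / q \<le> 1 / (4 * eps\<^sup>2)" "1 / q \<le> 1 / (2 * eps\<^sup>2)"
  proof -
    have g: "1 / q \<le> 1 / d" if "0 < d" "d \<le> q" for d using that by (intro frac_le) auto
    have "16 * eps\<^sup>2 \<le> q" "4 * eps\<^sup>2 \<le> q" "2 * eps\<^sup>2 \<le> q" using a eps(1) eps_q(4) by linarith+
    note * = g[OF _ this(1)] g[OF _ this(2)] g[OF _ this(3)]
    show "1 / q \<le> 1 / (16 * eps\<^sup>2)" "1 / q \<le> 1 / (4 * eps\<^sup>2)" "1 / q \<le> 1 / (2 * eps\<^sup>2)"
      by (rule *, use eps(5) in linarith)+
  qed
qed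

text \<open>On a sheet \<open>s\<close> and \<open>1 / s\<close> have modulus at most
  \<open>1 / q\<close>, and \<open>eps / q = q\<close>; hence errors of order
  \<open>q\<close>.\<close>

lemma Yreg_bounds:
  assumes "s \<in> sheet" shows "norm (Yreg eps s) \<le> 6 * q" "norm (Yreg (eps\<^sup>2) s) \<le> q / 10"
proof -
  note n = sheetD(6,7)[OF assms]
  have l: "norm (lambert eps t) \<le> 3 * q" if "norm t \<le> 1 / q" for t
  proof -
    have "norm (lambert eps t) \<le> 3 * eps * norm t" using that q_le_inverse_eps by (intro norm_lambert_le eps) linarith
    also have "\<dots> \<le> 3 * eps * (1 / q)" using that eps by (intro mult_left_mono) auto
    finally show ?thesis using eps_q(1) by simp
  qed
  have l2: "norm (lambert (eps\<^sup>2) t) \<le> 3 * (q / 10 ^ 12)" if "norm t \<le> 1 / q" for t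
  proof -
    have "norm (lambert (eps\<^sup>2) t) \<le> 3 * eps\<^sup>2 * norm t" using that q_le_inverse_eps by (intro norm_lambert_le eps) linarith
    also have "\<dots> \<le> 3 * eps\<^sup>2 * (1 / q)" using that eps by (intro mult_left_mono) auto
    finally show ?thesis using eps_q(3) by simp
  qed
  have "norm (Yreg eps s) \<le> norm (lambert eps (1 / s)) + norm (lambert eps s)"
    unfolding Yreg_def by (rule norm_triangle_ineq4)
  then show "norm (Yreg eps s) \<le> 6 * q" using l[OF n(1)] l[OF n(2)] by linarith
  have "norm (Yreg (eps\<^sup>2) s) \<le> norm (lambert (eps\<^sup>2) (1 / s)) + norm (lambert (eps\<^sup>2) s)"
    unfolding Yreg_def by (rule norm_triangle_ineq4)
  then show "norm (Yreg (eps\<^sup>2) s) \<le> q / 10" using l2[OF n(1)] l2[OF n(2)] q_pos by simp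
qed

lemma x1_eq: "x1 s = Re (zeta s) + 2 * Re (Yreg eps s - 2 * Yreg (eps\<^sup>2) s)"
  unfolding x1_def W_def Y_def half_cayley_zeta by (simp add: algebra_simps)

lemma x2_eq: "x2 s = b / 2 * (Im (zeta s) - 2 * Im (Yreg eps s))"
  unfolding x2_def Y_def half_cayley_zeta by (simp add: algebra_simps)

lemma x1_approx:
  assumes "s \<in> sheet" shows "\<bar>x1 s - Re (zeta s)\<bar> \<le> 13 * q"
proof -
  have "\<bar>Re (Yreg eps s)\<bar> \<le> 6 * q" "\<bar>Re (Yreg (eps\<^sup>2) s)\<bar> \<le> q / 10"
    using Yreg_bounds[OF assms] abs_Re_le_cmod order_trans by blast+
  then show ?thesis unfolding x1_eq using q_pos by simp
qed

lemma Im_Yreg: "s \<in> sheet \<Longrightarrow> \<bar>Im (Yreg eps s)\<bar> \<le> 6 * q"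
  using Yreg_bounds(1) abs_Im_le_cmod order_trans by blast

text \<open>The factor \<open>b / 2\<close> differs from 1 by order \<open>q\<^sup>2\<close>, which
  produces an error growing with \<open>zeta s\<close>.\<close>

lemma x2_approx:
  assumes "s \<in> sheet" shows "\<bar>x2 s - Im (zeta s)\<bar> \<le> 13 * q + 3 * q\<^sup>2 * norm (zeta s)"
proof -
  have b: "0 \<le> b / 2 - 1" "b / 2 - 1 \<le> 5 / 2 * q\<^sup>2" using constants by auto
  have qq: "q\<^sup>2 \<le> q / 10 ^ 12" using eps(8) by (simp add: eps_def)
  have "x2 s - Im (zeta s) = (b / 2 - 1) * Im (zeta s) - b * Im (Yreg eps s)"
    by (simp add: x2_eq algebra_simps)
  moreover have "\<bar>(b / 2 - 1) * Im (zeta s)\<bar> \<le> 5 / 2 * q\<^sup>2 * norm (zeta s)"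
    unfolding abs_mult using b abs_Im_le_cmod[of "zeta s"] by (intro mult_mono) auto
  moreover have "\<bar>b * Im (Yreg eps s)\<bar> \<le> (2 + 5 * q\<^sup>2) * (6 * q)"
    unfolding abs_mult using constants Im_Yreg[OF assms] by (intro mult_mono) auto
  moreover have "(2 + 5 * q\<^sup>2) * (6 * q) \<le> 13 * q"
    using qq q_small q_pos mult_right_mono[of "2 + 5 * q\<^sup>2" "13 / 6" "6 * q"] by simp
  moreover have "5 / 2 * q\<^sup>2 * norm (zeta s) \<le> 3 * q\<^sup>2 * norm (zeta s)" by (intro mult_right_mono) auto
  ultimately show ?thesis by linarith
qed

text \<open>An a priori bound without the growing error of \<open>x2_approx\<close>: since
  \<open>b \<ge> 2\<close>, the factor \<open>b / 2\<close> can only enlarge the second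
  coordinate.\<close>

lemma zeta_bound:
  assumes "s \<in> sheet" shows "norm (zeta s) \<le> \<bar>x1 s\<bar> + \<bar>x2 s\<bar> + 30 * q"
proof -
  have "\<bar>Im (zeta s) - 2 * Im (Yreg eps s)\<bar> \<le> \<bar>x2 s\<bar>"
  proof -
    have "1 * \<bar>Im (zeta s) - 2 * Im (Yreg eps s)\<bar> \<le> b / 2 * \<bar>Im (zeta s) - 2 * Im (Yreg eps s)\<bar>"
      using constants by (intro mult_right_mono) auto
    then show ?thesis unfolding x2_eq abs_mult using constants by simp
  qed
  then have "\<bar>Im (zeta s)\<bar> \<le> \<bar>x2 s\<bar> + 12 * q" using Im_Yreg[OF assms] by linarith
  then show ?thesis using x1_approx[OF assms] cmod_le[of "zeta s"] q_pos by linarith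
qed

lemma zeta_dist:
  assumes "s \<in> sheet" "t \<in> sheet" "x1 s = x1 t" "x2 s = x2 t"
  shows "norm (zeta s - zeta t) \<le> 50 * q"
proof -
  have "Im (zeta s) - 2 * Im (Yreg eps s) = Im (zeta t) - 2 * Im (Yreg eps t)"
    using assms(4) constants unfolding x2_eq by simp
  then have "\<bar>Im (zeta s - zeta t)\<bar> \<le> 24 * q" using Im_Yreg[OF assms(1)] Im_Yreg[OF assms(2)] by simp
  moreover have "\<bar>Re (zeta s - zeta t)\<bar> \<le> 26 * q"
    using x1_approx[OF assms(1)] x1_approx[OF assms(2)] assms(3) by simp
  ultimately show ?thesis using cmod_le[of "zeta s - zeta t"] by linarith
qed

lemma Sreg_bounds:
  assumes "s \<in> sheet" shows "norm (Sreg eps s) \<le> 18 * q" "norm (Sreg (eps\<^sup>2) s) \<le> 18 * q\<^sup>2 "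
proof -
  have gen: "norm (Sreg d s) \<le> 18 * d * (1 / q)" if d: "0 < d" "d \<le> 1 / 4" "s \<in> Dom1 d" "1 / q \<le> 1 / (4 * d)" for d
  proof -
    note n = sheetD(6,7)[OF assms]
    have l: "norm (deriv (lambert d) t) \<le> 9 * d" if "norm t \<le> 1 / q" for t
      using that d by (intro norm_deriv_lambert_le) linarith+
    have "norm (Sreg d s) \<le> norm (1 / s) * norm (deriv (lambert d) (1 / s)) + norm s * norm (deriv (lambert d) s)"
      unfolding Sreg_eq[OF d(1-3)]
      by (rule order_trans[OF norm_triangle_ineq]) (simp add: norm_mult norm_divide)
    also have "\<dots> \<le> (1 / q) * (9 * d) + (1 / q) * (9 * d)"
      using n l[OF n(1)] l[OF n(2)] q_pos by (intro add_mono mult_mono) auto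
    finally show ?thesis by (simp add: algebra_simps)
  qed
  show "norm (Sreg eps s) \<le> 18 * q"
    using gen[OF eps(1,2) sheetD(4)[OF assms] q_le_inverse_eps(2)] eps_q(1) by (simp add: mult.assoc)
  have "eps\<^sup>2 * (1 / q) = eps * (eps * (1 / q))" by (simp add: power2_eq_square)
  also have "\<dots> = eps * q" unfolding eps_q(1) ..
  also have "\<dots> \<le> q\<^sup>2" using q1 q_pos by (simp add: eps_def mult_left_le)
  finally show "norm (Sreg (eps\<^sup>2) s) \<le> 18 * q\<^sup>2"
    using gen[OF eps(5,6) sheetD(5)[OF assms] q_le_inverse_eps(5)] by (simp add: mult.assoc)
qed

text \<open>Beyond radius 100 the function \<open>koebe\<close> is about 1/100 or less, and the
  regular part is of order \<open>q\<close>. As \<open>S eps\<close> is minus the derivative of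
  \<open>Y\<close> in \<open>ln s\<close>, this gives the Lipschitz constant of
  \<open>Y_log_lipschitz\<close>.\<close>

lemma S_bound:
  assumes "100 \<le> norm s" "norm s \<le> 1 / q"
  shows "s \<in> sheet" "norm (S eps s) \<le> 1 / 50"
proof -
  show s: "s \<in> sheet" using assms q1 by (auto simp: sheet_def)
  have n: "99 / 100 * norm s \<le> norm (s - 1)" using norm_triangle_ineq2[of s 1] assms by simp
  have "norm (koebe s) = norm s / (norm (s - 1))\<^sup>2" by (simp add: koebe_def norm_divide norm_power)
  also have "\<dots> \<le> norm s / (99 / 100 * norm s)\<^sup>2"
  proof (rule divide_left_mono)
    show "(99 / 100 * norm s)\<^sup>2 \<le> (norm (s - 1))\<^sup>2" using n by (intro power_mono) auto
    have "s \<noteq> 1" "norm s > 0" using assms(1) by auto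
    then show "0 < (norm (s - 1))\<^sup>2 * (99 / 100 * norm s)\<^sup>2" by simp
  qed simp
  also have "\<dots> = (100 / 99)\<^sup>2 / norm s" using assms by (simp add: power2_eq_square)
  also have "\<dots> \<le> (100 / 99)\<^sup>2 / 100" using assms(1) by (intro divide_left_mono) auto
  finally have "norm (koebe s) \<le> (100 / 99)\<^sup>2 / 100" .
  moreover have "norm (S eps s) \<le> norm (koebe s) + norm (Sreg eps s)"
    unfolding S_eq_Sreg[OF eps(1,2) sheetD(3)[OF s]] by (rule norm_triangle_ineq)
  moreover have "18 * q \<le> 1 / 1000" using q_small by simp
  moreover have "(100 / 99)\<^sup>2 / 100 \<le> (15 / 1000 :: real)" by (simp add: power2_eq_square)
  ultimately show "norm (S eps s) \<le> 1 / 50" using Sreg_bounds(1)[OF s] by linarith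
qed

lemma Y_log_lipschitz:
  assumes "\<alpha> = ln 100" "\<beta> = ln (1 / q)" "\<alpha> \<le> Re u" "Re u \<le> \<beta>" "\<alpha> \<le> Re v" "Re v \<le> \<beta>"
  shows "norm (Y eps (exp u) - Y eps (exp v)) \<le> 1 / 50 * norm (u - v)"
proof (rule field_differentiable_bound[where S = "{u. Re u \<in> {\<alpha>..\<beta>}}" and f' = "\<lambda>u. - S eps (exp u)"])
  have "{u. Re u \<in> {\<alpha>..\<beta>}} = Re -` {\<alpha>..\<beta>}" by auto
  moreover have "convex (Re -` {\<alpha>..\<beta>})" by (intro convex_linear_vimage linearI) auto
  ultimately show "convex {u. Re u \<in> {\<alpha>..\<beta>}}" by simp
next
  fix w assume w: "w \<in> {u. Re u \<in> {\<alpha>..\<beta>}}"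
  have "exp \<alpha> \<le> norm (exp w)" "norm (exp w) \<le> exp \<beta>" using w by auto
  then have n: "100 \<le> norm (exp w)" "norm (exp w) \<le> 1 / q" using assms(1,2) q_pos by auto
  note b = S_bound[OF n]
  have "((\<lambda>w. Y eps (exp w)) has_field_derivative (- S eps (exp w) / exp w) * exp w) (at w)"
    using Y_deriv[OF eps(1,2) sheetD(3)[OF b(1)]] by (rule DERIV_chain2) (rule DERIV_exp)
  then show "((\<lambda>w. Y eps (exp w)) has_field_derivative - S eps (exp w)) (at w within {u. Re u \<in> {\<alpha>..\<beta>}})"
    by (simp add: has_field_derivative_at_within)
  show "norm (- S eps (exp w)) \<le> 1 / 50" using b by simp
qed (use assms in auto)

text \<open>On this circle \<open>cnj s = (1 / s) / eps\<close>, so conjugation, oddness and the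
  shift law combine to \<open>cnj Y = 1 - Y\<close>.\<close>

lemma Re_Y_top:
  assumes "norm s = 1 / q" shows "Re (Y eps s) = 1 / 2"
proof -
  have "q \<le> 1 / q" using q1 by linarith
  then have s: "s \<in> sheet" using assms q1(2) unfolding sheet_def by (metis (mono_tags, lifting) mem_Collect_eq norm_one order_less_irrefl order_refl)
  note D = sheetD[OF s]
  have "s * cnj s = of_real (1 / eps)"
    unfolding complex_norm_square[symmetric] assms by (simp add: eps_def power_divide)
  moreover have "cnj s = (s * cnj s) / s" using D(1) by simp
  ultimately have "cnj s = (1 / s) / of_real eps" by simp
  then have "cnj (Y eps s) = Y eps (1 / s) + 1"
    using Y_cnj[OF eps(1,3), of s] Y_divide[OF eps(1,3) Dom_inverse[OF D(3)]] by simp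
  also have "\<dots> = 1 - Y eps s" using Y_inverse D(1,2) by simp
  finally have "Re (cnj (Y eps s)) = Re (1 - Y eps s)" by simp
  then show ?thesis by simp
qed

text \<open>A whole waist lies in one horizontal plane, halfway between two levels. This is what
  later lets the height separate the levels.\<close>

lemma x3_top: "norm s = 1 / q \<Longrightarrow> x3 s = h / 2"
  by (simp add: x3_def Re_Y_top h_def algebra_simps)

lemma ln_100: "ln (100 :: real) \<le> 5"
proof -
  have "(1 + 1 / 16) ^ 16 \<le> exp (1 / 16 :: real) ^ 16"
    by (intro power_mono) (use exp_ge_add_one_self[of "1 / 16 :: real"] in auto)
  moreover have "exp (1 / 16 :: real) ^ 16 = exp 1" by (simp flip: exp_of_nat_mult)
  ultimately have "(2.6 :: real) \<le> exp 1" by (simp add: field_simps)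
  then have "2.6 ^ 5 \<le> exp (1 :: real) ^ 5" by (intro power_mono) auto
  also have "exp (1 :: real) ^ 5 = exp 5" by (simp flip: exp_of_nat_mult)
  finally have "(100 :: real) \<le> exp 5" by (simp add: field_simps)
  then have "ln (100 :: real) \<le> ln (exp 5)" by (subst ln_le_cancel_iff) auto
  then show ?thesis by simp
qed

lemma B_c0: "B * x \<le> 11 / 10 * c0 * x" if "0 \<le> x"
  using constants(5) that by (rule mult_right_mono)

lemma c0_pos: "0 < c0" using constants(1) q_pos by linarith

lemma h_pos: "0 < h" "h \<le> 10 * q * ln (1 / q)"
proof -
  have "B \<le> 11 / 10 * c0" "c0 \<le> 41 / 10 * q" "0 < B" using constants by auto
  moreover have "c0 * 100 \<le> c0 * ln (1 / q)" using ln_q c0_pos by (intro mult_left_mono) auto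
  moreover have "c0 * ln (1 / q) \<le> 41 / 10 * q * ln (1 / q)"
    using mult_right_mono[OF constants(2), of "ln (1 / q)"] ln_q by simp
  moreover have "0 \<le> q * ln (1 / q)" by (rule mult_nonneg_nonneg) (use q_pos ln_q in linarith)+
  ultimately show "0 < h" "h \<le> 10 * q * ln (1 / q)" unfolding h_def using c0_pos by linarith+
qed

text \<open>For \<open>100 \<le> norm s\<close> the logarithm grows towards the waist faster than
  \<open>B * Re Y\<close> can change, by the Lipschitz bound. For smaller \<open>norm s\<close> the
  logarithm is negligible, and the bound on \<open>zeta s\<close> keeps the tilt below the height of
  the waist.\<close>

lemma x3_less_top:
  assumes s: "s \<in> sheet" "norm s < 1 / q" "norm (zeta s) \<le> ln (1 / q) - 10"
  shows "x3 s < h / 2"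
proof (cases "100 \<le> norm s")
  case True
  define D where "D = ln (1 / q) - ln (norm s)"
  have n: "norm s > 0" using True by linarith
  have "ln (norm s) < ln (1 / q)" by (subst ln_less_cancel_iff) (use n s(2) q_pos in auto)
  then have D: "0 < D" by (simp add: D_def)
  \<comment> \<open>The point of the upper waist on the ray through \<open>s\<close>.\<close>
  define s' where "s' = exp (Ln s + of_real D)"
  have s0: "s \<noteq> 0" using n by auto
  have "norm s' = norm s * exp D" using s0 by (simp add: s'_def exp_add norm_mult)
  also have "exp D = (1 / q) / norm s" using n q_pos by (simp add: D_def exp_diff)
  finally have ns': "norm s' = 1 / q" using n by simp
  have "norm (Y eps (exp (Ln s + of_real D)) - Y eps (exp (Ln s))) \<le> 1 / 50 * norm (Ln s + of_real D - Ln s)"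
  proof (rule Y_log_lipschitz[OF refl refl])
    have "ln 100 \<le> ln (norm s)" by (subst ln_le_cancel_iff) (use True n in auto)
    moreover have "Re (Ln s) = ln (norm s)" "Re (Ln s + of_real D) = ln (1 / q)" using s0 by (simp_all add: D_def)
    ultimately show "ln 100 \<le> Re (Ln s + of_real D)" "Re (Ln s + of_real D) \<le> ln (1 / q)"
      "ln 100 \<le> Re (Ln s)" "Re (Ln s) \<le> ln (1 / q)"
      using \<open>ln (norm s) < ln (1 / q)\<close> by linarith+
  qed
  then have "norm (Y eps s' - Y eps s) \<le> D / 50" using s0 D by (simp add: s'_def)
  then have "\<bar>Re (Y eps s' - Y eps s)\<bar> \<le> D / 50" using abs_Re_le_cmod order_trans by blast
  moreover have "Re (Y eps s' - Y eps s) = 1 / 2 - Re (Y eps s)" using Re_Y_top[OF ns'] by simp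
  ultimately have "1 / 2 - D / 50 \<le> Re (Y eps s)" by linarith
  then have "B * (1 / 2 - D / 50) \<le> B * Re (Y eps s)" using constants(3) by (intro mult_left_mono) auto
  moreover have "B * (D / 50) \<le> 11 / 10 * c0 * (D / 50)" using D by (intro B_c0) auto
  moreover have "0 < c0 * D" using c0_pos D by simp
  moreover have "x3 s = c0 * ln (1 / q) - c0 * D - B * Re (Y eps s)" by (simp add: x3_def D_def algebra_simps)
  ultimately show ?thesis by (simp add: h_def algebra_simps)
next
  case False
  have "norm s > 0" using sheetD(1)[OF s(1)] by simp
  then have "ln (norm s) \<le> ln 100" using False by (subst ln_le_cancel_iff) auto
  then have 1: "c0 * ln (norm s) \<le> c0 * 5" using ln_100 c0_pos by (intro mult_left_mono) auto
  have "\<bar>Re (Yreg eps s)\<bar> \<le> 6 * q" using Yreg_bounds(1)[OF s(1)] abs_Re_le_cmod order_trans by blast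
  moreover have "\<bar>Re (half_cayley s)\<bar> \<le> norm (zeta s) / 2"
    using abs_Re_le_cmod[of "zeta s"] by (simp add: half_cayley_zeta)
  moreover have "6 * q \<le> 1" using q_small by simp
  ultimately have "- Re (Y eps s) \<le> ln (1 / q) / 2 - 4" using s(3) unfolding Y_def by simp
  then have "B * (- Re (Y eps s)) \<le> B * (ln (1 / q) / 2 - 4)" using constants(3) by (intro mult_left_mono) auto
  moreover have "B * (ln (1 / q) / 2 - 7 / 2) \<le> 11 / 10 * c0 * (ln (1 / q) / 2 - 7 / 2)" using ln_q by (intro B_c0) auto
  moreover have "c0 * 100 \<le> c0 * ln (1 / q)" using ln_q c0_pos by (intro mult_left_mono) auto
  ultimately have "x3 s \<le> c0 * 5 + 11 / 10 * c0 * (ln (1 / q) / 2 - 7 / 2) - B / 2"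
    using 1 by (simp add: x3_def algebra_simps)
  \<comment> \<open>The tilt uses only 11/20 of \<open>c0 * ln (1 / q)\<close>; as
    \<open>ln (1 / q) \<ge> 100\<close>, the rest absorbs the multiples of
    \<open>c0\<close>.\<close>
  also have "\<dots> < c0 * ln (1 / q) - B / 2"
  proof -
    have "11 / 10 * c0 * (ln (1 / q) / 2 - 7 / 2) = 11 / 20 * (c0 * ln (1 / q)) - 77 / 20 * c0"
      by (simp add: algebra_simps)
    then show ?thesis using \<open>c0 * 100 \<le> c0 * ln (1 / q)\<close> c0_pos by linarith
  qed
  finally show ?thesis by (simp add: h_def)
qed

lemma zeta_reflect: "s \<noteq> 0 \<Longrightarrow> norm (zeta (1 / cnj s)) = norm (zeta s)"
proof -
  assume "s \<noteq> 0"
  then have "zeta (1 / cnj s) = - cnj (zeta s)" using zeta_inverse[of "cnj s"] by (simp add: zeta_def)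
  then show ?thesis by simp
qed

lemma x3_greater_bottom:
  assumes s: "s \<in> sheet" "q < norm s" "norm (zeta s) \<le> ln (1 / q) - 10"
  shows "- h / 2 < x3 s"
proof -
  have s0: "s \<noteq> 0" using sheetD(1)[OF s(1)] .
  have "norm (1 / cnj s) < 1 / q" using s(2) q_pos by (auto simp: norm_divide intro!: divide_strict_left_mono mult_pos_pos)
  then have "x3 (1 / cnj s) < h / 2"
    by (intro x3_less_top sheet_reflect s) (simp_all add: zeta_reflect[OF s0] s)
  then show ?thesis using X_reflect(4)[OF sheetD(3)[OF s(1)]] by simp
qed

lemma x3_bottom: "norm s = q \<Longrightarrow> x3 s = - h / 2"
proof -
  assume n: "norm s = q"
  moreover have "q \<le> 1 / q" using q1 by linarith
  ultimately have "s \<in> sheet" using q1(1) unfolding sheet_def by force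
  moreover have "norm (1 / cnj s) = 1 / q" using n by (simp add: norm_divide)
  ultimately show ?thesis using x3_top[of "1 / cnj s"] X_reflect(4)[OF sheetD(3)] by simp
qed

lemma x3_range:
  assumes "s \<in> sheet" "norm (zeta s) \<le> ln (1 / q) - 10" shows "- h / 2 \<le> x3 s" "x3 s \<le> h / 2"
proof -
  show "x3 s \<le> h / 2"
    using x3_less_top[OF assms(1) _ assms(2)] x3_top[of s] sheetD(6)[OF assms(1)] by (cases "norm s = 1 / q") auto
  show "- h / 2 \<le> x3 s"
    using x3_greater_bottom[OF assms(1) _ assms(2)] x3_bottom[of s] sheetD(8)[OF assms(1)] by (cases "norm s = q") auto
qed

text \<open>The part of a sheet away from both waists, where the horizontal projection alone
  separates points.\<close>

definition mid :: "complex set" where "mid = {s. norm s \<le> 1 / (20 * q) \<and> norm (1 / s) \<le> 1 / (20 * q) \<and> s \<noteq> 0 \<and> s \<noteq> 1}"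

lemma mid_sheet: "s \<in> mid \<Longrightarrow> s \<in> sheet"
proof -
  assume s: "s \<in> mid"
  have "1 / (20 * q) \<le> 1 / q" using q_pos by (simp add: frac_le)
  moreover have "q \<le> norm s"
  proof -
    have "1 / norm s \<le> 1 / q" using s \<open>1 / (20 * q) \<le> 1 / q\<close> by (simp add: mid_def norm_divide)
    then show ?thesis using s q_pos by (simp add: mid_def frac_le field_simps)
  qed
  ultimately show ?thesis using s by (auto simp: mid_def sheet_def)
qed

lemma lambert_lipschitz:
  assumes "0 < d" "d \<le> 1 / 4" "norm s \<le> 1 / (4 * d)" "norm t \<le> 1 / (4 * d)"
  shows "norm (lambert d s - lambert d t) \<le> 9 * d * norm (s - t)"
proof (rule field_differentiable_bound[where S = "cball 0 (1 / (4 * d))" and f' = "deriv (lambert d)"])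
  fix z :: complex assume z: "z \<in> cball 0 (1 / (4 * d))"
  have "1 / (4 * d) < 1 / (2 * d)" using assms by (simp add: field_simps)
  then have "z \<in> ball 0 (1 / (2 * d))" using z by simp
  then show "(lambert d has_field_derivative deriv (lambert d) z) (at z within cball 0 (1 / (4 * d)))"
    using holomorphic_derivI[OF lambert_holomorphic_ball[OF assms(1,2)] open_ball] has_field_derivative_at_within by blast
  show "norm (deriv (lambert d) z) \<le> 9 * d" using z by (intro norm_deriv_lambert_le assms) auto
qed (use assms in auto)

text \<open>The projection is \<open>zeta\<close> plus a perturbation whose Lipschitz constant,
  measured in terms of \<open>zeta\<close>, is small. Equal projections give
  \<open>norm \<Delta> \<le> 8 / 40 * norm \<Delta>\<close>, so \<open>\<Delta> = 0\<close>.\<close>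

lemma mid_proj_inj:
  assumes s: "s \<in> mid" and t: "t \<in> mid" and eq: "x1 s = x1 t" "x2 s = x2 t"
  shows "s = t"
proof -
  define \<Delta> where "\<Delta> = zeta s - zeta t"
  have sD: "s \<noteq> 0" "s \<noteq> 1" "t \<noteq> 0" "t \<noteq> 1" using s t by (auto simp: mid_def)
  have q20: "1 / (20 * q) + 1 \<le> 1 / (19 * q)"
  proof -
    have "1 \<le> (1 / 19 - 1 / 20) * (1 / q)"
    proof -
      have "10 ^ 12 \<le> 1 / q" using q_small q_pos by (simp add: field_simps)
      then show ?thesis by simp
    qed
    then show ?thesis by simp
  qed
  \<comment> \<open>By \<open>zeta_diff\<close>, with \<open>1 - s\<close> and \<open>1 - t\<close>
    at most \<open>1 / (19 * q)\<close> in modulus; \<open>722\<close> is twice the square of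
    19.\<close>
  have diff: "norm (s - t) \<le> norm \<Delta> / (722 * q\<^sup>2)"
    if "norm s \<le> 1 / (20 * q)" "norm t \<le> 1 / (20 * q)" "s \<noteq> 1" "t \<noteq> 1" "norm (zeta s - zeta t) = norm \<Delta>" for s t
  proof -
    have a: "norm (1 - s) \<le> 1 / (19 * q)" "norm (1 - t) \<le> 1 / (19 * q)"
      using norm_triangle_ineq4[of 1 s] norm_triangle_ineq4[of 1 t] that q20 by simp_all
    have "norm (s - t) = norm \<Delta> * norm (1 - s) * norm (1 - t) / 2"
      unfolding that(5)[symmetric] by (subst zeta_diff[OF that(3,4)]) (simp add: norm_mult norm_divide)
    also have "\<dots> \<le> norm \<Delta> * (1 / (19 * q)) * (1 / (19 * q)) / 2"
      using a q_pos by (intro divide_right_mono mult_mono) auto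
    finally show ?thesis by (simp add: power2_eq_square)
  qed
  have d1: "norm (s - t) \<le> norm \<Delta> / (722 * q\<^sup>2)"
    by (rule diff) (use s t in \<open>auto simp: mid_def \<Delta>_def\<close>)
  have d2: "norm (1 / s - 1 / t) \<le> norm \<Delta> / (722 * q\<^sup>2)"
  proof (rule diff)
    have "zeta (1 / s) - zeta (1 / t) = - \<Delta>" using sD by (simp add: zeta_inverse \<Delta>_def)
    then show "norm (zeta (1 / s) - zeta (1 / t)) = norm \<Delta>" by simp
  qed (use s t in \<open>auto simp: mid_def\<close>)
  \<comment> \<open>The Lipschitz constant \<open>9 * d \<le> 9 * q\<^sup>2\<close> of the series
    cancels the \<open>q\<^sup>2\<close> in \<open>d1\<close> and \<open>d2\<close>; the two series
    together give 18/722, less than 1/40.\<close>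
  have Yd: "norm (Yreg d s - Yreg d t) \<le> norm \<Delta> / 40" if d: "0 < d" "d \<le> 1 / 4" "1 / q \<le> 1 / (4 * d)" "d \<le> eps" for d
  proof -
    have n: "norm s \<le> 1 / (4 * d)" "norm t \<le> 1 / (4 * d)" "norm (1 / s) \<le> 1 / (4 * d)" "norm (1 / t) \<le> 1 / (4 * d)"
      using sheetD(6,7)[OF mid_sheet[OF s]] sheetD(6,7)[OF mid_sheet[OF t]] d(3) by linarith+
    have "norm (Yreg d s - Yreg d t) \<le> norm (lambert d (1 / s) - lambert d (1 / t)) + norm (lambert d s - lambert d t)"
      unfolding Yreg_def using norm_triangle_ineq4[of "lambert d (1 / s) - lambert d (1 / t)" "lambert d s - lambert d t"]
      by (simp add: algebra_simps)
    also have "\<dots> \<le> 9 * d * norm (1 / s - 1 / t) + 9 * d * norm (s - t)"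
      using n d by (intro add_mono lambert_lipschitz) auto
    also have "\<dots> \<le> 9 * eps * (norm \<Delta> / (722 * q\<^sup>2)) + 9 * eps * (norm \<Delta> / (722 * q\<^sup>2))"
      using d1 d2 d by (intro add_mono mult_mono) auto
    also have "\<dots> = 18 / 722 * norm \<Delta>" using q_pos by (simp add: eps_def)
    also have "\<dots> \<le> norm \<Delta> / 40" by simp
    finally show ?thesis .
  qed
  note Y1 = Yd[OF eps(1,2) q_le_inverse_eps(2) order_refl]
  note Y2 = Yd[OF eps(5,6) q_le_inverse_eps(5) eps_q(4)]
  have "Re \<Delta> = - 2 * Re (Yreg eps s - Yreg eps t) + 4 * Re (Yreg (eps\<^sup>2) s - Yreg (eps\<^sup>2) t)"
    using eq(1) by (simp add: x1_eq \<Delta>_def)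
  then have "\<bar>Re \<Delta>\<bar> \<le> 2 * (norm \<Delta> / 40) + 4 * (norm \<Delta> / 40)"
    using order_trans[OF abs_Re_le_cmod Y1] order_trans[OF abs_Re_le_cmod Y2] by linarith
  moreover have "Im \<Delta> = 2 * Im (Yreg eps s - Yreg eps t)" using eq(2) constants by (simp add: x2_eq \<Delta>_def)
  then have "\<bar>Im \<Delta>\<bar> \<le> 2 * (norm \<Delta> / 40)"
    using order_trans[OF abs_Im_le_cmod Y1] by linarith
  ultimately have "norm \<Delta> \<le> 8 / 40 * norm \<Delta>" using cmod_le[of \<Delta>] by linarith
  then have "\<Delta> = 0" by simp
  then show ?thesis using zeta_inj sD by (simp add: \<Delta>_def)
qed

end

section \<open>Injectivity on the necks\<close>

lemma abs_sin_half_ge: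
  assumes "\<bar>\<theta>\<bar> \<le> pi" shows "\<bar>\<theta>\<bar> / 6 \<le> \<bar>sin (\<theta> / 2)\<bar>"
proof -
  define x where "x = \<theta> / 2"
  have x: "\<bar>x\<bar> \<le> 2" using assms pi_less_4 by (simp add: x_def)
  have "\<bar>sin x - (\<Sum>m<3. sin_coeff m * x ^ m)\<bar> \<le> inverse (fact 3) * \<bar>x\<bar> ^ 3"
    by (rule Maclaurin_sin_bound)
  moreover have "(\<Sum>m<3. sin_coeff m * x ^ m) = x"
    by (simp add: numeral_3_eq_3 sin_coeff_def)
  moreover have "inverse (fact 3 :: real) = 1 / 6" by (simp add: numeral_3_eq_3)
  ultimately have "\<bar>sin x - x\<bar> \<le> \<bar>x\<bar> ^ 3 / 6" by (simp only: mult_1 times_divide_eq_left)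
  moreover have "\<bar>x\<bar> ^ 3 \<le> 4 * \<bar>x\<bar>"
  proof -
    have "\<bar>x\<bar> ^ 3 = (\<bar>x\<bar> * \<bar>x\<bar>) * \<bar>x\<bar>" by (simp add: power3_eq_cube)
    also have "\<dots> \<le> (2 * 2) * \<bar>x\<bar>" using x by (intro mult_right_mono mult_mono) auto
    finally show ?thesis by simp
  qed
  ultimately have "\<bar>x\<bar> / 3 \<le> \<bar>sin x\<bar>" by linarith
  then show ?thesis by (simp add: x_def)
qed

text \<open>Law of cosines in the form
  \<open>(r - r')\<^sup>2 + 4 * r * r' * (sin (\<theta> / 2))\<^sup>2\<close>: the angle alone
  forces a distance.\<close>

lemma dist_polar_ge:
  assumes "0 < c" "c \<le> r" "c \<le> r'"
  shows "2 * c * \<bar>sin (\<theta> / 2)\<bar> \<le> norm (of_real r - of_real r' * exp (\<i> * of_real \<theta>))"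
proof (rule power2_le_imp_le)
  have "(norm (of_real r - of_real r' * exp (\<i> * of_real \<theta>)))\<^sup>2 = (r - r' * cos \<theta>)\<^sup>2 + (r' * sin \<theta>)\<^sup>2"
    by (simp add: cmod_power2 Re_exp Im_exp)
  also have "\<dots> = (r - r')\<^sup>2 + 4 * (r * r') * (sin (\<theta> / 2))\<^sup>2"
  proof -
    have "cos \<theta> = 1 - 2 * (sin (\<theta> / 2))\<^sup>2" using cos_double_sin[of "\<theta> / 2"] by simp
    with sin_cos_squared_add[of \<theta>] show ?thesis by algebra
  qed
  finally have eq: "(norm (of_real r - of_real r' * exp (\<i> * of_real \<theta>)))\<^sup>2 = (r - r')\<^sup>2 + 4 * (r * r') * (sin (\<theta> / 2))\<^sup>2" .
  have "c * c \<le> r * r'" using assms by (intro mult_mono) auto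
  then have "4 * (c * c) * (sin (\<theta> / 2))\<^sup>2 \<le> 4 * (r * r') * (sin (\<theta> / 2))\<^sup>2" by (intro mult_right_mono) auto
  then show "(2 * c * \<bar>sin (\<theta> / 2)\<bar>)\<^sup>2 \<le> (norm (of_real r - of_real r' * exp (\<i> * of_real \<theta>)))\<^sup>2"
    unfolding eq by (simp add: power_mult_distrib power2_eq_square[of c] add_increasing)
qed simp

context neck_stack
begin

text \<open>The error of the neck model. For large \<open>s\<close>, \<open>zeta s\<close> is about
  \<open>-1 - 2 / s\<close> and \<open>Yreg eps s\<close> about \<open>- eps * s\<close>, so the
  projection is about -1 minus twice \<open>1 / s + eps * cnj s\<close>, the projection of a
  catenoid with waist \<open>norm s = 1 / q\<close>. The pairs \<open>2, -4\<close> and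
  \<open>-2, 0\<close> for \<open>c1, c2\<close> belong to the first and the second coordinate, see
  \<open>Re_err\<close> and \<open>Im_err\<close>.\<close>

definition err :: "real \<Rightarrow> real \<Rightarrow> complex \<Rightarrow> complex" where
  "err c1 c2 s = - 2 / (s * (s - 1)) + of_real c1 * (lambert eps (1 / s) - (lambert eps s - of_real eps * s))
     + of_real c2 * Yreg (eps\<^sup>2) s"

text \<open>The overlap with \<open>mid\<close>, a factor 20 in radius, is what
  \<open>sheet_inj\<close> uses to exclude mixed pairs.\<close>

definition upper_neck :: "complex set" where "upper_neck = {s. 1 / (400 * q) \<le> norm s \<and> norm s \<le> 1 / q}"

lemma upper_neckD:
  assumes "s \<in> upper_neck" shows "100 \<le> norm s" "s \<in> sheet" "1 / norm s \<le> 400 * q"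
proof -
  have "100 \<le> 1 / (400 * q)" using q_small q_pos by (simp add: field_simps)
  then show a: "100 \<le> norm s" using assms by (simp add: upper_neck_def)
  then show "s \<in> sheet" using S_bound(1) assms by (simp add: upper_neck_def)
  have "1 / norm s \<le> 1 / (1 / (400 * q))" using assms q_pos a by (intro frac_le) (auto simp: upper_neck_def)
  then show "1 / norm s \<le> 400 * q" by simp
qed

text \<open>\<open>s * D\<close> is the derivative in \<open>ln s\<close>. Its order
  \<open>q\<^sup>2\<close> is one better than the size \<open>q\<close> of the waist. The constant
  is dominated by the first term of \<open>err\<close>, where
  \<open>5 * (400 * q)\<^sup>2 = 800000 * q\<^sup>2\<close>.\<close>

lemma err_deriv:
  assumes s: "s \<in> upper_neck" and c: "\<bar>c1\<bar> \<le> 2" "\<bar>c2\<bar> \<le> 4"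
  shows "\<exists>D. (err c1 c2 has_field_derivative D) (at s) \<and> norm (s * D) \<le> 10 ^ 6 * q\<^sup>2"
proof -
  note n = upper_neckD[OF s]
  note sD = sheetD[OF n(2)]
  have s1: "s - 1 \<noteq> 0" using sD by simp
  have L: "(lambert eps has_field_derivative deriv (lambert eps) s) (at s)"
    "(lambert eps has_field_derivative deriv (lambert eps) (1 / s)) (at (1 / s))"
    using sD(4) lambert_differentiable[OF eps(1,2)] by (auto simp: Dom1_def field_differentiable_derivI)
  have i: "((\<lambda>s. 1 / s) has_field_derivative - 1 / s\<^sup>2) (at s)"
    using sD(1) by (auto intro!: derivative_eq_intros simp: power2_eq_square)
  have Li: "((\<lambda>s. lambert eps (1 / s)) has_field_derivative deriv (lambert eps) (1 / s) * (- 1 / s\<^sup>2)) (at s)"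
    by (rule DERIV_chain2[OF L(2) i])
  have Y2: "(Yreg (eps\<^sup>2) has_field_derivative - Sreg (eps\<^sup>2) s / s) (at s)"
  proof -
    have "(Yreg (eps\<^sup>2) has_field_derivative deriv (Yreg (eps\<^sup>2)) s) (at s)"
      using Yreg_deriv[OF eps(5,6) sD(5)] DERIV_imp_deriv by metis
    then show ?thesis using sD(1) by (simp add: Sreg_def)
  qed
  define D1 where "D1 = 2 * (2 * s - 1) / (s * (s - 1))\<^sup>2"
  define D2 where "D2 = deriv (lambert eps) (1 / s) * (- 1 / s\<^sup>2) - (deriv (lambert eps) s - of_real eps)"
  define D3 where "D3 = - Sreg (eps\<^sup>2) s / s"
  have d1: "((\<lambda>s. - 2 / (s * (s - 1))) has_field_derivative D1) (at s)"
    unfolding D1_def using sD(1) s1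
    by (auto intro!: derivative_eq_intros simp: power2_eq_square divide_simps)
  have d2: "((\<lambda>s. lambert eps (1 / s) - (lambert eps s - of_real eps * s)) has_field_derivative D2) (at s)"
    unfolding D2_def by (rule derivative_eq_intros Li L(1) refl | simp)+
  have der: "(err c1 c2 has_field_derivative D1 + of_real c1 * D2 + of_real c2 * D3) (at s)"
    unfolding err_def[abs_def] D3_def by (intro DERIV_add d1 DERIV_cmult d2 Y2)
  have B1: "norm (s * D1) \<le> 800000 * q\<^sup>2"
  proof -
    have a: "99 / 100 * norm s \<le> norm (s - 1)" using norm_triangle_ineq2[of s 1] n(1) by simp
    have b: "norm (2 * s - 1) \<le> 201 / 100 * norm s"
      using norm_triangle_ineq4[of "2 * s" 1] n(1) by (simp add: norm_mult)
    have "s * D1 = 2 * (2 * s - 1) / (s * (s - 1)\<^sup>2)"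
      unfolding D1_def using sD(1) s1 by (simp add: power_mult_distrib power2_eq_square)
    then have "norm (s * D1) = 2 * norm (2 * s - 1) / (norm s * (norm (s - 1))\<^sup>2)"
      by (simp only: norm_mult norm_divide norm_power norm_numeral)
    also have "\<dots> \<le> 2 * (201 / 100 * norm s) / (norm s * (99 / 100 * norm s)\<^sup>2)"
      using a b n(1) s1 by (intro frac_le mult_left_mono power_mono mult_pos_pos) auto
    also have "\<dots> = 402 / 100 * (100 / 99)\<^sup>2 * (1 / norm s)\<^sup>2"
      using n(1) by (simp add: power2_eq_square)
    also have "\<dots> \<le> 5 * (400 * q)\<^sup>2"
      using n(1,3) by (intro mult_mono power_mono) (auto simp: power2_eq_square)
    finally show ?thesis by (simp add: power_mult_distrib)
  qed
  have qq: "eps = q\<^sup>2" by (simp add: eps_def)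
  have B2: "norm (s * D2) \<le> 6 * q\<^sup>2"
  proof -
    have "s * D2 = - (deriv (lambert eps) (1 / s) / s) - s * (deriv (lambert eps) s - of_real eps)"
      unfolding D2_def using sD(1) by (simp add: algebra_simps power2_eq_square)
    then have "norm (s * D2) \<le> norm (deriv (lambert eps) (1 / s)) * (1 / norm s) + norm s * norm (deriv (lambert eps) s - of_real eps)"
      using norm_triangle_ineq4[of "- (deriv (lambert eps) (1 / s) / s)" "s * (deriv (lambert eps) s - of_real eps)"]
      by (simp add: norm_mult norm_divide)
    moreover have "norm (deriv (lambert eps) (1 / s)) * (1 / norm s) \<le> 9 * eps * (1 / 100)"
    proof (intro mult_mono)
      show "norm (deriv (lambert eps) (1 / s)) \<le> 9 * eps"
        using sD(7) q_le_inverse_eps(2) by (intro norm_deriv_lambert_le eps) linarith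
      show "1 / norm s \<le> 1 / 100" using n(1) by (intro divide_left_mono) auto
    qed (use eps in auto)
    moreover have "norm s * norm (deriv (lambert eps) s - of_real eps) \<le> (1 / q) * (3 * eps\<^sup>2 * (1 / q) + 9 * eps\<^sup>2)"
    proof (intro mult_mono)
      have "norm (deriv (lambert eps) s - of_real eps) \<le> 3 * eps\<^sup>2 * norm s + 9 * eps\<^sup>2"
        using sD(6) q_le_inverse_eps(1) by (intro deriv_lambert_approx_gen eps) linarith
      also have "\<dots> \<le> 3 * eps\<^sup>2 * (1 / q) + 9 * eps\<^sup>2"
        using sD(6) by (intro add_mono mult_left_mono) auto
      finally show "norm (deriv (lambert eps) s - of_real eps) \<le> 3 * eps\<^sup>2 * (1 / q) + 9 * eps\<^sup>2" .
    qed (use sD(6) q_pos in auto)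
    moreover have "(1 / q) * (3 * eps\<^sup>2 * (1 / q) + 9 * eps\<^sup>2) = 3 * q\<^sup>2 + 9 * q * q\<^sup>2"
      using q_pos by (simp add: qq power2_eq_square algebra_simps)
    moreover have "9 * q * q\<^sup>2 \<le> 1 * q\<^sup>2" using q_small by (intro mult_right_mono) auto
    ultimately show ?thesis using qq zero_le_power2[of q] by linarith
  qed
  have B3: "norm (s * D3) \<le> 18 * q\<^sup>2"
    using Sreg_bounds(2)[OF n(2)] sD(1) by (simp add: D3_def)
  have "norm (s * (D1 + of_real c1 * D2 + of_real c2 * D3)) \<le>
      norm (s * D1) + \<bar>c1\<bar> * norm (s * D2) + \<bar>c2\<bar> * norm (s * D3)"
  proof -
    have "s * (D1 + of_real c1 * D2 + of_real c2 * D3) = s * D1 + of_real c1 * (s * D2) + of_real c2 * (s * D3)"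
      by (simp add: algebra_simps)
    also have "norm \<dots> \<le> norm (s * D1) + norm (of_real c1 * (s * D2)) + norm (of_real c2 * (s * D3))"
      by (intro norm_triangle_le add_mono norm_triangle_ineq order_refl)
    finally show ?thesis by (simp only: norm_mult norm_of_real)
  qed
  also have "\<dots> \<le> 800000 * q\<^sup>2 + 2 * (6 * q\<^sup>2) + 4 * (18 * q\<^sup>2)"
    using B1 B2 B3 c by (intro add_mono mult_mono) auto
  also have "\<dots> \<le> 10 ^ 6 * q\<^sup>2" by simp
  finally show ?thesis using der by blast
qed

lemma err_log_lipschitz:
  assumes "exp u \<in> upper_neck" "exp v \<in> upper_neck" and c: "\<bar>c1\<bar> \<le> 2" "\<bar>c2\<bar> \<le> 4"
  shows "norm (err c1 c2 (exp u) - err c1 c2 (exp v)) \<le> 10 ^ 6 * q\<^sup>2 * norm (u - v)"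
proof -
  define I where "I = {ln (1 / (400 * q))..ln (1 / q)}"
  have pos: "0 < 1 / (400 * q)" "0 < 1 / q" using q_pos by auto
  have I: "exp w \<in> upper_neck \<longleftrightarrow> Re w \<in> I" for w
  proof -
    have "1 / (400 * q) = exp (ln (1 / (400 * q)))" "1 / q = exp (ln (1 / q))" using pos by simp_all
    then have "exp w \<in> upper_neck \<longleftrightarrow> exp (ln (1 / (400 * q))) \<le> exp (Re w) \<and> exp (Re w) \<le> exp (ln (1 / q))"
      unfolding upper_neck_def by simp
    then show ?thesis by (simp only: exp_le_cancel_iff I_def atLeastAtMost_iff)
  qed
  have "\<exists>D. (err c1 c2 has_field_derivative D) (at (exp w)) \<and> norm (exp w * D) \<le> 10 ^ 6 * q\<^sup>2" if "Re w \<in> I" for w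
    using err_deriv[OF _ c] I that by blast
  then obtain D where D: "\<And>w. Re w \<in> I \<Longrightarrow> (err c1 c2 has_field_derivative D w) (at (exp w))"
    "\<And>w. Re w \<in> I \<Longrightarrow> norm (exp w * D w) \<le> 10 ^ 6 * q\<^sup>2" by metis
  show ?thesis
  proof (rule field_differentiable_bound[where S = "Re -` I" and f' = "\<lambda>w. D w * exp w"])
    show "convex (Re -` I)" unfolding I_def by (intro convex_linear_vimage linearI) auto
    fix w assume w: "w \<in> Re -` I"
    have "((\<lambda>w. err c1 c2 (exp w)) has_field_derivative D w * exp w) (at w)"
      using D(1) w by (intro DERIV_chain2[OF _ DERIV_exp]) auto
    then show "((\<lambda>w. err c1 c2 (exp w)) has_field_derivative D w * exp w) (at w within Re -` I)"
      by (rule has_field_derivative_at_within)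
    show "norm (D w * exp w) \<le> 10 ^ 6 * q\<^sup>2" using D(2) w by (simp add: mult.commute)
  qed (use I assms in auto)
qed

lemma Re_err: "s \<in> sheet \<Longrightarrow> Re (err 2 (-4) s) = x1 s + 1 + 2 * Re (1 / s + of_real eps * cnj s)"
  and Im_err: "s \<in> sheet \<Longrightarrow> Im (err (-2) 0 s) = 2 / b * x2 s + 2 * Im (1 / s + of_real eps * cnj s)"
proof -
  assume s: "s \<in> sheet"
  note sD = sheetD(1,2)[OF s]
  have b: "b \<noteq> 0" using constants by simp
  have "s - 1 \<noteq> 0" "1 - s \<noteq> 0" using sD by simp_all
  then have e: "- 2 / (s * (s - 1)) = zeta s + 1 + 2 / s"
    unfolding zeta_eq[OF sD(2)] using sD(1) by (simp add: divide_simps)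
  have 1: "err c1 c2 s = zeta s + 1 + 2 / s + of_real c1 * (Yreg eps s + of_real eps * s) + of_real c2 * Yreg (eps\<^sup>2) s" for c1 c2
    unfolding err_def e Yreg_def[of eps] by (simp add: algebra_simps)
  have 2: "Re (2 / s) = 2 * Re (1 / s)" "Im (2 / s) = 2 * Im (1 / s)"
  proof -
    have "Re (2 * z) = 2 * Re z" "Im (2 * z) = 2 * Im z" for z by simp_all
    from this[of "1 / s"] show "Re (2 / s) = 2 * Re (1 / s)" "Im (2 / s) = 2 * Im (1 / s)" by simp_all
  qed
  show "Re (err 2 (-4) s) = x1 s + 1 + 2 * Re (1 / s + of_real eps * cnj s)"
    unfolding 1 x1_eq by (simp add: 2)
  show "Im (err (-2) 0 s) = 2 / b * x2 s + 2 * Im (1 / s + of_real eps * cnj s)"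
    unfolding 1 x2_eq using b by (simp add: 2)
qed

text \<open>Put \<open>t = s * exp \<delta>\<close> with
  \<open>\<delta> = \<sigma> + \<i> * \<theta>\<close>. Equal heights bound \<open>\<sigma>\<close>
  by a small multiple of \<open>norm \<delta>\<close>, so \<open>\<theta>\<close> controls
  \<open>\<delta>\<close>. Equal projections make the catenoid terms \<open>p s\<close> and
  \<open>p t\<close> differ by at most order \<open>q\<^sup>2 * norm \<delta>\<close>, while the
  angle forces a difference of order \<open>q * \<bar>\<theta>\<bar>\<close>. Hence
  \<open>\<theta> = 0\<close>.\<close>

lemma neck_inj:
  assumes s: "s \<in> upper_neck" and t: "t \<in> upper_neck" and eq: "x1 s = x1 t" "x2 s = x2 t" "x3 s = x3 t"
  shows "s = t"
proof -
  note sn = upper_neckD[OF s] and tn = upper_neckD[OF t]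
  have s0: "s \<noteq> 0" "t \<noteq> 0" using sn tn by auto
  define \<delta> where "\<delta> = Ln (t / s)"
  define \<sigma> where "\<sigma> = Re \<delta>"
  define \<theta> where "\<theta> = Im \<delta>"
  have \<theta>: "\<bar>\<theta>\<bar> \<le> pi" using mpi_less_Im_Ln[of "t / s"] Im_Ln_le_pi[of "t / s"] s0 by (simp add: \<theta>_def \<delta>_def)
  define u where "u = Ln s"
  have es: "exp u = s" "exp (u + \<delta>) = t" using s0 by (simp_all add: u_def \<delta>_def exp_add)
  have ns: "norm t = norm s * exp \<sigma>"
  proof -
    have "norm t = norm (exp u) * norm (exp \<delta>)" using es by (metis exp_add norm_mult)
    then show ?thesis using es by (simp add: \<sigma>_def)
  qed
  have Re: "ln 100 \<le> Re u" "Re u \<le> ln (1 / q)" "ln 100 \<le> Re (u + \<delta>)" "Re (u + \<delta>) \<le> ln (1 / q)"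
  proof -
    have "Re u = ln (norm s)" "Re (u + \<delta>) = ln (norm t)"
      using s0 by (simp_all add: u_def \<delta>_def ln_div norm_divide)
    then show "ln 100 \<le> Re u" "Re u \<le> ln (1 / q)" "ln 100 \<le> Re (u + \<delta>)" "Re (u + \<delta>) \<le> ln (1 / q)"
      using sn(1) tn(1) sheetD(6)[OF sn(2)] sheetD(6)[OF tn(2)] q_pos s0 by (auto simp: ln_le_cancel_iff simp del: ln_divide_pos)
  qed
  have "norm (Y eps (exp (u + \<delta>)) - Y eps (exp u)) \<le> 1 / 50 * norm (u + \<delta> - u)"
    by (rule Y_log_lipschitz[OF refl refl Re(3,4) Re(1,2)])
  then have "\<bar>Re (Y eps t) - Re (Y eps s)\<bar> \<le> 1 / 50 * norm \<delta>"
    using abs_Re_le_cmod[of "Y eps t - Y eps s"] unfolding es by simp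
  then have "11 / 10 * c0 * \<bar>Re (Y eps t) - Re (Y eps s)\<bar> \<le> 11 / 10 * c0 * (1 / 50 * norm \<delta>)"
    using c0_pos by (intro mult_left_mono) auto
  moreover have "B * \<bar>Re (Y eps t) - Re (Y eps s)\<bar> \<le> 11 / 10 * c0 * \<bar>Re (Y eps t) - Re (Y eps s)\<bar>"
    by (rule B_c0) simp
  ultimately have "B * \<bar>Re (Y eps t) - Re (Y eps s)\<bar> \<le> 11 / 10 * c0 * (1 / 50 * norm \<delta>)" by linarith
  moreover have "c0 * \<sigma> = B * (Re (Y eps t) - Re (Y eps s))"
  proof -
    have "ln (norm t) = ln (norm s) + \<sigma>" using ns s0 by (simp add: ln_mult)
    then show ?thesis using eq(3) by (simp add: x3_def algebra_simps)
  qed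
  then have "\<bar>c0 * \<sigma>\<bar> = \<bar>B * (Re (Y eps t) - Re (Y eps s))\<bar>" by (rule arg_cong)
  then have "c0 * \<bar>\<sigma>\<bar> = B * \<bar>Re (Y eps t) - Re (Y eps s)\<bar>"
    unfolding abs_mult using c0_pos constants(3) by simp
  moreover have "11 / 10 * c0 * (1 / 50 * norm \<delta>) \<le> c0 * (1 / 40 * norm \<delta>)"
    using c0_pos mult_right_mono[of "11 / 500" "1 / 40" "c0 * norm \<delta>"] by (simp add: mult_ac)
  ultimately have "c0 * \<bar>\<sigma>\<bar> \<le> c0 * (1 / 40 * norm \<delta>)" by linarith
  then have "\<bar>\<sigma>\<bar> \<le> 1 / 40 * norm \<delta>" using c0_pos by simp
  moreover have "norm \<delta> \<le> \<bar>\<sigma>\<bar> + \<bar>\<theta>\<bar>" using cmod_le[of \<delta>] by (simp add: \<sigma>_def \<theta>_def)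
  ultimately have \<delta>\<theta>: "norm \<delta> \<le> 2 * \<bar>\<theta>\<bar>" by linarith
  define p where "p s = 1 / s + of_real eps * cnj s" for s
  have "2 * Re (p t - p s) = Re (err 2 (-4) t - err 2 (-4) s)"
    "2 * Im (p t - p s) = Im (err (-2) 0 t - err (-2) 0 s)"
    using Re_err[OF sn(2)] Re_err[OF tn(2)] Im_err[OF sn(2)] Im_err[OF tn(2)] eq by (simp_all add: p_def)
  moreover have L: "norm (err c1 c2 t - err c1 c2 s) \<le> 10 ^ 6 * q\<^sup>2 * norm \<delta>" if "\<bar>c1\<bar> \<le> 2" "\<bar>c2\<bar> \<le> 4" for c1 c2
    using err_log_lipschitz[of "u + \<delta>" u, OF _ _ that] s t es by simp
  have "norm (err 2 (-4) t - err 2 (-4) s) \<le> 10 ^ 6 * q\<^sup>2 * norm \<delta>"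
    "norm (err (-2) 0 t - err (-2) 0 s) \<le> 10 ^ 6 * q\<^sup>2 * norm \<delta>" by (rule L; simp)+
  then have "\<bar>Re (err 2 (-4) t - err 2 (-4) s)\<bar> \<le> 10 ^ 6 * q\<^sup>2 * norm \<delta>"
    "\<bar>Im (err (-2) 0 t - err (-2) 0 s)\<bar> \<le> 10 ^ 6 * q\<^sup>2 * norm \<delta>"
    using abs_Re_le_cmod[of "err 2 (-4) t - err 2 (-4) s"] abs_Im_le_cmod[of "err (-2) 0 t - err (-2) 0 s"] by linarith+
  ultimately have pd: "norm (p t - p s) \<le> 10 ^ 6 * q\<^sup>2 * norm \<delta>" using cmod_le[of "p t - p s"] by linarith
  \<comment> \<open>The radial profile of the catenoid term, least at the waist
    \<open>norm s = 1 / q\<close>, where it equals \<open>2 * q\<close>.\<close>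
  define \<tau> where "\<tau> s = 1 / norm s + eps * norm s" for s :: complex
  have \<tau>: "2 * q \<le> \<tau> s" if "s \<noteq> 0" for s
  proof -
    have "0 \<le> (1 - q * norm s)\<^sup>2 / norm s" by simp
    also have "\<dots> = \<tau> s - 2 * q" using that by (simp add: \<tau>_def eps_def power2_eq_square field_simps)
    finally show ?thesis by simp
  qed
  have pe: "p z = of_real (\<tau> z) * cnj (sgn z)" if "z \<noteq> 0" for z
  proof -
    have n: "complex_of_real (norm z) \<noteq> 0" using that by simp
    have "z * cnj z = of_real (norm z) * of_real (norm z)"
      using complex_norm_square[of z] by (simp add: power2_eq_square)
    moreover have "1 / z = cnj z / (z * cnj z)" using that by simp
    ultimately have "1 / z = cnj z / (of_real (norm z) * of_real (norm z))" by simp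
    moreover have "cnj (sgn z) = cnj z / of_real (norm z)" by (simp add: sgn_eq)
    moreover have "of_real (\<tau> z) * (cnj z / of_real (norm z)) =
       cnj z / (of_real (norm z) * of_real (norm z)) + of_real eps * cnj z"
      using n by (simp add: \<tau>_def distrib_right add_divide_distrib)
    ultimately show ?thesis by (simp add: p_def)
  qed
  have sg: "sgn t = sgn s * exp (\<i> * of_real \<theta>)"
  proof -
    have "\<delta> = of_real \<sigma> + \<i> * of_real \<theta>" by (simp add: \<sigma>_def \<theta>_def complex_eq_iff)
    then have "exp \<delta> = exp (of_real \<sigma> + \<i> * of_real \<theta>)" by (rule arg_cong)
    then have "exp \<delta> = of_real (exp \<sigma>) * exp (\<i> * of_real \<theta>)" by (simp only: exp_add exp_of_real)
    moreover have "t = exp u * exp \<delta>" by (simp only: es(2)[symmetric] exp_add)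
    ultimately have "t = s * (of_real (exp \<sigma>) * exp (\<i> * of_real \<theta>))" by (simp only: es(1))
    moreover have "complex_of_real (norm t) = of_real (norm s) * of_real (exp \<sigma>)" by (simp only: ns of_real_mult)
    moreover have "complex_of_real (exp \<sigma>) \<noteq> 0" by simp
    ultimately have "t / of_real (norm t) = s / of_real (norm s) * exp (\<i> * of_real \<theta>)"
      by (simp only: times_divide_times_eq mult.left_commute nonzero_mult_divide_mult_cancel_left
          mult.assoc[symmetric] mult.commute[of s] mult_divide_mult_cancel_left_if) simp
    then show ?thesis by (simp only: sgn_eq)
  qed
  have "p s - p t = cnj (sgn s) * (of_real (\<tau> s) - of_real (\<tau> t) * exp (\<i> * of_real (- \<theta>)))"
  proof -
    have e: "cnj (exp (\<i> * of_real \<theta>)) = exp (\<i> * of_real (- \<theta>))"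
      using exp_cnj[of "\<i> * of_real \<theta>"] by simp
    show ?thesis unfolding pe[OF s0(1)] pe[OF s0(2)] sg complex_cnj_mult e
      by (simp only: right_diff_distrib mult_ac)
  qed
  then have "norm (p s - p t) = norm (of_real (\<tau> s) - of_real (\<tau> t) * exp (\<i> * of_real (- \<theta>)))"
    using s0 by (simp add: norm_mult norm_sgn)
  also have "\<dots> \<ge> 2 * (2 * q) * \<bar>sin (- \<theta> / 2)\<bar>" using \<tau> s0 q_pos by (intro dist_polar_ge) auto
  finally have "4 * q * \<bar>sin (\<theta> / 2)\<bar> \<le> norm (p t - p s)" by (simp add: norm_minus_commute)
  moreover have "4 * q * (\<bar>\<theta>\<bar> / 6) \<le> 4 * q * \<bar>sin (\<theta> / 2)\<bar>" using abs_sin_half_ge[OF \<theta>] q_pos by (intro mult_left_mono) auto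
  moreover have "10 ^ 6 * q\<^sup>2 * norm \<delta> \<le> 10 ^ 6 * q\<^sup>2 * (2 * \<bar>\<theta>\<bar>)" using \<delta>\<theta> by (intro mult_left_mono) auto
  moreover have "10 ^ 6 * q\<^sup>2 * (2 * \<bar>\<theta>\<bar>) \<le> q / 10 * \<bar>\<theta>\<bar>"
  proof -
    have "10 ^ 6 * q\<^sup>2 * 2 \<le> q / 10" using eps(8) q_pos by (simp add: eps_def)
    then have "10 ^ 6 * q\<^sup>2 * 2 * \<bar>\<theta>\<bar> \<le> q / 10 * \<bar>\<theta>\<bar>" by (intro mult_right_mono) auto
    then show ?thesis by simp
  qed
  ultimately have "q * \<bar>\<theta>\<bar> * (4 / 6) \<le> q * \<bar>\<theta>\<bar> * (1 / 10)" using pd by (simp add: algebra_simps)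
  then have "q * \<bar>\<theta>\<bar> \<le> 0" by simp
  then have "\<theta> = 0" using q_pos by (simp add: mult_le_0_iff)
  then have "\<delta> = 0" using \<delta>\<theta> by simp
  then show ?thesis using es by simp
qed

text \<open>Pairs in \<open>mid\<close> or in \<open>upper_neck\<close> are settled, and reflection
  handles the lower neck. A mixed pair cannot occur: \<open>norm (zeta s + 1)\<close> is at most
  \<open>42 * q\<close> beyond radius \<open>1 / (20 * q)\<close> and at least
  \<open>400 * q\<close> below \<open>1 / (400 * q)\<close>, while equal projections allow a gap of
  only \<open>50 * q\<close>.\<close>

lemma sheet_inj:
  assumes s: "s \<in> sheet" and t: "t \<in> sheet" and eq: "x1 s = x1 t" "x2 s = x2 t" "x3 s = x3 t"
  shows "s = t"
proof -
  have q400: "10 ^ 12 \<le> 1 / q" using q_small q_pos by (simp add: field_simps)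
  have up: "s = t" if st: "s \<in> sheet" "t \<in> sheet" "x1 s = x1 t" "x2 s = x2 t" "x3 s = x3 t" "1 / (20 * q) < norm s" for s t
  proof -
    have "1 / (400 * q) \<le> 1 / (20 * q)" using q_pos by (simp add: frac_le)
    then have su: "s \<in> upper_neck" using st(6) sheetD(6)[OF st(1)] by (simp add: upper_neck_def)
    show ?thesis
    proof (cases "t \<in> upper_neck")
      case True then show ?thesis using neck_inj su st by blast
    next
      case False
      then have nt: "norm t < 1 / (400 * q)" using sheetD(6)[OF st(2)] by (simp add: upper_neck_def)
      have z: "zeta s + 1 = 2 / (1 - s)" "zeta t + 1 = 2 / (1 - t)"
        using zeta_eq sheetD(2)[OF st(1)] sheetD(2)[OF st(2)] by simp_all
      have "norm (1 - s) \<ge> 1 / (21 * q)" using norm_triangle_ineq2[of s 1] st(6) q400 by (simp add: norm_minus_commute)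
      then have "2 / norm (1 - s) \<le> 2 / (1 / (21 * q))" using q_pos by (intro frac_le) auto
      then have a: "norm (zeta s + 1) \<le> 42 * q" unfolding z norm_divide by simp
      have "norm (1 - t) \<le> 1 / (200 * q)" using norm_triangle_ineq4[of 1 t] nt q400 by simp
      moreover have "norm (1 - t) > 0" using sheetD(2)[OF st(2)] by simp
      ultimately have "2 / (1 / (200 * q)) \<le> 2 / norm (1 - t)" using q_pos by (intro frac_le) auto
      then have "400 * q \<le> norm (zeta t + 1)" unfolding z norm_divide by simp
      moreover have "norm (zeta t + 1) \<le> norm (zeta s + 1) + norm (zeta s - zeta t)"
        using norm_triangle_ineq4[of "zeta s + 1" "zeta s - zeta t"] by (simp add: add.commute)
      ultimately show ?thesis using a zeta_dist[OF st(1-4)] q_pos by linarith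
    qed
  qed
  have down: "s = t" if st: "s \<in> sheet" "t \<in> sheet" "x1 s = x1 t" "x2 s = x2 t" "x3 s = x3 t" "1 / (20 * q) < norm (1 / s)" for s t
  proof -
    have "1 / cnj s = 1 / cnj t"
      using X_reflect[OF sheetD(3)[OF st(1)]] X_reflect[OF sheetD(3)[OF st(2)]] st
      by (intro up sheet_reflect) (auto simp: norm_divide)
    then show ?thesis by simp
  qed
  show ?thesis
  proof (cases "s \<in> mid")
    case True
    show ?thesis
    proof (cases "t \<in> mid")
      case True then show ?thesis using mid_proj_inj \<open>s \<in> mid\<close> eq by blast
    next
      case False
      then have "1 / (20 * q) < norm t \<or> 1 / (20 * q) < norm (1 / t)" using sheetD[OF t] by (auto simp: mid_def)
      then show ?thesis using up[OF t s] down[OF t s] eq by metis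
    qed
  next
    case False
    then have "1 / (20 * q) < norm s \<or> 1 / (20 * q) < norm (1 / s)" using sheetD[OF s] by (auto simp: mid_def)
    then show ?thesis using up[OF s t] down[OF s t] eq by metis
  qed
qed

end

section \<open>The surface in a ball\<close>

lemma pt3_nth [simp]: "pt3 x y z $ 1 = x" "pt3 x y z $ 2 = y" "pt3 x y z $ 3 = z"
  by (simp_all add: pt3_def)

lemma norm_pt3: "(norm (pt3 x y z))\<^sup>2 = x\<^sup>2 + y\<^sup>2 + z\<^sup>2"
  unfolding power2_norm_eq_inner by (simp add: inner_vec_def sum_3 power2_eq_square)

lemma abs_le_norm_pt3: "\<bar>x\<bar> \<le> norm (pt3 x y z)" "\<bar>y\<bar> \<le> norm (pt3 x y z)" "\<bar>z\<bar> \<le> norm (pt3 x y z)"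
  using component_le_norm_cart[of "pt3 x y z" 1] component_le_norm_cart[of "pt3 x y z" 2]
    component_le_norm_cart[of "pt3 x y z" 3] by simp_all

lemma pt3_eq_iff: "pt3 x y z = pt3 x' y' z' \<longleftrightarrow> x = x' \<and> y = y' \<and> z = z'"
  by (auto simp: vec_eq_iff forall_3)

lemma continuous_on_pt3 [continuous_intros]:
  assumes "continuous_on A f" "continuous_on A g" "continuous_on A k"
  shows "continuous_on A (\<lambda>s. pt3 (f s) (g s) (k s))"
proof -
  have "pt3 x y z = x *\<^sub>R axis 1 1 + y *\<^sub>R axis 2 1 + z *\<^sub>R axis 3 1" for x y z
    by (simp add: vec_eq_iff forall_3 axis_def)
  then show ?thesis using assms by (auto intro!: continuous_intros)
qed

context neck_stack
begin

text \<open>Chosen so that \<open>norm (X s) \<le> R\<close> yields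
  \<open>norm (zeta t) \<le> 2 * R + 1 \<le> ln (1 / q) - 10\<close>, the range in which
  \<open>x3_range\<close> keeps each sheet in its slab.\<close>

definition R :: real where "R = ln (1 / q) / 4"
definition T0 :: "complex set" where "T0 = {s \<in> Dom eps. norm (X s) < R}"
text \<open>A component is connected by definition, which avoids an analysis of \<open>T0\<close>
  near the sphere; \<open>small_in_T\<close> shows that the inner part is retained.\<close>

definition T :: "complex set" where "T = connected_component_set T0 (- 1)"

lemma R_ge: "25 \<le> R" using ln_q by (simp add: R_def)

lemma h_small: "h \<le> 20 * sqrt q" "h \<le> 1 / 1000"
proof -
  have "ln (1 / q) = 2 * ln (1 / sqrt q)" using q_pos by (simp add: ln_div ln_sqrt)
  also have "\<dots> \<le> 2 * (1 / sqrt q)" using q_pos ln_le_minus_one[of "1 / sqrt q"] by simp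
  finally have "q * ln (1 / q) \<le> q * (2 * (1 / sqrt q))" using q_pos by (intro mult_left_mono) auto
  also have "\<dots> = 2 * (q / sqrt q)" by simp
  also have "\<dots> = 2 * sqrt q" using q_pos by (simp only: real_div_sqrt less_imp_le)
  finally show a: "h \<le> 20 * sqrt q" using h_pos(2) by simp
  have "sqrt q \<le> sqrt ((1 / 10 ^ 6)\<^sup>2)" using q_small by (intro real_sqrt_le_mono) (simp add: power2_eq_square)
  also have "\<dots> = 1 / 10 ^ 6" by simp
  finally show "h \<le> 1 / 1000" using a by simp
qed

lemma X_continuous: "continuous_on (Dom eps) X"
proof -
  have "continuous_on (Dom eps) x1" "continuous_on (Dom eps) x2" "continuous_on (Dom eps) x3"
    by (meson continuous_at_imp_continuous_on has_derivative_continuous x1_deriv x2_deriv x3_deriv)+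
  then show ?thesis unfolding X_def[abs_def] by (intro continuous_intros)
qed

lemma sheet_coordinates:
  assumes "s \<in> Dom eps"
  obtains k t where "t \<in> sheet" "norm t < 1 / q" "s = t * of_real (eps powi (- k))"
    "X s = pt3 (sg k * x1 t) (x2 t) (x3 t + of_int k * h)"
proof -
  obtain k where k: "q \<le> norm (s * of_real (eps powi k))" "norm (s * of_real (eps powi k)) < 1 / q"
    using exists_scale[OF q_pos q1(1) Dom_nonzero[OF assms]] unfolding eps_def by blast
  define t where "t = s * of_real (eps powi k)"
  have t: "t \<in> Dom eps" unfolding t_def by (rule Dom_scale[OF assms eps(1)])
  have ts: "t \<in> sheet" using k Dom_ne_1[OF t] by (auto simp: sheet_def t_def)
  have s: "s = t * of_real (eps powi (- k))"
    using eps(1) by (simp add: t_def power_int_minus mult.assoc)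
  have "X s = pt3 (sg k * x1 t) (x2 t) (x3 t + of_int k * h)"
    using X_scale[OF t, of k] unfolding X_def s by simp
  then show ?thesis using that[OF ts k(2)[folded t_def] s] by blast
qed

lemma abs_sg [simp]: "\<bar>sg k * x\<bar> = \<bar>x\<bar>" by (simp add: sg_def)

lemma X_small_zeta:
  assumes "t \<in> sheet" "norm (pt3 (sg k * x1 t) (x2 t) z) \<le> R"
  shows "norm (zeta t) \<le> ln (1 / q) - 10" "norm (zeta t) \<le> 2 * R + 1"
proof -
  have "\<bar>x1 t\<bar> \<le> R" "\<bar>x2 t\<bar> \<le> R"
    using assms(2) abs_le_norm_pt3(1)[of "sg k * x1 t" "x2 t" z] abs_le_norm_pt3(2)[of "x2 t" "sg k * x1 t" z]
    by simp_all
  moreover have "30 * q \<le> 1" using q_small by simp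
  ultimately show "norm (zeta t) \<le> 2 * R + 1" using zeta_bound[OF assms(1)] by linarith
  then show "norm (zeta t) \<le> ln (1 / q) - 10" using ln_q by (simp add: R_def)
qed

text \<open>The slabs are half-open like the annulus: a waist counts to the sheet above it.\<close>

lemma height_interval:
  assumes "t \<in> sheet" "norm t < 1 / q" "norm (zeta t) \<le> ln (1 / q) - 10"
  shows "(of_int k - 1 / 2) * h \<le> x3 t + of_int k * h" "x3 t + of_int k * h < (of_int k + 1 / 2) * h"
  using x3_range(1)[OF assms(1,3)] x3_less_top[OF assms] by (simp_all add: algebra_simps)

lemma height_unique:
  fixes k k' :: int
  assumes "(of_int k - 1 / 2) * h \<le> x" "x < (of_int k + 1 / 2) * h"
    "(of_int k' - 1 / 2) * h \<le> x" "x < (of_int k' + 1 / 2) * h"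
  shows "k = k'"
proof -
  have "(of_int k - 1 / 2) * h < (of_int k' + 1 / 2) * h" "(of_int k' - 1 / 2) * h < (of_int k + 1 / 2) * h"
    using assms by linarith+
  then have "real_of_int k - 1 / 2 < of_int k' + 1 / 2" "real_of_int k' - 1 / 2 < of_int k + 1 / 2"
    using h_pos(1) by (simp_all add: mult_less_cancel_right)
  then show ?thesis by linarith
qed

text \<open>The height determines the level, so both points come from the same sheet and
  \<open>sheet_inj\<close> applies.\<close>

lemma X_inj: "inj_on X {s \<in> Dom eps. norm (X s) \<le> R}"
proof (rule inj_onI)
  fix s s' assume "s \<in> {s \<in> Dom eps. norm (X s) \<le> R}" "s' \<in> {s \<in> Dom eps. norm (X s) \<le> R}" and eq: "X s = X s'"
  then have D: "s \<in> Dom eps" "s' \<in> Dom eps" and n: "norm (X s) \<le> R" "norm (X s') \<le> R" by auto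
  obtain k t where t: "t \<in> sheet" "norm t < 1 / q" "s = t * of_real (eps powi (- k))"
    "X s = pt3 (sg k * x1 t) (x2 t) (x3 t + of_int k * h)" using sheet_coordinates[OF D(1)] .
  obtain k' t' where t': "t' \<in> sheet" "norm t' < 1 / q" "s' = t' * of_real (eps powi (- k'))"
    "X s' = pt3 (sg k' * x1 t') (x2 t') (x3 t' + of_int k' * h)" using sheet_coordinates[OF D(2)] .
  note z = X_small_zeta(1)[OF t(1) n(1)[unfolded t(4)]]
  note z' = X_small_zeta(1)[OF t'(1) n(2)[unfolded t'(4)]]
  have e: "sg k * x1 t = sg k' * x1 t'" "x2 t = x2 t'" "x3 t + of_int k * h = x3 t' + of_int k' * h"
    using eq unfolding t(4) t'(4) pt3_eq_iff by auto
  have levels: "k = k'"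
    by (rule height_unique[OF height_interval[OF t(1,2) z] height_interval[OF t'(1,2) z', of k', folded e(3)]])
  then have "x1 t = x1 t'" "x3 t = x3 t'" using e by (auto simp: sg_def split: if_splits)
  then have "t = t'" using sheet_inj[OF t(1) t'(1)] e(2) by blast
  then show "s = s'" using t(3) t'(3) levels by simp
qed

text \<open>The condition \<open>norm (zeta t) \<le> \<rho>\<close> with the denominator cleared:
  visibly closed, and false at \<open>t = 1\<close>.\<close>

definition Krho :: "real \<Rightarrow> complex set" where
  "Krho \<rho> = {t. q \<le> norm t \<and> norm t \<le> 1 / q \<and> norm (1 + t) \<le> \<rho> * norm (1 - t)}"

lemma Krho_iff: "t \<in> Krho \<rho> \<longleftrightarrow> t \<in> sheet \<and> norm (zeta t) \<le> \<rho>"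
proof (cases "t = 1")
  case False
  then have "norm (1 - t) > 0" by simp
  then have "norm (zeta t) \<le> \<rho> \<longleftrightarrow> norm (1 + t) \<le> \<rho> * norm (1 - t)"
    by (simp add: zeta_def norm_divide pos_divide_le_eq)
  then show ?thesis using False by (auto simp: Krho_def sheet_def)
qed (simp add: Krho_def sheet_def)

lemma compact_Krho: "compact (Krho \<rho>)"
proof -
  have "Krho \<rho> = cball 0 (1 / q) \<inter> {t. q \<le> norm t} \<inter> {t. norm (1 + t) \<le> \<rho> * norm (1 - t)}"
    by (auto simp: Krho_def)
  moreover have "closed {t::complex. q \<le> norm t}" "closed {t::complex. norm (1 + t) \<le> \<rho> * norm (1 - t)}"
    by (intro closed_Collect_le continuous_intros)+
  ultimately show ?thesis by (metis closed_Int compact_Int_closed compact_cball inf_assoc)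
qed

definition level :: "int \<Rightarrow> complex set \<Rightarrow> complex set" where
  "level k A = (\<lambda>t. t * of_real (eps powi (- k))) ` A"

lemma compact_level: "compact A \<Longrightarrow> compact (level k A)"
  unfolding level_def by (intro compact_continuous_image continuous_intros)

lemma level_Dom: "A \<subseteq> sheet \<Longrightarrow> level k A \<subseteq> Dom eps"
  using Dom_scale[OF sheetD(3) eps(1)] by (auto simp: level_def)

text \<open>Properness: a bounded height leaves finitely many levels, and on each of them a bounded
  projection confines the parameter to a compact \<open>Krho\<close>.\<close>

lemma compact_preimage:
  assumes "compact U" "U \<subseteq> cball 0 R" shows "compact {s \<in> Dom eps. X s \<in> U}"
proof -
  define N where "N = \<lceil>(R + h) / h\<rceil>"
  define M where "M = (\<Union>k\<in>{-N..N}. level k (Krho (2 * R + 1)))"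
  have M: "compact M" unfolding M_def by (intro compact_UN compact_level compact_Krho) auto
  have MD: "M \<subseteq> Dom eps" unfolding M_def using level_Dom Krho_iff by (auto simp: subset_iff)
  have sub: "{s \<in> Dom eps. X s \<in> U} \<subseteq> M"
  proof
    fix s assume s: "s \<in> {s \<in> Dom eps. X s \<in> U}"
    then have n: "norm (X s) \<le> R" using assms(2) by auto
    from s obtain k t where t: "t \<in> sheet" "norm t < 1 / q" "s = t * of_real (eps powi (- k))"
      "X s = pt3 (sg k * x1 t) (x2 t) (x3 t + of_int k * h)" using sheet_coordinates by blast
    note z = X_small_zeta[OF t(1) n[unfolded t(4)]]
    have "\<bar>x3 t + of_int k * h\<bar> \<le> R" using n abs_le_norm_pt3(3) unfolding t(4) by (rule order_trans[rotated])
    then have "\<bar>of_int k * h\<bar> \<le> R + h" using x3_range[OF t(1) z(1)] h_pos(1) by linarith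
    then have "\<bar>real_of_int k\<bar> \<le> (R + h) / h" using h_pos(1) by (simp add: abs_mult field_simps)
    then have "k \<in> {-N..N}" unfolding N_def by simp linarith
    moreover have "s \<in> level k (Krho (2 * R + 1))" using t z by (auto simp: level_def Krho_iff)
    ultimately show "s \<in> M" by (auto simp: M_def)
  qed
  have "closedin (top_of_set M) (M \<inter> X -` U)"
    using continuous_closedin_preimage[OF continuous_on_subset[OF X_continuous MD]] assms(1) compact_imp_closed by blast
  then have "compact (M \<inter> X -` U)" using M closedin_compact by blast
  moreover have "M \<inter> X -` U = {s \<in> Dom eps. X s \<in> U}" using sub MD by auto
  ultimately show ?thesis by simp
qed

lemma open_T0: "open T0"
proof -
  have "open (Dom eps \<inter> X -` ball 0 R)" by (intro continuous_open_preimage X_continuous open_dom open_ball)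
  moreover have "T0 = Dom eps \<inter> X -` ball 0 R" by (auto simp: T0_def)
  ultimately show ?thesis by simp
qed

lemma X_base: "- 1 \<in> Dom eps" "X (- 1) = 0" "- 1 \<in> T0"
proof -
  show D: "- 1 \<in> Dom eps" using unit_Dom1[OF eps(1,3), of "- 1"] Dom_eq[OF eps(1)] by (auto simp: complex_eq_iff)
  have "Y d (- 1) = 0" for d using Y_inverse[of "- 1" d] by simp
  then have "X (- 1) = pt3 0 0 0" by (simp add: X_def x1_def x2_def x3_def W_def)
  then show z: "X (- 1) = 0" by (simp add: vec_eq_iff forall_3)
  show "- 1 \<in> T0" using D z R_ge by (simp add: T0_def)
qed

lemma T: "open T" "connected T" "T \<subseteq> T0" "closedin (top_of_set T0) T" "- 1 \<in> T"
proof -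
  show "open T" "connected T" "T \<subseteq> T0" "closedin (top_of_set T0) T"
    unfolding T_def by (rule open_connected_component[OF open_T0] connected_connected_component
      connected_component_subset closedin_connected_component)+
  show "- 1 \<in> T" unfolding T_def mem_Collect_eq using connected_component_refl X_base(3) by blast
qed

lemma T_Dom: "T \<subseteq> Dom eps" using T(3) by (auto simp: T0_def)

text \<open>Properness makes \<open>X\<close> a closed map into the ball. This serves twice, for the
  homeomorphism and for the absence of boundary inside the ball.\<close>

lemma closedin_image:
  assumes "closedin (top_of_set T) C" shows "closedin (top_of_set (ball 0 R)) (X ` C)"
proof (rule proper_map)
  show "closedin (top_of_set T0) C" using assms T(4) closedin_trans by blast
  show "X ` T0 \<subseteq> ball 0 R" by (auto simp: T0_def)
  fix U :: "(real^3) set" assume U: "U \<subseteq> ball 0 R" "compact U"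
  then have "T0 \<inter> X -` U = {s \<in> Dom eps. X s \<in> U}" by (auto simp: T0_def)
  then show "compact (T0 \<inter> X -` U)" using compact_preimage[OF U(2)] U(1) ball_subset_cball by fastforce
qed

lemma X_homeomorphism: obtains g where "homeomorphism T (X ` T) X g"
proof (rule homeomorphism_injective_closed_map[of T X "X ` T"])
  show "continuous_on T X" using X_continuous T_Dom continuous_on_subset by blast
  show "inj_on X T" by (rule inj_on_subset[OF X_inj]) (use T(3) in \<open>auto simp: T0_def\<close>)
  show "closedin (top_of_set (X ` T)) (X ` U)" if "closedin (top_of_set T) U" for U
  proof (rule closedin_subset_trans[OF closedin_image[OF that]])
    show "X ` U \<subseteq> X ` T" using closedin_imp_subset[OF that] by blast
    show "X ` T \<subseteq> ball 0 R" using T(3) by (auto simp: T0_def)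
  qed
qed auto

definition surface :: "(real^3) set" where "surface = X ` T"

lemma surface_ball: "surface \<subseteq> ball 0 R" using T(3) by (auto simp: surface_def T0_def)

lemma surface_boundary: "closure surface - surface \<subseteq> sphere 0 R"
proof -
  have "closedin (top_of_set (ball 0 R)) surface"
    unfolding surface_def by (rule closedin_image) (simp add: closedin_subtopology_refl)
  then obtain C where C: "closed C" "surface = ball 0 R \<inter> C" by (auto simp: closedin_closed)
  have "closure surface \<subseteq> C" using C by (simp add: closure_minimal)
  moreover have "closure surface \<subseteq> cball 0 R" using surface_ball ball_subset_cball by (metis closed_cball closure_minimal order_trans)
  ultimately show ?thesis using C(2) by (force simp: sphere_def)
qed

lemma surface_minimal: "minimal_surface surface"
proof -
  obtain g where g: "homeomorphism T (X ` T) X g" by (rule X_homeomorphism)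
  show ?thesis unfolding surface_def
  proof (rule minimal_surface_image[OF T(1) _ _ _ _ _ _ _ _ _ g, where ?p1.0 = p1 and ?p2.0 = p2 and ?p3.0 = p3])
    show "X s = pt3 (x1 s) (x2 s) (x3 s)" for s by (simp add: X_def)
    show "p1 holomorphic_on T" "p2 holomorphic_on T" "p3 holomorphic_on T"
      using p_holomorphic T_Dom holomorphic_on_subset by blast+
  qed (use T_Dom x1_deriv x2_deriv x3_deriv conformal immersion in blast)+
qed

lemma surface_planar: "planar_domain surface"
proof -
  define f where "f z = (Re z, Im z)" for z
  define g where "g p = Complex (fst p) (snd p)" for p :: "real \<times> real"
  have gc: "continuous_on A g" for A unfolding g_def[abs_def] complex_eq by (intro continuous_intros)
  have fc: "continuous_on A f" for A unfolding f_def[abs_def] by (intro continuous_intros)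
  have fg: "f (g p) = p" "g (f z) = z" for p z by (simp_all add: f_def g_def)
  have eq: "f ` T = g -` T"
  proof (intro set_eqI iffI)
    fix p assume "p \<in> g -` T" then show "p \<in> f ` T" using fg(1)[of p] by (metis image_eqI vimageE)
  qed (use fg in auto)
  have "T homeomorphic f ` T"
  proof (rule homeomorphicI[of f _ _ g])
    show "g ` f ` T = T" by (simp add: image_image fg)
  qed (use fc gc fg in auto)
  moreover have "X ` T homeomorphic T"
    using X_homeomorphism by (metis homeomorphic_def homeomorphic_sym)
  moreover have "open (f ` T)" unfolding eq by (intro open_vimage T gc)
  moreover have "connected (f ` T)" by (intro connected_continuous_image fc T)
  ultimately show ?thesis unfolding planar_domain_def surface_def using homeomorphic_trans by blast
qed

end

section \<open>Connectedness of the part near the origin\<close>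

lemma norm_polar: "norm (1 + of_real r * cis \<phi>) ^ 2 = 1 + r\<^sup>2 + 2 * r * cos \<phi>"
  "norm (1 - of_real r * cis \<phi>) ^ 2 = 1 + r\<^sup>2 - 2 * r * cos \<phi>"
proof -
  have "sin \<phi> * sin \<phi> = 1 - cos \<phi> * cos \<phi>" using sin_cos_squared_add[of \<phi>] by (simp add: power2_eq_square)
  then show "norm (1 + of_real r * cis \<phi>) ^ 2 = 1 + r\<^sup>2 + 2 * r * cos \<phi>"
    "norm (1 - of_real r * cis \<phi>) ^ 2 = 1 + r\<^sup>2 - 2 * r * cos \<phi>"
    unfolding cmod_power2 by (simp_all add: power2_eq_square) algebra+
qed

lemma norm_one_real: "norm (1 + - complex_of_real r) = \<bar>1 - r\<bar>" "norm (1 - - complex_of_real r) = \<bar>1 + r\<bar>"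
  "norm (- complex_of_real r) = \<bar>r\<bar>"
proof -
  have "1 + - complex_of_real r = of_real (1 - r)" "1 - - complex_of_real r = of_real (1 + r)"
    "- complex_of_real r = of_real (- r)" by simp_all
  then show "norm (1 + - complex_of_real r) = \<bar>1 - r\<bar>" "norm (1 - - complex_of_real r) = \<bar>1 + r\<bar>"
    "norm (- complex_of_real r) = \<bar>r\<bar>" by (simp_all only: norm_of_real abs_minus_cancel)
qed

context neck_stack
begin

text \<open>Turning a point away from the positive real axis decreases \<open>norm (1 + t)\<close>
  and increases \<open>norm (1 - t)\<close>.\<close>

lemma polar_Krho:
  assumes "0 < r" "0 \<le> \<rho>" "cos \<mu> \<le> cos \<phi>" "of_real r * cis \<phi> \<in> Krho \<rho>"
  shows "of_real r * cis \<mu> \<in> Krho \<rho>"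
proof -
  have n: "norm (of_real r * cis x) = r" for x using assms(1) by (simp add: norm_mult)
  have "norm (1 + of_real r * cis \<mu>) ^ 2 \<le> norm (1 + of_real r * cis \<phi>) ^ 2"
    "norm (1 - of_real r * cis \<phi>) ^ 2 \<le> norm (1 - of_real r * cis \<mu>) ^ 2"
    unfolding norm_polar using assms(1,3) by simp_all
  then have "norm (1 + of_real r * cis \<mu>) \<le> norm (1 + of_real r * cis \<phi>)"
    "norm (1 - of_real r * cis \<phi>) \<le> norm (1 - of_real r * cis \<mu>)"
    by (auto dest: power2_le_imp_le)
  moreover have "norm (1 + of_real r * cis \<phi>) \<le> \<rho> * norm (1 - of_real r * cis \<phi>)"
    using assms(4) by (simp add: Krho_def)
  ultimately have "norm (1 + of_real r * cis \<mu>) \<le> \<rho> * norm (1 - of_real r * cis \<mu>)"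
    using assms(2) by (meson mult_left_mono order_trans)
  then show ?thesis using assms(4) n by (simp add: Krho_def)
qed

text \<open>Each point is rotated, inside the set, to the negative real axis. There
  \<open>zeta\<close> has modulus at most 1, so a segment of the axis leads on to -1.\<close>

lemma connected_Krho:
  assumes "1 \<le> \<rho>" shows "connected (Krho \<rho>)"
proof -
  define L where "L = (\<lambda>r. - complex_of_real r) ` {q..1 / q}"
  have Lc: "connected L" unfolding L_def by (intro connected_continuous_image continuous_intros) auto
  have LK: "L \<subseteq> Krho \<rho>"
  proof
    fix t assume "t \<in> L"
    then obtain r where r: "t = - of_real r" "q \<le> r" "r \<le> 1 / q" by (auto simp: L_def)
    have rp: "0 < r" using r q_pos by linarith
    have "norm (1 + t) = \<bar>1 - r\<bar>" "norm (1 - t) = 1 + r" "norm t = r"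
      unfolding r(1) norm_one_real using rp by simp_all
    moreover have "\<bar>1 - r\<bar> \<le> 1 * (1 + r)" using rp by simp
    moreover have "1 * (1 + r) \<le> \<rho> * (1 + r)" using assms rp by (intro mult_right_mono) auto
    ultimately show "t \<in> Krho \<rho>" using r by (simp add: Krho_def)
  qed
  have one: "- 1 \<in> L" using q1 unfolding L_def by (intro image_eqI[of _ _ 1]) auto
  have "connected_component (Krho \<rho>) t (- 1)" if t: "t \<in> Krho \<rho>" for t
  proof -
    define r where "r = norm t"
    have r: "q \<le> r" "r \<le> 1 / q" "0 < r" using t q_pos by (auto simp: Krho_def r_def)
    define \<theta> where "\<theta> = Arg t"
    have t0: "t \<noteq> 0" using r by (auto simp: r_def)
    have th: "\<bar>\<theta>\<bar> \<le> pi" using Arg_bounded[of t] unfolding \<theta>_def by linarith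
    define \<sigma> :: real where "\<sigma> = (if \<theta> \<ge> 0 then 1 else - 1)"
    have st: "\<sigma> * \<bar>\<theta>\<bar> = \<theta>" "\<sigma> = 1 \<or> \<sigma> = - 1" by (auto simp: \<sigma>_def)
    define A where "A = (\<lambda>l. of_real r * cis (\<sigma> * l)) ` {\<bar>\<theta>\<bar>..pi}"
    have teq: "t = of_real r * cis \<theta>" using rcis_cmod_Arg[of t] by (simp add: rcis_def r_def \<theta>_def)
    have "connected A" unfolding A_def by (intro connected_continuous_image continuous_intros) auto
    moreover have "A \<subseteq> Krho \<rho>"
    proof
      fix z assume "z \<in> A"
      then obtain l where l: "z = of_real r * cis (\<sigma> * l)" "\<bar>\<theta>\<bar> \<le> l" "l \<le> pi"
        unfolding A_def image_iff Bex_def atLeastAtMost_iff by blast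
      have "cos (\<sigma> * l) = cos l" using st(2) by auto
      moreover have "cos \<theta> = cos \<bar>\<theta>\<bar>" by simp
      moreover have "cos l \<le> cos \<bar>\<theta>\<bar>" by (rule cos_monotone_0_pi_le) (use l in auto)
      ultimately show "z \<in> Krho \<rho>" unfolding l(1)
        using polar_Krho[OF r(3), of \<rho> "\<sigma> * l" \<theta>] assms t teq by simp
    qed
    moreover have "t \<in> A" unfolding A_def using th st(1) teq by (intro image_eqI[of _ _ "\<bar>\<theta>\<bar>"]) auto
    moreover have "- of_real r \<in> A"
    proof -
      have "cis (\<sigma> * pi) = - 1" using st(2) by (auto simp: complex_eq_iff)
      then show ?thesis unfolding A_def using th by (intro image_eqI[of _ _ pi]) auto
    qed
    ultimately have "connected_component (Krho \<rho>) t (- of_real r)"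
      unfolding connected_component_def by blast
    moreover have "connected_component (Krho \<rho>) (- of_real r) (- 1)"
      unfolding connected_component_def using Lc LK one r by (auto simp: L_def)
    ultimately show ?thesis by (rule connected_component_trans)
  qed
  then show ?thesis
    unfolding connected_iff_connected_component by (meson connected_component_sym connected_component_trans)
qed

text \<open>Consecutive levels share the point of the negative real axis on their common
  waist.\<close>

lemma connected_levels:
  assumes "1 \<le> \<rho>" shows "connected (\<Union>k\<in>{- int n..int n}. level k (Krho \<rho>))"
proof (induction n)
  case 0
  show ?case using connected_Krho[OF assms] by (simp add: level_def)
next
  case (Suc n)
  have c: "connected (level k (Krho \<rho>))" for k
    unfolding level_def by (intro connected_continuous_image continuous_intros connected_Krho assms)
  have mem: "- of_real (1 / q) * of_real (eps powi (- k)) \<in> level k (Krho \<rho>) \<inter> level (k + 1) (Krho \<rho>)" for k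
  proof
    have "- complex_of_real (1 / q) \<in> Krho \<rho>"
    proof -
      have "norm (1 + - complex_of_real (1 / q)) = 1 / q - 1" "norm (1 - - complex_of_real (1 / q)) = 1 + 1 / q"
        unfolding norm_one_real using q1 q_pos by simp_all
      moreover have "1 / q - 1 \<le> 1 * (1 + 1 / q)" by simp
      moreover have "1 * (1 + 1 / q) \<le> \<rho> * (1 + 1 / q)" using assms q_pos by (intro mult_right_mono) auto
      moreover have "q \<le> 1 / q" using q1 by linarith
      moreover have "1 / q - 1 \<le> \<rho> * (1 + 1 / q)" using calculation(3,4) by linarith
      ultimately show ?thesis unfolding Krho_def mem_Collect_eq using q_pos
        by (simp only: norm_one_real) simp
    qed
    then show "- of_real (1 / q) * of_real (eps powi (- k)) \<in> level k (Krho \<rho>)"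
      unfolding level_def by (rule imageI)
    have "- complex_of_real q \<in> Krho \<rho>"
    proof -
      have "norm (1 + - complex_of_real q) = 1 - q" "norm (1 - - complex_of_real q) = 1 + q"
        unfolding norm_one_real using q1 q_pos by simp_all
      moreover have "1 - q \<le> 1 * (1 + q)" using q_pos by simp
      moreover have "1 * (1 + q) \<le> \<rho> * (1 + q)" using assms q_pos by (intro mult_right_mono) auto
      moreover have "q \<le> 1 / q" using q1 by linarith
      moreover have "1 - q \<le> \<rho> * (1 + q)" using calculation(3,4) by linarith
      ultimately show ?thesis unfolding Krho_def mem_Collect_eq using q_pos
        by (simp only: norm_one_real) simp
    qed
    moreover have "- of_real (1 / q) * of_real (eps powi (- k)) = - complex_of_real q * of_real (eps powi (- (k + 1)))"
    proof -
      have "eps powi (- (k + 1)) = eps powi (- k) / eps"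
        using eps(1) power_int_diff[of eps "- k" 1] by simp
      then have "q * eps powi (- (k + 1)) = (1 / q) * eps powi (- k)"
        using q_pos by (simp add: eps_def power2_eq_square)
      then show ?thesis by (simp only: of_real_mult[symmetric] mult_minus_left)
    qed
    ultimately show "- of_real (1 / q) * of_real (eps powi (- k)) \<in> level (k + 1) (Krho \<rho>)"
      unfolding level_def by (metis image_eqI)
  qed
  define U where "U = (\<Union>k\<in>{- int n..int n}. level k (Krho \<rho>))"
  have "connected (U \<union> level (int n + 1) (Krho \<rho>))"
  proof (rule connected_Un)
    show "U \<inter> level (int n + 1) (Krho \<rho>) \<noteq> {}" using mem[of "int n"] by (force simp: U_def)
  qed (use Suc c U_def in auto)
  then have "connected ((U \<union> level (int n + 1) (Krho \<rho>)) \<union> level (- int n - 1) (Krho \<rho>))"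
  proof (rule connected_Un)
    have "- of_real (1 / q) * of_real (eps powi (- (- int n - 1))) \<in> U"
      using mem[of "- int n - 1"] unfolding U_def by (intro UN_I[of "- int n"]) auto
    then show "(U \<union> level (int n + 1) (Krho \<rho>)) \<inter> level (- int n - 1) (Krho \<rho>) \<noteq> {}"
      using mem[of "- int n - 1"] by blast
  qed (rule c)
  moreover have "{- int (Suc n)..int (Suc n)} = {- int n..int n} \<union> {int n + 1} \<union> {- int n - 1}" by auto
  ultimately show ?case by (simp add: U_def Un_ac)
qed

lemma q_ln: "q * ln (1 / q) \<le> 1 / 1000"
proof -
  have "100 * q \<le> q * ln (1 / q)" using mult_left_mono[OF ln_q, of q] q_pos by simp
  moreover have "39 / 10 * q * ln (1 / q) \<le> c0 * ln (1 / q)"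
    using mult_right_mono[OF constants(1), of "ln (1 / q)"] ln_q by simp
  ultimately have "q * ln (1 / q) \<le> h" unfolding h_def using constants q_pos by linarith
  then show ?thesis using h_small by linarith
qed

text \<open>\<open>C\<close> is a connected set between the preimages of the balls of radius
  \<open>r\<close> and \<open>2 * r\<close>. It consists of finitely many levels, cut off at
  \<open>norm (zeta t) \<le> \<rho>\<close>.\<close>

lemma core:
  assumes r: "1 < r" "2 * r \<le> R"
  obtains C where "connected C" "C \<subseteq> Dom eps" "- 1 \<in> C" "\<And>s. s \<in> C \<Longrightarrow> norm (X s) < 2 * r"
    "\<And>s. s \<in> Dom eps \<Longrightarrow> norm (X s) < r \<Longrightarrow> s \<in> C"
proof -
  \<comment> \<open>The factor must exceed \<open>sqrt 2\<close>, which is lost in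
    \<open>zeta_bound\<close>, and stay below \<open>sqrt 3\<close>, because the height already
    contributes about \<open>r\<close> to a total of \<open>2 * r\<close>.\<close>
  define \<rho> where "\<rho> = 3 / 2 * r"
  define n where "n = nat \<lfloor>(r + h) / h\<rfloor>"
  define C where "C = (\<Union>k\<in>{- int n..int n}. level k (Krho \<rho>))"
  have rho: "1 \<le> \<rho>" "\<rho> \<le> ln (1 / q) - 10" using r ln_q by (simp_all add: \<rho>_def R_def)
  have hr: "0 \<le> (r + h) / h" using r h_pos by simp
  then have n: "int n = \<lfloor>(r + h) / h\<rfloor>" by (simp add: n_def)
  show ?thesis
  proof (rule that)
    show "connected C" unfolding C_def by (rule connected_levels[OF rho(1)])
    show "C \<subseteq> Dom eps" unfolding C_def using level_Dom Krho_iff by (auto simp: subset_iff)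
    have "- 1 \<in> Krho \<rho>" using q1 rho by (simp add: Krho_def less_imp_le)
    then have "- 1 \<in> level 0 (Krho \<rho>)" by (simp add: level_def)
    then show "- 1 \<in> C" unfolding C_def by (intro UN_I[of 0]) auto
  next
    fix s assume "s \<in> C"
    then obtain k where k: "k \<in> {- int n..int n}" "s \<in> level k (Krho \<rho>)" unfolding C_def by blast
    then obtain t where t': "t \<in> Krho \<rho>" "s = t * of_real (eps powi (- k))" unfolding level_def by blast
    then have t: "t \<in> sheet" "norm (zeta t) \<le> \<rho>" "s = t * of_real (eps powi (- k))" by (simp_all add: Krho_iff)
    have k: "\<bar>k\<bar> \<le> int n" using k by auto
    have X: "X s = pt3 (sg k * x1 t) (x2 t) (x3 t + of_int k * h)"
      using X_scale[OF sheetD(3)[OF t(1)], of k] unfolding X_def t(3) by simp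
    have "\<bar>real_of_int k\<bar> \<le> (r + h) / h" using k n of_int_floor_le[of "(r + h) / h"] by linarith
    then have "\<bar>real_of_int k * h\<bar> \<le> r + h" using h_pos(1) by (simp add: abs_mult field_simps)
    then have "\<bar>x3 t + of_int k * h\<bar> \<le> 101 / 100 * r"
      using x3_range[OF t(1) order_trans[OF t(2) rho(2)]] h_small(2) r by linarith
    then have 3: "(x3 t + of_int k * h)\<^sup>2 \<le> (101 / 100 * r)\<^sup>2" by (metis abs_ge_zero power2_abs power_mono)
    have "3 * q\<^sup>2 * norm (zeta t) \<le> 3 * q\<^sup>2 * ln (1 / q)" using t(2) rho(2) by (intro mult_left_mono) auto
    also have "\<dots> = 3 * q * (q * ln (1 / q))" by (simp add: power2_eq_square)
    also have "\<dots> \<le> 3 * q * (1 / 1000)" using q_ln q_pos by (intro mult_left_mono) auto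
    finally have "\<bar>x2 t - Im (zeta t)\<bar> \<le> 13 * q + 3 * q * (1 / 1000)" using x2_approx[OF t(1)] by linarith
    then have "\<bar>x2 t - Im (zeta t)\<bar> \<le> 1 / 10" using q_small by simp
    then have 2: "\<bar>x2 t\<bar> \<le> \<bar>Im (zeta t)\<bar> + 1 / 10" by linarith
    have "\<bar>x1 t - Re (zeta t)\<bar> \<le> 1 / 10" using x1_approx[OF t(1)] q_small by simp
    then have 1: "\<bar>x1 t\<bar> \<le> \<bar>Re (zeta t)\<bar> + 1 / 10" by linarith
    have "\<bar>sg k * x1 t\<bar>\<^sup>2 + \<bar>x2 t\<bar>\<^sup>2 \<le> (\<bar>Re (zeta t)\<bar> + 1 / 10)\<^sup>2 + (\<bar>Im (zeta t)\<bar> + 1 / 10)\<^sup>2"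
      unfolding abs_sg using 1 2 by (intro add_mono power_mono) auto
    also have "\<dots> = (norm (zeta t))\<^sup>2 + (\<bar>Re (zeta t)\<bar> + \<bar>Im (zeta t)\<bar>) / 5 + 1 / 50"
      unfolding power2_sum cmod_power2 power2_abs by (simp add: power2_eq_square)
    also have "\<dots> \<le> \<rho>\<^sup>2 + (\<rho> + \<rho>) / 5 + 1 / 50"
      using t(2) abs_Re_le_cmod[of "zeta t"] abs_Im_le_cmod[of "zeta t"] rho
      by (intro add_mono power_mono divide_right_mono) linarith+
    also have "\<dots> = 9 / 4 * r\<^sup>2 + 3 / 5 * r + 1 / 50" by (simp add: \<rho>_def power2_eq_square)
    finally have "(norm (X s))\<^sup>2 \<le> 9 / 4 * r\<^sup>2 + 3 / 5 * r + 1 / 50 + (101 / 100 * r)\<^sup>2"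
      using 3 unfolding X norm_pt3 power2_abs by linarith
    also have "\<dots> < (2 * r)\<^sup>2"
    proof -
      have "r < r\<^sup>2" "1 < r\<^sup>2" using r(1) by (simp_all add: power2_eq_square less_1_mult)
      then show ?thesis by (simp add: power_mult_distrib) (simp add: power2_eq_square)
    qed
    finally show "norm (X s) < 2 * r" using r by (intro power2_less_imp_less[of "norm (X s)"]) auto
  next
    fix s assume s: "s \<in> Dom eps" "norm (X s) < r"
    obtain k t where t: "t \<in> sheet" "norm t < 1 / q" "s = t * of_real (eps powi (- k))"
      "X s = pt3 (sg k * x1 t) (x2 t) (x3 t + of_int k * h)" using sheet_coordinates[OF s(1)] .
    have n2: "(x1 t)\<^sup>2 + (x2 t)\<^sup>2 \<le> r\<^sup>2"
    proof -
      have "(norm (X s))\<^sup>2 \<le> r\<^sup>2" using s(2) by (intro power_mono) auto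
      moreover have "(sg k * x1 t)\<^sup>2 = (x1 t)\<^sup>2" using power2_abs[of "sg k * x1 t"] by simp
      ultimately show ?thesis unfolding t(4) norm_pt3 by (smt (verit) zero_le_power2)
    qed
    have "(\<bar>x1 t\<bar> + \<bar>x2 t\<bar>)\<^sup>2 \<le> 2 * ((x1 t)\<^sup>2 + (x2 t)\<^sup>2)"
      using sum_squares_bound[of "\<bar>x1 t\<bar>" "\<bar>x2 t\<bar>"] by (simp add: power2_sum)
    also have "\<dots> \<le> (142 / 100 * r)\<^sup>2"
    proof -
      have "(142 / 100 * r)\<^sup>2 = 20164 / 10000 * r\<^sup>2" by (simp add: power2_eq_square)
      moreover have "2 * ((x1 t)\<^sup>2 + (x2 t)\<^sup>2) \<le> 20164 / 10000 * r\<^sup>2"      proof -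
        have "2 * ((x1 t)\<^sup>2 + (x2 t)\<^sup>2) \<le> 2 * r\<^sup>2" using n2 by simp
        also have "\<dots> \<le> 20164 / 10000 * r\<^sup>2" by (intro mult_right_mono) auto
        finally show ?thesis .
      qed
      ultimately show ?thesis by (simp only:)
    qed
    finally have "\<bar>x1 t\<bar> + \<bar>x2 t\<bar> \<le> 142 / 100 * r" using r by (intro power2_le_imp_le[of "\<bar>x1 t\<bar> + \<bar>x2 t\<bar>"]) auto
    moreover have "30 * q \<le> 8 / 100 * r" using q_small r by simp
    ultimately have z: "norm (zeta t) \<le> \<rho>" using zeta_bound[OF t(1)] by (simp add: \<rho>_def)
    have "\<bar>x3 t + of_int k * h\<bar> < r" using s(2) abs_le_norm_pt3(3) unfolding t(4) by (rule order_le_less_trans[rotated])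
    then have "\<bar>of_int k * h\<bar> \<le> r + h"
      using x3_range[OF t(1) order_trans[OF z rho(2)]] h_pos(1) by linarith
    then have "\<bar>real_of_int k\<bar> \<le> (r + h) / h" using h_pos(1) by (simp add: abs_mult field_simps)
    then have "\<bar>k\<bar> \<le> int n" unfolding n by linarith
    then show "s \<in> C" unfolding C_def level_def using t z
      by (intro UN_I[of k] image_eqI[of _ _ t]) (auto simp: Krho_iff)
  qed
qed

lemma small_in_T:
  assumes "1 < r" "2 * r \<le> R" "s \<in> Dom eps" "norm (X s) < r" shows "s \<in> T"
proof -
  obtain C where C: "connected C" "C \<subseteq> Dom eps" "- 1 \<in> C" "\<And>s. s \<in> C \<Longrightarrow> norm (X s) < 2 * r"
    "\<And>s. s \<in> Dom eps \<Longrightarrow> norm (X s) < r \<Longrightarrow> s \<in> C" using core[OF assms(1,2)] by metis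
  have "C \<subseteq> T0" using C(2,4) assms(2) by (fastforce simp: T0_def)
  then have "C \<subseteq> T" unfolding T_def using C by (intro connected_component_maximal) auto
  then show ?thesis using C(5) assms by blast
qed

lemma surface_same_component:
  assumes r: "1 < r" "2 * r \<le> R" and p: "p \<in> surface \<inter> ball 0 r" "p' \<in> surface \<inter> ball 0 r"
  shows "\<exists>C\<in>components (surface \<inter> ball 0 (2 * r)). p \<in> C \<and> p' \<in> C"
proof -
  obtain C where C: "connected C" "C \<subseteq> Dom eps" "- 1 \<in> C" "\<And>s. s \<in> C \<Longrightarrow> norm (X s) < 2 * r"
    "\<And>s. s \<in> Dom eps \<Longrightarrow> norm (X s) < r \<Longrightarrow> s \<in> C" using core[OF r] by metis
  have "C \<subseteq> T0" using C(2,4) r(2) by (fastforce simp: T0_def)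
  then have "C \<subseteq> T" unfolding T_def using C by (intro connected_component_maximal) auto
  then have sub: "X ` C \<subseteq> surface \<inter> ball 0 (2 * r)" using C(4) by (auto simp: surface_def)
  have con: "connected (X ` C)" using X_continuous C by (meson connected_continuous_image continuous_on_subset)
  have mem: "p \<in> X ` C" "p' \<in> X ` C" using p C(5) T_Dom by (auto simp: surface_def)
  define D where "D = connected_component_set (surface \<inter> ball 0 (2 * r)) p"
  have "X ` C \<subseteq> D" unfolding D_def by (rule connected_component_maximal[OF mem(1) con sub])
  moreover have "D \<in> components (surface \<inter> ball 0 (2 * r))" using sub mem by (auto simp: components_def D_def)
  ultimately show ?thesis using mem by blast
qed

end

section \<open>Heights, waists and intrinsic distances\<close>

text \<open>The intermediate value theorem is applied repeatedly to the remaining interval, so the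
  crossing times come in order.\<close>

lemma continuous_crossings:
  fixes f :: "real \<Rightarrow> real"
  assumes "continuous_on {0..1} f" "f 0 \<le> c 0" "\<And>k. k < n \<Longrightarrow> c k \<le> c (Suc k)" "c n \<le> f 1"
  shows "\<exists>t. (\<forall>k\<le>n. 0 \<le> t k \<and> t k \<le> 1 \<and> f (t k) = c k) \<and> (\<forall>k<n. t k \<le> t (Suc k))"
  using assms(3,4)
proof (induction n)
  case 0
  obtain x where "0 \<le> x" "x \<le> 1" "f x = c 0"
    using IVT'[of f 0 "c 0" 1] assms(1,2) 0 by auto
  then show ?case by (intro exI[of _ "\<lambda>_. x"]) auto
next
  case (Suc n)
  have "c n \<le> f 1" using Suc.prems(1)[of n] Suc.prems(2) by simp
  then obtain t where t: "\<And>k. k \<le> n \<Longrightarrow> 0 \<le> t k \<and> t k \<le> 1 \<and> f (t k) = c k" "\<And>k. k < n \<Longrightarrow> t k \<le> t (Suc k)"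
    using Suc.IH Suc.prems(1) by (metis less_SucI)
  have "continuous_on {t n..1} f" using assms(1) t(1)[of n] by (auto intro: continuous_on_subset)
  then obtain x where x: "t n \<le> x" "x \<le> 1" "f x = c (Suc n)"
    using IVT'[of f "t n" "c (Suc n)" 1] t(1)[of n] Suc.prems by auto
  show ?case
  proof (intro exI[of _ "t(Suc n := x)"] conjI allI impI)
    fix k assume "k \<le> Suc n"
    then show "0 \<le> (t(Suc n := x)) k" "(t(Suc n := x)) k \<le> 1" "f ((t(Suc n := x)) k) = c k"
      using t(1)[of k] t(1)[of n] x by (cases "k = Suc n"; force)+
  next
    fix k assume "k < Suc n"
    then show "(t(Suc n := x)) k \<le> (t(Suc n := x)) (Suc k)" using t(2)[of k] x(1) by (cases "k = n") auto
  qed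
qed

lemma curve_length_ge:
  assumes "\<forall>k\<le>n. 0 \<le> t k \<and> t k \<le> 1" "\<forall>k<n. t k \<le> t (Suc k)" "\<And>k. k < n \<Longrightarrow> d \<le> dist (g (t (Suc k))) (g (t k))"
  shows "ereal (real n * d) \<le> curve_length g"
proof -
  \<comment> \<open>The times \<open>t\<close> shifted by one and padded with the endpoints 0 and 1,
    which partitions in \<open>curve_length\<close> must contain.\<close>
  define u where "u j = (if j = 0 then 0 else if j \<le> Suc n then t (j - 1) else 1)" for j
  have u: "u 0 = 0" "u (Suc (Suc n)) = 1" by (simp_all add: u_def)
  have mono: "u k \<le> u (Suc k)" if k: "k < Suc (Suc n)" for k
  proof (cases k)
    case 0 then show ?thesis using assms(1) by (simp add: u_def)
  next
    case (Suc j)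
    show ?thesis
    proof (cases "j < n")
      case True then show ?thesis using assms(2) Suc by (simp add: u_def)
    next
      case False then show ?thesis using assms(1) Suc k by (simp add: u_def)
    qed
  qed
  have "real n * d = (\<Sum>k<n. d)" by simp
  also have "\<dots> \<le> (\<Sum>k<n. dist (g (t (Suc k))) (g (t k)))" by (intro sum_mono assms(3)) auto
  also have "\<dots> = (\<Sum>k<n. dist (g (u (Suc (Suc k)))) (g (u (Suc k))))"
    by (intro sum.cong) (auto simp: u_def)
  also have "\<dots> = (\<Sum>k\<in>Suc ` {..<n}. dist (g (u (Suc k))) (g (u k)))"
    by (simp add: sum.reindex)
  also have "\<dots> \<le> (\<Sum>k<Suc (Suc n). dist (g (u (Suc k))) (g (u k)))"
    by (intro sum_mono2) auto
  finally have "ereal (real n * d) \<le> ereal (\<Sum>k<Suc (Suc n). dist (g (u (Suc k))) (g (u k)))" by simp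
  also have "\<dots> \<le> curve_length g"
    unfolding curve_length_def using u mono by (intro SUP_upper2[of "(Suc (Suc n), u)"]) auto
  finally show ?thesis .
qed

context neck_stack
begin

lemma surface_coordinates:
  assumes "p \<in> surface"
  obtains k t where "t \<in> sheet" "norm t < 1 / q" "norm (zeta t) \<le> ln (1 / q) - 10"
    "p = pt3 (sg k * x1 t) (x2 t) (x3 t + of_int k * h)"
proof -
  obtain s where s: "s \<in> T" "p = X s" using assms by (auto simp: surface_def)
  then have D: "s \<in> Dom eps" "norm (X s) < R" using T(3) by (auto simp: T0_def)
  obtain k t where t: "t \<in> sheet" "norm t < 1 / q" "s = t * of_real (eps powi (- k))"
    "X s = pt3 (sg k * x1 t) (x2 t) (x3 t + of_int k * h)" using sheet_coordinates[OF D(1)] .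
  have "norm (zeta t) \<le> ln (1 / q) - 10"     using X_small_zeta(1)[OF t(1), of k "x3 t + of_int k * h"] D(2) unfolding t(4) by simp
  with t s(2) that show ?thesis by metis
qed

lemma sg_Suc: "sg (j + int (Suc i)) = - sg (j + int i)"
  by (simp add: sg_def)

text \<open>At this height the level is \<open>k\<close> and the point lies at the bottom of its
  slab, hence on the waist \<open>norm t = q\<close>. There \<open>zeta t\<close> is within
  \<open>4 * q\<close> of 1, and the sign \<open>sg k\<close> places the waist alternately at the
  two lines.\<close>

lemma waist_position:
  fixes p :: "real^3"
  assumes "p \<in> surface" "p $ 3 = (of_int k - 1 / 2) * h"
  shows "\<bar>p $ 1 - sg k\<bar> \<le> 20 * q" "\<bar>p $ 2\<bar> \<le> 20 * q"
proof -
  obtain j t where t: "t \<in> sheet" "norm t < 1 / q" "norm (zeta t) \<le> ln (1 / q) - 10"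
    "p = pt3 (sg j * x1 t) (x2 t) (x3 t + of_int j * h)" using surface_coordinates[OF assms(1)] .
  have eq: "x3 t + of_int j * h = (of_int k - 1 / 2) * h" using assms(2) unfolding t(4) by simp
  have kj: "k = j"
  proof (rule height_unique[of k "(of_int k - 1 / 2) * h" j])
    show "(of_int k - 1 / 2) * h < (of_int k + 1 / 2) * h" using h_pos(1) by simp
  qed (use height_interval[OF t(1-3), of j] eq in auto)
  then have "x3 t = - h / 2" using eq by (simp add: algebra_simps)
  then have "norm t = q" using x3_greater_bottom[OF t(1) _ t(3)] sheetD(8)[OF t(1)] by (cases "norm t = q") auto
  then have n: "norm t \<le> q" by simp
  have "zeta t - 1 = 2 * t / (1 - t)" using sheetD(2)[OF t(1)] by (simp add: zeta_eq field_simps)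
  then have z: "norm (zeta t - 1) = 2 * norm t / norm (1 - t)" by (simp add: norm_divide norm_mult)
  have "norm (1 - t) \<ge> 1 / 2" using norm_triangle_ineq2[of 1 t] n q_small by simp
  then have "2 * norm t / norm (1 - t) \<le> 2 * q / (1 / 2)" using n q_pos by (intro frac_le) auto
  then have z4: "norm (zeta t - 1) \<le> 4 * q" using z by simp
  have "norm (zeta t) \<le> 2" using norm_triangle_ineq2[of "zeta t" 1] z4 q_small by simp
  then have "3 * q\<^sup>2 * norm (zeta t) \<le> 3 * q\<^sup>2 * 2" by (intro mult_left_mono) auto
  moreover have "3 * q\<^sup>2 * 2 \<le> q" using eps(8) q_pos by (simp add: eps_def)
  moreover have "Re (zeta t - 1) = Re (zeta t) - 1" "Im (zeta t - 1) = Im (zeta t)" by simp_all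
  moreover have "\<bar>Re (zeta t - 1)\<bar> \<le> 4 * q" "\<bar>Im (zeta t - 1)\<bar> \<le> 4 * q"
    using z4 abs_Re_le_cmod abs_Im_le_cmod order_trans by blast+
  ultimately have *: "\<bar>x1 t - 1\<bar> \<le> 20 * q" "\<bar>x2 t\<bar> \<le> 20 * q"
    using x1_approx[OF t(1)] x2_approx[OF t(1)] q_pos by linarith+
  have "p $ 1 - sg k = sg k * (x1 t - 1)" unfolding t(4) kj by (simp add: algebra_simps)
  then show "\<bar>p $ 1 - sg k\<bar> \<le> 20 * q" using * by simp
  show "\<bar>p $ 2\<bar> \<le> 20 * q" using * unfolding t(4) by simp
qed

text \<open>The curve meets \<open>n + 1\<close> consecutive waists in order, and neighbouring
  waists lie near different lines, at distance at least \<open>2 - 40 * q\<close> by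
  \<open>waist_position\<close>.\<close>

lemma curve_length_ge_height:
  fixes p p' :: "real^3" and g :: "real \<Rightarrow> real^3"
  assumes p: "p \<in> surface" "p' \<in> surface" and le: "p $ 3 + real n * h + h \<le> p' $ 3"
    and g: "path g" "path_image g \<subseteq> surface" "{pathstart g, pathfinish g} = {p, p'}"
  shows "ereal (real n / 2) \<le> curve_length g"
proof -
  define f where "f x = g x $ 3" for x
  \<comment> \<open>The first waist at or above \<open>p\<close>. Reaching it may use up almost a
    full period, which explains the additional \<open>h\<close> in the hypothesis.\<close>
  define j where "j = \<lceil>p $ 3 / h + 1 / 2\<rceil>"
  have j: "p $ 3 / h + 1 / 2 \<le> of_int j" "of_int j < p $ 3 / h + 3 / 2" unfolding j_def by linarith+
  have jh: "p $ 3 \<le> (of_int j - 1 / 2) * h" "(of_int j - 1 / 2) * h < p $ 3 + h"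
  proof -
    have "p $ 3 / h \<le> of_int j - 1 / 2" "of_int j - 1 / 2 < p $ 3 / h + 1" using j by linarith+
    then have "p $ 3 / h * h \<le> (of_int j - 1 / 2) * h" "(of_int j - 1 / 2) * h < (p $ 3 / h + 1) * h"
      using h_pos(1) by (intro mult_right_mono mult_strict_right_mono; simp)+
    then show "p $ 3 \<le> (of_int j - 1 / 2) * h" "(of_int j - 1 / 2) * h < p $ 3 + h"
      using h_pos(1) by (simp_all add: distrib_right)
  qed
  define c where "c k = (of_int (j + int k) - 1 / 2) * h" for k
  have c: "c k = (of_int j - 1 / 2) * h + real k * h" for k by (simp add: c_def algebra_simps)
  have cf: "continuous_on {0..1} (\<lambda>x. g x $ 3)" using g(1) unfolding path_def by (intro continuous_intros)
  have ends: "g 0 = p \<and> g 1 = p' \<or> g 0 = p' \<and> g 1 = p" using g(3) by (auto simp: pathstart_def pathfinish_def doubleton_eq_iff)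
  have cs: "c k \<le> c (Suc k)" for k using h_pos(1) by (simp add: c algebra_simps)
  have bounds: "p $ 3 \<le> c 0" "c n \<le> p' $ 3" using jh le by (simp_all add: c)
  have main: "ereal (real n * (1 - 40 * q)) \<le> curve_length g"
  proof (cases "g 0 = p \<and> g 1 = p'")
    case True
    obtain t where t: "\<forall>k\<le>n. 0 \<le> t k \<and> t k \<le> 1 \<and> g (t k) $ 3 = c k" "\<forall>k<n. t k \<le> t (Suc k)"
      using continuous_crossings[OF cf, of c n] cs bounds True by auto
    show ?thesis
    proof (rule curve_length_ge[where t = t])
      fix k assume k: "k < n"
      have w: "\<bar>g (t i) $ 1 - sg (j + int i)\<bar> \<le> 20 * q" if "i \<le> n" for i
      proof (rule waist_position(1))
        show "g (t i) \<in> surface" using t(1) that g(2) by (auto simp: path_image_def)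
        show "g (t i) $ 3 = (real_of_int (j + int i) - 1 / 2) * h" using t(1) that by (simp add: c_def)
      qed
      have "sg (j + int (Suc k)) = - sg (j + int k)" by (simp add: sg_def)
      then have "1 - 40 * q \<le> \<bar>g (t (Suc k)) $ 1 - g (t k) $ 1\<bar>"
        using w[of k] w[of "Suc k"] k by (auto simp: sg_def split: if_splits)
      also have "\<dots> \<le> dist (g (t (Suc k))) (g (t k))"
        using component_le_norm_cart[of "g (t (Suc k)) - g (t k)" 1] by (simp add: dist_norm)
      finally show "1 - 40 * q \<le> dist (g (t (Suc k))) (g (t k))" .
    qed (use t in auto)
  next
    case False
    then have F: "g 0 = p'" "g 1 = p" using ends by auto
    \<comment> \<open>The curve descends here, so the same crossings are listed in reverse for the
      negated height.\<close>
    define c' where "c' k = - c (n - k)" for k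
    obtain t where t: "\<forall>k\<le>n. 0 \<le> t k \<and> t k \<le> 1 \<and> - (g (t k) $ 3) = c' k" "\<forall>k<n. t k \<le> t (Suc k)"
    proof -
      have "c' k \<le> c' (Suc k)" if "k < n" for k
        using cs[of "n - Suc k"] that by (simp add: c'_def Suc_diff_Suc)
      moreover have "continuous_on {0..1} (\<lambda>x. - (g x $ 3))" using cf by (rule continuous_on_minus)
      ultimately show ?thesis
        using continuous_crossings[of "\<lambda>x. - (g x $ 3)" c' n] bounds F that by (auto simp: c'_def)
    qed
    show ?thesis
    proof (rule curve_length_ge[where t = t])
      fix k assume k: "k < n"
      have w: "\<bar>g (t i) $ 1 - sg (j + int (n - i))\<bar> \<le> 20 * q" if "i \<le> n" for i
      proof (rule waist_position(1))
        show "g (t i) \<in> surface" using t(1) that g(2) by (auto simp: path_image_def)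
        show "g (t i) $ 3 = (real_of_int (j + int (n - i)) - 1 / 2) * h" using t(1) that by (auto simp: c_def c'_def)
      qed
      have "n - k = Suc (n - Suc k)" using k by simp
      then have "sg (j + int (n - k)) = - sg (j + int (n - Suc k))" by (simp only: sg_Suc)
      then have "1 - 40 * q \<le> \<bar>g (t (Suc k)) $ 1 - g (t k) $ 1\<bar>"
        using w[of k] w[of "Suc k"] k by (auto simp: sg_def split: if_splits)
      also have "\<dots> \<le> dist (g (t (Suc k))) (g (t k))"
        using component_le_norm_cart[of "g (t (Suc k)) - g (t k)" 1] by (simp add: dist_norm)
      finally show "1 - 40 * q \<le> dist (g (t (Suc k))) (g (t k))" .
    qed (use t in auto)
  qed
  have "real n * (1 / 2) \<le> real n * (1 - 40 * q)" using q_small by (intro mult_left_mono) auto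
  then have "ereal (real n / 2) \<le> ereal (real n * (1 - 40 * q))" by simp
  then show ?thesis using main by (rule order_trans)
qed

lemma intrinsic_dist_ge:
  fixes p p' :: "real^3"
  assumes "p \<in> surface" "p' \<in> surface" "real n * h + h \<le> \<bar>p $ 3 - p' $ 3\<bar>"
  shows "ereal (real n / 2) \<le> intrinsic_dist surface p' p"
  unfolding intrinsic_dist_def
proof (rule INF_greatest)
  fix g assume g: "g \<in> {g. path g \<and> path_image g \<subseteq> surface \<and> pathstart g = p' \<and> pathfinish g = p}"
  show "ereal (real n / 2) \<le> curve_length g"
  proof (cases "p $ 3 \<le> p' $ 3")
    case True
    show ?thesis by (rule curve_length_ge_height[OF assms(1,2)]) (use True assms(3) g in auto)
  next
    case False
    show ?thesis by (rule curve_length_ge_height[OF assms(2,1)]) (use False assms(3) g in auto)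
  qed
qed

end

section \<open>Graphs away from the axes\<close>

text \<open>From \<open>zeta s + 1 = 2 / (1 - s)\<close> and
  \<open>zeta s - 1 = 2 * s / (1 - s)\<close>: distance from the two neck positions keeps
  \<open>s\<close> away from infinity and from 0.\<close>

lemma zeta_pm1:
  assumes "s \<noteq> 1" "0 < d" "d \<le> norm (zeta s + 1)" "d \<le> norm (zeta s - 1)"
  shows "s \<noteq> 0" "norm (1 - s) \<le> 2 / d" "norm s \<le> 1 + 2 / d" "norm (1 / s) \<le> 1 + 2 / d"
proof -
  have n: "norm (1 - s) > 0" using assms(1) by simp
  have z: "zeta s + 1 = 2 / (1 - s)" "zeta s - 1 = 2 * s / (1 - s)"
    using assms(1) by (simp_all add: zeta_def field_simps)
  show s0: "s \<noteq> 0" using assms(2,4) z(2) by auto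
  have "d * norm (1 - s) \<le> 2" using assms(3) n unfolding z(1) norm_divide by (simp add: pos_le_divide_eq)
  then show a: "norm (1 - s) \<le> 2 / d" using assms(2) by (simp add: field_simps)
  show "norm s \<le> 1 + 2 / d" using norm_triangle_ineq4[of 1 "1 - s"] a by simp
  have "d * norm (1 - s) \<le> 2 * norm s"
    using assms(4) n unfolding z(2) norm_divide norm_mult by (simp add: pos_le_divide_eq)
  then have "norm (1 - s) / norm s \<le> 2 / d" using assms(2) s0 by (simp add: field_simps)
  moreover have "1 / s = 1 + (1 - s) / s" using s0 by (simp add: field_simps)
  ultimately show "norm (1 / s) \<le> 1 + 2 / d"
    using norm_triangle_ineq[of 1 "(1 - s) / s"] by (simp add: norm_divide)
qed

definition axes :: "(real^3) set" where
  "axes = {x. proj12 x = (1, 0)} \<union> {x. proj12 x = (- 1, 0)}"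

lemma tubeI:
  fixes p :: "real^3"
  assumes "\<sigma> = 1 \<or> \<sigma> = - 1" "\<bar>p $ 1 - \<sigma>\<bar> + \<bar>p $ 2\<bar> < d"
  shows "p \<in> tube axes d"
proof -
  have "norm (pt3 \<sigma> 0 (p $ 3) - p) \<le> (\<Sum>i\<in>UNIV. \<bar>(pt3 \<sigma> 0 (p $ 3) - p) $ i\<bar>)"
    by (rule norm_le_l1_cart)
  also have "\<dots> < d" using assms(2) by (simp add: sum_3 abs_minus_commute)
  finally have "p \<in> ball (pt3 \<sigma> 0 (p $ 3)) d" by (simp add: dist_norm)
  moreover have "pt3 \<sigma> 0 (p $ 3) \<in> axes" using assms(1) by (auto simp: axes_def proj12_def)
  ultimately show ?thesis unfolding tube_def by blast
qed

context neck_stack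
begin

lemma q2_zeta: "norm (zeta t) \<le> ln (1 / q) \<Longrightarrow> 3 * q\<^sup>2 * norm (zeta t) \<le> q"
proof -
  assume "norm (zeta t) \<le> ln (1 / q)"
  then have "3 * q\<^sup>2 * norm (zeta t) \<le> 3 * q\<^sup>2 * ln (1 / q)" by (intro mult_left_mono) auto
  also have "\<dots> = 3 * q * (q * ln (1 / q))" by (simp add: power2_eq_square)
  also have "\<dots> \<le> 3 * q * (1 / 1000)" using q_ln q_pos by (intro mult_left_mono) auto
  finally have "3 * q\<^sup>2 * norm (zeta t) \<le> 3 * q * (1 / 1000)" .
  then show ?thesis using q_pos by linarith
qed

lemma proj_approx:
  assumes "t \<in> sheet" "norm (zeta t) \<le> ln (1 / q)"
  shows "\<bar>x1 t - Re (zeta t)\<bar> + \<bar>x2 t - Im (zeta t)\<bar> \<le> 27 * q"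
  using x1_approx[OF assms(1)] x2_approx[OF assms(1)] q2_zeta[OF assms(2)] by linarith

text \<open>All surface points at a waist height lie in the tube, so a component of the rest cannot
  change its level. On one level the points off the tube have parameters in \<open>mid\<close>,
  where the projection is injective.\<close>

lemma graph_components:
  assumes e: "0 < d" "1 + 8 / d \<le> 1 / (20 * q)"
    and C: "C \<in> components ((surface \<inter> ball 0 R) - tube axes d)"
  shows "inj_on proj12 C"
proof (rule inj_onI)
  fix p p' assume p: "p \<in> C" "p' \<in> C" and eq: "proj12 p = proj12 p'"
  have Csub: "C \<subseteq> surface" "C \<inter> tube axes d = {}" using in_components_subset[OF C] by auto
  have conC: "connected C" using in_components_connected[OF C] .
  have dq: "160 * q \<le> d"
  proof -
    have "8 / d \<le> 1 / (20 * q)" using e by linarith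
    then show ?thesis using e(1) q_pos by (simp add: field_simps)
  qed
  have avoid: "x $ 3 \<noteq> (of_int k - 1 / 2) * h" if "x \<in> C" for x :: "real^3" and k
  proof
    assume x: "x $ 3 = (of_int k - 1 / 2) * h"
    have "\<bar>x $ 1 - sg k\<bar> + \<bar>x $ 2\<bar> < d" using waist_position[OF _ x] that Csub dq q_pos by force
    moreover have "sg k = 1 \<or> sg k = - 1" by (simp add: sg_def)
    ultimately have "x \<in> tube axes d" by (rule tubeI[rotated])
    then show False using that Csub by blast
  qed
  obtain k t where t: "t \<in> sheet" "norm t < 1 / q" "norm (zeta t) \<le> ln (1 / q) - 10"
    "p = pt3 (sg k * x1 t) (x2 t) (x3 t + of_int k * h)" using surface_coordinates p Csub by blast
  obtain k' t' where t': "t' \<in> sheet" "norm t' < 1 / q" "norm (zeta t') \<le> ln (1 / q) - 10"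
    "p' = pt3 (sg k' * x1 t') (x2 t') (x3 t' + of_int k' * h)" using surface_coordinates p Csub by blast
  have con3: "connected ((\<lambda>x. x $ 3) ` C)" by (intro connected_continuous_image continuous_intros conC)
  have step: False if "x \<in> C" "y \<in> C" "x $ 3 < (of_int i + 1 / 2) * h" "(of_int j - 1 / 2) * h \<le> y $ 3" "i < j" for x y :: "real^3" and i j
  proof -
    have "(of_int i + 1 / 2) * h \<le> (of_int j - 1 / 2) * h" using that(5) h_pos(1) by (intro mult_right_mono) linarith+
    then have "(of_int i + 1 / 2) * h \<in> (\<lambda>x. x $ 3) ` C"
      using connectedD_interval[OF con3, of "x $ 3" "y $ 3" "(of_int i + 1 / 2) * h"] that by force
  then obtain z :: "real^3" where "z \<in> C" "z $ 3 = (of_int (i + 1) - 1 / 2) * h" by (auto simp: algebra_simps)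
    then show False using avoid by blast
  qed
  note hi = height_interval[OF t(1-3), of k] and hi' = height_interval[OF t'(1-3), of k']
  have p3: "p $ 3 = x3 t + of_int k * h" "p' $ 3 = x3 t' + of_int k' * h" unfolding t(4) t'(4) by simp_all
  have levels: "k = k'"
    using step[OF p, of k k'] step[OF p(2,1), of k' k] hi hi' p3 by (cases k k' rule: linorder_cases) auto
  have mid: "t \<in> mid" if t: "t \<in> sheet" "norm (zeta t) \<le> ln (1 / q) - 10"
    "pt3 (sg k * x1 t) (x2 t) z \<in> C" for t k z
  proof -
    define P where "P = pt3 (sg k * x1 t) (x2 t) z"
    have out: "d \<le> \<bar>P $ 1 - \<sigma>\<bar> + \<bar>P $ 2\<bar>" if "\<sigma> = 1 \<or> \<sigma> = - 1" for \<sigma>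
      using tubeI[OF that, of P d] t(3) Csub by (force simp: P_def)
    have o: "d \<le> \<bar>x1 t - 1\<bar> + \<bar>x2 t\<bar>" "d \<le> \<bar>x1 t + 1\<bar> + \<bar>x2 t\<bar>"
      using out[of 1] out[of "- 1"] by (auto simp: P_def sg_def split: if_splits)
    have a: "\<bar>x1 t - Re (zeta t)\<bar> + \<bar>x2 t - Im (zeta t)\<bar> \<le> 27 * q" using proj_approx t by simp
    \<comment> \<open>Half of \<open>d\<close> absorbs the projection error, and passing from the
      sum of two absolute values to the modulus halves again; \<open>2 / (d / 4)\<close> is the
      \<open>8 / d\<close> of the hypothesis.\<close>
    have "\<bar>Re (zeta t - 1)\<bar> + \<bar>Im (zeta t - 1)\<bar> \<ge> d / 2" "\<bar>Re (zeta t + 1)\<bar> + \<bar>Im (zeta t + 1)\<bar> \<ge> d / 2"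
      using o a dq q_pos unfolding minus_complex.simps plus_complex.simps one_complex.simps by linarith+
    then have z: "d / 4 \<le> norm (zeta t + 1)" "d / 4 \<le> norm (zeta t - 1)"
      using abs_Re_le_cmod[of "zeta t - 1"] abs_Im_le_cmod[of "zeta t - 1"]
        abs_Re_le_cmod[of "zeta t + 1"] abs_Im_le_cmod[of "zeta t + 1"] by linarith+
    show "t \<in> mid"
      using zeta_pm1[OF sheetD(2)[OF t(1)] _ z] e sheetD(1,2)[OF t(1)] unfolding mid_def by auto
  qed
  have "t \<in> mid" "t' \<in> mid" using mid[OF t(1,3)] mid[OF t'(1,3)] p unfolding t(4) t'(4) by auto
  moreover have "x1 t = x1 t'" "x2 t = x2 t'"
    using eq levels unfolding t(4) t'(4) by (auto simp: proj12_def sg_def split: if_splits)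
  ultimately have "t = t'" by (rule mid_proj_inj)
  then show "p = p'" unfolding t(4) t'(4) levels by simp
qed

end

section \<open>Charts near a point off the axes\<close>

definition nbh :: "complex \<Rightarrow> real \<Rightarrow> complex set" where "nbh \<omega> r = {s. s \<noteq> 1 \<and> norm (zeta s - \<omega>) < 3 * r}"
text \<open>Nested radii: the graphs are taken over the disc of radius \<open>r\<close>, their
  parameters lie in the compact \<open>nbK\<close>, and the estimates hold on the larger open
  \<open>nbh\<close>, so that convergence on compact subsets applies.\<close>

definition nbK :: "complex \<Rightarrow> real \<Rightarrow> complex set" where "nbK \<omega> r = {s. s \<noteq> 1 \<and> norm (zeta s - \<omega>) \<le> 2 * r}"

lemma zeta_continuous: "continuous_on (- {1}) zeta"
  unfolding zeta_def[abs_def] by (intro continuous_intros) auto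

lemma open_nbh: "open (nbh \<omega> r)"
proof -
  have "open ((- {1}) \<inter> zeta -` ball \<omega> (3 * r))"
    by (intro continuous_open_preimage zeta_continuous) auto
  moreover have "nbh \<omega> r = (- {1}) \<inter> zeta -` ball \<omega> (3 * r)" by (auto simp: nbh_def dist_norm norm_minus_commute)
  ultimately show ?thesis by simp
qed

definition unzeta :: "complex \<Rightarrow> complex" where "unzeta w = (w - 1) / (w + 1)"

lemma zeta_unzeta: "w \<noteq> - 1 \<Longrightarrow> unzeta w \<noteq> 1 \<and> zeta (unzeta w) = w"
proof -
  assume "w \<noteq> - 1"
  then have w: "w + 1 \<noteq> 0" by (simp add: eq_neg_iff_add_eq_0)
  have a: "1 - unzeta w = 2 / (w + 1)" "1 + unzeta w = 2 * w / (w + 1)" unfolding unzeta_def using w by (simp_all add: field_simps)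
  have "1 - unzeta w \<noteq> 0" unfolding a using w by simp
  moreover have "zeta (unzeta w) = w" unfolding zeta_def a using w by simp
  ultimately show ?thesis by auto
qed

lemma unzeta_zeta: "s \<noteq> 1 \<Longrightarrow> unzeta (zeta s) = s"
  using zeta_inj[of "unzeta (zeta s)" s] zeta_unzeta[of "zeta s"] by (force simp: zeta_eq)

text \<open>The margin \<open>4 * r\<close> leaves distance \<open>r\<close> from both neck
  positions after the radius \<open>3 * r\<close> of \<open>nbh\<close>.\<close>

locale off_axis =
  fixes \<omega> :: complex and r :: real
  assumes r: "0 < r" "r \<le> 1" and far: "4 * r \<le> norm (\<omega> - 1)" "4 * r \<le> norm (\<omega> + 1)"
begin

text \<open>On \<open>nbh\<close>, \<open>M\<close> bounds \<open>s\<close> and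
  \<open>1 / s\<close>, and \<open>V / 4\<close> bounds \<open>koebe\<close>. Neither depends on
  \<open>q\<close>, which makes the estimates uniform along the sequence.\<close>

definition "M = 1 + 2 / r"
definition "V = (norm \<omega> + 3)\<^sup>2 + 1"

lemma nbK_nbh: "nbK \<omega> r \<subseteq> nbh \<omega> r" using r by (auto simp: nbh_def nbK_def)

lemma compact_nbK: "compact (nbK \<omega> r)"
proof -
  have ne: "w \<noteq> - 1" if "w \<in> cball \<omega> (2 * r)" for w
    using that far(2) r by (auto simp: dist_norm norm_minus_commute add.commute)
  then have ne': "w + 1 \<noteq> 0" if "w \<in> cball \<omega> (2 * r)" for w using that eq_neg_iff_add_eq_0[of w 1] by blast
  have "nbK \<omega> r = unzeta ` cball \<omega> (2 * r)"
  proof (intro set_eqI iffI)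
    fix s assume "s \<in> nbK \<omega> r"
    then show "s \<in> unzeta ` cball \<omega> (2 * r)"
      using unzeta_zeta[of s] by (intro image_eqI[of _ _ "zeta s"]) (auto simp: nbK_def dist_norm norm_minus_commute)
  next
    fix s assume "s \<in> unzeta ` cball \<omega> (2 * r)"
    then show "s \<in> nbK \<omega> r" using zeta_unzeta ne by (auto simp: nbK_def dist_norm norm_minus_commute)
  qed
  moreover have "continuous_on (cball \<omega> (2 * r)) unzeta"
    unfolding unzeta_def[abs_def] using ne' by (intro continuous_intros) auto
  ultimately show ?thesis by (metis compact_cball compact_continuous_image)
qed

text \<open>The identity \<open>koebe s = (zeta s + 1) * (zeta s - 1) / 4\<close> turns distances
  from the neck positions into a lower bound.\<close>

lemma nbhD:
  assumes "s \<in> nbh \<omega> r"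
  shows "s \<noteq> 1" "s \<noteq> 0" "norm s \<le> M" "norm (1 / s) \<le> M" "r\<^sup>2 / 4 \<le> norm (koebe s)" "norm (koebe s) \<le> V / 4" "norm (zeta s) \<le> norm \<omega> + 3"
proof -
  have s: "s \<noteq> 1" "norm (zeta s - \<omega>) < 3 * r" using assms by (auto simp: nbh_def)
  show "s \<noteq> 1" by fact
  have z: "r \<le> norm (zeta s + 1)" "r \<le> norm (zeta s - 1)"
    using norm_triangle_ineq4[of "zeta s + 1" "zeta s - \<omega>"] norm_triangle_ineq4[of "zeta s - 1" "zeta s - \<omega>"] far s(2)
    by (simp_all add: algebra_simps)
  show "s \<noteq> 0" "norm s \<le> M" "norm (1 / s) \<le> M" using zeta_pm1[OF s(1) r(1) z] by (simp_all add: M_def)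
  show zb: "norm (zeta s) \<le> norm \<omega> + 3" using norm_triangle_ineq[of "zeta s - \<omega>" \<omega>] s(2) r by simp
  have n: "s - 1 \<noteq> 0" "1 - s \<noteq> 0" using s by auto
  have v: "koebe s = (zeta s + 1) * (zeta s - 1) / 4"
  proof -
    have "zeta s + 1 = 2 / (1 - s)" "zeta s - 1 = 2 * s / (1 - s)"
      using s(1) by (simp_all add: zeta_def field_simps)
    moreover have "(s - 1)\<^sup>2 = (1 - s) * (1 - s)" by (simp add: power2_eq_square algebra_simps)
    ultimately show ?thesis by (simp add: koebe_def)
  qed
  have "r * r \<le> norm (zeta s + 1) * norm (zeta s - 1)" using z r by (intro mult_mono) auto
  then show "r\<^sup>2 / 4 \<le> norm (koebe s)" unfolding v norm_divide norm_mult norm_numeral power2_eq_square by linarith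
  have "koebe s = ((zeta s)\<^sup>2 - 1) / 4" unfolding v by (simp add: power2_eq_square algebra_simps)
  then have "norm (koebe s) = norm ((zeta s)\<^sup>2 - 1) / 4" by (simp only: norm_divide norm_numeral)
  also have "\<dots> \<le> ((norm (zeta s))\<^sup>2 + 1) / 4"
    using norm_triangle_ineq4[of "(zeta s)\<^sup>2" 1] by (simp add: norm_power)
  also have "\<dots> \<le> V / 4" unfolding V_def using zb by (intro divide_right_mono add_right_mono power_mono) auto
  finally show "norm (koebe s) \<le> V / 4" .
qed

lemma M_ge: "1 \<le> M" "0 < M" and V_ge: "1 \<le> V" using r by (simp_all add: M_def V_def add_pos_pos)

end

text \<open>Smallness of \<open>q\<close> relative to fixed \<open>\<omega>\<close> and
  \<open>r\<close>: \<open>q_M\<close> places \<open>nbh\<close> inside \<open>mid\<close>,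
  \<open>q_V\<close> protects the Jacobian, and \<open>q_ln_omega\<close> keeps \<open>zeta\<close>
  in the range where heights are controlled.\<close>

locale off_axis_stack = neck_stack + off_axis +
  assumes q_M: "M \<le> 1 / (20 * q)" and q_V: "(10 * V + 1) * q \<le> r ^ 4 / 32"
    and q_ln_omega: "norm \<omega> + 15 \<le> ln (1 / q)"
begin

lemma q_r: "40 * q \<le> r"
proof -
  have "2 / r \<le> 1 / (20 * q)" using q_M by (simp add: M_def)
  then show ?thesis using r q_pos by (simp add: field_simps)
qed

lemma nbh_mid: "s \<in> nbh \<omega> r \<Longrightarrow> s \<in> mid"
  using nbhD[of s] q_M unfolding mid_def by auto

lemma nbh_sheet: "s \<in> nbh \<omega> r \<Longrightarrow> s \<in> sheet" using nbh_mid mid_sheet by blast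

lemma nbh_approx: "s \<in> nbh \<omega> r \<Longrightarrow> \<bar>x1 s - Re (zeta s)\<bar> + \<bar>x2 s - Im (zeta s)\<bar> \<le> 27 * q"
  using proj_approx[OF nbh_sheet] nbhD(7) q_ln_omega by force

text \<open>To leading order both factors in \<open>p1\<close> and \<open>p2\<close> are
  \<open>koebe\<close>, which reflects that the projection is nearly the Moebius map
  \<open>zeta\<close>.\<close>

lemma S_parts:
  assumes "s \<in> nbh \<omega> r"
  shows "norm (S eps s - koebe s) \<le> 20 * q" "norm (2 * S (eps\<^sup>2) s - S eps s - koebe s) \<le> 20 * q"
proof -
  have D: "s \<in> Dom eps" using sheetD(3) nbh_sheet assms by blast
  have q2: "36 * q\<^sup>2 \<le> q" using eps(8) q_pos by (simp add: eps_def)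
  note b = Sreg_bounds[OF nbh_sheet[OF assms]]
  have e: "S eps s = koebe s + Sreg eps s" "S (eps\<^sup>2) s = koebe s + Sreg (eps\<^sup>2) s"
    using S_eq_Sreg[OF eps(1,2) D] S_eq_Sreg[OF eps(5,6) Dom_square[OF eps(1) D]] by auto
  show "norm (S eps s - koebe s) \<le> 20 * q" using b(1) q_pos by (simp add: e)
  have "norm (2 * Sreg (eps\<^sup>2) s - Sreg eps s) \<le> 2 * norm (Sreg (eps\<^sup>2) s) + norm (Sreg eps s)"
    using norm_triangle_ineq4[of "2 * Sreg (eps\<^sup>2) s" "Sreg eps s"] by (simp add: norm_mult)
  also have "\<dots> \<le> 20 * q" using b q2 q_pos by linarith
  finally show "norm (2 * S (eps\<^sup>2) s - S eps s - koebe s) \<le> 20 * q" by (simp add: e algebra_simps)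
qed

lemma S_upper: "s \<in> nbh \<omega> r \<Longrightarrow> norm (S eps s) \<le> V" "s \<in> nbh \<omega> r \<Longrightarrow> norm (2 * S (eps\<^sup>2) s - S eps s) \<le> V"
  using S_parts[of s] nbhD(6)[of s] norm_triangle_ineq[of "S eps s - koebe s" "koebe s"] V_ge q_small
    norm_triangle_ineq[of "2 * S (eps\<^sup>2) s - S eps s - koebe s" "koebe s"] by simp_all

text \<open>To leading order the Jacobian is \<open>- 4 * (norm (koebe s) / norm s)\<^sup>2\<close>;
  the error in the product is absorbed by \<open>q_V\<close>.\<close>

lemma jac_bound:
  assumes s: "s \<in> nbh \<omega> r" shows "r ^ 4 / (8 * M\<^sup>2) \<le> \<bar>jac p1 p2 s\<bar>"
proof -
  define w where "w = 2 * S (eps\<^sup>2) s - S eps s"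
  define T where "T = S eps s"
  define v where "v = koebe s"
  have s0: "s \<noteq> 0" and sM: "norm s \<le> M" using nbhD[OF s] by auto
  have wb: "norm (w - v) \<le> 20 * q" "norm (T - v) \<le> 20 * q" using S_parts[OF s] by (auto simp: w_def T_def v_def)
  have vb: "r\<^sup>2 / 4 \<le> norm v" "norm v \<le> V / 4" using nbhD(5,6)[OF s] by (auto simp: v_def)
  have "cnj w * T = cnj v * v + (cnj (w - v) * v + cnj v * (T - v) + cnj (w - v) * (T - v))"
    by (simp add: algebra_simps)
  moreover have "norm (cnj (w - v) * v + cnj v * (T - v) + cnj (w - v) * (T - v))
     \<le> norm (w - v) * norm v + norm v * norm (T - v) + norm (w - v) * norm (T - v)"
    by (intro norm_triangle_le add_mono) (simp_all only: norm_mult complex_mod_cnj order_refl)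
  moreover have "norm (w - v) * norm v + norm v * norm (T - v) + norm (w - v) * norm (T - v)
     \<le> 20 * q * (V / 4) + V / 4 * (20 * q) + 20 * q * (20 * q)"
    using wb vb V_ge q_pos by (intro add_mono mult_mono) auto
  moreover have "20 * q * (20 * q) \<le> q" using q_small q_pos by simp
  ultimately have "norm (cnj w * T - cnj v * v) \<le> (10 * V + 1) * q" by (simp add: algebra_simps)
  then have "\<bar>Re (cnj w * T - cnj v * v)\<bar> \<le> r ^ 4 / 32" using abs_Re_le_cmod[of "cnj w * T - cnj v * v"] q_V by linarith
  moreover have "Re (cnj v * v) = (norm v)\<^sup>2" using cmod_power2[of v] by (simp add: power2_eq_square)
  moreover have "(r\<^sup>2 / 4)\<^sup>2 \<le> (norm v)\<^sup>2" using vb r by (intro power_mono) auto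
  moreover have "(r\<^sup>2 / 4)\<^sup>2 = r ^ 4 / 16" by (simp add: power_divide)
  moreover have "Re (cnj w * T - cnj v * v) = Re (cnj w * T) - Re (cnj v * v)" by (simp only: minus_complex.simps)
  ultimately have re: "r ^ 4 / 32 \<le> Re (cnj w * T)" by linarith
  have P: "cnj (p1 s) = 2 * cnj w / cnj s" "p2 s = - \<i> * of_real b * T / s"
    by (simp_all add: p1_def w_def p2_def T_def)
  have N: "cnj s * s = of_real ((norm s)\<^sup>2)" using complex_norm_square[of s] by (simp add: mult.commute)
  have "cnj (p1 s) * p2 s = (2 * cnj w) * (- \<i> * of_real b * T) / (cnj s * s)"
    unfolding P by (rule times_divide_times_eq)
  also have "\<dots> = of_real (2 * b / (norm s)\<^sup>2) * (- \<i> * (cnj w * T))"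
    unfolding N of_real_divide of_real_mult of_real_numeral by (simp add: mult_ac)
  finally have E: "cnj (p1 s) * p2 s = of_real (2 * b / (norm s)\<^sup>2) * (- \<i> * (cnj w * T))" .
  have im: "Im (of_real x * (- \<i> * z)) = x * (- Re z)" for x z by simp
  have "jac p1 p2 s = Im (cnj (p1 s) * p2 s)" by (simp add: jac_def algebra_simps)
  also have "\<dots> = 2 * b / (norm s)\<^sup>2 * (- Re (cnj w * T))" unfolding E by (rule im)
  finally have "jac p1 p2 s = 2 * b / (norm s)\<^sup>2 * (- Re (cnj w * T))" .
  moreover have "\<bar>k * (- x)\<bar> = k * x" if "0 \<le> k" "0 \<le> x" for k x :: real using that by (simp add: abs_mult)
  moreover have "0 \<le> Re (cnj w * T)" using re zero_le_power[of r 4] r by linarith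
  moreover have "0 \<le> 2 * b / (norm s)\<^sup>2" using constants(6) by simp
  ultimately have "\<bar>jac p1 p2 s\<bar> = 2 * b / (norm s)\<^sup>2 * Re (cnj w * T)" by (simp only:)
  also have "\<dots> \<ge> 4 / M\<^sup>2 * (r ^ 4 / 32)"
    using re constants sM s0 r M_ge by (intro mult_mono frac_le power_mono) auto
  finally show ?thesis by simp
qed

text \<open>The factor \<open>q\<close> in the bound for \<open>p3\<close> is the source of the
  flattening of the sheets.\<close>

lemma p_bounds:
  assumes "s \<in> nbh \<omega> r"
  shows "norm (p1 s) \<le> 2 * V * M" "norm (p2 s) \<le> 3 * V * M" "norm (p3 s) \<le> q * (10 * V * M)"
proof -
  have i: "norm (1 / s) \<le> M" "0 \<le> M" using nbhD(4)[OF assms] M_ge by auto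
  have b3: "b \<le> 3" "0 \<le> b" using constants q_small eps(8) by (simp_all add: eps_def)
  note u = S_upper[OF assms]
  have "norm (p1 s) = 2 * norm (2 * S (eps\<^sup>2) s - S eps s) * norm (1 / s)"
    by (simp only: p1_def norm_mult norm_divide norm_numeral norm_one) simp
  also have "\<dots> \<le> 2 * V * M" using u i V_ge by (intro mult_mono) auto
  finally show "norm (p1 s) \<le> 2 * V * M" .
  have "norm (p2 s) = b * norm (S eps s) * norm (1 / s)" using b3 by (simp add: p2_def norm_mult norm_divide)
  also have "\<dots> \<le> 3 * V * M" using u i V_ge b3 by (intro mult_mono) auto
  finally show "norm (p2 s) \<le> 3 * V * M" .
  have "norm (of_real c0 + of_real B * S eps s) \<le> c0 + B * norm (S eps s)"
    using norm_triangle_ineq[of "of_real c0" "of_real B * S eps s"] c0_pos constants(3) by (simp add: norm_mult)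
  also have "\<dots> \<le> 41 / 10 * q * V + 42 / 10 * q * V"
  proof (intro add_mono mult_mono)
    show "c0 \<le> 41 / 10 * q * V" using constants(2) V_ge q_pos mult_left_mono[of 1 V "41 / 10 * q"] by linarith
  qed (use constants u q_pos in auto)
  finally have "norm (of_real c0 + of_real B * S eps s) \<le> 83 / 10 * (q * V)" by simp
  moreover have "0 \<le> q * V" using V_ge q_pos by simp
  ultimately have "norm (of_real c0 + of_real B * S eps s) \<le> 10 * q * V" by simp
  then have "norm (of_real c0 + of_real B * S eps s) * norm (1 / s) \<le> 10 * q * V * M"
    using i V_ge q_pos by (intro mult_mono) auto
  then show "norm (p3 s) \<le> q * (10 * V * M)" by (simp add: p3_def norm_mult norm_divide mult_ac)
qed

lemma nbh_Dom: "nbh \<omega> r \<subseteq> Dom eps" using sheetD(3) nbh_sheet by blast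

lemma local_graph: "harmonic_graph (nbh \<omega> r) x1 x2 x3 p1 p2 p3"
proof
  fix s assume s: "s \<in> nbh \<omega> r"
  then have D: "s \<in> Dom eps" using nbh_Dom by blast
  show "(x1 has_derivative (\<lambda>d. Re (p1 s * d))) (at s)" "(x2 has_derivative (\<lambda>d. Re (p2 s * d))) (at s)"
    "(x3 has_derivative (\<lambda>d. Re (p3 s * d))) (at s)" using D x1_deriv x2_deriv x3_deriv by auto
  have "0 < r ^ 4 / (8 * M\<^sup>2)" using r M_ge by simp
  then show "jac p1 p2 s \<noteq> 0" using jac_bound[OF s] by auto
next
  show "inj_on (\<lambda>s. (x1 s, x2 s)) (nbh \<omega> r)"
    using mid_proj_inj nbh_mid by (auto simp: inj_on_def)
qed (use open_nbh p_holomorphic nbh_Dom holomorphic_on_subset in blast)+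

text \<open>Brouwer's theorem for \<open>\<Phi>\<close>: the projection composed with
  \<open>unzeta\<close> is within \<open>27 * q\<close> of the identity, so \<open>\<Phi>\<close>
  maps the disc of radius \<open>2 * r\<close> into itself, and a fixed point solves the
  equation.\<close>

lemma local_surjective:
  assumes "norm (Complex a c - \<omega>) < r"
  shows "\<exists>s\<in>nbK \<omega> r. x1 s = a \<and> x2 s = c"
proof -
  have ne: "w \<noteq> - 1" if "w \<in> cball \<omega> (2 * r)" for w
    using that far(2) r by (auto simp: dist_norm norm_minus_commute add.commute)
  then have ne': "w + 1 \<noteq> 0" if "w \<in> cball \<omega> (2 * r)" for w using that eq_neg_iff_add_eq_0[of w 1] by blast
  have uK: "unzeta w \<in> nbK \<omega> r" "zeta (unzeta w) = w" if "w \<in> cball \<omega> (2 * r)" for w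
    using zeta_unzeta[OF ne[OF that]] that by (auto simp: nbK_def dist_norm norm_minus_commute)
  define F where "F s = Complex (x1 s) (x2 s)" for s
  define \<Phi> where "\<Phi> w = w + (Complex a c - F (unzeta w))" for w
  have "continuous_on (Dom eps) x1" "continuous_on (Dom eps) x2"
    by (meson continuous_at_imp_continuous_on has_derivative_continuous x1_deriv x2_deriv)+
  then have "continuous_on (Dom eps) F" unfolding F_def complex_eq by (intro continuous_intros)
  moreover have "continuous_on (cball \<omega> (2 * r)) unzeta"
    unfolding unzeta_def[abs_def] using ne' by (intro continuous_intros) auto
  moreover have "unzeta ` cball \<omega> (2 * r) \<subseteq> Dom eps" using uK(1) nbK_nbh nbh_Dom by blast
  ultimately have "continuous_on (cball \<omega> (2 * r)) (\<lambda>w. F (unzeta w))"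
    by (rule continuous_on_compose2)
  then have cont: "continuous_on (cball \<omega> (2 * r)) \<Phi>" unfolding \<Phi>_def by (intro continuous_intros)
  have maps: "\<Phi> ` cball \<omega> (2 * r) \<subseteq> cball \<omega> (2 * r)"
  proof
    fix x assume "x \<in> \<Phi> ` cball \<omega> (2 * r)"
    then obtain w where w: "w \<in> cball \<omega> (2 * r)" "x = \<Phi> w" by auto
    have "norm (zeta (unzeta w) - F (unzeta w)) \<le> 27 * q"
      using cmod_le[of "zeta (unzeta w) - F (unzeta w)"] nbh_approx[of "unzeta w"] uK(1)[OF w(1)] nbK_nbh
      by (force simp: F_def abs_minus_commute)
    then have "norm (w - F (unzeta w)) \<le> r" using q_r q_pos uK(2)[OF w(1)] by simp
    then have "norm ((Complex a c - \<omega>) + (w - F (unzeta w))) \<le> 2 * r"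
      using norm_triangle_ineq[of "Complex a c - \<omega>" "w - F (unzeta w)"] assms by simp
    moreover have "x - \<omega> = (Complex a c - \<omega>) + (w - F (unzeta w))" by (simp add: w \<Phi>_def)
    ultimately have "norm (x - \<omega>) \<le> 2 * r" by (simp only:)
    then show "x \<in> cball \<omega> (2 * r)" by (subst mem_cball, subst dist_commute) (simp only: dist_norm)
  qed
  obtain w where w: "w \<in> cball \<omega> (2 * r)" "\<Phi> w = w"
    using brouwer[OF compact_cball convex_cball _ cont] maps r by (metis cball_eq_empty image_subset_iff_funcset less_le_not_le mult_pos_pos not_less zero_less_numeral)
  then have "F (unzeta w) = Complex a c" by (simp add: \<Phi>_def)
  then show ?thesis using uK(1)[OF w(1)] by (auto simp: F_def)
qed

text \<open>\<open>zeta_bound\<close> has to come first, because the error in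
  \<open>x2_approx\<close> is small only once \<open>zeta t\<close> is known to be moderate.\<close>

lemma near_in_nbh:
  assumes "t \<in> sheet" "norm (Complex (x1 t) (x2 t) - \<omega>) < r"
  shows "t \<in> nbh \<omega> r"
proof -
  have "norm (Complex (x1 t) (x2 t)) \<le> norm \<omega> + 1"
    using assms(2) norm_triangle_ineq[of "Complex (x1 t) (x2 t) - \<omega>" \<omega>] r by simp
  then have x: "\<bar>x1 t\<bar> \<le> norm \<omega> + 1" "\<bar>x2 t\<bar> \<le> norm \<omega> + 1"
    using abs_Re_le_cmod[of "Complex (x1 t) (x2 t)"] abs_Im_le_cmod[of "Complex (x1 t) (x2 t)"] by simp_all
  have z: "norm (zeta t) \<le> 2 * norm \<omega> + 3" using zeta_bound[OF assms(1)] x q_small by simp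
  have "3 * q\<^sup>2 * norm (zeta t) \<le> 3 * q\<^sup>2 * (2 * ln (1 / q))"
    using z q_ln_omega by (intro mult_left_mono) auto
  also have "\<dots> = 6 * q * (q * ln (1 / q))" by (simp add: power2_eq_square)
  also have "\<dots> \<le> 6 * q * (1 / 1000)" using q_ln q_pos by (intro mult_left_mono) auto
  finally have "\<bar>x1 t - Re (zeta t)\<bar> + \<bar>x2 t - Im (zeta t)\<bar> \<le> 27 * q"
    using x1_approx[OF assms(1)] x2_approx[OF assms(1)] q_pos by linarith
  then have "norm (zeta t - Complex (x1 t) (x2 t)) \<le> r"
    using cmod_le[of "zeta t - Complex (x1 t) (x2 t)"] q_r q_pos by (simp add: abs_minus_commute)
  then have "norm (zeta t - \<omega>) < 3 * r"
    using norm_triangle_ineq[of "zeta t - Complex (x1 t) (x2 t)" "Complex (x1 t) (x2 t) - \<omega>"] assms(2) r by simp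
  then show ?thesis using sheetD(2)[OF assms(1)] by (simp add: nbh_def)
qed

end

lemma iter_pd_affine:
  assumes g: "smooth_on W g" and z: "z \<in> W"
  shows "iter_pd bs (\<lambda>z. c + d * g z) z = (if bs = [] then c else 0) + d * iter_pd bs g z"
  using z
proof (induction bs arbitrary: z)
  case (Cons b bs)
  define k where "k = (if bs = [] then c else 0)"
  have W: "open W" using g by (simp add: smooth_on_def)
  have eq: "iter_pd bs (\<lambda>z. c + d * g z) z = k + d * iter_pd bs g z" if "z \<in> W" for z
    using Cons.IH[OF that] by (simp add: k_def)
  have "iter_pd bs g differentiable (at z)" using g Cons.prems by (simp add: smooth_on_def)
  note D = has_derivative_pd[OF this]
  have "((\<lambda>z. k + d * iter_pd bs g z) has_derivative
     (\<lambda>(x, y). x * (d * pd1 (iter_pd bs g) z) + y * (d * pd2 (iter_pd bs g) z))) (at z)"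
    by (rule has_derivative_eq_rhs[OF has_derivative_add[OF has_derivative_const has_derivative_mult_right[OF D]]])
      (auto simp: fun_eq_iff algebra_simps)
  note pd = pd_eq_has_derivative[OF this]
  show ?case using pd pd_cong_open[OF W eq Cons.prems] by simp
qed simp

lemma smooth_on_affine:
  assumes g: "smooth_on W g" and V: "open V" "V \<subseteq> W"
  shows "smooth_on V (\<lambda>z. c + d * g z)"
  unfolding smooth_on_def
proof (intro conjI allI ballI)
  fix bs z assume "z \<in> V"
  then have z: "z \<in> W" using V by blast
  have W: "open W" using g by (simp add: smooth_on_def)
  have "iter_pd bs g differentiable (at z)" using g z by (simp add: smooth_on_def)
  then have "(\<lambda>z. (if bs = [] then c else 0) + d * iter_pd bs g z) differentiable (at z)"
    by (intro differentiable_add differentiable_mult differentiable_const)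
  then obtain D where "((\<lambda>z. (if bs = [] then c else 0) + d * iter_pd bs g z) has_derivative D) (at z)"
    unfolding differentiable_def by blast
  then have "(iter_pd bs (\<lambda>z. c + d * g z) has_derivative D) (at z)"
    by (rule has_derivative_transform_within_open[OF _ W z]) (simp add: iter_pd_affine[OF g])
  then show "iter_pd bs (\<lambda>z. c + d * g z) differentiable (at z)" unfolding differentiable_def by blast
qed (rule V)

lemma dist_proj12: "dist (proj12 x) (proj12 y) \<le> dist x y"
  unfolding dist_vec_def L2_set_def sum_3 proj12_def dist_prod_def by (simp add: real_sqrt_le_mono)

lemma dist_Pair_Complex: "dist (a, c) (Re w, Im w) = norm (Complex a c - w)"
  by (simp add: dist_prod_def dist_real_def cmod_def)

context off_axis_stack
begin

interpretation loc: harmonic_graph "nbh \<omega> r" x1 x2 x3 p1 p2 p3 by (rule local_graph)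

lemma sg_abs: "\<bar>sg k\<bar> = 1" by (simp add: sg_def)

text \<open>Odd sheets are reflected. Composing with \<open>X_reflect\<close> brings their
  parameters back to the chart at \<open>\<omega>\<close> and replaces \<open>x3\<close> by
  \<open>- x3\<close>, so one function \<open>gr\<close> describes every sheet.\<close>

definition leaf :: "int \<Rightarrow> real \<times> real \<Rightarrow> real" where
  "leaf k z = of_int k * h + sg k * harmonic_graph.gr (nbh \<omega> r) x1 x2 x3 z"

lemma disc_chart:
  assumes "(a, c) \<in> ball (Re \<omega>, Im \<omega>) r"
  shows "(a, c) \<in> loc.W" "loc.inv_chart (a, c) \<in> nbK \<omega> r" "x1 (loc.inv_chart (a, c)) = a" "x2 (loc.inv_chart (a, c)) = c"
proof -
  have "norm (Complex a c - \<omega>) < r" using assms dist_Pair_Complex[of a c \<omega>] by (simp add: dist_commute)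
  then obtain s where s: "s \<in> nbK \<omega> r" "x1 s = a" "x2 s = c" using local_surjective by blast
  have sn: "s \<in> nbh \<omega> r" using s nbK_nbh by blast
  then show "(a, c) \<in> loc.W" using s(2,3) unfolding loc.W_def by (intro image_eqI[of _ _ s]) auto
  have "loc.inv_chart (a, c) = s" using loc.inv_chart[OF sn] s by simp
  then show "loc.inv_chart (a, c) \<in> nbK \<omega> r" "x1 (loc.inv_chart (a, c)) = a" "x2 (loc.inv_chart (a, c)) = c"
    using s by simp_all
qed

lemma disc_subset: "ball (Re \<omega>, Im \<omega>) r \<subseteq> loc.W" using disc_chart(1) by (auto simp del: mem_ball)

lemma leaf_smooth: "smooth_on (ball (Re \<omega>, Im \<omega>) r) (leaf k)"
  using smooth_on_affine[OF loc.smooth_gr open_ball disc_subset] unfolding leaf_def[abs_def] .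

lemma leaf_pd:
  assumes "z \<in> ball (Re \<omega>, Im \<omega>) r" "bs \<noteq> []"
  shows "\<bar>iter_pd bs (leaf k) z\<bar> = \<bar>iter_pd bs (harmonic_graph.gr (nbh \<omega> r) x1 x2 x3) z\<bar>"
proof -
  have "z \<in> loc.W" using assms disc_subset by blast
  from iter_pd_affine[OF loc.smooth_gr this, of bs "of_int k * h" "sg k"] show ?thesis
    using assms unfolding leaf_def[abs_def] by (simp add: abs_mult sg_abs)
qed

lemma leaf_near: "(a, c) \<in> ball (Re \<omega>, Im \<omega>) r \<Longrightarrow> \<bar>leaf k (a, c) - of_int k * h\<bar> \<le> h / 2"
proof -
  assume "(a, c) \<in> ball (Re \<omega>, Im \<omega>) r"
  then have s: "loc.inv_chart (a, c) \<in> nbh \<omega> r" using disc_chart(2) nbK_nbh by blast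
  have "norm (zeta (loc.inv_chart (a, c))) \<le> ln (1 / q) - 10" using nbhD(7)[OF s] q_ln_omega by linarith
  then have "\<bar>x3 (loc.inv_chart (a, c))\<bar> \<le> h / 2" using x3_range[OF nbh_sheet[OF s]] by (simp add: abs_le_iff)
  then show ?thesis by (simp add: leaf_def loc.gr_def abs_mult sg_abs)
qed

text \<open>\<open>near_in_nbh\<close> puts every piece of the surface into the chart. Conversely, a
  point of a leaf is a value of \<open>X\<close>, and \<open>small_in_T\<close>, through
  \<open>big\<close>, places its parameter in the chosen component \<open>T\<close>.\<close>

lemma surface_ball_leaves:
  fixes p :: "real^3"
  assumes p: "proj12 p = (Re \<omega>, Im \<omega>)" and big: "2 * (norm p + r + 2) \<le> R"
  shows "surface \<inter> ball p r = (\<Union>u\<in>range leaf. hgraph (ball (proj12 p) r) u) \<inter> ball p r"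
proof (intro set_eqI iffI)
  fix x assume x: "x \<in> surface \<inter> ball p r"
  then obtain k t where t: "t \<in> sheet" "x = pt3 (sg k * x1 t) (x2 t) (x3 t + of_int k * h)"
    using surface_coordinates by blast
  define t' where "t' = (if even k then t else 1 / cnj t)"
  have t': "t' \<in> sheet" "x = pt3 (x1 t') (x2 t') (of_int k * h + sg k * x3 t')"
    using t X_reflect[OF sheetD(3)[OF t(1)]] sheet_reflect[OF t(1)] by (auto simp: t'_def sg_def add.commute)
  have "dist (proj12 x) (proj12 p) < r" using x dist_proj12[of x p] by (simp add: dist_commute)
  then have d: "dist (x1 t', x2 t') (Re \<omega>, Im \<omega>) < r" unfolding p by (simp add: t'(2) proj12_def)
  then have "t' \<in> nbh \<omega> r" using near_in_nbh[OF t'(1)] by (simp add: dist_Pair_Complex)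
  then have "leaf k (x1 t', x2 t') = of_int k * h + sg k * x3 t'" by (simp add: leaf_def loc.gr_def loc.inv_chart)
  then have "x \<in> hgraph (ball (proj12 p) r) (leaf k)"
    unfolding hgraph_def p mem_Collect_eq using d t'(2)
    by (intro exI[of _ "x1 t'"] exI[of _ "x2 t'"]) (simp add: dist_commute)
  then show "x \<in> (\<Union>u\<in>range leaf. hgraph (ball (proj12 p) r) u) \<inter> ball p r" using x by blast
next
  fix x assume "x \<in> (\<Union>u\<in>range leaf. hgraph (ball (proj12 p) r) u) \<inter> ball p r"
  then obtain k a c where x: "x \<in> ball p r" "(a, c) \<in> ball (Re \<omega>, Im \<omega>) r" "x = pt3 a c (leaf k (a, c))"
    unfolding hgraph_def p by blast
  define s where "s = loc.inv_chart (a, c)"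
  have s: "s \<in> sheet" "x1 s = a" "x2 s = c"
    using disc_chart[OF x(2)] nbK_nbh nbh_sheet by (auto simp: s_def)
  define t where "t = (if even k then s else 1 / cnj s)"
  have t: "t \<in> sheet" "sg k * x1 t = a" "x2 t = c" "x3 t = sg k * x3 s"
    using s X_reflect[OF sheetD(3)[OF s(1)]] sheet_reflect[OF s(1)] by (auto simp: t_def sg_def)
  define u where "u = t * of_real (eps powi (- k))"
  have u: "u \<in> Dom eps" unfolding u_def by (rule Dom_scale[OF sheetD(3)[OF t(1)] eps(1)])
  have "X u = x"
    using X_scale[OF sheetD(3)[OF t(1)], of k] t unfolding X_def u_def
    by (simp add: x(3) leaf_def loc.gr_def s_def add.commute)
  moreover have "norm x \<le> norm p + r" using x(1) norm_triangle_sub[of x p] by (simp add: dist_norm norm_minus_commute)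
  ultimately have "u \<in> T" using small_in_T[OF _ big u] r by (simp add: add_pos_nonneg)
  then show "x \<in> surface \<inter> ball p r" using x(1) \<open>X u = x\<close> by (auto simp: surface_def)
qed

lemma surface_near:
  fixes p y :: "real^3"
  assumes p: "proj12 p = (Re \<omega>, Im \<omega>)" and big: "2 * (norm p + r + 2) \<le> R"
    and y: "dist p y + 2 * h < r"
  shows "\<exists>x\<in>surface. dist x y \<le> 2 * h"
proof -
  define k where "k = \<lfloor>y $ 3 / h\<rfloor>"
  have k: "of_int k * h \<le> y $ 3" "y $ 3 < of_int k * h + h"
    using h_pos(1) floor_divide_lower[of h "y $ 3"] floor_divide_upper[of h "y $ 3"]
    by (simp_all add: k_def algebra_simps)
  define x where "x = pt3 (y $ 1) (y $ 2) (leaf k (y $ 1, y $ 2))"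
  have "dist (proj12 p) (proj12 y) < r" using dist_proj12[of p y] y h_pos(1) by linarith
  then have b: "(y $ 1, y $ 2) \<in> ball (Re \<omega>, Im \<omega>) r" unfolding p by (simp add: proj12_def)
  have "\<bar>leaf k (y $ 1, y $ 2) - y $ 3\<bar> \<le> 2 * h" using leaf_near[OF b, of k] k h_pos(1) by linarith
  moreover have "norm (x - y) \<le> (\<Sum>i\<in>UNIV. \<bar>(x - y) $ i\<bar>)" by (rule norm_le_l1_cart)
  ultimately have d: "dist x y \<le> 2 * h" by (simp add: x_def sum_3 dist_norm)
  then have "x \<in> ball p r" using y dist_triangle[of p x y] by (simp add: dist_commute)
  moreover have "x \<in> hgraph (ball (proj12 p) r) (leaf k)" unfolding hgraph_def p x_def using b by blast
  ultimately have "x \<in> surface" using surface_ball_leaves[OF p big] by blast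
  with d show ?thesis by blast
qed

end

section \<open>Convergence\<close>

lemma locally_bounded_familyI:
  assumes "0 < C" "\<forall>\<^sub>F i in sequentially. \<forall>s\<in>N. norm (E i s) \<le> C"
  shows "locally_bounded_family N E"
  unfolding locally_bounded_family_def
proof (intro allI impI exI conjI)
  fix K assume "compact K \<and> K \<subseteq> N"
  then have K: "K \<subseteq> N" by simp
  show "\<forall>\<^sub>F i in sequentially. \<forall>s\<in>K. norm (E i s) \<le> C"
    using assms(2) by eventually_elim (use K in blast)
qed (rule assms)

lemma locally_null_familyI:
  assumes "\<forall>\<^sub>F i in sequentially. \<forall>s\<in>N. norm (E i s) \<le> d i" "d \<longlonglongrightarrow> 0"
  shows "locally_null_family N E"
  unfolding locally_null_family_def
proof (intro allI impI)
  fix K and e :: real assume K: "compact K \<and> K \<subseteq> N" and e: "0 < e"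
  have "\<forall>\<^sub>F i in sequentially. d i < e" using assms(2) e by (rule order_tendstoD)
  with assms(1) show "\<forall>\<^sub>F i in sequentially. \<forall>s\<in>K. norm (E i s) < e"
    by eventually_elim (use K in fastforce)
qed

text \<open>With this choice \<open>ln (1 / q i)\<close> is \<open>200 + i\<close>, so the radii
  \<open>50 + i / 4\<close> tend to infinity while \<open>q\<close> tends to 0.\<close>

locale stack_sequence =
  fixes q e m :: "nat \<Rightarrow> real"
  assumes stack: "\<And>i. neck_stack (q i) (e i) (m i)" and q_eq: "\<And>i. q i = exp (- (200 + real i))"
begin

lemma ln_q_eq: "ln (1 / q i) = 200 + real i"
  by (simp add: q_eq ln_div)

lemma q_null: "q \<longlonglongrightarrow> 0"
  unfolding q_eq[abs_def] by real_asymp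

lemma q_eventually_le: "0 < c \<Longrightarrow> \<forall>\<^sub>F i in sequentially. q i < c"
  using order_tendstoD(2)[OF q_null] .

abbreviation "height i \<equiv> neck_stack.h (q i) (e i) (m i)"
abbreviation "surf i \<equiv> neck_stack.surface (q i) (e i) (m i)"
abbreviation "radius i \<equiv> neck_stack.R (q i)"

lemma height_null: "height \<longlonglongrightarrow> 0"
proof (rule tendsto_sandwich[of "\<lambda>_. 0" _ _ "\<lambda>i. 20 * sqrt (q i)"])
  show "\<forall>\<^sub>F i in sequentially. 0 \<le> height i" using neck_stack.h_pos(1)[OF stack] by (simp add: less_imp_le)
  show "\<forall>\<^sub>F i in sequentially. height i \<le> 20 * sqrt (q i)" using neck_stack.h_small(1)[OF stack] by simp
  show "(\<lambda>i. 20 * sqrt (q i)) \<longlonglongrightarrow> 0" unfolding q_eq by real_asymp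
qed simp

lemma radius_eq: "radius i = 50 + real i / 4"
  using neck_stack.R_def[OF stack, of i] by (simp add: ln_q_eq)

lemma radius_at_top: "filterlim radius at_top sequentially"
  unfolding radius_eq[abs_def] by real_asymp

lemma radius_eventually_ge: "\<forall>\<^sub>F i in sequentially. c \<le> radius i"
  using radius_at_top by (simp add: filterlim_at_top)

lemma eventually_off_axis_stack:
  assumes "off_axis \<omega> r"
  shows "\<forall>\<^sub>F i in sequentially. off_axis_stack (q i) (e i) (m i) \<omega> r"
proof -
  interpret off_axis \<omega> r by (rule assms)
  define c1 where "c1 = 1 / (20 * M)"
  define c2 where "c2 = r ^ 4 / 32 / (10 * V + 1)"
  have c: "0 < c1" "0 < c2" using M_ge V_ge r by (simp_all add: c1_def c2_def)
  have "\<forall>\<^sub>F i in sequentially. norm \<omega> + 15 \<le> 200 + real i" by real_asymp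
  with q_eventually_le[OF c(1)] q_eventually_le[OF c(2)] show ?thesis
  proof eventually_elim
    case (elim i)
    have q: "0 < q i" by (simp add: q_eq)
    have "M * q i \<le> M * c1" using elim M_ge by (intro mult_left_mono) auto
    then have 1: "M \<le> 1 / (20 * q i)" using M_ge q by (simp add: c1_def field_simps)
    have "(10 * V + 1) * q i \<le> (10 * V + 1) * c2" using elim V_ge by (intro mult_left_mono) auto
    also have "\<dots> = r ^ 4 / 32"
      unfolding c2_def using V_ge nonzero_mult_div_cancel_left[of "10 * V + 1" "r ^ 4 / 32"] by simp
    finally have 2: "(10 * V + 1) * q i \<le> r ^ 4 / 32" .
    have 3: "norm \<omega> + 15 \<le> ln (1 / q i)" using elim by (simp add: ln_q_eq)
    show ?case by (intro off_axis_stack.intro stack assms off_axis_stack_axioms.intro 1 2 3)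
  qed
qed

abbreviation "leaves \<omega> r i \<equiv> range (off_axis_stack.leaf (q i) (e i) (m i) \<omega> r)"

text \<open>\<open>p3\<close> is a null family and the dual vectors are smooth families, so every
  derivative is null uniformly on the compact \<open>nbK\<close>, which contains the parameters of
  the whole disc. All leaves have the same derivatives up to sign, hence the uniformity over
  infinitely many of them.\<close>

lemma leaves_derivatives_null:
  assumes O: "off_axis \<omega> r" and bs: "bs \<noteq> []" and \<delta>: "0 < \<delta>"
  shows "\<forall>\<^sub>F i in sequentially. \<forall>u\<in>leaves \<omega> r i. \<forall>z\<in>ball (Re \<omega>, Im \<omega>) r. \<bar>iter_pd bs u z\<bar> < \<delta>"
proof -
  interpret off_axis \<omega> r by (rule O)
  note ev = eventually_off_axis_stack[OF O]
  define N where "N = nbh \<omega> r"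
  define x1 where "x1 i = neck_stack.x1 (q i)" for i
  define x2 where "x2 i = neck_stack.x2 (q i) (e i) (m i)" for i
  define x3 where "x3 i = neck_stack.x3 (q i) (e i) (m i)" for i
  define p1 where "p1 i = neck_stack.p1 (q i)" for i
  define p2 where "p2 i = neck_stack.p2 (q i) (e i) (m i)" for i
  define p3 where "p3 i = neck_stack.p3 (q i) (e i) (m i)" for i
  note defs = N_def x1_def x2_def x3_def p1_def p2_def p3_def
  have hg: "\<forall>\<^sub>F i in sequentially. harmonic_graph N (x1 i) (x2 i) (x3 i) (p1 i) (p2 i) (p3 i)"
    using ev unfolding defs by eventually_elim (rule off_axis_stack.local_graph)
  have hol: "\<forall>\<^sub>F i in sequentially. p1 i holomorphic_on N" "\<forall>\<^sub>F i in sequentially. p2 i holomorphic_on N"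
    "\<forall>\<^sub>F i in sequentially. p3 i holomorphic_on N"
    by (rule eventually_mono[OF hg], erule harmonic_graph.hol)+
  have VM: "0 < 2 * V * M" "0 < 3 * V * M" using V_ge M_ge by simp_all
  have b1: "\<forall>\<^sub>F i in sequentially. \<forall>s\<in>N. norm (p1 i s) \<le> 2 * V * M"
    using ev unfolding defs by eventually_elim (use off_axis_stack.p_bounds(1) in blast)
  have b2: "\<forall>\<^sub>F i in sequentially. \<forall>s\<in>N. norm (p2 i s) \<le> 3 * V * M"
    using ev unfolding defs by eventually_elim (use off_axis_stack.p_bounds(2) in blast)
  have b3: "\<forall>\<^sub>F i in sequentially. \<forall>s\<in>N. norm (p3 i s) \<le> q i * (10 * V * M)"
    using ev unfolding defs by eventually_elim (use off_axis_stack.p_bounds(3) in blast)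
  have bJ: "\<forall>\<^sub>F i in sequentially. \<forall>s\<in>N. r ^ 4 / (8 * M\<^sup>2) \<le> \<bar>jac (p1 i) (p2 i) s\<bar>"
    using ev unfolding defs by eventually_elim (use off_axis_stack.jac_bound in blast)
  have J0: "0 < r ^ 4 / (8 * M\<^sup>2)" using r M_ge by simp
  have sm: "smooth_family N p1" "smooth_family N p2"
    by (rule smooth_family.holomorphic[OF hol(1) locally_bounded_familyI[OF VM(1) b1]],
        rule smooth_family.holomorphic[OF hol(2) locally_bounded_familyI[OF VM(2) b2]])
  have nl: "null_family N p3"
  proof (rule null_family.holomorphic[OF hol(3) locally_null_familyI[OF b3]])
    show "(\<lambda>i. q i * (10 * V * M)) \<longlonglongrightarrow> 0" using tendsto_mult_left_zero[OF q_null] .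
  qed
  have Jb: "locally_bounded_family N (\<lambda>i s. inverse (of_real (jac (p1 i) (p2 i) s)))"
  proof (rule locally_bounded_familyI)
    show "0 < inverse (r ^ 4 / (8 * M\<^sup>2))" using J0 by (rule positive_imp_inverse_positive)
    show "\<forall>\<^sub>F i in sequentially. \<forall>s\<in>N. norm (inverse (complex_of_real (jac (p1 i) (p2 i) s))) \<le> inverse (r ^ 4 / (8 * M\<^sup>2))"
      using bJ by eventually_elim (unfold norm_inverse norm_of_real, intro ballI le_imp_inverse_le J0, blast)
  qed
  have Jn: "\<forall>\<^sub>F i in sequentially. \<forall>s\<in>N. jac (p1 i) (p2 i) s \<noteq> 0"
    using bJ by eventually_elim (use J0 in fastforce)
  note Z = smooth_family_Z[OF sm Jb Jn]
  have oN: "open N" unfolding N_def by (rule open_nbh)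
  obtain E where E: "null_family N E" "\<forall>\<^sub>F i in sequentially. \<forall>z\<in>harmonic_graph.W N (x1 i) (x2 i).
      iter_pd bs (harmonic_graph.gr N (x1 i) (x2 i) (x3 i)) z = Re (E i (harmonic_graph.inv_chart N (x1 i) (x2 i) z)) \<and>
      iter_pd bs (harmonic_graph.gr N (x1 i) (x2 i) (x3 i)) differentiable (at z)"
    using harmonic_graph_family[OF oN hg, of "null_family N" bs,
        OF null_family_chart_step[OF oN Z] null_family.mult[OF nl Z(1)] null_family.mult[OF nl Z(2)] bs] by blast
  have "nbK \<omega> r \<subseteq> N" unfolding N_def by (rule nbK_nbh)
  then have "\<forall>\<^sub>F i in sequentially. \<forall>s\<in>nbK \<omega> r. norm (E i s) < \<delta>"
    using null_family_null[OF E(1)] compact_nbK \<delta> unfolding locally_null_family_def by blast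
  with E(2) ev show ?thesis
  proof eventually_elim
    case (elim i)
    interpret s: off_axis_stack "q i" "e i" "m i" \<omega> r by (rule elim)
    show ?case
    proof (intro ballI)
      fix u z assume u: "u \<in> leaves \<omega> r i" and z: "z \<in> ball (Re \<omega>, Im \<omega>) r"
      obtain k where k: "u = s.leaf k" using u by blast
      obtain a c where ac: "z = (a, c)" by (cases z)
      note d = s.disc_chart(1,2)[OF z[unfolded ac]]
      have "iter_pd bs (harmonic_graph.gr N (x1 i) (x2 i) (x3 i)) z = Re (E i (harmonic_graph.inv_chart N (x1 i) (x2 i) z))"
        using elim(1) d(1) unfolding ac defs by blast
      moreover have "norm (E i (harmonic_graph.inv_chart N (x1 i) (x2 i) z)) < \<delta>"
        using elim(3) d(2) unfolding ac defs by blast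
      moreover have "\<bar>iter_pd bs u z\<bar> = \<bar>iter_pd bs (harmonic_graph.gr N (x1 i) (x2 i) (x3 i)) z\<bar>"
        unfolding k defs by (rule s.leaf_pd[OF z bs])
      ultimately show "\<bar>iter_pd bs u z\<bar> < \<delta>"
        using abs_Re_le_cmod[of "E i (harmonic_graph.inv_chart N (x1 i) (x2 i) z)"] by linarith
    qed
  qed
qed

lemma base_point: "0 \<in> surf i"
proof -
  interpret neck_stack "q i" "e i" "m i" by (rule stack)
  have "X (- 1) \<in> surface" unfolding surface_def using T(5) by (rule imageI)
  then show ?thesis by (simp add: X_base)
qed

lemma convergence: "converges_to_horizontal_foliation_away surf axes"
  unfolding converges_to_horizontal_foliation_away_def
proof (intro allI impI)
  fix p :: "real^3" assume p: "p \<notin> axes"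
  define \<omega> where "\<omega> = Complex (p $ 1) (p $ 2)"
  \<comment> \<open>A quarter of the distance to the nearer line, as \<open>off_axis\<close>
    demands, and at most 1.\<close>
  define r where "r = min 1 (min (norm (\<omega> - 1)) (norm (\<omega> + 1)) / 4)"
  have ne: "\<omega> \<noteq> 1" "\<omega> \<noteq> - 1" using p by (auto simp: axes_def proj12_def \<omega>_def complex_eq_iff)
  then have "\<omega> - 1 \<noteq> 0" "\<omega> + 1 \<noteq> 0" by (simp_all add: eq_neg_iff_add_eq_0)
  then have O: "off_axis \<omega> r" by unfold_locales (auto simp: r_def min_def)
  then interpret off_axis \<omega> r .
  have pp: "proj12 p = (Re \<omega>, Im \<omega>)" by (simp add: proj12_def \<omega>_def)
  have disj: "ball p r \<inter> axes = {}"
  proof -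
    have "r \<le> dist p x" if x: "x \<in> axes" for x :: "real^3"
    proof -
      have "4 * r \<le> dist (proj12 x) (proj12 p)"
        using x far dist_Pair_Complex[of 1 0 \<omega>] dist_Pair_Complex[of "- 1" 0 \<omega>] unfolding axes_def pp
        by (auto simp: complex_of_real_def[symmetric] Complex_eq norm_minus_commute[of 1] norm_minus_commute[of "- 1"])
      then show ?thesis using dist_proj12[of x p] r(1) by (simp add: dist_commute)
    qed
    then show ?thesis by fastforce
  qed
  have big: "\<forall>\<^sub>F i in sequentially. 2 * (norm p + r + 2) \<le> radius i" by (rule radius_eventually_ge)
  note ev = eventually_off_axis_stack[OF O]
  have F1: "\<forall>\<^sub>F i in sequentially.
      surf i \<inter> ball p r = (\<Union>u\<in>leaves \<omega> r i. hgraph (ball (proj12 p) r) u) \<inter> ball p r \<and>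
      (\<forall>u\<in>leaves \<omega> r i. smooth_on (ball (proj12 p) r) u)"
    using ev big
  proof eventually_elim
    case (elim i)
    then interpret s: off_axis_stack "q i" "e i" "m i" \<omega> r by simp
    show ?case using s.surface_ball_leaves[OF pp elim(2)] s.leaf_smooth unfolding pp by blast
  qed
  have F2: "\<forall>bs. bs \<noteq> [] \<longrightarrow> (\<forall>\<delta>>0. \<forall>\<^sub>F i in sequentially.
      \<forall>u\<in>leaves \<omega> r i. \<forall>z\<in>ball (proj12 p) r. \<bar>iter_pd bs u z\<bar> < \<delta>)"
    unfolding pp using leaves_derivatives_null[OF O] by blast
  have lim: "\<exists>x :: nat \<Rightarrow> real^3. (\<forall>i. x i \<in> surf i) \<and> x \<longlonglongrightarrow> y" if y: "y \<in> ball p r" for y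
  proof -
    have "0 < (r - dist p y) / 2" using y by simp
    from order_tendstoD(2)[OF height_null this]
    have "\<forall>\<^sub>F i in sequentially. dist p y + 2 * height i < r" by eventually_elim (simp add: field_simps)
    with ev big have near: "\<forall>\<^sub>F i in sequentially. \<exists>x\<in>surf i. dist x y \<le> 2 * height i"
      by eventually_elim (rule off_axis_stack.surface_near[OF _ pp])
    \<comment> \<open>The sequence needs a point on every surface. For the finitely many indices
      without a near point it is 0, which lies on all of them by \<open>base_point\<close>.\<close>
    define x where "x i = (if \<exists>x\<in>surf i. dist x y \<le> 2 * height i
      then SOME x. x \<in> surf i \<and> dist x y \<le> 2 * height i else 0)" for i
    have x: "x i \<in> surf i \<and> dist (x i) y \<le> 2 * height i" if "\<exists>x\<in>surf i. dist x y \<le> 2 * height i" for i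
      using someI_ex[of "\<lambda>x. x \<in> surf i \<and> dist x y \<le> 2 * height i"] that unfolding x_def by auto
    have "(\<lambda>i. dist (x i) y) \<longlonglongrightarrow> 0"
    proof (rule tendsto_sandwich[of "\<lambda>_. 0" _ _ "\<lambda>i. 2 * height i"])
      show "\<forall>\<^sub>F i in sequentially. dist (x i) y \<le> 2 * height i" using near by eventually_elim (use x in blast)
      show "(\<lambda>i. 2 * height i) \<longlonglongrightarrow> 0" using tendsto_mult_right_zero[OF height_null] .
    qed auto
    then have "x \<longlonglongrightarrow> y" by (rule tendsto_dist_iff[THEN iffD2])
    moreover have "x i \<in> surf i" for i using x[of i] base_point[of i] unfolding x_def by (auto split: if_splits)
    ultimately show ?thesis by blast
  qed
  show "\<exists>r>0. ball p r \<inter> axes = {} \<and>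
       (\<exists>F :: nat \<Rightarrow> (real \<times> real \<Rightarrow> real) set.
          (\<forall>\<^sub>F i in sequentially.
             surf i \<inter> ball p r = (\<Union>u\<in>F i. hgraph (ball (proj12 p) r) u) \<inter> ball p r \<and>
             (\<forall>u\<in>F i. smooth_on (ball (proj12 p) r) u)) \<and>
          (\<forall>bs. bs \<noteq> [] \<longrightarrow> (\<forall>e>0. \<forall>\<^sub>F i in sequentially.
             \<forall>u\<in>F i. \<forall>z\<in>ball (proj12 p) r. \<bar>iter_pd bs u z\<bar> < e))) \<and>
       (\<forall>q\<in>ball p r. \<exists>x :: nat \<Rightarrow> real^3. (\<forall>i. x i \<in> surf i) \<and> x \<longlonglongrightarrow> q)"
    by (intro exI[of _ r] conjI r(1) disj exI[of _ "leaves \<omega> r"] F1 F2 ballI lim)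
qed

lemma graphs_away_from_axes:
  assumes "0 < d"
  shows "\<forall>\<^sub>F i in sequentially. \<forall>C\<in>components ((surf i \<inter> ball 0 (radius i)) - tube axes d). inj_on proj12 C"
proof -
  have "0 < 1 / (20 * (1 + 8 / d))" using assms by (simp add: add_pos_pos)
  from q_eventually_le[OF this] show ?thesis
  proof eventually_elim
    case (elim i)
    have "0 < q i" "0 < 1 + 8 / d" using assms by (simp_all add: q_eq add_pos_pos)
    then have "1 + 8 / d \<le> 1 / (20 * q i)" using elim by (simp add: pos_le_divide_eq pos_less_divide_eq mult_ac)
    then show ?case using neck_stack.graph_components[OF stack assms] by blast
  qed
qed

text \<open>\<open>Q\<close> stands for further conditions on the points, such as the height gap in
  the theorem.\<close>

lemma same_component:
  assumes "1 < r" "\<forall>\<^sub>F i in sequentially. pp i \<in> surf i \<inter> ball 0 r \<and> pm i \<in> surf i \<inter> ball 0 r \<and> Q i"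
  shows "\<forall>\<^sub>F i in sequentially. \<exists>C\<in>components (surf i \<inter> ball 0 (2 * r)). pm i \<in> C \<and> pp i \<in> C"
  using assms(2) radius_eventually_ge[of "2 * r"]
proof eventually_elim
  case (elim i)
  show ?case using neck_stack.surface_same_component[OF stack assms(1) elim(2)] elim(1) by blast
qed

lemma intrinsic_dist_at_top:
  fixes pp pm :: "nat \<Rightarrow> real^3"
  assumes d: "0 < d" and p: "\<forall>\<^sub>F i in sequentially. pp i \<in> surf i \<inter> ball 0 r \<and> pm i \<in> surf i \<inter> ball 0 r \<and>
     d < \<bar>pp i $ 3 - pm i $ 3\<bar>"
  shows "(\<lambda>i. intrinsic_dist (surf i) (pm i) (pp i)) \<longlonglongrightarrow> \<infinity>"
  unfolding tendsto_PInfty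
proof
  fix c :: real
  \<comment> \<open>Climbing past \<open>n\<close> periods costs length at least
    \<open>n / 2\<close>, so \<open>n > 2 * c\<close> suffices.\<close>
  obtain n where n: "2 * c < real n" using reals_Archimedean2 by blast
  have "0 < d / (real n + 1)" using d by (simp add: add_nonneg_pos)
  from order_tendstoD(2)[OF height_null this] p
  show "\<forall>\<^sub>F i in sequentially. ereal c < intrinsic_dist (surf i) (pm i) (pp i)"
  proof eventually_elim
    case (elim i)
    have "real n * height i + height i \<le> \<bar>pp i $ 3 - pm i $ 3\<bar>"
      using elim by (simp add: pos_less_divide_eq add_nonneg_pos algebra_simps)
    then have "ereal (real n / 2) \<le> intrinsic_dist (surf i) (pm i) (pp i)"
      using neck_stack.intrinsic_dist_ge[OF stack] elim(2) by blast
    moreover have "ereal c < ereal (real n / 2)" using n by simp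
    ultimately show ?case by (rule less_le_trans[rotated])
  qed
qed

end

lemma stack_sequence_exists: "\<exists>q e m. stack_sequence q e m"
proof -
  define q where "q i = exp (- (200 + real i))" for i
  have q: "0 < q i" "q i \<le> 1 / 10 ^ 12" "100 \<le> ln (1 / q i)" for i
  proof -
    show "0 < q i" "100 \<le> ln (1 / q i)" by (simp_all add: q_def ln_div)
    have "(2::real) ^ 200 \<le> exp 1 ^ 200" using exp_ge_add_one_self[of 1] by (intro power_mono) auto
    also have "\<dots> = exp 200" by (simp add: exp_of_nat_mult[symmetric])
    finally have "10 ^ 12 \<le> exp (200::real)" by simp
    also have "\<dots> \<le> exp (200 + real i)" by simp
    finally show "q i \<le> 1 / 10 ^ 12" unfolding q_def exp_minus by (simp add: field_simps)
  qed
  have "\<exists>e m. neck_stack (q i) e m" for i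
  proof -
    have "q i \<le> 1 / 1000" using q(2)[of i] by simp
    from elliptic_relation[OF q(1) this] show ?thesis using q[of i] unfolding neck_stack_def by blast
  qed
  then obtain e m where "\<And>i. neck_stack (q i) (e i) (m i)" by metis
  then have "stack_sequence q e m" by (intro stack_sequence.intro) (simp_all add: q_def)
  then show ?thesis by blast
qed

theorem theorem1p1:
  shows "\<exists>(\<Sigma> :: nat \<Rightarrow> (real^3) set) (R :: nat \<Rightarrow> real) (cp :: real \<times> real) (cm :: real \<times> real).
    let S = {x. proj12 x = cp} \<union> {x. proj12 x = cm} in
    (\<forall>i. R i > 0 \<and> minimal_surface (\<Sigma> i) \<and> planar_domain (\<Sigma> i) \<and>
         \<Sigma> i \<subseteq> ball 0 (R i) \<and> closure (\<Sigma> i) - \<Sigma> i \<subseteq> sphere 0 (R i)) \<and>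
    filterlim R at_top sequentially \<and>
    norm cp = 1 \<and> norm cm = 1 \<and> cp \<noteq> cm \<and>
    converges_to_horizontal_foliation_away \<Sigma> S \<and>
    (\<forall>e>0. \<forall>\<^sub>F i in sequentially.
       \<forall>C\<in>components ((\<Sigma> i \<inter> ball 0 (R i)) - tube S e). inj_on proj12 C) \<and>
    (\<forall>r>1. \<forall>d>0. \<forall>pp pm :: nat \<Rightarrow> real^3.
       (\<forall>\<^sub>F i in sequentially. pp i \<in> \<Sigma> i \<inter> ball 0 r \<and> pm i \<in> \<Sigma> i \<inter> ball 0 r \<and>
            d < \<bar>pp i $ 3 - pm i $ 3\<bar>) \<longrightarrow>
       (\<forall>\<^sub>F i in sequentially. \<exists>C\<in>components (\<Sigma> i \<inter> ball 0 (2 * r)). pm i \<in> C \<and> pp i \<in> C) \<and>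
       ((\<lambda>i. intrinsic_dist (\<Sigma> i) (pm i) (pp i)) \<longlongrightarrow> \<infinity>) sequentially)"
proof -
  obtain q e m where "stack_sequence q e m" using stack_sequence_exists by blast
  then interpret stack_sequence q e m .
  have "radius i > 0 \<and> minimal_surface (surf i) \<and> planar_domain (surf i) \<and>
      surf i \<subseteq> ball 0 (radius i) \<and> closure (surf i) - surf i \<subseteq> sphere 0 (radius i)" for i
    using neck_stack.R_ge[OF stack, of i] neck_stack.surface_minimal[OF stack, of i] neck_stack.surface_planar[OF stack, of i]
      neck_stack.surface_ball[OF stack, of i] neck_stack.surface_boundary[OF stack, of i] by simp
  moreover have "norm (1 :: real, 0 :: real) = 1" "norm (- 1 :: real, 0 :: real) = 1" by (simp_all add: norm_Pair)
  ultimately show ?thesis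
    unfolding Let_def
    by (intro exI[of _ surf] exI[of _ radius] exI[of _ "(1, 0)"] exI[of _ "(- 1, 0)"] conjI allI impI)
      (simp_all add: radius_at_top convergence[unfolded axes_def] graphs_away_from_axes[unfolded axes_def]
        same_component intrinsic_dist_at_top)
qed

end
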